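(* Suppose that $\Gamma$ is a countable discrete group with Property (T) and that $\Lambda\triangleleft\Gamma$ is a non-amenable normal subgroup of infinite index. Suppose $D_1\triangleleft\ell^\infty(\Gamma)$ and $D_2\triangleleft\ell^\infty(\Gamma/\Lambda)$ are ideals satisfying the following conditions: (1) $D_1$ is proper and translation invariant; (2) $D_2$ is translation invariant; (3) $D_1$ contains the image of $D_2$ under the inclusion $\ell^\infty(\Gamma/\Lambda)\subset\ell^\infty(\Gamma)$ (composition with the quotient map $\Gamma\to\Gamma/\Lambda$). Then $C^*_{D_1}(\Gamma)$ is an exotic compact quantum group; that is, it is a compact quantum group with comultiplication determined by $\Delta(s)=s\otimes s$ for $s\in\Gamma$, and $C^*(\Gamma)\neq C^*_{D_1}(\Gamma)\neq C^*_r(\Gamma)$.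
   Context: For a discrete group $G$, an ideal $D$ of $\ell^\infty(G)$ means an algebraic (not necessarily norm-closed) two-sided ideal; it is translation invariant if it is invariant under both the left and right translation actions of $G$. For a unitary representation $\pi:G\to B(\mathcal H)$ and $\xi,\eta\in\mathcal H$, put $\pi_{\xi,\eta}(s)=\langle\pi_s(\xi),\eta\rangle$. The representation $\pi$ is a $D$-representation if there is a dense linear subspace $\mathcal H_0\subset\mathcal H$ with $\pi_{\xi,\eta}\in D$ for all $\xi,\eta\in\mathcal H_0$. $C^*_D(G)$ is the completion of the group ring $\mathbb C[G]$ with respect to $\|x\|_D=\sup\{\|\pi(x)\|:\pi\text{ a }D\text{-representation}\}$ (after dividing by the elements of norm zero, if there are any). $C^*(G)$ and $C^*_r(G)$ are the full and reduced group C$^*$-algebras. Equality of two of these completions of $\mathbb C[G]$ means that the identity map on $\mathbb C[G]$ extends to an isomorphism between them, and $\neq$ means that it does not. A compact quantum group is a pair $(A,\Delta)$ with $A$ a unital C$^*$-algebra and $\Delta:A\to A\otimes A$ (spatial tensor product) a unital $*$-homomorphism such that $(\Delta\otimes\mathrm{id}_A)\Delta=(\mathrm{id}_A\otimes\Delta)\Delta$ and $\Delta(A)(A\otimes1)$, $\Delta(A)(1\otimes A)$ are dense subspaces of $A\otimes A$.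
   Formalization: The ideal D_2 is assumed nonzero; with D_2 = {0} the statement fails, since D_1 = c_c(Γ) satisfies (1)-(3) but C*_{D_1}(Γ) = C*_r(Γ). *)

theory Defs
  imports "HOL-Analysis.Analysis" "HOL-Algebra.Module" "HOL-Algebra.Ideal" "HOL-Algebra.Coset"
    "HOL-Library.Infinite_Typeclass"
    "HOL-Library.Nonpos_Ints" "HOL-Library.Countable_Set"
begin

section \<open>Complex Hilbert spaces\<close>

text \<open>Inner products are linear in the first argument.\<close>

class complex_hilbert = real_inner + complete_space +
  fixes scaleC :: "complex \<Rightarrow> 'a \<Rightarrow> 'a"
    and cinner :: "'a \<Rightarrow> 'a \<Rightarrow> complex"
  assumes scaleC_add_right: "scaleC a (x + y) = scaleC a x + scaleC a y"
    and scaleC_add_left: "scaleC (a + b) x = scaleC a x + scaleC b x"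
    and scaleC_scaleC: "scaleC a (scaleC b x) = scaleC (a * b) x"
    and scaleR_scaleC: "scaleR r x = scaleC (complex_of_real r) x"
    and cinner_add_left: "cinner (x + y) z = cinner x z + cinner y z"
    and cinner_scaleC_left: "cinner (scaleC a x) y = a * cinner x y"
    and cinner_commute: "cinner x y = cnj (cinner y x)"
    and inner_cinner: "inner x y = Re (cinner x y)"

definition csubspace :: "'h::complex_hilbert set \<Rightarrow> bool" where
  "csubspace H \<longleftrightarrow> 0 \<in> H \<and> (\<forall>x\<in>H. \<forall>y\<in>H. x + y \<in> H) \<and> (\<forall>a. \<forall>x\<in>H. scaleC a x \<in> H)"

text \<open>
  Representations act on closed subspaces of a type of class \<open>complex_hilbert\<close>, which plays the
  role of a universe of Hilbert spaces. Notions that quantify over all representations carry this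
  universe as a type argument. Every Hilbert space is unitarily equivalent to a closed subspace of
  the space \<open>'i ell2\<close> (below) for a suitable index type. For a countable group, and for a separable
  C*-algebra, a universe of any infinite dimension gives the usual norms and properties, because
  they are detected by representations on separable spaces.
\<close>

definition closed_csubspace :: "'h::complex_hilbert set \<Rightarrow> bool" where
  "closed_csubspace H \<longleftrightarrow> csubspace H \<and> closed H"

definition linear_op_on :: "'h::complex_hilbert set \<Rightarrow> ('h \<Rightarrow> 'h) \<Rightarrow> bool" where
  "linear_op_on H T \<longleftrightarrow> (\<forall>x\<in>H. T x \<in> H) \<and> (\<forall>x\<in>H. \<forall>y\<in>H. T (x + y) = T x + T y)
     \<and> (\<forall>a. \<forall>x\<in>H. T (scaleC a x) = scaleC a (T x))"

definition bounded_op_on :: "'h::complex_hilbert set \<Rightarrow> ('h \<Rightarrow> 'h) \<Rightarrow> bool" where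
  "bounded_op_on H T \<longleftrightarrow> linear_op_on H T \<and> (\<exists>B. \<forall>x\<in>H. norm (T x) \<le> B * norm x)"

definition unitary_op_on :: "'h::complex_hilbert set \<Rightarrow> ('h \<Rightarrow> 'h) \<Rightarrow> bool" where
  "unitary_op_on H U \<longleftrightarrow> linear_op_on H U \<and> U ` H = H
     \<and> (\<forall>x\<in>H. \<forall>y\<in>H. cinner (U x) (U y) = cinner x y)"

definition op_norm_on :: "'h::complex_hilbert set \<Rightarrow> ('h \<Rightarrow> 'h) \<Rightarrow> real" where
  "op_norm_on H T = Sup {norm (T x) | x. x \<in> H \<and> norm x \<le> 1}"


subsection \<open>The space of square summable functions\<close>

lemma square_summable_mult:
  fixes f g :: "'i \<Rightarrow> complex"
  assumes "(\<lambda>i. (cmod (f i))\<^sup>2) summable_on UNIV" "(\<lambda>i. (cmod (g i))\<^sup>2) summable_on UNIV"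
  shows "(\<lambda>i. f i * cnj (g i)) summable_on UNIV"
proof (rule abs_summable_summable, rule abs_summable_product)
  show "(\<lambda>i. norm (f i * f i)) summable_on UNIV"
    using assms(1) by (simp add: norm_mult power2_eq_square)
  show "(\<lambda>i. norm (cnj (g i) * cnj (g i))) summable_on UNIV"
    using assms(2) by (simp add: norm_mult power2_eq_square)
qed

lemma square_summable_add:
  fixes f g :: "'i \<Rightarrow> complex"
  assumes "(\<lambda>i. (cmod (f i))\<^sup>2) summable_on UNIV" "(\<lambda>i. (cmod (g i))\<^sup>2) summable_on UNIV"
  shows "(\<lambda>i. (cmod (f i + g i))\<^sup>2) summable_on UNIV"
proof (rule summable_on_comparison_test)
  show "(\<lambda>i. 2 * (cmod (f i))\<^sup>2 + 2 * (cmod (g i))\<^sup>2) summable_on UNIV"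
    by (intro summable_on_add summable_on_cmult_right assms)
  fix i
  have "(cmod (f i + g i))\<^sup>2 \<le> (cmod (f i) + cmod (g i))\<^sup>2"
    by (intro power_mono norm_triangle_ineq) auto
  also have "\<dots> \<le> 2 * (cmod (f i))\<^sup>2 + 2 * (cmod (g i))\<^sup>2"
    using sum_squares_bound[of "cmod (f i)" "cmod (g i)"] by (simp add: power2_sum)
  finally show "(cmod (f i + g i))\<^sup>2 \<le> 2 * (cmod (f i))\<^sup>2 + 2 * (cmod (g i))\<^sup>2" .
qed auto

lemma square_summable_scale:
  fixes f :: "'i \<Rightarrow> complex"
  assumes "(\<lambda>i. (cmod (f i))\<^sup>2) summable_on UNIV"
  shows "(\<lambda>i. (cmod (a * f i))\<^sup>2) summable_on UNIV"
  by (simp add: norm_mult power_mult_distrib summable_on_cmult_right assms)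

typedef 'i ell2 = "{f :: 'i \<Rightarrow> complex. (\<lambda>i. (cmod (f i))\<^sup>2) summable_on UNIV}"
  by (rule exI[of _ "\<lambda>_. 0"]) simp

setup_lifting type_definition_ell2

lemma ell2_summable: "(\<lambda>i. (cmod (Rep_ell2 f i))\<^sup>2) summable_on UNIV"
  using Rep_ell2[of f] by simp

lift_definition ell2_scaleC :: "complex \<Rightarrow> 'a ell2 \<Rightarrow> 'a ell2" is "\<lambda>a f i. a * f i"
  by (rule square_summable_scale)
lift_definition ell2_cinner :: "'a ell2 \<Rightarrow> 'a ell2 \<Rightarrow> complex"
  is "\<lambda>f g. \<Sum>\<^sub>\<infinity>i. f i * cnj (g i)" .

instantiation ell2 :: (type) real_inner
begin

lift_definition zero_ell2 :: "'a ell2" is "\<lambda>_. 0" by simp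
lift_definition plus_ell2 :: "'a ell2 \<Rightarrow> 'a ell2 \<Rightarrow> 'a ell2" is "\<lambda>f g i. f i + g i"
  by (rule square_summable_add)
lift_definition uminus_ell2 :: "'a ell2 \<Rightarrow> 'a ell2" is "\<lambda>f i. - f i" by simp
lift_definition minus_ell2 :: "'a ell2 \<Rightarrow> 'a ell2 \<Rightarrow> 'a ell2" is "\<lambda>f g i. f i - g i"
proof -
  fix f g :: "'a \<Rightarrow> complex"
  assume "(\<lambda>i. (cmod (f i))\<^sup>2) summable_on UNIV" "(\<lambda>i. (cmod (g i))\<^sup>2) summable_on UNIV"
  then show "(\<lambda>i. (cmod (f i - g i))\<^sup>2) summable_on UNIV"
    using square_summable_add[of f "\<lambda>i. - g i"] by simp
qed
lift_definition scaleR_ell2 :: "real \<Rightarrow> 'a ell2 \<Rightarrow> 'a ell2" is "\<lambda>r f i. complex_of_real r * f i"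
  by (rule square_summable_scale)
definition inner_ell2 :: "'a ell2 \<Rightarrow> 'a ell2 \<Rightarrow> real" where "inner_ell2 x y = Re (ell2_cinner x y)"
definition norm_ell2 :: "'a ell2 \<Rightarrow> real" where "norm_ell2 x = sqrt (inner x x)"
definition sgn_ell2 :: "'a ell2 \<Rightarrow> 'a ell2" where "sgn_ell2 x = inverse (norm x) *\<^sub>R x"
definition dist_ell2 :: "'a ell2 \<Rightarrow> 'a ell2 \<Rightarrow> real" where "dist_ell2 x y = norm (x - y)"
definition uniformity_ell2 :: "('a ell2 \<times> 'a ell2) filter" where
  "uniformity_ell2 = (INF e\<in>{0 <..}. principal {(x, y). dist x y < e})"
definition open_ell2 :: "'a ell2 set \<Rightarrow> bool" where
  "open_ell2 U \<longleftrightarrow> (\<forall>x\<in>U. \<forall>\<^sub>F (x', y) in uniformity. x' = x \<longrightarrow> y \<in> U)"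

lemma ell2_cinner_add: "ell2_cinner (x + y) z = ell2_cinner x z + ell2_cinner (y::'a ell2) z"
  by transfer (simp add: distrib_right infsum_add square_summable_mult)

lemma ell2_cinner_scale: "ell2_cinner (ell2_scaleC a x) y = a * ell2_cinner (x::'a ell2) y"
  by transfer (simp add: mult.assoc infsum_cmult_right square_summable_mult)

lemma ell2_cinner_commute: "ell2_cinner x y = cnj (ell2_cinner y (x::'a ell2))"
  by transfer (simp flip: infsum_cnj add: mult.commute)

lemma ell2_scaleR: "scaleR r (x::'a ell2) = ell2_scaleC (complex_of_real r) x"
  by transfer simp

lemma ell2_inner_self: "inner x (x::'a ell2) = (\<Sum>\<^sub>\<infinity>i. (cmod (Rep_ell2 x i))\<^sup>2)"
proof -
  have *: "(\<lambda>i. Rep_ell2 x i * cnj (Rep_ell2 x i)) summable_on UNIV"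
    by (intro square_summable_mult ell2_summable)
  have "inner x x = Re (\<Sum>\<^sub>\<infinity>i. Rep_ell2 x i * cnj (Rep_ell2 x i))"
    by (simp add: inner_ell2_def ell2_cinner.rep_eq)
  also have "\<dots> = (\<Sum>\<^sub>\<infinity>i. Re (Rep_ell2 x i * cnj (Rep_ell2 x i)))"
    using infsum_Re[OF *] by simp
  also have "\<dots> = (\<Sum>\<^sub>\<infinity>i. (cmod (Rep_ell2 x i))\<^sup>2)"
    by (rule infsum_cong) (simp add: cmod_power2 flip: power2_eq_square)
  finally show ?thesis .
qed

lemma ell2_finite_sum_le: "finite F \<Longrightarrow> (\<Sum>i\<in>F. (cmod (Rep_ell2 x i))\<^sup>2) \<le> (norm (x::'a ell2))\<^sup>2"
proof -
  assume F: "finite F"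
  have "0 \<le> inner x x"
    unfolding ell2_inner_self by (rule infsum_nonneg) simp
  then have "(norm x)\<^sup>2 = inner x x"
    by (simp add: norm_ell2_def)
  then show ?thesis
    unfolding ell2_inner_self using F
    by (simp add: finite_sum_le_infsum ell2_summable)
qed

lemma ell2_norm_le:
  assumes "\<And>F. finite F \<Longrightarrow> (\<Sum>i\<in>F. (cmod (Rep_ell2 (x::'a ell2) i))\<^sup>2) \<le> e\<^sup>2" "0 \<le> e"
  shows "norm x \<le> e"
proof -
  have "inner x x \<le> e\<^sup>2"
    unfolding ell2_inner_self by (rule infsum_le_finite_sums) (auto simp: ell2_summable assms)
  then show ?thesis
    using assms(2) by (simp add: norm_ell2_def real_le_lsqrt)
qed

instance
proof
  fix x y z :: "'a ell2" and r s :: real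
  show "x + y + z = x + (y + z)" by transfer (simp add: add.assoc)
  show "x + y = y + x" by transfer (simp add: add.commute)
  show "0 + x = x" by transfer simp
  show "- x + x = 0" by transfer simp
  show "x - y = x + - y" by transfer simp
  show "r *\<^sub>R (x + y) = r *\<^sub>R x + r *\<^sub>R y" by transfer (simp add: algebra_simps)
  show "(r + s) *\<^sub>R x = r *\<^sub>R x + s *\<^sub>R x" by transfer (simp add: algebra_simps)
  show "r *\<^sub>R s *\<^sub>R x = (r * s) *\<^sub>R x" by transfer (simp add: algebra_simps)
  show "1 *\<^sub>R x = x" by transfer simp
  show "sgn x = inverse (norm x) *\<^sub>R x" by (rule sgn_ell2_def)
  show "dist x y = norm (x - y)" by (rule dist_ell2_def)
  show "(uniformity :: ('a ell2 \<times> 'a ell2) filter) = (INF e\<in>{0 <..}. principal {(x, y). dist x y < e})"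
    by (rule uniformity_ell2_def)
  show "open U \<longleftrightarrow> (\<forall>x\<in>U. \<forall>\<^sub>F (x', y) in uniformity. x' = x \<longrightarrow> y \<in> U)" for U :: "'a ell2 set"
    by (rule open_ell2_def)
  show "inner x y = inner y x"
    using ell2_cinner_commute[of x y] by (simp add: inner_ell2_def)
  show "inner (x + y) z = inner x z + inner y z"
    by (simp add: inner_ell2_def ell2_cinner_add)
  show "inner (r *\<^sub>R x) y = r * inner x y"
    by (simp add: inner_ell2_def ell2_scaleR ell2_cinner_scale)
  show "0 \<le> inner x x"
    unfolding ell2_inner_self by (rule infsum_nonneg) simp
  show "norm x = sqrt (inner x x)" by (rule norm_ell2_def)
  show "(inner x x = 0) = (x = 0)"
  proof
    assume 0: "inner x x = 0"
    have "Rep_ell2 x i = 0" for i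
      using ell2_finite_sum_le[of "{i}" x] 0 by (simp add: norm_ell2_def)
    then show "x = 0"
      by (simp add: Rep_ell2_inject[symmetric] zero_ell2.rep_eq fun_eq_iff)
  qed (simp add: ell2_inner_self zero_ell2.rep_eq)
qed

end

instance ell2 :: (type) complete_space
proof
  fix X :: "nat \<Rightarrow> 'a ell2"
  assume X: "Cauchy X"
  have rep_diff: "Rep_ell2 (x - y) i = Rep_ell2 x i - Rep_ell2 y i" for x y :: "'a ell2" and i
    by (simp add: minus_ell2.rep_eq)
  have "Cauchy (\<lambda>n. Rep_ell2 (X n) i)" for i
  proof (rule metric_CauchyI)
    fix e :: real
    assume "0 < e"
    then obtain M where M: "\<And>m n. M \<le> m \<Longrightarrow> M \<le> n \<Longrightarrow> dist (X m) (X n) < e"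
      using X by (meson metric_CauchyD)
    have "dist (Rep_ell2 (X m) i) (Rep_ell2 (X n) i) < e" if "M \<le> m" "M \<le> n" for m n
    proof -
      have "(cmod (Rep_ell2 (X m - X n) i))\<^sup>2 \<le> (norm (X m - X n))\<^sup>2"
        using ell2_finite_sum_le[of "{i}" "X m - X n"] by simp
      then have "cmod (Rep_ell2 (X m - X n) i) \<le> norm (X m - X n)"
        by (rule power2_le_imp_le) simp
      then show ?thesis
        using M[OF that] by (simp add: dist_norm rep_diff)
    qed
    then show "\<exists>M. \<forall>m\<ge>M. \<forall>n\<ge>M. dist (Rep_ell2 (X m) i) (Rep_ell2 (X n) i) < e"
      by blast
  qed
  then have "\<exists>l. (\<lambda>n. Rep_ell2 (X n) i) \<longlonglongrightarrow> l" for i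
    by (simp add: Cauchy_convergent_iff convergent_def)
  then obtain f where f: "\<And>i. (\<lambda>n. Rep_ell2 (X n) i) \<longlonglongrightarrow> f i"
    by metis
  have bound: "(\<Sum>i\<in>F. (cmod (f i - Rep_ell2 (X n) i))\<^sup>2) \<le> e\<^sup>2"
    if M: "\<And>m. M \<le> m \<Longrightarrow> norm (X m - X n) \<le> e" and F: "finite F" for M n e and F :: "'a set"
  proof (rule LIMSEQ_le_const2)
    show "(\<lambda>m. \<Sum>i\<in>F. (cmod (Rep_ell2 (X m) i - Rep_ell2 (X n) i))\<^sup>2)
        \<longlonglongrightarrow> (\<Sum>i\<in>F. (cmod (f i - Rep_ell2 (X n) i))\<^sup>2)"
      by (intro tendsto_intros f)
    have "(\<Sum>i\<in>F. (cmod (Rep_ell2 (X m) i - Rep_ell2 (X n) i))\<^sup>2) \<le> e\<^sup>2" if "M \<le> m" for m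
    proof -
      have "(norm (X m - X n))\<^sup>2 \<le> e\<^sup>2"
        using M[OF that] by (simp add: power_mono)
      then show ?thesis
        using ell2_finite_sum_le[OF F, of "X m - X n"] by (simp add: rep_diff)
    qed
    then show "\<exists>N. \<forall>m\<ge>N. (\<Sum>i\<in>F. (cmod (Rep_ell2 (X m) i - Rep_ell2 (X n) i))\<^sup>2) \<le> e\<^sup>2"
      by blast
  qed
  have tail: "\<exists>N. \<forall>n\<ge>N. \<forall>F. finite F \<longrightarrow> (\<Sum>i\<in>F. (cmod (f i - Rep_ell2 (X n) i))\<^sup>2) \<le> e\<^sup>2"
    if "0 < e" for e :: real
  proof -
    obtain N where "\<And>m n. N \<le> m \<Longrightarrow> N \<le> n \<Longrightarrow> dist (X m) (X n) < e"
      using X \<open>0 < e\<close> by (meson metric_CauchyD)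
    then have "\<And>m n. N \<le> m \<Longrightarrow> N \<le> n \<Longrightarrow> norm (X m - X n) \<le> e"
      by (simp add: dist_norm less_imp_le)
    then show ?thesis
      using bound by blast
  qed
  obtain N where N: "\<And>F. finite F \<Longrightarrow> (\<Sum>i\<in>F. (cmod (f i - Rep_ell2 (X N) i))\<^sup>2) \<le> 1"
    using tail[of 1] by auto
  have "(\<lambda>i. (cmod (f i - Rep_ell2 (X N) i))\<^sup>2) summable_on UNIV"
    by (rule nonneg_bdd_above_summable_on) (auto intro!: bdd_aboveI2[where M = 1] N)
  then have "(\<lambda>i. (cmod (f i))\<^sup>2) summable_on UNIV"
    using square_summable_add[OF _ ell2_summable[of "X N"], of "\<lambda>i. f i - Rep_ell2 (X N) i"] by simp
  then have rep: "Rep_ell2 (Abs_ell2 f) = f"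
    by (simp add: Abs_ell2_inverse)
  have "X \<longlonglongrightarrow> Abs_ell2 f"
  proof (rule metric_LIMSEQ_I)
    fix r :: real
    assume "0 < r"
    then obtain N where N: "\<And>n F. N \<le> n \<Longrightarrow> finite F
        \<Longrightarrow> (\<Sum>i\<in>F. (cmod (f i - Rep_ell2 (X n) i))\<^sup>2) \<le> (r / 2)\<^sup>2"
      using tail[of "r / 2"] by auto
    have "dist (X n) (Abs_ell2 f) < r" if "N \<le> n" for n
    proof -
      have "norm (Abs_ell2 f - X n) \<le> r / 2"
        by (rule ell2_norm_le) (use N[OF that] \<open>0 < r\<close> in \<open>auto simp: rep_diff rep\<close>)
      then show ?thesis
        using \<open>0 < r\<close> by (simp add: dist_norm norm_minus_commute)
    qed
    then show "\<exists>N. \<forall>n\<ge>N. dist (X n) (Abs_ell2 f) < r"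
      by blast
  qed
  then show "convergent X"
    by (auto simp: convergent_def)
qed

instantiation ell2 :: (type) complex_hilbert
begin

definition scaleC_ell2 :: "complex \<Rightarrow> 'a ell2 \<Rightarrow> 'a ell2" where "scaleC_ell2 = ell2_scaleC"
definition cinner_ell2 :: "'a ell2 \<Rightarrow> 'a ell2 \<Rightarrow> complex" where "cinner_ell2 = ell2_cinner"

instance
proof
  fix a b :: complex and r :: real and x y z :: "'a ell2"
  show "scaleC a (x + y) = scaleC a x + scaleC a y"
    unfolding scaleC_ell2_def by transfer (simp add: algebra_simps)
  show "scaleC (a + b) x = scaleC a x + scaleC b x"
    unfolding scaleC_ell2_def by transfer (simp add: algebra_simps)
  show "scaleC a (scaleC b x) = scaleC (a * b) x"
    unfolding scaleC_ell2_def by transfer (simp add: algebra_simps)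
  show "r *\<^sub>R x = scaleC (complex_of_real r) x"
    by (simp add: scaleC_ell2_def ell2_scaleR)
  show "cinner (x + y) z = cinner x z + cinner y z"
    by (simp add: cinner_ell2_def ell2_cinner_add)
  show "cinner (scaleC a x) y = a * cinner x y"
    by (simp add: cinner_ell2_def scaleC_ell2_def ell2_cinner_scale)
  show "cinner x y = cnj (cinner y x)"
    unfolding cinner_ell2_def by (rule ell2_cinner_commute)
  show "inner x y = Re (cinner x y)"
    by (simp add: cinner_ell2_def inner_ell2_def)
qed

end


section \<open>Unital C*-algebras and completions\<close>

record 'a normed_star_algebra = "(complex, 'a) module" +
  star :: "'a \<Rightarrow> 'a"
  nrm :: "'a \<Rightarrow> real"

definition complex_ring :: "complex ring" where
  "complex_ring = \<lparr>carrier = UNIV, mult = (*), one = 1, zero = 0, add = (+)\<rparr>"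

definition cauchy_seqs :: "('a, 'm) normed_star_algebra_scheme \<Rightarrow> (nat \<Rightarrow> 'a) set" where
  "cauchy_seqs A = {X. range X \<subseteq> carrier A
     \<and> (\<forall>e>0. \<exists>M. \<forall>m\<ge>M. \<forall>n\<ge>M. nrm A (X m \<ominus>\<^bsub>A\<^esub> X n) < e)}"

locale unital_cstar_algebra =
  fixes A :: "('a, 'm) normed_star_algebra_scheme" (structure)
  assumes is_ring: "Ring.ring A"
    and is_module: "Module.module complex_ring A"
    and smult_mult: "\<lbrakk>x \<in> carrier A; y \<in> carrier A\<rbrakk>
          \<Longrightarrow> (c \<odot> x) \<otimes> y = c \<odot> (x \<otimes> y) \<and> x \<otimes> (c \<odot> y) = c \<odot> (x \<otimes> y)"
    and star_closed: "x \<in> carrier A \<Longrightarrow> star A x \<in> carrier A"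
    and star_add: "\<lbrakk>x \<in> carrier A; y \<in> carrier A\<rbrakk> \<Longrightarrow> star A (x \<oplus> y) = star A x \<oplus> star A y"
    and star_smult: "x \<in> carrier A \<Longrightarrow> star A (c \<odot> x) = cnj c \<odot> star A x"
    and star_mult: "\<lbrakk>x \<in> carrier A; y \<in> carrier A\<rbrakk> \<Longrightarrow> star A (x \<otimes> y) = star A y \<otimes> star A x"
    and star_star: "x \<in> carrier A \<Longrightarrow> star A (star A x) = x"
    and nrm_nonneg: "x \<in> carrier A \<Longrightarrow> 0 \<le> nrm A x"
    and nrm_eq_0: "x \<in> carrier A \<Longrightarrow> nrm A x = 0 \<longleftrightarrow> x = \<zero>"
    and nrm_triangle: "\<lbrakk>x \<in> carrier A; y \<in> carrier A\<rbrakk> \<Longrightarrow> nrm A (x \<oplus> y) \<le> nrm A x + nrm A y"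
    and nrm_smult: "x \<in> carrier A \<Longrightarrow> nrm A (c \<odot> x) = cmod c * nrm A x"
    and nrm_mult: "\<lbrakk>x \<in> carrier A; y \<in> carrier A\<rbrakk> \<Longrightarrow> nrm A (x \<otimes> y) \<le> nrm A x * nrm A y"
    and cstar_identity: "x \<in> carrier A \<Longrightarrow> nrm A (star A x \<otimes> x) = (nrm A x)\<^sup>2"
    and complete: "X \<in> cauchy_seqs A
          \<Longrightarrow> \<exists>x\<in>carrier A. (\<lambda>n. nrm A (X n \<ominus> x)) \<longlonglongrightarrow> 0"

definition star_hom ::
  "('a, 'm) normed_star_algebra_scheme \<Rightarrow> ('b, 'n) normed_star_algebra_scheme \<Rightarrow> ('a \<Rightarrow> 'b) \<Rightarrow> bool" where
  "star_hom A B f \<longleftrightarrow> f \<in> ring_hom A B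
     \<and> (\<forall>c. \<forall>x\<in>carrier A. f (c \<odot>\<^bsub>A\<^esub> x) = c \<odot>\<^bsub>B\<^esub> f x)
     \<and> (\<forall>x\<in>carrier A. f (star A x) = star B (f x))"

definition star_iso ::
  "('a, 'm) normed_star_algebra_scheme \<Rightarrow> ('b, 'n) normed_star_algebra_scheme \<Rightarrow> ('a \<Rightarrow> 'b) \<Rightarrow> bool" where
  "star_iso A B f \<longleftrightarrow> star_hom A B f \<and> bij_betw f (carrier A) (carrier B)"

definition linear_span :: "('a, 'm) normed_star_algebra_scheme \<Rightarrow> 'a set \<Rightarrow> 'a set" where
  "linear_span A S = \<Inter>{V. Module.submodule V complex_ring A \<and> S \<subseteq> V}"

definition dense_in :: "('a, 'm) normed_star_algebra_scheme \<Rightarrow> 'a set \<Rightarrow> bool" where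
  "dense_in A S \<longleftrightarrow> S \<subseteq> carrier A \<and> (\<forall>x\<in>carrier A. \<forall>e>0. \<exists>y\<in>S. nrm A (x \<ominus>\<^bsub>A\<^esub> y) < e)"


subsection \<open>Separation and completion of a seminormed *-algebra\<close>

text \<open>
  Elements of the completion are classes of Cauchy sequences that differ by a null sequence, so
  that elements of seminorm zero are divided out.
\<close>

type_synonym 'a completion = "(nat \<Rightarrow> 'a) set"

definition cauchy_class :: "('a, 'm) normed_star_algebra_scheme \<Rightarrow> (nat \<Rightarrow> 'a) \<Rightarrow> 'a completion" where
  "cauchy_class A X = {Y \<in> cauchy_seqs A. (\<lambda>n. nrm A (X n \<ominus>\<^bsub>A\<^esub> Y n)) \<longlonglongrightarrow> 0}"

definition cauchy_rep :: "'a completion \<Rightarrow> nat \<Rightarrow> 'a" where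
  "cauchy_rep U = (SOME X. X \<in> U)"

definition completion :: "('a, 'm) normed_star_algebra_scheme \<Rightarrow> 'a completion normed_star_algebra" where
  "completion A = \<lparr>
     carrier = cauchy_class A ` cauchy_seqs A,
     mult = (\<lambda>U V. cauchy_class A (\<lambda>n. cauchy_rep U n \<otimes>\<^bsub>A\<^esub> cauchy_rep V n)),
     one = cauchy_class A (\<lambda>_. \<one>\<^bsub>A\<^esub>),
     zero = cauchy_class A (\<lambda>_. \<zero>\<^bsub>A\<^esub>),
     add = (\<lambda>U V. cauchy_class A (\<lambda>n. cauchy_rep U n \<oplus>\<^bsub>A\<^esub> cauchy_rep V n)),
     smult = (\<lambda>c U. cauchy_class A (\<lambda>n. c \<odot>\<^bsub>A\<^esub> cauchy_rep U n)),
     star = (\<lambda>U. cauchy_class A (\<lambda>n. star A (cauchy_rep U n))),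
     nrm = (\<lambda>U. lim (\<lambda>n. nrm A (cauchy_rep U n)))\<rparr>"

definition completion_emb :: "('a, 'm) normed_star_algebra_scheme \<Rightarrow> 'a \<Rightarrow> 'a completion" where
  "completion_emb A x = cauchy_class A (\<lambda>_. x)"


subsection \<open>The *-algebra of a monoid with involution\<close>

definition fin_supp_on :: "'a set \<Rightarrow> ('a \<Rightarrow> complex) set" where
  "fin_supp_on S = {x. finite {s. x s \<noteq> 0} \<and> {s. x s \<noteq> 0} \<subseteq> S}"

definition delta :: "'a \<Rightarrow> 'a \<Rightarrow> complex" where
  "delta s = (\<lambda>t. if t = s then 1 else 0)"

text \<open>The bilinear extension of an operation to formal linear combinations.\<close>

definition convolve :: "('a \<Rightarrow> 'b \<Rightarrow> 'c) \<Rightarrow> ('a \<Rightarrow> complex) \<Rightarrow> ('b \<Rightarrow> complex) \<Rightarrow> 'c \<Rightarrow> complex" where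
  "convolve f x y = (\<lambda>t. \<Sum>(s, r) \<in> {(s, r). x s \<noteq> 0 \<and> y r \<noteq> 0 \<and> f s r = t}. x s * y r)"

definition monoid_star_algebra ::
  "('a, 'm) monoid_scheme \<Rightarrow> ('a \<Rightarrow> 'a) \<Rightarrow> (('a \<Rightarrow> complex) \<Rightarrow> real) \<Rightarrow> ('a \<Rightarrow> complex) normed_star_algebra"
  where
  "monoid_star_algebra M j N = \<lparr>
     carrier = fin_supp_on (carrier M),
     mult = convolve (mult M),
     one = delta \<one>\<^bsub>M\<^esub>,
     zero = (\<lambda>_. 0),
     add = (\<lambda>x y t. x t + y t),
     smult = (\<lambda>c x t. c * x t),
     star = (\<lambda>x t. \<Sum>s | x s \<noteq> 0 \<and> j s = t. cnj (x s)),
     nrm = N\<rparr>"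


section \<open>Spatial tensor products\<close>

definition cstar_rep ::
  "('a, 'm) normed_star_algebra_scheme \<Rightarrow> 'h::complex_hilbert set \<Rightarrow> ('a \<Rightarrow> 'h \<Rightarrow> 'h) \<Rightarrow> bool" where
  "cstar_rep A H \<pi> \<longleftrightarrow> closed_csubspace H
     \<and> (\<forall>a\<in>carrier A. bounded_op_on H (\<pi> a))
     \<and> (\<forall>\<xi>\<in>H. \<pi> \<one>\<^bsub>A\<^esub> \<xi> = \<xi>)
     \<and> (\<forall>a\<in>carrier A. \<forall>b\<in>carrier A. \<forall>\<xi>\<in>H.
          \<pi> (a \<oplus>\<^bsub>A\<^esub> b) \<xi> = \<pi> a \<xi> + \<pi> b \<xi> \<and> \<pi> (a \<otimes>\<^bsub>A\<^esub> b) \<xi> = \<pi> a (\<pi> b \<xi>))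
     \<and> (\<forall>c. \<forall>a\<in>carrier A. \<forall>\<xi>\<in>H. \<pi> (c \<odot>\<^bsub>A\<^esub> a) \<xi> = scaleC c (\<pi> a \<xi>))
     \<and> (\<forall>a\<in>carrier A. \<forall>\<xi>\<in>H. \<forall>\<eta>\<in>H. cinner (\<pi> a \<xi>) \<eta> = cinner \<xi> (\<pi> (star A a) \<eta>))"

text \<open>
  A formal linear combination \<open>u\<close> of pairs stands for the element \<open>\<Sum> u(\<xi>,\<eta>) \<xi> \<otimes> \<eta>\<close> of the
  algebraic tensor product of two Hilbert spaces; \<open>tensor_norm u\<close> is its Hilbert space norm.
\<close>

definition tensor_norm :: "('h::complex_hilbert \<times> 'h \<Rightarrow> complex) \<Rightarrow> real" where
  "tensor_norm u = sqrt (Re (\<Sum>(\<xi>, \<eta>) \<in> {p. u p \<noteq> 0}. \<Sum>(\<xi>', \<eta>') \<in> {p. u p \<noteq> 0}.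
     u (\<xi>, \<eta>) * cnj (u (\<xi>', \<eta>')) * cinner \<xi> \<xi>' * cinner \<eta> \<eta>'))"

text \<open>
  The operator norm of \<open>\<Sum> x(a,b) \<pi>(a) \<otimes> \<rho>(b)\<close> on the Hilbert space tensor product of \<open>H\<close> and \<open>K\<close>,
  computed on the dense subspace given by the algebraic tensor product.
\<close>

definition tensor_op_norm ::
  "'h::complex_hilbert set \<Rightarrow> ('a \<Rightarrow> 'h \<Rightarrow> 'h) \<Rightarrow> 'h set \<Rightarrow> ('b \<Rightarrow> 'h \<Rightarrow> 'h) \<Rightarrow> ('a \<times> 'b \<Rightarrow> complex) \<Rightarrow> real"
  where
  "tensor_op_norm H \<pi> K \<rho> x =
     Sup {tensor_norm (convolve (\<lambda>(a, b) (\<xi>, \<eta>). (\<pi> a \<xi>, \<rho> b \<eta>)) x u) | u.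
       u \<in> fin_supp_on (H \<times> K) \<and> tensor_norm u \<le> 1}"

definition spatial_norm ::
  "'h::complex_hilbert itself \<Rightarrow> ('a, 'm) normed_star_algebra_scheme \<Rightarrow> ('b, 'n) normed_star_algebra_scheme
     \<Rightarrow> ('a \<times> 'b \<Rightarrow> complex) \<Rightarrow> real" where
  "spatial_norm _ A B x = Sup {tensor_op_norm H \<pi> K \<rho> x | (H :: 'h set) \<pi> (K :: 'h set) \<rho>.
     cstar_rep A H \<pi> \<and> cstar_rep B K \<rho>}"

text \<open>
  The algebraic tensor product of \<open>A\<close> and \<open>B\<close> is the quotient of the free vector space on
  \<open>carrier A \<times> carrier B\<close> by the bilinearity relations, and the spatial norm is a norm on it. Hence
  the relations are exactly the formal combinations of spatial seminorm zero, and they are divided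
  out in the completion.
\<close>

type_synonym ('a, 'b) tensor = "('a \<times> 'b \<Rightarrow> complex) completion"

definition formal_tensor ::
  "'h::complex_hilbert itself \<Rightarrow> ('a, 'm) normed_star_algebra_scheme \<Rightarrow> ('b, 'n) normed_star_algebra_scheme
     \<Rightarrow> ('a \<times> 'b \<Rightarrow> complex) normed_star_algebra" where
  "formal_tensor h A B =
     monoid_star_algebra (A \<times>\<times> B) (\<lambda>(a, b). (star A a, star B b)) (spatial_norm h A B)"

definition spatial_tensor ::
  "'h::complex_hilbert itself \<Rightarrow> ('a, 'm) normed_star_algebra_scheme \<Rightarrow> ('b, 'n) normed_star_algebra_scheme
     \<Rightarrow> ('a, 'b) tensor normed_star_algebra" where
  "spatial_tensor h A B = completion (formal_tensor h A B)"

definition elem_tensor ::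
  "'h::complex_hilbert itself \<Rightarrow> ('a, 'm) normed_star_algebra_scheme \<Rightarrow> ('b, 'n) normed_star_algebra_scheme
     \<Rightarrow> 'a \<Rightarrow> 'b \<Rightarrow> ('a, 'b) tensor" where
  "elem_tensor h A B a b = completion_emb (formal_tensor h A B) (delta (a, b))"


section \<open>Compact quantum groups\<close>

text \<open>
  The maps \<open>F\<close>, \<open>G\<close> and \<open>\<alpha>\<close> are \<open>\<Delta> \<otimes> id\<close>, \<open>id \<otimes> \<Delta>\<close> and the canonical identification of
  \<open>(A \<otimes> A) \<otimes> A\<close> with \<open>A \<otimes> (A \<otimes> A)\<close>. Being *-homomorphisms of C*-algebras they are continuous,
  hence determined by their values on elementary tensors.
\<close>

definition coassociative ::
  "'h::complex_hilbert itself \<Rightarrow> ('a, 'm) normed_star_algebra_scheme \<Rightarrow> ('a \<Rightarrow> ('a, 'a) tensor) \<Rightarrow> bool" where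
  "coassociative h A \<Delta> \<longleftrightarrow>
     (let AA = spatial_tensor h A A;
          AA_A = spatial_tensor h AA A;
          A_AA = spatial_tensor h A AA
      in \<exists>F G \<alpha>. star_hom AA AA_A F \<and> star_hom AA A_AA G \<and> star_iso AA_A A_AA \<alpha>
        \<and> (\<forall>a\<in>carrier A. \<forall>b\<in>carrier A. F (elem_tensor h A A a b) = elem_tensor h AA A (\<Delta> a) b)
        \<and> (\<forall>a\<in>carrier A. \<forall>b\<in>carrier A. G (elem_tensor h A A a b) = elem_tensor h A AA a (\<Delta> b))
        \<and> (\<forall>a\<in>carrier A. \<forall>b\<in>carrier A. \<forall>c\<in>carrier A.
             \<alpha> (elem_tensor h AA A (elem_tensor h A A a b) c)
               = elem_tensor h A AA a (elem_tensor h A A b c))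
        \<and> (\<forall>a\<in>carrier A. \<alpha> (F (\<Delta> a)) = G (\<Delta> a)))"

text \<open>\<open>\<Delta>(A)(A \<otimes> 1)\<close> and \<open>\<Delta>(A)(1 \<otimes> A)\<close> denote linear spans of products.\<close>

definition compact_quantum_group ::
  "'h::complex_hilbert itself \<Rightarrow> ('a, 'm) normed_star_algebra_scheme \<Rightarrow> ('a \<Rightarrow> ('a, 'a) tensor) \<Rightarrow> bool" where
  "compact_quantum_group h A \<Delta> \<longleftrightarrow>
     (let AA = spatial_tensor h A A
      in unital_cstar_algebra A \<and> star_hom A AA \<Delta> \<and> coassociative h A \<Delta>
        \<and> dense_in AA (linear_span AA
             {\<Delta> a \<otimes>\<^bsub>AA\<^esub> elem_tensor h A A b \<one>\<^bsub>A\<^esub> | a b. a \<in> carrier A \<and> b \<in> carrier A})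
        \<and> dense_in AA (linear_span AA
             {\<Delta> a \<otimes>\<^bsub>AA\<^esub> elem_tensor h A A \<one>\<^bsub>A\<^esub> b | a b. a \<in> carrier A \<and> b \<in> carrier A}))"


section \<open>Discrete groups\<close>

text \<open>Functions on a group \<open>G\<close> are represented by functions that vanish outside \<open>carrier G\<close>.\<close>

definition linf :: "('g, 'm) monoid_scheme \<Rightarrow> ('g \<Rightarrow> complex) ring" where
  "linf G = \<lparr>
     carrier = {f. bounded (range f) \<and> (\<forall>s. s \<notin> carrier G \<longrightarrow> f s = 0)},
     mult = (\<lambda>f g s. f s * g s),
     one = (\<lambda>s. if s \<in> carrier G then 1 else 0),
     zero = (\<lambda>_. 0),
     add = (\<lambda>f g s. f s + g s)\<rparr>"

definition left_translate :: "('g, 'm) monoid_scheme \<Rightarrow> 'g \<Rightarrow> ('g \<Rightarrow> complex) \<Rightarrow> 'g \<Rightarrow> complex" where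
  "left_translate G s f = (\<lambda>t. if t \<in> carrier G then f (inv\<^bsub>G\<^esub> s \<otimes>\<^bsub>G\<^esub> t) else 0)"

definition right_translate :: "('g, 'm) monoid_scheme \<Rightarrow> 'g \<Rightarrow> ('g \<Rightarrow> complex) \<Rightarrow> 'g \<Rightarrow> complex" where
  "right_translate G s f = (\<lambda>t. if t \<in> carrier G then f (t \<otimes>\<^bsub>G\<^esub> s) else 0)"

definition translation_invariant :: "('g, 'm) monoid_scheme \<Rightarrow> ('g \<Rightarrow> complex) set \<Rightarrow> bool" where
  "translation_invariant G D \<longleftrightarrow>
     (\<forall>s\<in>carrier G. \<forall>f\<in>D. left_translate G s f \<in> D \<and> right_translate G s f \<in> D)"

text \<open>The inclusion of \<open>linf (G Mod L)\<close> into \<open>linf G\<close>.\<close>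

definition quotient_pullback ::
  "('g, 'm) monoid_scheme \<Rightarrow> 'g set \<Rightarrow> ('g set \<Rightarrow> complex) \<Rightarrow> 'g \<Rightarrow> complex" where
  "quotient_pullback G L f = (\<lambda>s. if s \<in> carrier G then f (L #>\<^bsub>G\<^esub> s) else 0)"

definition amenable :: "('g, 'm) monoid_scheme \<Rightarrow> bool" where
  "amenable G \<longleftrightarrow> (\<exists>\<mu> :: ('g \<Rightarrow> complex) \<Rightarrow> complex.
     (\<forall>f\<in>carrier (linf G). \<forall>g\<in>carrier (linf G). \<mu> (\<lambda>s. f s + g s) = \<mu> f + \<mu> g)
     \<and> (\<forall>c. \<forall>f\<in>carrier (linf G). \<mu> (\<lambda>s. c * f s) = c * \<mu> f)
     \<and> (\<forall>f\<in>carrier (linf G). range f \<subseteq> \<real>\<^sub>\<ge>\<^sub>0 \<longrightarrow> \<mu> f \<in> \<real>\<^sub>\<ge>\<^sub>0)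
     \<and> \<mu> \<one>\<^bsub>linf G\<^esub> = 1
     \<and> (\<forall>s\<in>carrier G. \<forall>f\<in>carrier (linf G). \<mu> (left_translate G s f) = \<mu> f))"

definition unitary_rep ::
  "('g, 'm) monoid_scheme \<Rightarrow> 'h::complex_hilbert set \<Rightarrow> ('g \<Rightarrow> 'h \<Rightarrow> 'h) \<Rightarrow> bool" where
  "unitary_rep G H \<pi> \<longleftrightarrow> closed_csubspace H
     \<and> (\<forall>s\<in>carrier G. unitary_op_on H (\<pi> s))
     \<and> (\<forall>s\<in>carrier G. \<forall>t\<in>carrier G. \<forall>\<xi>\<in>H. \<pi> (s \<otimes>\<^bsub>G\<^esub> t) \<xi> = \<pi> s (\<pi> t \<xi>))"

text \<open>Property (T) in terms of a Kazhdan pair \<open>(Q, \<epsilon>)\<close>; compact subsets of a discrete group are finite.\<close>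

definition property_T :: "'h::complex_hilbert itself \<Rightarrow> ('g, 'm) monoid_scheme \<Rightarrow> bool" where
  "property_T _ G \<longleftrightarrow> (\<exists>Q \<epsilon>. finite Q \<and> Q \<subseteq> carrier G \<and> 0 < \<epsilon>
     \<and> (\<forall>(H :: 'h set) \<pi>. unitary_rep G H \<pi>
          \<and> (\<exists>\<xi>\<in>H. \<xi> \<noteq> 0 \<and> (\<forall>s\<in>Q. norm (\<pi> s \<xi> - \<xi>) < \<epsilon> * norm \<xi>))
          \<longrightarrow> (\<exists>\<eta>\<in>H. \<eta> \<noteq> 0 \<and> (\<forall>s\<in>carrier G. \<pi> s \<eta> = \<eta>))))"

definition D_representation ::
  "('g, 'm) monoid_scheme \<Rightarrow> ('g \<Rightarrow> complex) set \<Rightarrow> 'h::complex_hilbert set \<Rightarrow> ('g \<Rightarrow> 'h \<Rightarrow> 'h) \<Rightarrow> bool" where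
  "D_representation G D H \<pi> \<longleftrightarrow> unitary_rep G H \<pi>
     \<and> (\<exists>H0. csubspace H0 \<and> H0 \<subseteq> H \<and> H \<subseteq> closure H0
          \<and> (\<forall>\<xi>\<in>H0. \<forall>\<eta>\<in>H0. (\<lambda>s. if s \<in> carrier G then cinner (\<pi> s \<xi>) \<eta> else 0) \<in> D))"


section \<open>Group C*-algebras\<close>

definition group_algebra ::
  "('g, 'm) monoid_scheme \<Rightarrow> (('g \<Rightarrow> complex) \<Rightarrow> real) \<Rightarrow> ('g \<Rightarrow> complex) normed_star_algebra" where
  "group_algebra G N = monoid_star_algebra G (m_inv G) N"

definition group_algebra_op :: "('g \<Rightarrow> 'h \<Rightarrow> 'h::complex_hilbert) \<Rightarrow> ('g \<Rightarrow> complex) \<Rightarrow> 'h \<Rightarrow> 'h" where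
  "group_algebra_op \<pi> x \<xi> = (\<Sum>s | x s \<noteq> 0. scaleC (x s) (\<pi> s \<xi>))"

definition full_norm ::
  "'h::complex_hilbert itself \<Rightarrow> ('g, 'm) monoid_scheme \<Rightarrow> ('g \<Rightarrow> complex) \<Rightarrow> real" where
  "full_norm _ G x = Sup {op_norm_on H (group_algebra_op \<pi> x) | (H :: 'h set) \<pi>. unitary_rep G H \<pi>}"

definition D_norm ::
  "'h::complex_hilbert itself \<Rightarrow> ('g, 'm) monoid_scheme \<Rightarrow> ('g \<Rightarrow> complex) set \<Rightarrow> ('g \<Rightarrow> complex) \<Rightarrow> real" where
  "D_norm _ G D x =
     Sup {op_norm_on H (group_algebra_op \<pi> x) | (H :: 'h set) \<pi>. D_representation G D H \<pi>}"

definition left_regular :: "('g, 'm) monoid_scheme \<Rightarrow> 'g \<Rightarrow> 'g ell2 \<Rightarrow> 'g ell2" where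
  "left_regular G s f = Abs_ell2 (left_translate G s (Rep_ell2 f))"

definition reduced_norm :: "('g, 'm) monoid_scheme \<Rightarrow> ('g \<Rightarrow> complex) \<Rightarrow> real" where
  "reduced_norm G x =
     op_norm_on {f. \<forall>s. s \<notin> carrier G \<longrightarrow> Rep_ell2 f s = 0} (group_algebra_op (left_regular G) x)"

text \<open>
  The completions of the group ring with respect to two norms are equal when the identity map of
  the group ring extends to an isomorphism.
\<close>

definition group_completions_equal ::
  "('g, 'm) monoid_scheme \<Rightarrow> (('g \<Rightarrow> complex) \<Rightarrow> real) \<Rightarrow> (('g \<Rightarrow> complex) \<Rightarrow> real) \<Rightarrow> bool" where
  "group_completions_equal G N1 N2 \<longleftrightarrow>
     (\<exists>\<Phi>. star_iso (completion (group_algebra G N1)) (completion (group_algebra G N2)) \<Phi>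
        \<and> (\<forall>x\<in>fin_supp_on (carrier G).
             \<Phi> (completion_emb (group_algebra G N1) x) = completion_emb (group_algebra G N2) x))"

definition cstar_D ::
  "'h::complex_hilbert itself \<Rightarrow> ('g, 'm) monoid_scheme \<Rightarrow> ('g \<Rightarrow> complex) set
     \<Rightarrow> ('g \<Rightarrow> complex) completion normed_star_algebra" where
  "cstar_D h G D = completion (group_algebra G (D_norm h G D))"

definition cstar_D_emb ::
  "'h::complex_hilbert itself \<Rightarrow> ('g, 'm) monoid_scheme \<Rightarrow> ('g \<Rightarrow> complex) set
     \<Rightarrow> 'g \<Rightarrow> ('g \<Rightarrow> complex) completion" where
  "cstar_D_emb h G D s = completion_emb (group_algebra G (D_norm h G D)) (delta s)"

end

theory Submission
  imports Defs
begin

text \<open>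
  The coefficients of \<open>\<pi> \<otimes> \<tau>\<close> at elementary tensors are products of coefficients of \<open>\<pi>\<close> and bounded
  functions. Hence \<open>\<pi> \<otimes> \<tau>\<close> is a \<open>D1\<close>-representation for every \<open>D1\<close>-representation \<open>\<pi>\<close> and every unitary
  representation \<open>\<tau>\<close>, and \<open>\<parallel>\<Sum> x(s) \<pi>\<^sub>s \<otimes> \<tau>\<^sub>s\<parallel> \<le> \<parallel>x\<parallel>\<close> in the norm of \<open>C*\<^sub>D\<^sub>1(\<Gamma>)\<close>. As weak containment
  is stable under tensor products, this estimate persists when \<open>\<pi>\<close> comes from any representation of
  \<open>C*\<^sub>D\<^sub>1(\<Gamma>)\<close>. So \<open>s \<mapsto> s \<otimes> s\<close> extends to a comultiplication, and the density conditions hold because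
  \<open>s \<otimes> t = \<Delta>(s) (1 \<otimes> s\<^sup>-\<^sup>1t)\<close>.

  If \<open>C*\<^sub>D\<^sub>1(\<Gamma>)\<close> were the full C*-algebra, then some \<open>D1\<close>-representation would have almost invariant
  vectors, and by Property (T) a nonzero invariant vector. The coefficient at a nearby vector of the dense
  subspace lies in \<open>D1\<close> and is bounded away from zero, so that \<open>D1\<close> would not be proper.

  A nonzero translation invariant ideal contains all finitely supported functions. Applied to \<open>D2\<close>,
  this shows that the quasi-regular representation on \<open>\<ell>\<^sup>2(\<Gamma>/\<Lambda>)\<close> is a \<open>D1\<close>-representation. It has a
  nonzero \<open>\<Lambda>\<close>-invariant vector, so if \<open>C*\<^sub>D\<^sub>1(\<Gamma>)\<close> were the reduced C*-algebra, then the left regular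
  representation of \<open>\<Gamma>\<close> would have almost \<open>\<Lambda>\<close>-invariant vectors, and \<open>\<Lambda>\<close> would be amenable.
\<close>

section \<open>Hilbert spaces\<close>

text \<open>The \<open>D1\<close>-representations absorb unitary representations under tensor
  products, but a representation of the completion need only be weakly contained in them, and the
  spatial norm ranges over all representations of the completion. This gap occurs for the
  comultiplication and again for coassociativity, where representations of
  \<open>A \<otimes> A\<close> have to be compared with tensor products of representations; the
  estimate \<open>tensor_act_weak_containment\<close> closes it each time.

  No spectral theory enters. The seminorms considered are recovered from positive functionals whose
  left multiplications they bound (\<open>pre_cstar\<close>). This survives completion, yields the
  C*-identity and, through the Neumann series, shows that *-homomorphisms and representations are
  contractive.

  The suprema defining \<open>D_norm\<close>, \<open>full_norm\<close> and the spatial norm run over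
  closed subspaces of one \<open>'i ell2\<close>; since \<open>'i\<close> is infinite, a bijection
  of \<open>'i \<times> 'i\<close> with \<open>'i\<close> keeps tensor products inside it.\<close>

lemma scaleC_one: "scaleC 1 (x::'h::complex_hilbert) = x"
  using scaleR_scaleC[of 1 x] by simp

lemma cinner_add_right: "cinner (x::'h::complex_hilbert) (y + z) = cinner x y + cinner x z"
  by (metis cinner_add_left cinner_commute complex_cnj_add)

lemma cinner_scaleC_right: "cinner (x::'h::complex_hilbert) (scaleC a y) = cnj a * cinner x y"
  by (metis cinner_scaleC_left cinner_commute complex_cnj_mult)

lemma cinner_self: "cinner (x::'h::complex_hilbert) x = of_real ((norm x)\<^sup>2)"
proof -
  have "Im (cinner x x) = 0"
    using arg_cong[OF cinner_commute[of x x], of Im] by simp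
  moreover have "Re (cinner x x) = (norm x)\<^sup>2"
    by (simp flip: inner_cinner add: power2_norm_eq_inner)
  ultimately show ?thesis by (simp add: complex_eq_iff)
qed

lemma norm_scaleC: "norm (scaleC a (x::'h::complex_hilbert)) = cmod a * norm x"
proof -
  have "complex_of_real ((norm (scaleC a x))\<^sup>2) = of_real ((cmod a * norm x)\<^sup>2)"
    unfolding cinner_self[symmetric] cinner_scaleC_left cinner_scaleC_right
    by (simp add: cinner_self power_mult_distrib mult_ac complex_norm_square[symmetric])
  then have "(norm (scaleC a x))\<^sup>2 = (cmod a * norm x)\<^sup>2"
    by (simp only: of_real_eq_iff)
  then show ?thesis by (simp add: power2_eq_iff_nonneg)
qed

text \<open>Scaling \<open>x\<close> by the conjugate of \<open>cinner x y\<close> makes the inner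
  product a nonnegative real, so that the real Cauchy-Schwarz inequality applies; the common factor
  \<open>cmod a\<close> then cancels.\<close>

lemma cmod_cinner_le: "cmod (cinner (x::'h::complex_hilbert) y) \<le> norm x * norm y"
proof (cases "cinner x y = 0")
  case False
  define a where "a = cnj (cinner x y)"
  have "cmod a * cmod (cinner x y) = Re (a * cinner x y)"
    unfolding a_def using cmod_power2[of "cinner x y"]
    by (simp add: power2_eq_square)
  also have "\<dots> = inner (scaleC a x) y"
    by (simp add: inner_cinner cinner_scaleC_left)
  also have "\<dots> \<le> norm (scaleC a x) * norm y" by (rule norm_cauchy_schwarz)
  also have "\<dots> = cmod a * (norm x * norm y)" by (simp add: norm_scaleC)
  finally show ?thesis using False by (simp add: a_def)
qed simp

lemma bounded_bilinear_scaleC: "bounded_bilinear (scaleC :: complex \<Rightarrow> 'h \<Rightarrow> 'h::complex_hilbert)"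
  by unfold_locales
    (auto simp: scaleC_add_left scaleC_add_right scaleR_scaleC scaleC_scaleC norm_scaleC mult.commute
      scaleR_conv_of_real intro!: exI[of _ 1])

lemma bounded_bilinear_cinner: "bounded_bilinear (cinner :: 'h \<Rightarrow> 'h::complex_hilbert \<Rightarrow> complex)"
  by unfold_locales
    (auto simp: cinner_add_left cinner_add_right cinner_scaleC_left cinner_scaleC_right scaleR_scaleC
      scaleR_conv_of_real cmod_cinner_le intro!: exI[of _ 1])

interpretation scaleC: bounded_bilinear "scaleC :: complex \<Rightarrow> 'h \<Rightarrow> 'h::complex_hilbert"
  by (rule bounded_bilinear_scaleC)

interpretation cinner: bounded_bilinear "cinner :: 'h \<Rightarrow> 'h::complex_hilbert \<Rightarrow> complex"
  by (rule bounded_bilinear_cinner)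

lemmas [simp] = scaleC.zero_left scaleC.zero_right cinner.zero_left cinner.zero_right scaleC_one

text \<open>Meant for \<open>x = T y\<close>: an estimate for coefficients of \<open>T\<close>,
  tested against the vector \<open>T y\<close> itself, becomes a bound on the norm of
  \<open>T y\<close>.\<close>

lemma norm_le_of_cinner:
  assumes "0 \<le> B" "cmod (cinner (x::'h::complex_hilbert) x) \<le> B * norm x"
  shows "norm x \<le> B"
  using assms by (cases "x = 0") (auto simp: cinner_self norm_power power2_eq_square norm_mult)

lemma csubspace_0: "csubspace H \<Longrightarrow> 0 \<in> H"
  and csubspace_add: "csubspace H \<Longrightarrow> x \<in> H \<Longrightarrow> y \<in> H \<Longrightarrow> x + y \<in> H"
  and csubspace_scaleC: "csubspace H \<Longrightarrow> x \<in> H \<Longrightarrow> scaleC a x \<in> H"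
  by (auto simp: csubspace_def)

lemma csubspace_diff: "csubspace H \<Longrightarrow> x \<in> H \<Longrightarrow> y \<in> H \<Longrightarrow> x - y \<in> H"
  using csubspace_add[of H x "scaleC (-1) y"] csubspace_scaleC[of H y "-1"]
  by (simp add: scaleC.minus_left scaleC_one)

lemma csubspace_sum: "csubspace H \<Longrightarrow> (\<And>i. i \<in> F \<Longrightarrow> f i \<in> H) \<Longrightarrow> sum f F \<in> H"
  by (induction F rule: infinite_finite_induct) (simp_all add: csubspace_0 csubspace_add)

lemma csubspace_closure:
  assumes "csubspace (H::'h::complex_hilbert set)" shows "csubspace (closure H)"
  unfolding csubspace_def
proof (intro conjI ballI allI)
  show "0 \<in> closure H" using csubspace_0[OF assms] closure_subset[of H] by blast
next
  fix x y assume "x \<in> closure H" "y \<in> closure H"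
  then obtain f g where *: "\<And>n. f n \<in> H" "f \<longlonglongrightarrow> x" "\<And>n. g n \<in> H" "g \<longlonglongrightarrow> y"
    by (meson closure_sequential)
  then have "(\<lambda>n. f n + g n) \<longlonglongrightarrow> x + y" by (intro tendsto_add)
  then show "x + y \<in> closure H" using * csubspace_add[OF assms]
    by (intro iffD2[OF closure_sequential] exI[of _ "\<lambda>n. f n + g n"]) simp
next
  fix a x assume "x \<in> closure H"
  then obtain f where *: "\<And>n. f n \<in> H" "f \<longlonglongrightarrow> x" by (meson closure_sequential)
  then have "(\<lambda>n. scaleC a (f n)) \<longlonglongrightarrow> scaleC a x"
    by (intro scaleC.tendsto tendsto_const)
  then show "scaleC a x \<in> closure H" using * csubspace_scaleC[OF assms]
    by (intro iffD2[OF closure_sequential] exI[of _ "\<lambda>n. scaleC a (f n)"]) simp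
qed

definition cspan :: "'h::complex_hilbert set \<Rightarrow> 'h set" where
  "cspan S = \<Inter>{V. csubspace V \<and> S \<subseteq> V}"

lemma csubspace_cspan: "csubspace (cspan S)"
  unfolding cspan_def csubspace_def by auto

lemma cspan_superset: "S \<subseteq> cspan S"
  unfolding cspan_def by auto

lemma cspan_least: "csubspace V \<Longrightarrow> S \<subseteq> V \<Longrightarrow> cspan S \<subseteq> V"
  unfolding cspan_def by auto

lemma closed_csubspace_closure_cspan: "closed_csubspace (closure (cspan S))"
  unfolding closed_csubspace_def using csubspace_closure csubspace_cspan by auto

lemma linear_op_onD:
  assumes "linear_op_on H T"
  shows "x \<in> H \<Longrightarrow> T x \<in> H" "x \<in> H \<Longrightarrow> y \<in> H \<Longrightarrow> T (x + y) = T x + T y"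
    "x \<in> H \<Longrightarrow> T (scaleC a x) = scaleC a (T x)"
  using assms by (auto simp: linear_op_on_def)

lemma linear_op_on_0: "linear_op_on H T \<Longrightarrow> csubspace H \<Longrightarrow> T 0 = 0"
  using linear_op_onD(3)[of H T 0 0] csubspace_0[of H] by simp

lemma linear_op_on_diff:
  "linear_op_on H T \<Longrightarrow> csubspace H \<Longrightarrow> x \<in> H \<Longrightarrow> y \<in> H \<Longrightarrow> T (x - y) = T x - T y"
  using linear_op_onD(2)[of H T "x - y" y] csubspace_diff[of H x y] by (simp add: algebra_simps)

lemma linear_op_on_sum:
  assumes "linear_op_on H T" "csubspace H" "\<And>i. i \<in> F \<Longrightarrow> f i \<in> H"
  shows "T (sum f F) = (\<Sum>i\<in>F. T (f i))"
  using assms(3)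
proof (induction F rule: infinite_finite_induct)
  case (insert x F)
  then show ?case
    using linear_op_onD(2)[OF assms(1), of "f x" "sum f F"] csubspace_sum[OF assms(2), of F f] by auto
qed (auto simp: linear_op_on_0[OF assms(1,2)])

lemma bounded_op_on_tendsto:
  assumes "bounded_op_on H T" "csubspace H" "\<And>n. f n \<in> H" "x \<in> H" "f \<longlonglongrightarrow> x"
  shows "(\<lambda>n. T (f n)) \<longlonglongrightarrow> T x"
proof -
  from assms(1) obtain B where lin: "linear_op_on H T" and B: "\<And>x. x \<in> H \<Longrightarrow> norm (T x) \<le> B * norm x"
    by (auto simp: bounded_op_on_def)
  have "(\<lambda>n. T (f n) - T x) \<longlonglongrightarrow> 0"
  proof (rule Lim_null_comparison)
    show "\<forall>\<^sub>F n in sequentially. norm (T (f n) - T x) \<le> B * norm (f n - x)"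
      using B[OF csubspace_diff[OF assms(2,3,4)]]
      by (simp add: linear_op_on_diff[OF lin assms(2,3,4), symmetric])
    show "(\<lambda>n. B * norm (f n - x)) \<longlonglongrightarrow> 0"
      using assms(5) by (intro tendsto_mult_right_zero tendsto_norm_zero) (simp add: LIM_zero_iff)
  qed
  then show ?thesis by (simp add: LIM_zero_iff)
qed

text \<open>Boundedness with some constant gives continuity; continuity then carries the sharp
  constant \<open>B\<close> from a dense set to all of \<open>H\<close>.\<close>

lemma bounded_op_on_bound_closure:
  assumes T: "bounded_op_on H T" and "csubspace H" "S \<subseteq> H" "H \<subseteq> closure S"
    and B: "\<And>x. x \<in> S \<Longrightarrow> norm (T x) \<le> B * norm x" and "x \<in> H"
  shows "norm (T x) \<le> B * norm x"
proof -
  obtain f where f: "\<And>n. f n \<in> S" "f \<longlonglongrightarrow> x"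
    using assms(4,6) unfolding closure_sequential[symmetric] by (meson closure_sequential subsetD)
  have "(\<lambda>n. T (f n)) \<longlonglongrightarrow> T x"
    using f assms by (intro bounded_op_on_tendsto[OF T]) auto
  then show ?thesis
    by (rule LIMSEQ_le[OF tendsto_norm tendsto_mult_left[OF tendsto_norm[OF f(2)]]])
      (use B f in auto)
qed

lemma csubspace_equalizer:
  assumes "linear_op_on H T" "linear_op_on H T'" "csubspace H"
  shows "csubspace {x \<in> H. T x = T' x}"
  using assms(3) unfolding csubspace_def
  by (auto simp: linear_op_onD[OF assms(1)] linear_op_onD[OF assms(2)]
    linear_op_on_0[OF assms(1,3)] linear_op_on_0[OF assms(2,3)])

lemma bounded_op_on_eq_closure_cspan:
  assumes T: "bounded_op_on H T" and T': "bounded_op_on H T'" and H: "H = closure (cspan S)"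
    and eq: "\<And>x. x \<in> S \<Longrightarrow> T x = T' x" and "x \<in> H"
  shows "T x = T' x"
proof -
  have csH: "csubspace H" unfolding H by (rule csubspace_closure[OF csubspace_cspan])
  have sub: "cspan S \<subseteq> H" unfolding H by (rule closure_subset)
  have "cspan S \<subseteq> {x \<in> H. T x = T' x}"
    proof (intro cspan_least csubspace_equalizer csH)
    show "linear_op_on H T" "linear_op_on H T'" using T T' by (auto simp: bounded_op_on_def)
    show "S \<subseteq> {x \<in> H. T x = T' x}" using eq cspan_superset[of S] sub by blast
  qed
  then have span: "T x = T' x" if "x \<in> cspan S" for x using that by auto
  obtain f where f: "\<And>n. f n \<in> cspan S" "f \<longlonglongrightarrow> x"
    using \<open>x \<in> H\<close> unfolding H closure_sequential by blast
  have "(\<lambda>n. T (f n)) \<longlonglongrightarrow> T x" "(\<lambda>n. T' (f n)) \<longlonglongrightarrow> T' x"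
    using f sub by (blast intro: bounded_op_on_tendsto[OF T csH _ \<open>x \<in> H\<close>]
      bounded_op_on_tendsto[OF T' csH _ \<open>x \<in> H\<close>])+
  then show ?thesis using span f LIMSEQ_unique by simp
qed

text \<open>The constant \<open>C\<close> guarantees that the set in \<open>op_norm_on\<close> is
  bounded, so that its supremum can be compared with \<open>B\<close>; rescaling to norm one turns
  the bound on the unit ball into a homogeneous one.\<close>

lemma op_norm_on_le_iff:
  assumes T: "linear_op_on H T" and "csubspace (H::'h::complex_hilbert set)"
    and bd: "\<And>x. x \<in> H \<Longrightarrow> norm (T x) \<le> C * norm x" and "0 \<le> B"
  shows "op_norm_on H T \<le> B \<longleftrightarrow> (\<forall>x\<in>H. norm (T x) \<le> B * norm x)"
proof -
  let ?S = "{norm (T x) | x. x \<in> H \<and> norm x \<le> 1}"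
  have ne: "?S \<noteq> {}" using csubspace_0[OF assms(2)] by fastforce
  have bdd: "bdd_above ?S"
  proof (rule bdd_aboveI)
    fix y assume "y \<in> ?S"
    then obtain x where x: "y = norm (T x)" "x \<in> H" "norm x \<le> 1" by auto
    have "norm (T x) \<le> C * norm x" by (rule bd) fact
    also have "\<dots> \<le> \<bar>C\<bar> * 1" using x by (intro mult_mono) auto
    finally show "y \<le> \<bar>C\<bar>" using x by simp
  qed
  show ?thesis unfolding op_norm_on_def cSup_le_iff[OF ne bdd]
  proof
    assume *: "\<forall>y\<in>?S. y \<le> B"
    show "\<forall>x\<in>H. norm (T x) \<le> B * norm x"
    proof
      fix x assume x: "x \<in> H"
      show "norm (T x) \<le> B * norm x"
      proof (cases "x = 0")
        case False
        have "norm (T (scaleC (of_real (inverse (norm x))) x)) \<in> ?S"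
          using False csubspace_scaleC[OF assms(2) x]
          by (intro CollectI exI conjI refl) (auto simp: norm_scaleC norm_inverse)
        then have "norm (T (scaleC (of_real (inverse (norm x))) x)) \<le> B"
          using * by blast
        then show ?thesis using False x
          by (simp add: linear_op_onD(3)[OF T] norm_scaleC norm_divide norm_inverse field_simps)
      qed (use linear_op_on_0[OF T assms(2)] in simp)
    qed
  next
    assume *: "\<forall>x\<in>H. norm (T x) \<le> B * norm x"
    show "\<forall>y\<in>?S. y \<le> B"
    proof
      fix y assume "y \<in> ?S"
      then obtain x where x: "y = norm (T x)" "x \<in> H" "norm x \<le> 1" by auto
      have "norm (T x) \<le> B * 1" using * x \<open>0 \<le> B\<close> by (meson mult_left_mono order_trans)
      then show "y \<le> B" using x by simp
    qed
  qed
qed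


section \<open>Finitely supported functions\<close>

text \<open>The linear extension of \<open>v\<close> to formal combinations. The action of an
  algebra element on a vector, the evaluation of a formal tensor and, for complex-valued
  \<open>v\<close>, the pairing of a function with a test function all have this form, so they share
  one calculus.\<close>

definition lincomb :: "('a \<Rightarrow> 'h::complex_hilbert) \<Rightarrow> ('a \<Rightarrow> complex) \<Rightarrow> 'h" where
  "lincomb v x = (\<Sum>s | x s \<noteq> 0. scaleC (x s) (v s))"

lemma group_algebra_op_lincomb: "group_algebra_op W x \<xi> = lincomb (\<lambda>s. W s \<xi>) x"
  by (simp add: group_algebra_op_def lincomb_def)

lemma fin_supp_onD: "x \<in> fin_supp_on S \<Longrightarrow> finite {s. x s \<noteq> 0}"
  "x \<in> fin_supp_on S \<Longrightarrow> x s \<noteq> 0 \<Longrightarrow> s \<in> S"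
  by (auto simp: fin_supp_on_def)



lemma lincomb_superset:
  assumes "finite F" "{s. x s \<noteq> 0} \<subseteq> F"
  shows "lincomb v x = (\<Sum>s\<in>F. scaleC (x s) (v s))"
  unfolding lincomb_def using assms by (intro sum.mono_neutral_left) auto

lemma lincomb_cong:
  assumes "x \<in> fin_supp_on S" "\<And>s. s \<in> S \<Longrightarrow> v s = w s" shows "lincomb v x = lincomb w x"
  unfolding lincomb_def using assms by (intro sum.cong) (auto simp: fin_supp_on_def)

lemma lincomb_add:
  assumes "x \<in> fin_supp_on S" "y \<in> fin_supp_on S'"
  shows "lincomb v (\<lambda>t. x t + y t) = lincomb v x + lincomb v y"
proof -
  let ?F = "{s. x s \<noteq> 0} \<union> {s. y s \<noteq> 0}"
  have F: "finite ?F" using assms by (auto simp: fin_supp_on_def)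
  show ?thesis
    by (subst (1 2 3) lincomb_superset[OF F]) (auto simp: scaleC_add_left sum.distrib)
qed

lemma lincomb_scale:
  assumes "x \<in> fin_supp_on S"
  shows "lincomb v (\<lambda>t. c * x t) = scaleC c (lincomb v x)"
proof -
  have F: "finite {s. x s \<noteq> 0}" using assms by (auto simp: fin_supp_on_def)
  show ?thesis
    by (subst (1 2) lincomb_superset[OF F]) (auto simp: scaleC_scaleC scaleC.sum_right)
qed

lemma lincomb_delta: "lincomb v (delta s) = v s"
  by (subst lincomb_superset[of "{s}"]) (auto simp: delta_def scaleC_one)

lemma lincomb_zero: "lincomb v (\<lambda>_. 0) = 0"
  by (simp add: lincomb_def)

lemma lincomb_linear_op:
  assumes "linear_op_on H T" "csubspace H" "x \<in> fin_supp_on S" "\<And>s. s \<in> S \<Longrightarrow> v s \<in> H"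
  shows "T (lincomb v x) = lincomb (\<lambda>s. T (v s)) x" "lincomb v x \<in> H"
proof -
  have "T (lincomb v x) = (\<Sum>s | x s \<noteq> 0. T (scaleC (x s) (v s)))"
    unfolding lincomb_def using assms
    by (intro linear_op_on_sum[OF assms(1,2)] csubspace_scaleC) (auto simp: fin_supp_on_def)
  also have "\<dots> = lincomb (\<lambda>s. T (v s)) x"
    unfolding lincomb_def using assms
    by (intro sum.cong linear_op_onD(3)[OF assms(1)]) (auto simp: fin_supp_on_def)
  finally show "T (lincomb v x) = lincomb (\<lambda>s. T (v s)) x" .
  show "lincomb v x \<in> H"
    unfolding lincomb_def using assms
    by (intro csubspace_sum csubspace_scaleC) (auto simp: fin_supp_on_def)
qed

lemma lincomb_in: "csubspace H \<Longrightarrow> x \<in> fin_supp_on S \<Longrightarrow> (\<And>s. s \<in> S \<Longrightarrow> v s \<in> H) \<Longrightarrow> lincomb v x \<in> H"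
  unfolding lincomb_def
  by (intro csubspace_sum csubspace_scaleC) (auto simp: fin_supp_on_def)

lemma lincomb_sum_op:
  assumes "x \<in> fin_supp_on S"
  shows "lincomb (\<lambda>s. v s + w s) x = lincomb v x + lincomb w x"
    "lincomb (\<lambda>s. scaleC c (v s)) x = scaleC c (lincomb v x)"
  by (simp_all add: lincomb_def scaleC_add_right sum.distrib scaleC.sum_right scaleC_scaleC mult.commute)

lemma norm_lincomb_le:
  assumes "\<And>s. s \<in> S \<Longrightarrow> norm (v s) \<le> b s" "x \<in> fin_supp_on S"
  shows "norm (lincomb v x) \<le> (\<Sum>s | x s \<noteq> 0. cmod (x s) * b s)"
  unfolding lincomb_def
  by (rule sum_norm_le) (use assms in \<open>auto simp: norm_scaleC fin_supp_on_def intro!: mult_left_mono\<close>)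

lemma cinner_lincomb:
  "cinner (lincomb v x) w = (\<Sum>s | x s \<noteq> 0. x s * cinner (v s) w)"
  "cinner w (lincomb v x) = (\<Sum>s | x s \<noteq> 0. cnj (x s) * cinner w (v s))"
  by (simp_all add: lincomb_def cinner.sum_left cinner.sum_right cinner_scaleC_left cinner_scaleC_right)

lemma fin_supp_on_add: "x \<in> fin_supp_on S \<Longrightarrow> y \<in> fin_supp_on S \<Longrightarrow> (\<lambda>t. x t + y t) \<in> fin_supp_on S"
  proof -
  assume "x \<in> fin_supp_on S" "y \<in> fin_supp_on S"
  moreover have "{s. x s + y s \<noteq> 0} \<subseteq> {s. x s \<noteq> 0} \<union> {s. y s \<noteq> 0}" by auto
  ultimately show ?thesis unfolding fin_supp_on_def by (blast intro: finite_subset finite_UnI)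
qed

lemma fin_supp_on_scale: "x \<in> fin_supp_on S \<Longrightarrow> (\<lambda>t. c * x t) \<in> fin_supp_on S"
  by (cases "c = 0") (auto simp: fin_supp_on_def)

lemma fin_supp_on_zero: "(\<lambda>_. 0) \<in> fin_supp_on S"
  by (simp add: fin_supp_on_def)

lemma fin_supp_on_delta: "s \<in> S \<Longrightarrow> delta s \<in> fin_supp_on S"
  by (auto simp: fin_supp_on_def delta_def)

lemma cspan_eq_lincomb: "cspan (v ` I) = {lincomb v u | u. u \<in> fin_supp_on I}"
proof (rule antisym)
  show "{lincomb v u | u. u \<in> fin_supp_on I} \<subseteq> cspan (v ` I)"
    using cspan_superset[of "v ` I"] by (auto intro!: lincomb_in csubspace_cspan)
  show "cspan (v ` I) \<subseteq> {lincomb v u | u. u \<in> fin_supp_on I}"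
  proof (rule cspan_least)
    show "v ` I \<subseteq> {lincomb v u | u. u \<in> fin_supp_on I}"
    proof
      fix y assume "y \<in> v ` I"
      then obtain i where i: "i \<in> I" "y = v i" by auto
      have "delta i \<in> fin_supp_on I" using i by (auto simp: fin_supp_on_def delta_def)
      then show "y \<in> {lincomb v u | u. u \<in> fin_supp_on I}"
        using i by (intro CollectI exI[of _ "delta i"]) (simp add: lincomb_delta)
    qed
    show "csubspace {lincomb v u |u. u \<in> fin_supp_on I}"
      unfolding csubspace_def
    proof (intro conjI ballI allI)
      show "0 \<in> {lincomb v u |u. u \<in> fin_supp_on I}"
        by (intro CollectI exI[of _ "\<lambda>_. 0"]) (simp add: lincomb_zero fin_supp_on_zero)
    next
      fix x y assume "x \<in> {lincomb v u |u. u \<in> fin_supp_on I}" "y \<in> {lincomb v u |u. u \<in> fin_supp_on I}"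
      then obtain a b where "x = lincomb v a" "y = lincomb v b" "a \<in> fin_supp_on I" "b \<in> fin_supp_on I"
        by blast
      then show "x + y \<in> {lincomb v u |u. u \<in> fin_supp_on I}"
        by (intro CollectI exI[of _ "\<lambda>t. a t + b t"]) (simp add: lincomb_add fin_supp_on_add)
    next
      fix c x assume "x \<in> {lincomb v u |u. u \<in> fin_supp_on I}"
      then obtain a where "x = lincomb v a" "a \<in> fin_supp_on I" by blast
      then show "scaleC c x \<in> {lincomb v u |u. u \<in> fin_supp_on I}"
        by (intro CollectI exI[of _ "\<lambda>t. c * a t"]) (simp add: lincomb_scale fin_supp_on_scale)
    qed
  qed
qed


section \<open>Seminormed *-algebras with enough positive functionals\<close>

text \<open>The purely algebraic axioms of \<open>unital_cstar_algebra\<close>. Seminormed algebras,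
  their completions and the algebras of monoids satisfy them, whatever norm is attached.\<close>

locale star_algebra =
  fixes A :: "('a, 'm) normed_star_algebra_scheme" (structure)
  assumes is_ring: "Ring.ring A"
    and is_module: "Module.module complex_ring A"
    and smult_mult: "\<lbrakk>x \<in> carrier A; y \<in> carrier A\<rbrakk>
          \<Longrightarrow> (c \<odot> x) \<otimes> y = c \<odot> (x \<otimes> y) \<and> x \<otimes> (c \<odot> y) = c \<odot> (x \<otimes> y)"
    and star_closed: "x \<in> carrier A \<Longrightarrow> star A x \<in> carrier A"
    and star_add: "\<lbrakk>x \<in> carrier A; y \<in> carrier A\<rbrakk> \<Longrightarrow> star A (x \<oplus> y) = star A x \<oplus> star A y"
    and star_smult: "x \<in> carrier A \<Longrightarrow> star A (c \<odot> x) = cnj c \<odot> star A x"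
    and star_mult: "\<lbrakk>x \<in> carrier A; y \<in> carrier A\<rbrakk> \<Longrightarrow> star A (x \<otimes> y) = star A y \<otimes> star A x"
    and star_star: "x \<in> carrier A \<Longrightarrow> star A (star A x) = x"

sublocale star_algebra \<subseteq> ring A by (rule is_ring)

context star_algebra begin

lemma smult_closed: "x \<in> carrier A \<Longrightarrow> c \<odot> x \<in> carrier A"
  and smult_add_left: "x \<in> carrier A \<Longrightarrow> (c + d) \<odot> x = c \<odot> x \<oplus> d \<odot> x"
  and smult_add_right: "x \<in> carrier A \<Longrightarrow> y \<in> carrier A \<Longrightarrow> c \<odot> (x \<oplus> y) = c \<odot> x \<oplus> c \<odot> y"
  and smult_smult: "x \<in> carrier A \<Longrightarrow> c \<odot> (d \<odot> x) = (c * d) \<odot> x"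
  and smult_one: "x \<in> carrier A \<Longrightarrow> 1 \<odot> x = x"
  using is_module unfolding module_def module_axioms_def by (auto simp: complex_ring_def)

lemma smult_zero: "x \<in> carrier A \<Longrightarrow> 0 \<odot> x = \<zero>"
  using smult_add_left[of x 0 0] smult_closed[of x 0] by (metis add.r_cancel_one' add_0)

lemma smult_minus_one: "x \<in> carrier A \<Longrightarrow> (-1) \<odot> x = \<ominus> x"
  using smult_add_left[of x 1 "-1"] smult_one smult_zero smult_closed
  by (metis add.inv_equality add.right_inverse add.m_comm ab_left_minus add.inv_closed minus_equality)

lemma minus_eq_smult: "x \<in> carrier A \<Longrightarrow> y \<in> carrier A \<Longrightarrow> x \<ominus> y = x \<oplus> (-1) \<odot> y"
  by (simp add: smult_minus_one a_minus_def)

lemma smult_minus_right: "x \<in> carrier A \<Longrightarrow> y \<in> carrier A \<Longrightarrow> c \<odot> (x \<ominus> y) = c \<odot> x \<ominus> c \<odot> y"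
  by (simp add: minus_eq_smult smult_closed smult_add_right smult_smult)

lemma star_minus: "x \<in> carrier A \<Longrightarrow> y \<in> carrier A \<Longrightarrow> star A (x \<ominus> y) = star A x \<ominus> star A y"
  by (simp add: minus_eq_smult smult_closed star_add star_smult star_closed)

lemma star_one: "star A \<one> = \<one>"
proof -
  have "star A \<one> = star A \<one> \<otimes> star A (star A \<one>)" by (simp add: star_star star_closed)
  also have "\<dots> = star A (star A \<one> \<otimes> \<one>)" by (subst star_mult) (simp_all add: star_closed)
  also have "\<dots> = \<one>" by (subst r_one) (simp_all add: star_closed star_star)
  finally show ?thesis .
qed

lemma minus_trans: "\<lbrakk>x \<in> carrier A; y \<in> carrier A; z \<in> carrier A\<rbrakk> \<Longrightarrow> x \<ominus> z = (x \<ominus> y) \<oplus> (y \<ominus> z)"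
  by (simp add: a_minus_def) (metis a_assoc add.inv_closed l_neg l_zero a_closed)

lemma add_minus_add:
  "\<lbrakk>x \<in> carrier A; y \<in> carrier A; x' \<in> carrier A; y' \<in> carrier A\<rbrakk>
    \<Longrightarrow> (x \<oplus> y) \<ominus> (x' \<oplus> y') = (x \<ominus> x') \<oplus> (y \<ominus> y')"
  by (simp add: a_minus_def minus_add a_assoc a_lcomm)

lemma mult_minus_mult:
  "\<lbrakk>x \<in> carrier A; y \<in> carrier A; x' \<in> carrier A; y' \<in> carrier A\<rbrakk>
    \<Longrightarrow> (x \<otimes> y) \<ominus> (x' \<otimes> y') = ((x \<ominus> x') \<otimes> y) \<oplus> (x' \<otimes> (y \<ominus> y'))"
  by (subst minus_trans[of _ "x' \<otimes> y"])
    (simp_all add: a_minus_def l_distr r_distr l_minus r_minus)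

end

text \<open>The last condition says that left multiplication by \<open>x\<close> has norm at most
  \<open>nrm A x\<close> on the GNS space of \<open>\<phi>\<close>. For C*-algebras this is
  automatic; for a mere seminorm it is what ties the functional to \<open>nrm\<close>.\<close>

definition pos_functional :: "('a, 'm) normed_star_algebra_scheme \<Rightarrow> ('a \<Rightarrow> complex) \<Rightarrow> bool" where
  "pos_functional A \<phi> \<longleftrightarrow>
     (\<forall>x\<in>carrier A. \<forall>y\<in>carrier A. \<phi> (x \<oplus>\<^bsub>A\<^esub> y) = \<phi> x + \<phi> y)
     \<and> (\<forall>c. \<forall>x\<in>carrier A. \<phi> (c \<odot>\<^bsub>A\<^esub> x) = c * \<phi> x)
     \<and> (\<forall>x\<in>carrier A. \<phi> (star A x) = cnj (\<phi> x))
     \<and> (\<forall>x\<in>carrier A. 0 \<le> Re (\<phi> (star A x \<otimes>\<^bsub>A\<^esub> x)))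
     \<and> (\<forall>x\<in>carrier A. \<forall>y\<in>carrier A.
          Re (\<phi> (star A (x \<otimes>\<^bsub>A\<^esub> y) \<otimes>\<^bsub>A\<^esub> (x \<otimes>\<^bsub>A\<^esub> y))) \<le> (nrm A x)\<^sup>2 * Re (\<phi> (star A y \<otimes>\<^bsub>A\<^esub> y)))"

text \<open>Minimise over \<open>c\<close>. For positive \<open>q\<close> the minimum is attained at
  \<open>- cnj b / q\<close>; for \<open>q = 0\<close> the expression is affine in \<open>c\<close>
  and can stay nonnegative only if \<open>b = 0\<close>.\<close>

lemma cauchy_schwarz_of_quadratic:
  fixes b :: complex
  assumes "\<And>c. 0 \<le> p + 2 * Re (c * b) + (cmod c)\<^sup>2 * q" and "0 \<le> q"
  shows "(cmod b)\<^sup>2 \<le> p * q"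
proof (cases "q = 0")
  case True
  show ?thesis
  proof (rule ccontr)
    assume "\<not> ?thesis"
    then have b: "(cmod b)\<^sup>2 > 0" using True by simp
    \<comment> \<open>The scalar is chosen so that the linear term equals \<open>- (p + 1)\<close>,
      which makes the whole expression \<open>- 1\<close>.\<close>
    have "2 * Re (- of_real ((p + 1) / (2 * (cmod b)\<^sup>2)) * cnj b * b) = - (p + 1)"
      using b by (simp add: mult.assoc complex_norm_square[symmetric] mult.commute[of "cnj b"]
        del: of_real_divide of_real_add) (simp add: field_simps)
    then show False using assms(1)[of "- of_real ((p + 1) / (2 * (cmod b)\<^sup>2)) * cnj b"] True by simp
  qed
next
  case False
  then have q: "q > 0" using assms(2) by simp
  define c where "c = - of_real (1 / q) * cnj b"
  have "Re (c * b) = - (cmod b)\<^sup>2 / q"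
    by (simp add: c_def mult.assoc mult.commute[of "cnj b"] complex_norm_square[symmetric])
  moreover have "(cmod c)\<^sup>2 * q = (cmod b)\<^sup>2 / q"
    using q by (simp add: c_def norm_mult norm_divide power2_eq_square)
  ultimately have "0 \<le> p - (cmod b)\<^sup>2 / q" using assms(1)[of c] by simp
  then show ?thesis using q by (simp add: field_simps)
qed

text \<open>\<open>form\<close> is the GNS inner product, and \<open>q\<close> the square of the GNS seminorm.\<close>

locale pos_functional_form = star_algebra A
  for A :: "('a, 'm) normed_star_algebra_scheme" (structure) +
  fixes \<phi> :: "'a \<Rightarrow> complex"
  assumes add: "\<lbrakk>x \<in> carrier A; y \<in> carrier A\<rbrakk> \<Longrightarrow> \<phi> (x \<oplus> y) = \<phi> x + \<phi> y"
    and smult: "x \<in> carrier A \<Longrightarrow> \<phi> (c \<odot> x) = c * \<phi> x"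
    and herm: "x \<in> carrier A \<Longrightarrow> \<phi> (star A x) = cnj (\<phi> x)"
    and pos: "x \<in> carrier A \<Longrightarrow> 0 \<le> Re (\<phi> (star A x \<otimes> x))"
begin

definition form where "form x y = \<phi> (star A y \<otimes> x)"
definition q where "q x = Re (form x x)"

lemma q_nonneg: "x \<in> carrier A \<Longrightarrow> 0 \<le> q x"
  unfolding q_def form_def by (rule pos)

lemma form_cnj: "x \<in> carrier A \<Longrightarrow> y \<in> carrier A \<Longrightarrow> form y x = cnj (form x y)"
  unfolding form_def by (subst herm[symmetric]) (simp_all add: star_closed star_mult star_star)

lemma form_add: "\<lbrakk>x \<in> carrier A; y \<in> carrier A; z \<in> carrier A\<rbrakk> \<Longrightarrow> form (x \<oplus> y) z = form x z + form y z"
  unfolding form_def by (simp add: r_distr star_closed add)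

lemma form_smult: "\<lbrakk>x \<in> carrier A; z \<in> carrier A\<rbrakk> \<Longrightarrow> form (c \<odot> x) z = c * form x z"
  unfolding form_def by (simp add: smult_mult star_closed smult)

lemma form_add_right: "\<lbrakk>x \<in> carrier A; y \<in> carrier A; z \<in> carrier A\<rbrakk> \<Longrightarrow> form z (x \<oplus> y) = form z x + form z y"
  by (metis form_add form_cnj a_closed complex_cnj_add)

lemma form_smult_right: "\<lbrakk>x \<in> carrier A; z \<in> carrier A\<rbrakk> \<Longrightarrow> form z (c \<odot> x) = cnj c * form z x"
  by (metis form_smult form_cnj smult_closed complex_cnj_mult)

lemma form_mult: "\<lbrakk>a \<in> carrier A; x \<in> carrier A; y \<in> carrier A\<rbrakk> \<Longrightarrow> form (a \<otimes> x) y = form x (star A a \<otimes> y)"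
  unfolding form_def by (simp add: star_mult star_star star_closed m_assoc)

lemma form_self: "x \<in> carrier A \<Longrightarrow> form x x = of_real (q x)"
  using form_cnj[of x x] by (simp add: q_def complex_eq_iff)

lemma q_add_smult:
  assumes "x \<in> carrier A" "y \<in> carrier A"
  shows "q (x \<oplus> c \<odot> y) = q x + 2 * Re (c * form y x) + (cmod c)\<^sup>2 * q y"
proof -
  have "form (x \<oplus> c \<odot> y) (x \<oplus> c \<odot> y)
      = form x x + cnj c * form x y + c * form y x + c * cnj c * form y y"
    using assms
    by (simp add: form_add form_add_right form_smult form_smult_right smult_closed ring_distribs)
  moreover have "cnj c * form x y = cnj (c * form y x)"
    using form_cnj[of y x] assms by simp
  moreover have "c * cnj c * form y y = of_real ((cmod c)\<^sup>2 * q y)"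
    using assms complex_norm_square[of c] by (simp add: form_self)
  ultimately show ?thesis by (simp add: q_def)
qed

lemma q_smult:
  assumes "x \<in> carrier A" shows "q (c \<odot> x) = (cmod c)\<^sup>2 * q x"
proof -
  have "form (c \<odot> x) (c \<odot> x) = (c * cnj c) * form x x"
    using assms by (simp add: form_smult form_smult_right smult_closed)
  then show ?thesis
    unfolding q_def complex_norm_square[symmetric] by (simp flip: of_real_power)
qed

lemma cauchy_schwarz:
  assumes "x \<in> carrier A" "y \<in> carrier A"
  shows "(cmod (form x y))\<^sup>2 \<le> q x * q y"
proof -
  have "(cmod (form y x))\<^sup>2 \<le> q x * q y"
    by (rule cauchy_schwarz_of_quadratic, unfold q_add_smult[OF assms, symmetric])
      (rule q_nonneg a_closed smult_closed assms)+
  then show ?thesis using form_cnj[of y x] assms by simp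
qed

lemma cauchy_schwarz': "x \<in> carrier A \<Longrightarrow> y \<in> carrier A \<Longrightarrow> cmod (form x y) \<le> sqrt (q x) * sqrt (q y)"
  using cauchy_schwarz[of x y] by (simp add: real_le_rsqrt flip: real_sqrt_mult)

lemma minkowski:
  assumes "x \<in> carrier A" "y \<in> carrier A"
  shows "sqrt (q (x \<oplus> y)) \<le> sqrt (q x) + sqrt (q y)"
proof (rule real_le_lsqrt)
  have "q (x \<oplus> y) = q x + 2 * Re (form y x) + q y"
    using q_add_smult[of x y 1] assms by (simp add: smult_one)
  also have "\<dots> \<le> q x + 2 * (sqrt (q y) * sqrt (q x)) + q y"
    using cauchy_schwarz'[of y x] complex_Re_le_cmod[of "form y x"] assms by simp
  also have "\<dots> = (sqrt (q x) + sqrt (q y))\<^sup>2"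
    using q_nonneg assms by (simp add: power2_sum)
  finally show "q (x \<oplus> y) \<le> (sqrt (q x) + sqrt (q y))\<^sup>2" .
qed (use q_nonneg assms in auto)

end

lemma (in star_algebra) pos_functional_form: "pos_functional A \<phi> \<Longrightarrow> pos_functional_form A \<phi>"
  by unfold_locales (auto simp: pos_functional_def)

text \<open>The C*-axioms in dual form: \<open>nrm\<close> is the supremum of the GNS seminorms of
  functionals of mass at most one. Norm inequalities can then be proved in GNS spaces, as instances
  of Cauchy-Schwarz or Minkowski. Separation and completeness are left out, so that group rings and
  formal tensors qualify.\<close>

locale pre_cstar = star_algebra +
  assumes nrm_nonneg: "x \<in> carrier A \<Longrightarrow> 0 \<le> nrm A x"
    and norming: "\<lbrakk>x \<in> carrier A; 0 < e\<rbrakk> \<Longrightarrow> \<exists>\<phi>. pos_functional A \<phi> \<and> Re (\<phi> \<one>) \<le> 1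
      \<and> (nrm A x)\<^sup>2 - e < Re (\<phi> (star A x \<otimes> x))"
begin

lemma pos_functional_bound:
  assumes "pos_functional A \<phi>" "x \<in> carrier A" "y \<in> carrier A"
  shows "pos_functional_form.q A \<phi> (x \<otimes> y) \<le> (nrm A x)\<^sup>2 * pos_functional_form.q A \<phi> y"
proof -
  interpret pos_functional_form A \<phi> using assms by (intro pos_functional_form)
  show ?thesis using assms unfolding q_def form_def pos_functional_def by auto
qed

lemma nrm_leI:
  assumes "x \<in> carrier A" "0 \<le> B"
    and le: "\<And>\<phi>. pos_functional A \<phi> \<Longrightarrow> Re (\<phi> \<one>) \<le> 1 \<Longrightarrow> Re (\<phi> (star A x \<otimes> x)) \<le> B\<^sup>2"
  shows "nrm A x \<le> B"
proof -
  have "(nrm A x)\<^sup>2 \<le> B\<^sup>2 + e" if "0 < e" for e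
    using norming[OF assms(1) that] le by fastforce
  then have "(nrm A x)\<^sup>2 \<le> B\<^sup>2" by (rule field_le_epsilon)
  then show ?thesis using \<open>0 \<le> B\<close> by (rule power2_le_imp_le)
qed

lemma q_le_nrm:
  assumes "pos_functional A \<phi>" "Re (\<phi> \<one>) \<le> 1" "x \<in> carrier A"
  shows "pos_functional_form.q A \<phi> x \<le> (nrm A x)\<^sup>2"
proof -
  interpret pos_functional_form A \<phi> using assms by (intro pos_functional_form)
  have "q x \<le> (nrm A x)\<^sup>2 * q \<one>"
    using pos_functional_bound[OF assms(1,3) one_closed] assms by simp
  also have "\<dots> \<le> (nrm A x)\<^sup>2 * 1"
    using assms by (intro mult_left_mono) (simp_all add: q_def form_def star_one)
  finally show ?thesis by simp
qed

lemma sqrt_q_le_nrm: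
  "pos_functional A \<phi> \<Longrightarrow> Re (\<phi> \<one>) \<le> 1 \<Longrightarrow> x \<in> carrier A \<Longrightarrow> sqrt (pos_functional_form.q A \<phi> x) \<le> nrm A x"
  by (rule real_le_lsqrt) (use q_le_nrm nrm_nonneg in auto)

lemma nrm_triangle:
  assumes "x \<in> carrier A" "y \<in> carrier A" shows "nrm A (x \<oplus> y) \<le> nrm A x + nrm A y"
proof (rule nrm_leI)
  fix \<phi> assume \<phi>: "pos_functional A \<phi>" "Re (\<phi> \<one>) \<le> 1"
  interpret pos_functional_form A \<phi> using \<phi> by (intro pos_functional_form)
  have "sqrt (q (x \<oplus> y)) \<le> nrm A x + nrm A y"
    using minkowski[of x y] sqrt_q_le_nrm[OF \<phi>, of x] sqrt_q_le_nrm[OF \<phi>, of y] assms by simp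
  then have "q (x \<oplus> y) \<le> (nrm A x + nrm A y)\<^sup>2" by (rule sqrt_le_D)
  then show "Re (\<phi> (star A (x \<oplus> y) \<otimes> (x \<oplus> y))) \<le> (nrm A x + nrm A y)\<^sup>2"
    by (simp add: q_def form_def)
qed (use assms nrm_nonneg in auto)

lemma nrm_smult_le:
  assumes "x \<in> carrier A" shows "nrm A (c \<odot> x) \<le> cmod c * nrm A x"
proof (rule nrm_leI)
  fix \<phi> assume \<phi>: "pos_functional A \<phi>" "Re (\<phi> \<one>) \<le> 1"
  interpret pos_functional_form A \<phi> using \<phi> by (intro pos_functional_form)
  show "Re (\<phi> (star A (c \<odot> x) \<otimes> (c \<odot> x))) \<le> (cmod c * nrm A x)\<^sup>2"
    using q_le_nrm[OF \<phi> assms] mult_left_mono[of "q x" "(nrm A x)\<^sup>2" "(cmod c)\<^sup>2"] q_smult[OF assms, of c]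
    by (simp add: q_def form_def power_mult_distrib)
qed (use assms nrm_nonneg in \<open>auto intro: smult_closed\<close>)

lemma nrm_smult:
  assumes "x \<in> carrier A" shows "nrm A (c \<odot> x) = cmod c * nrm A x"
proof (cases "c = 0")
  case True
  then show ?thesis using nrm_smult_le[OF assms, of c] nrm_nonneg[OF smult_closed[OF assms]]
    by (simp add: order.antisym)
next
  case False
  have "nrm A x \<le> cmod (inverse c) * nrm A (c \<odot> x)"
    using nrm_smult_le[OF smult_closed[OF assms], of "inverse c" c] False assms
    by (simp add: smult_smult smult_one)
  then show ?thesis using nrm_smult_le[OF assms, of c] False by (simp add: norm_divide norm_inverse field_simps)
qed

lemma nrm_mult:
  assumes "x \<in> carrier A" "y \<in> carrier A" shows "nrm A (x \<otimes> y) \<le> nrm A x * nrm A y"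
proof (rule nrm_leI)
  fix \<phi> assume \<phi>: "pos_functional A \<phi>" "Re (\<phi> \<one>) \<le> 1"
  interpret pos_functional_form A \<phi> using \<phi> by (intro pos_functional_form)
  have "q (x \<otimes> y) \<le> (nrm A x)\<^sup>2 * (nrm A y)\<^sup>2"
    using pos_functional_bound[OF \<phi>(1) assms] q_le_nrm[OF \<phi> assms(2)]
    by (meson mult_left_mono order_trans zero_le_power2)
  then show "Re (\<phi> (star A (x \<otimes> y) \<otimes> (x \<otimes> y))) \<le> (nrm A x * nrm A y)\<^sup>2"
    by (simp add: q_def form_def power_mult_distrib)
qed (use assms nrm_nonneg in auto)

lemma nrm_zero: "nrm A \<zero> = 0"
  using nrm_smult[OF zero_closed, of 0] smult_zero by simp

text \<open>In each GNS space the value at \<open>star A x \<otimes> x\<close> is the inner product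
  of that element with the unit, and Cauchy-Schwarz bounds it by the norm of the element. This is
  the nontrivial half of the C*-identity.\<close>

lemma power2_nrm_le: 
  assumes "x \<in> carrier A" shows "(nrm A x)\<^sup>2 \<le> nrm A (star A x \<otimes> x)"
proof -
  let ?h = "star A x \<otimes> x"
  have h: "?h \<in> carrier A" using assms star_closed by auto
  have "nrm A x \<le> sqrt (nrm A ?h)"
  proof (rule nrm_leI)
    fix \<phi> assume \<phi>: "pos_functional A \<phi>" "Re (\<phi> \<one>) \<le> 1"
    interpret pos_functional_form A \<phi> using \<phi> by (intro pos_functional_form)
    have "Re (\<phi> ?h) \<le> cmod (form ?h \<one>)"
      using complex_Re_le_cmod h by (simp add: form_def star_one)
    also have "\<dots> \<le> sqrt (q ?h) * sqrt (q \<one>)" using h by (intro cauchy_schwarz') auto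
    also have "\<dots> \<le> nrm A ?h * 1"
      using sqrt_q_le_nrm[OF \<phi> h] \<phi>(2) nrm_nonneg[OF h] q_nonneg[of \<one>]
      by (intro mult_mono) (auto simp: q_def form_def star_one)
    finally show "Re (\<phi> ?h) \<le> (sqrt (nrm A ?h))\<^sup>2" using nrm_nonneg[OF h] by simp
  qed (use assms nrm_nonneg h in auto)
  then show ?thesis using nrm_nonneg[OF h] nrm_nonneg[OF assms]
    by (metis power_mono real_sqrt_pow2)
qed

text \<open>Combine the preceding inequality with submultiplicativity, cancel
  \<open>nrm A y\<close>, and apply the result to \<open>x\<close> and to its adjoint.\<close>

lemma nrm_star: assumes "x \<in> carrier A" shows "nrm A (star A x) = nrm A x"
proof -
  have le: "nrm A y \<le> nrm A (star A y)" if "y \<in> carrier A" for y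
  proof (cases "nrm A y = 0")
    case False
    have "nrm A y * nrm A y \<le> nrm A (star A y) * nrm A y"
      using power2_nrm_le[OF that] nrm_mult[OF star_closed[OF that] that] by (simp add: power2_eq_square)
    then show ?thesis using False nrm_nonneg[OF that] by (simp add: mult_le_cancel_right)
  qed (use nrm_nonneg star_closed that in simp)
  show ?thesis using le[OF assms] le[OF star_closed[OF assms]] assms by (simp add: star_star)
qed

lemma cstar_identity: assumes "x \<in> carrier A" shows "nrm A (star A x \<otimes> x) = (nrm A x)\<^sup>2"
  using power2_nrm_le[OF assms] nrm_mult[OF star_closed[OF assms] assms] nrm_star[OF assms]
  by (simp add: power2_eq_square)

lemma nrm_minus_commute: "x \<in> carrier A \<Longrightarrow> y \<in> carrier A \<Longrightarrow> nrm A (x \<ominus> y) = nrm A (y \<ominus> x)"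
proof -
  assume *: "x \<in> carrier A" "y \<in> carrier A"
  then have "y \<ominus> x = (-1) \<odot> (x \<ominus> y)"
    by (simp add: smult_minus_one a_minus_def minus_add a_comm)
  then show ?thesis using nrm_smult[of "x \<ominus> y" "-1"] * by simp
qed

lemma nrm_triangle_minus:
  "\<lbrakk>x \<in> carrier A; y \<in> carrier A; z \<in> carrier A\<rbrakk> \<Longrightarrow> nrm A (x \<ominus> z) \<le> nrm A (x \<ominus> y) + nrm A (y \<ominus> z)"
  by (subst minus_trans[of x y z]) (auto intro: nrm_triangle)

lemma nrm_diff_le: "\<lbrakk>x \<in> carrier A; y \<in> carrier A\<rbrakk> \<Longrightarrow> \<bar>nrm A x - nrm A y\<bar> \<le> nrm A (x \<ominus> y)"
  using nrm_triangle_minus[of x y \<zero>] nrm_triangle_minus[of y x \<zero>] nrm_minus_commute[of x y]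
  by (simp add: a_minus_def)

text \<open>Gives the Lipschitz continuity needed to extend a positive functional to the completion.
  It combines Cauchy-Schwarz against the unit with the bound on left multiplication.\<close>

lemma pos_functional_cmod_le:
  assumes "pos_functional A \<phi>" "x \<in> carrier A"
  shows "cmod (\<phi> x) \<le> Re (\<phi> \<one>) * nrm A x"
proof -
  interpret pos_functional_form A \<phi> using assms by (intro pos_functional_form)
  have q1: "q \<one> = Re (\<phi> \<one>)" by (simp add: q_def form_def star_one)
  have "q x \<le> (nrm A x)\<^sup>2 * q \<one>"
    using pos_functional_bound[OF assms one_closed] assms by simp
  then have "sqrt (q x) \<le> nrm A x * sqrt (q \<one>)"
    using real_sqrt_le_mono[of "q x"] nrm_nonneg[OF assms(2)] by (fastforce simp: real_sqrt_mult)
  then have "sqrt (q x) * sqrt (q \<one>) \<le> (nrm A x * sqrt (q \<one>)) * sqrt (q \<one>)"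
    using q_nonneg[of \<one>] by (intro mult_right_mono) auto
  then have "sqrt (q x) * sqrt (q \<one>) \<le> nrm A x * q \<one>"
    using q_nonneg[of \<one>] by (simp add: mult.assoc)
  moreover have "cmod (\<phi> x) \<le> sqrt (q x) * sqrt (q \<one>)"
    using cauchy_schwarz'[of x \<one>] assms by (simp add: form_def star_one)
  ultimately show ?thesis by (simp add: q1 mult.commute)
qed

end

lemma unital_cstar_algebraI:
  assumes "pre_cstar A" and "\<And>x. x \<in> carrier A \<Longrightarrow> nrm A x = 0 \<Longrightarrow> x = \<zero>\<^bsub>A\<^esub>"
    and "\<And>X. X \<in> cauchy_seqs A \<Longrightarrow> \<exists>x\<in>carrier A. (\<lambda>n. nrm A (X n \<ominus>\<^bsub>A\<^esub> x)) \<longlonglongrightarrow> 0"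
  shows "unital_cstar_algebra A"
proof -
  interpret pre_cstar A by fact
  show ?thesis
    by (rule unital_cstar_algebra.intro)
      (use assms(2,3) in \<open>simp_all add: is_ring is_module smult_mult star_closed star_add star_smult star_mult
        star_star nrm_nonneg nrm_triangle nrm_smult nrm_mult cstar_identity\<close>,
       use assms(2) nrm_zero in blast)
qed


section \<open>Completions\<close>

context pre_cstar begin

lemma cauchy_seqsD: "X \<in> cauchy_seqs A \<Longrightarrow> X n \<in> carrier A"
  by (auto simp: cauchy_seqs_def)

lemma cauchy_seqsE:
  assumes "X \<in> cauchy_seqs A" "0 < e"
  obtains M where "\<And>m n. M \<le> m \<Longrightarrow> M \<le> n \<Longrightarrow> nrm A (X m \<ominus> X n) < e"
proof -
  have "\<exists>M. \<forall>m\<ge>M. \<forall>n\<ge>M. nrm A (X m \<ominus> X n) < e" using assms by (simp add: cauchy_seqs_def)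
  then show thesis using that by metis
qed

lemma nrm_tendsto_0I:
  assumes "f \<longlonglongrightarrow> 0" "\<And>n. X n \<in> carrier A" "\<And>n. nrm A (X n) \<le> f n"
  shows "(\<lambda>n. nrm A (X n)) \<longlonglongrightarrow> 0"
  by (rule tendsto_sandwich[OF _ _ tendsto_const assms(1)])
    (use assms nrm_nonneg in auto)

lemma cauchy_seqsI:
  assumes "\<And>n. X n \<in> carrier A" "\<And>e. 0 < e \<Longrightarrow> \<exists>M. \<forall>m\<ge>M. \<forall>n\<ge>M. nrm A (X m \<ominus> X n) < e"
  shows "X \<in> cauchy_seqs A"
  using assms by (auto simp: cauchy_seqs_def)

text \<open>One estimate for all operations: sums and products use both sequences, scalar multiples
  and adjoints take \<open>D = 0\<close>.\<close>

lemma cauchy_seqs_le_sum: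
  assumes X: "X \<in> cauchy_seqs A" and Y: "Y \<in> cauchy_seqs A" and Z: "\<And>n. Z n \<in> carrier A"
    and le: "\<And>m n. nrm A (Z m \<ominus> Z n) \<le> C * nrm A (X m \<ominus> X n) + D * nrm A (Y m \<ominus> Y n)"
    and CD: "0 \<le> C" "0 \<le> D"
  shows "Z \<in> cauchy_seqs A"
proof (rule cauchy_seqsI[OF Z])
  fix e :: real assume e: "0 < e"
  \<comment> \<open>The summand 1 avoids division by zero and makes the final inequality
    strict.\<close>
  define d where "d = e / (C + D + 1)"
  have d: "0 < d" using e CD by (simp add: d_def)
  obtain M where M: "\<And>m n. M \<le> m \<Longrightarrow> M \<le> n \<Longrightarrow> nrm A (X m \<ominus> X n) < d"
    using cauchy_seqsE[OF X d] by metis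
  obtain N where N: "\<And>m n. N \<le> m \<Longrightarrow> N \<le> n \<Longrightarrow> nrm A (Y m \<ominus> Y n) < d"
    using cauchy_seqsE[OF Y d] by metis
  have "nrm A (Z m \<ominus> Z n) < e" if "max M N \<le> m" "max M N \<le> n" for m n
  proof -
    have "nrm A (Z m \<ominus> Z n) \<le> C * d + D * d"
      using le[of m n] mult_left_mono[OF less_imp_le[OF M[of m n]] CD(1)]
        mult_left_mono[OF less_imp_le[OF N[of m n]] CD(2)] that by simp
    also have "\<dots> = (C + D) * d" by (simp add: ring_distribs)
    also have "\<dots> < (C + D + 1) * d" using d by (intro mult_strict_right_mono) auto
    also have "\<dots> = e" using CD by (simp add: d_def)
    finally show ?thesis .
  qed
  then show "\<exists>M. \<forall>m\<ge>M. \<forall>n\<ge>M. nrm A (Z m \<ominus> Z n) < e" by blast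
qed

lemma cauchy_seqs_bounded:
  assumes X: "X \<in> cauchy_seqs A" shows "\<exists>C\<ge>0. \<forall>n. nrm A (X n) \<le> C"
proof -
  have c: "X n \<in> carrier A" for n using X by (rule cauchy_seqsD)
  obtain M where M: "\<And>m n. M \<le> m \<Longrightarrow> M \<le> n \<Longrightarrow> nrm A (X m \<ominus> X n) < 1"
    using cauchy_seqsE[OF X zero_less_one] by metis
  define C where "C = Max ((\<lambda>n. nrm A (X n)) ` {..M}) + 1"
  have le: "nrm A (X n) \<le> C - 1" if "n \<le> M" for n using that by (auto simp: C_def)
  have "nrm A (X n) \<le> C" for n
  proof (cases "n \<le> M")
    case False
    then have "nrm A (X n) \<le> nrm A (X M) + 1"
      using M[of n M] nrm_diff_le[OF c c, of n M] by force
    then show ?thesis using le[of M] by simp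
  qed (use le in force)
  moreover have "0 \<le> C" using le[of 0] nrm_nonneg[OF c, of 0] by simp
  ultimately show ?thesis by blast
qed

lemma cauchy_seqs_const: "x \<in> carrier A \<Longrightarrow> (\<lambda>_. x) \<in> cauchy_seqs A"
  by (intro cauchy_seqsI) (auto simp: a_minus_def r_neg nrm_zero)

lemma cauchy_seqs_add:
  assumes "X \<in> cauchy_seqs A" "Y \<in> cauchy_seqs A" shows "(\<lambda>n. X n \<oplus> Y n) \<in> cauchy_seqs A"
proof (rule cauchy_seqs_le_sum[OF assms, of _ 1 1])
  note [simp] = cauchy_seqsD[OF assms(1)] cauchy_seqsD[OF assms(2)]
  show "nrm A (X m \<oplus> Y m \<ominus> (X n \<oplus> Y n)) \<le> 1 * nrm A (X m \<ominus> X n) + 1 * nrm A (Y m \<ominus> Y n)" for m n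
    using nrm_triangle[of "X m \<ominus> X n" "Y m \<ominus> Y n"] by (simp add: add_minus_add)
qed (auto simp: cauchy_seqsD[OF assms(1)] cauchy_seqsD[OF assms(2)])

lemma nrm_mult_minus_mult_le:
  assumes "x \<in> carrier A" "y \<in> carrier A" "x' \<in> carrier A" "y' \<in> carrier A"
  shows "nrm A ((x \<otimes> y) \<ominus> (x' \<otimes> y')) \<le> nrm A y * nrm A (x \<ominus> x') + nrm A x' * nrm A (y \<ominus> y')"
  using nrm_triangle[of "(x \<ominus> x') \<otimes> y" "x' \<otimes> (y \<ominus> y')"] nrm_mult[of "x \<ominus> x'" y]
    nrm_mult[of x' "y \<ominus> y'"] assms by (simp add: mult_minus_mult mult.commute)

lemma cauchy_seqs_mult:
  assumes "X \<in> cauchy_seqs A" "Y \<in> cauchy_seqs A" shows "(\<lambda>n. X n \<otimes> Y n) \<in> cauchy_seqs A"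
proof -
  note [simp] = cauchy_seqsD[OF assms(1)] cauchy_seqsD[OF assms(2)]
  obtain C D where C: "0 \<le> C" "\<And>n. nrm A (Y n) \<le> C" and D: "0 \<le> D" "\<And>n. nrm A (X n) \<le> D"
    using cauchy_seqs_bounded[OF assms(1)] cauchy_seqs_bounded[OF assms(2)] by auto
  show ?thesis
  proof (rule cauchy_seqs_le_sum[OF assms, of _ C D])
    fix m n
    show "nrm A (X m \<otimes> Y m \<ominus> X n \<otimes> Y n) \<le> C * nrm A (X m \<ominus> X n) + D * nrm A (Y m \<ominus> Y n)"
      using nrm_mult_minus_mult_le[of "X m" "Y m" "X n" "Y n"]
        mult_right_mono[OF C(2), of "nrm A (X m \<ominus> X n)" m] mult_right_mono[OF D(2), of "nrm A (Y m \<ominus> Y n)" n]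
        nrm_nonneg by simp
  qed (use C D in auto)
qed

lemma cauchy_seqs_smult:
  assumes "X \<in> cauchy_seqs A" shows "(\<lambda>n. c \<odot> X n) \<in> cauchy_seqs A"
proof (rule cauchy_seqs_le_sum[OF assms assms, of _ "cmod c" 0])
  note [simp] = cauchy_seqsD[OF assms]
  show "nrm A (c \<odot> X m \<ominus> c \<odot> X n) \<le> cmod c * nrm A (X m \<ominus> X n) + 0 * nrm A (X m \<ominus> X n)" for m n
    using nrm_smult[of "X m \<ominus> X n" c] by (simp add: smult_minus_right)
qed (auto simp: cauchy_seqsD[OF assms] smult_closed)

lemma cauchy_seqs_star:
  assumes "X \<in> cauchy_seqs A" shows "(\<lambda>n. star A (X n)) \<in> cauchy_seqs A"
proof (rule cauchy_seqs_le_sum[OF assms assms, of _ 1 0])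
  note [simp] = cauchy_seqsD[OF assms]
  show "nrm A (star A (X m) \<ominus> star A (X n)) \<le> 1 * nrm A (X m \<ominus> X n) + 0 * nrm A (X m \<ominus> X n)" for m n
    using nrm_star[of "X m \<ominus> X n"] by (simp add: star_minus)
qed (auto simp: cauchy_seqsD[OF assms] star_closed)

definition null_diff :: "(nat \<Rightarrow> 'a) \<Rightarrow> (nat \<Rightarrow> 'a) \<Rightarrow> bool" where
  "null_diff X Y \<longleftrightarrow> (\<lambda>n. nrm A (X n \<ominus> Y n)) \<longlonglongrightarrow> 0"

lemma null_diff_le_sum:
  assumes "null_diff X X'" "null_diff Y Y'" "\<And>n. Z n \<in> carrier A" "\<And>n. Z' n \<in> carrier A"
    and "\<And>n. nrm A (Z n \<ominus> Z' n) \<le> C * nrm A (X n \<ominus> X' n) + D * nrm A (Y n \<ominus> Y' n)"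
  shows "null_diff Z Z'"
  unfolding null_diff_def
  by (rule nrm_tendsto_0I[of "\<lambda>n. C * nrm A (X n \<ominus> X' n) + D * nrm A (Y n \<ominus> Y' n)"])
    (use assms in \<open>auto simp: null_diff_def intro!: tendsto_add_zero tendsto_mult_right_zero\<close>)

lemma null_diff_refl: "X \<in> cauchy_seqs A \<Longrightarrow> null_diff X X"
  by (simp add: null_diff_def a_minus_def r_neg cauchy_seqsD nrm_zero)

lemma null_diff_sym: "X \<in> cauchy_seqs A \<Longrightarrow> Y \<in> cauchy_seqs A \<Longrightarrow> null_diff X Y \<Longrightarrow> null_diff Y X"
  unfolding null_diff_def by (subst nrm_minus_commute) (auto simp: cauchy_seqsD)

lemma null_diff_trans:
  assumes XYZ: "X \<in> cauchy_seqs A" "Y \<in> cauchy_seqs A" "Z \<in> cauchy_seqs A"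
    and "null_diff X Y" "null_diff Y Z"
  shows "null_diff X Z"
  by (rule null_diff_le_sum[OF assms(4,5), of _ _ 1 1])
    (use nrm_triangle_minus XYZ[THEN cauchy_seqsD] in auto)

lemma cauchy_class_eq_iff:
  assumes "X \<in> cauchy_seqs A" "Y \<in> cauchy_seqs A"
  shows "cauchy_class A X = cauchy_class A Y \<longleftrightarrow> null_diff X Y"
proof
  assume "cauchy_class A X = cauchy_class A Y"
  moreover have "Y \<in> cauchy_class A Y"
    using assms null_diff_refl by (auto simp: cauchy_class_def null_diff_def)
  ultimately show "null_diff X Y" by (auto simp: cauchy_class_def null_diff_def)
next
  assume "null_diff X Y"
  then show "cauchy_class A X = cauchy_class A Y"
    using null_diff_trans null_diff_sym assms unfolding cauchy_class_def null_diff_def[symmetric] by blast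
qed

text \<open>Shows that the arbitrary choice in \<open>cauchy_rep\<close> is harmless: the operations
  of the completion, defined through chosen representatives, can be computed on any
  representatives.\<close>

lemma cauchy_rep_class:
  assumes "X \<in> cauchy_seqs A"
  shows "cauchy_rep (cauchy_class A X) \<in> cauchy_seqs A" "null_diff X (cauchy_rep (cauchy_class A X))"
proof -
  have "X \<in> cauchy_class A X"
    using assms null_diff_refl by (auto simp: cauchy_class_def null_diff_def)
  then have "cauchy_rep (cauchy_class A X) \<in> cauchy_class A X"
    unfolding cauchy_rep_def by (rule someI[of "\<lambda>Y. Y \<in> cauchy_class A X"])
  then show "cauchy_rep (cauchy_class A X) \<in> cauchy_seqs A" "null_diff X (cauchy_rep (cauchy_class A X))"
    by (auto simp: cauchy_class_def null_diff_def)
qed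

lemma completion_carrier: "carrier (completion A) = cauchy_class A ` cauchy_seqs A"
  by (simp add: completion_def)

lemma completion_add:
  assumes "X \<in> cauchy_seqs A" "Y \<in> cauchy_seqs A"
  shows "cauchy_class A X \<oplus>\<^bsub>completion A\<^esub> cauchy_class A Y = cauchy_class A (\<lambda>n. X n \<oplus> Y n)"
proof -
  note X = cauchy_rep_class[OF assms(1)] and Y = cauchy_rep_class[OF assms(2)]
  let ?X = "cauchy_rep (cauchy_class A X)" and ?Y = "cauchy_rep (cauchy_class A Y)"
  note c = cauchy_seqsD[OF assms(1)] cauchy_seqsD[OF assms(2)] cauchy_seqsD[OF X(1)] cauchy_seqsD[OF Y(1)]
  have "null_diff (\<lambda>n. X n \<oplus> Y n) (\<lambda>n. ?X n \<oplus> ?Y n)"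
  proof (rule null_diff_le_sum[OF X(2) Y(2), of _ _ 1 1])
    show "nrm A (X n \<oplus> Y n \<ominus> (?X n \<oplus> ?Y n)) \<le> 1 * nrm A (X n \<ominus> ?X n) + 1 * nrm A (Y n \<ominus> ?Y n)" for n
      using nrm_triangle[of "X n \<ominus> ?X n" "Y n \<ominus> ?Y n"] c by (simp add: add_minus_add)
  qed (use c in auto)
  then have "cauchy_class A (\<lambda>n. X n \<oplus> Y n) = cauchy_class A (\<lambda>n. ?X n \<oplus> ?Y n)"
    by (subst cauchy_class_eq_iff) (intro cauchy_seqs_add assms X(1) Y(1))+
  then show ?thesis by (simp add: completion_def)
qed

lemma completion_mult:
  assumes "X \<in> cauchy_seqs A" "Y \<in> cauchy_seqs A"
  shows "cauchy_class A X \<otimes>\<^bsub>completion A\<^esub> cauchy_class A Y = cauchy_class A (\<lambda>n. X n \<otimes> Y n)"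
proof -
  note X = cauchy_rep_class[OF assms(1)] and Y = cauchy_rep_class[OF assms(2)]
  let ?X = "cauchy_rep (cauchy_class A X)" and ?Y = "cauchy_rep (cauchy_class A Y)"
  note c = cauchy_seqsD[OF assms(1)] cauchy_seqsD[OF assms(2)] cauchy_seqsD[OF X(1)] cauchy_seqsD[OF Y(1)]
  obtain C D where C: "\<And>n. nrm A (Y n) \<le> C" and D: "\<And>n. nrm A (?X n) \<le> D"
    using cauchy_seqs_bounded[OF X(1)] cauchy_seqs_bounded[OF assms(2)] by auto
  have "null_diff (\<lambda>n. X n \<otimes> Y n) (\<lambda>n. ?X n \<otimes> ?Y n)"
  proof (rule null_diff_le_sum[OF X(2) Y(2), of _ _ C D])
    fix n show "nrm A (X n \<otimes> Y n \<ominus> (?X n \<otimes> ?Y n)) \<le> C * nrm A (X n \<ominus> ?X n) + D * nrm A (Y n \<ominus> ?Y n)"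
      using nrm_mult_minus_mult_le[of "X n" "Y n" "?X n" "?Y n"]
        mult_right_mono[OF C, of "nrm A (X n \<ominus> ?X n)" n] mult_right_mono[OF D, of "nrm A (Y n \<ominus> ?Y n)" n]
        nrm_nonneg c by simp
  qed (use c in auto)
  then have "cauchy_class A (\<lambda>n. X n \<otimes> Y n) = cauchy_class A (\<lambda>n. ?X n \<otimes> ?Y n)"
    by (subst cauchy_class_eq_iff) (intro cauchy_seqs_mult assms X(1) Y(1))+
  then show ?thesis by (simp add: completion_def)
qed

lemma completion_smult:
  assumes "X \<in> cauchy_seqs A"
  shows "c \<odot>\<^bsub>completion A\<^esub> cauchy_class A X = cauchy_class A (\<lambda>n. c \<odot> X n)"
proof -
  note X = cauchy_rep_class[OF assms(1)]
  let ?X = "cauchy_rep (cauchy_class A X)"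
  note c = cauchy_seqsD[OF assms(1)] cauchy_seqsD[OF X(1)]
  have "null_diff (\<lambda>n. c \<odot> X n) (\<lambda>n. c \<odot> ?X n)"
    by (rule null_diff_le_sum[OF X(2) X(2), of _ _ "cmod c" 0])
      (use c in \<open>auto simp: smult_closed nrm_smult simp flip: smult_minus_right\<close>)
  then have "cauchy_class A (\<lambda>n. c \<odot> X n) = cauchy_class A (\<lambda>n. c \<odot> ?X n)"
    by (subst cauchy_class_eq_iff) (intro cauchy_seqs_smult assms X(1))+
  then show ?thesis by (simp add: completion_def)
qed

lemma completion_star:
  assumes "X \<in> cauchy_seqs A"
  shows "star (completion A) (cauchy_class A X) = cauchy_class A (\<lambda>n. star A (X n))"
proof -
  note X = cauchy_rep_class[OF assms(1)]
  let ?X = "cauchy_rep (cauchy_class A X)"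
  note c = cauchy_seqsD[OF assms(1)] cauchy_seqsD[OF X(1)]
  have "null_diff (\<lambda>n. star A (X n)) (\<lambda>n. star A (?X n))"
    by (rule null_diff_le_sum[OF X(2) X(2), of _ _ 1 0])
      (use c in \<open>auto simp: star_closed nrm_star simp flip: star_minus\<close>)
  then have "cauchy_class A (\<lambda>n. star A (X n)) = cauchy_class A (\<lambda>n. star A (?X n))"
    by (subst cauchy_class_eq_iff) (intro cauchy_seqs_star assms X(1))+
  then show ?thesis by (simp add: completion_def)
qed

lemma completion_one: "\<one>\<^bsub>completion A\<^esub> = cauchy_class A (\<lambda>_. \<one>)"
  and completion_zero: "\<zero>\<^bsub>completion A\<^esub> = cauchy_class A (\<lambda>_. \<zero>)"
  by (simp_all add: completion_def)

lemma cauchy_seqs_nrm_convergent: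
  assumes "X \<in> cauchy_seqs A" shows "convergent (\<lambda>n. nrm A (X n))"
proof (rule Cauchy_convergent, rule metric_CauchyI)
  fix e :: real assume "0 < e"
  then obtain M where "\<And>m n. M \<le> m \<Longrightarrow> M \<le> n \<Longrightarrow> nrm A (X m \<ominus> X n) < e"
    using cauchy_seqsE[OF assms] by metis
  then have "dist (nrm A (X m)) (nrm A (X n)) < e" if "M \<le> m" "M \<le> n" for m n
    using nrm_diff_le[OF cauchy_seqsD[OF assms] cauchy_seqsD[OF assms], of m n] that
    by (force simp: dist_real_def)
  then show "\<exists>M. \<forall>m\<ge>M. \<forall>n\<ge>M. dist (nrm A (X m)) (nrm A (X n)) < e" by blast
qed

lemma completion_nrm:
  assumes "X \<in> cauchy_seqs A"
  shows "(\<lambda>n. nrm A (X n)) \<longlonglongrightarrow> nrm (completion A) (cauchy_class A X)"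
proof -
  note X = cauchy_rep_class[OF assms(1)]
  let ?X = "cauchy_rep (cauchy_class A X)"
  note c = cauchy_seqsD[OF assms(1)] cauchy_seqsD[OF X(1)]
  have "(\<lambda>n. nrm A (?X n)) \<longlonglongrightarrow> nrm (completion A) (cauchy_class A X)"
    using cauchy_seqs_nrm_convergent[OF X(1)] by (simp add: completion_def convergent_LIMSEQ_iff)
  moreover have "(\<lambda>n. nrm A (X n) - nrm A (?X n)) \<longlonglongrightarrow> 0"
    by (rule Lim_null_comparison[OF _ X(2)[unfolded null_diff_def]])
      (use nrm_diff_le c in simp)
  ultimately show ?thesis using tendsto_add by fastforce
qed

lemma completion_nrm_const: "x \<in> carrier A \<Longrightarrow> nrm (completion A) (completion_emb A x) = nrm A x"
  using completion_nrm[OF cauchy_seqs_const, of x] by (simp add: completion_emb_def LIMSEQ_const_iff)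

lemmas completion_ops = completion_add completion_mult completion_smult completion_star completion_one
  completion_zero cauchy_seqs_add cauchy_seqs_mult cauchy_seqs_smult cauchy_seqs_star cauchy_seqs_const
  star_closed smult_closed cauchy_seqsD

lemma completion_carrierE:
  assumes "x \<in> carrier (completion A)"
  obtains X where "X \<in> cauchy_seqs A" "x = cauchy_class A X"
  using assms by (auto simp: completion_carrier)

lemma completion_ring: "Ring.ring (completion A)"
proof (rule ringI)
  show "abelian_group (completion A)"
  proof (rule abelian_groupI)
    fix x assume "x \<in> carrier (completion A)"
    then obtain X where X: "X \<in> cauchy_seqs A" "x = cauchy_class A X" by (rule completion_carrierE)
    have Y: "(\<lambda>n. (-1) \<odot> X n) \<in> cauchy_seqs A" by (rule cauchy_seqs_smult[OF X(1)])
    have "cauchy_class A (\<lambda>n. (-1) \<odot> X n) \<oplus>\<^bsub>completion A\<^esub> x = \<zero>\<^bsub>completion A\<^esub>"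
      unfolding X(2) completion_add[OF Y X(1)] completion_zero
      using cauchy_seqsD[OF X(1)] by (simp add: smult_minus_one l_neg)
    then show "\<exists>y\<in>carrier (completion A). y \<oplus>\<^bsub>completion A\<^esub> x = \<zero>\<^bsub>completion A\<^esub>"
      using Y by (auto simp: completion_carrier)
  qed (auto simp: completion_carrier completion_ops a_ac)
  show "monoid (completion A)"
    by (rule monoidI) (auto simp: completion_carrier completion_ops m_assoc)
qed (auto simp: completion_carrier completion_ops l_distr r_distr)

lemma completion_module: "module complex_ring (completion A)"
proof (rule moduleI)
  show "cring complex_ring" using is_module by (simp add: module_def)
  show "abelian_group (completion A)" by (rule ring.is_abelian_group[OF completion_ring])
qed (auto simp: completion_carrier completion_ops complex_ring_def smult_add_left smult_add_right
    smult_smult smult_one elim!: completion_carrierE)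

lemma completion_star_algebra: "star_algebra (completion A)"
proof (rule star_algebra.intro)
  fix x y c assume "x \<in> carrier (completion A)" "y \<in> carrier (completion A)"
  then obtain X Y where *: "X \<in> cauchy_seqs A" "x = cauchy_class A X" "Y \<in> cauchy_seqs A" "y = cauchy_class A Y"
    by (metis completion_carrierE)
  note [simp] = *(2,4) cauchy_seqsD[OF *(1)] cauchy_seqsD[OF *(3)] completion_ops *(1,3)
  show "star (completion A) (x \<oplus>\<^bsub>completion A\<^esub> y) = star (completion A) x \<oplus>\<^bsub>completion A\<^esub> star (completion A) y"
    by (simp add: star_add)
  show "star (completion A) (x \<otimes>\<^bsub>completion A\<^esub> y) = star (completion A) y \<otimes>\<^bsub>completion A\<^esub> star (completion A) x"
    by (simp add: star_mult)
  show "(c \<odot>\<^bsub>completion A\<^esub> x) \<otimes>\<^bsub>completion A\<^esub> y = c \<odot>\<^bsub>completion A\<^esub> (x \<otimes>\<^bsub>completion A\<^esub> y)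
      \<and> x \<otimes>\<^bsub>completion A\<^esub> (c \<odot>\<^bsub>completion A\<^esub> y) = c \<odot>\<^bsub>completion A\<^esub> (x \<otimes>\<^bsub>completion A\<^esub> y)"
    by (simp add: smult_mult)
next
  fix x c assume "x \<in> carrier (completion A)"
  then obtain X where *: "X \<in> cauchy_seqs A" "x = cauchy_class A X" by (rule completion_carrierE)
  note [simp] = *(2) cauchy_seqsD[OF *(1)] completion_ops *(1)
  show "star (completion A) x \<in> carrier (completion A)" by (simp add: completion_carrier)
  show "star (completion A) (c \<odot>\<^bsub>completion A\<^esub> x) = cnj c \<odot>\<^bsub>completion A\<^esub> star (completion A) x"
    by (simp add: star_smult)
  show "star (completion A) (star (completion A) x) = x" by (simp add: star_star)
qed (rule completion_ring completion_module)+

lemma completion_minus: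
  assumes "X \<in> cauchy_seqs A" "Y \<in> cauchy_seqs A"
  shows "cauchy_class A X \<ominus>\<^bsub>completion A\<^esub> cauchy_class A Y = cauchy_class A (\<lambda>n. X n \<ominus> Y n)"
    "(\<lambda>n. X n \<ominus> Y n) \<in> cauchy_seqs A"
proof -
  interpret c: star_algebra "completion A" by (rule completion_star_algebra)
  have eq: "(\<lambda>n. X n \<ominus> Y n) = (\<lambda>n. X n \<oplus> (-1) \<odot> Y n)"
    using assms cauchy_seqsD by (auto simp: minus_eq_smult)
  show "cauchy_class A X \<ominus>\<^bsub>completion A\<^esub> cauchy_class A Y = cauchy_class A (\<lambda>n. X n \<ominus> Y n)"
    using assms unfolding eq
    by (subst c.minus_eq_smult)
      (auto simp: completion_carrier completion_add completion_smult cauchy_seqs_smult)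
  show "(\<lambda>n. X n \<ominus> Y n) \<in> cauchy_seqs A"
    unfolding eq using assms by (intro cauchy_seqs_add cauchy_seqs_smult)
qed

text \<open>A positive functional is Lipschitz for the seminorm, so its values along a Cauchy
  sequence converge, and null sequences do not change the limit.\<close>

lemma pos_functional_tendsto:
  assumes \<phi>: "pos_functional A \<phi>" and X: "X \<in> cauchy_seqs A"
  shows "(\<lambda>n. \<phi> (X n)) \<longlonglongrightarrow> lim (\<lambda>n. \<phi> (cauchy_rep (cauchy_class A X) n))"
proof -
  interpret \<phi>: pos_functional_form A \<phi> using \<phi> by (rule pos_functional_form)
  note R = cauchy_rep_class[OF X]
  let ?X = "cauchy_rep (cauchy_class A X)"
  have lip: "cmod (\<phi> x - \<phi> y) \<le> \<bar>Re (\<phi> \<one>)\<bar> * nrm A (x \<ominus> y)" if "x \<in> carrier A" "y \<in> carrier A" for x y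
  proof -
    have "\<phi> x - \<phi> y = \<phi> (x \<ominus> y)"
      using that by (simp add: minus_eq_smult \<phi>.add \<phi>.smult smult_closed)
    then have "cmod (\<phi> x - \<phi> y) \<le> Re (\<phi> \<one>) * nrm A (x \<ominus> y)"
      using pos_functional_cmod_le[OF \<phi>, of "x \<ominus> y"] that by simp
    also have "\<dots> \<le> \<bar>Re (\<phi> \<one>)\<bar> * nrm A (x \<ominus> y)"
      using that nrm_nonneg by (intro mult_right_mono) auto
    finally show ?thesis .
  qed
  have "Cauchy (\<lambda>n. \<phi> (?X n))"
  proof (rule metric_CauchyI)
    fix e :: real assume e: "0 < e"
    define d where "d = e / (\<bar>Re (\<phi> \<one>)\<bar> + 1)"
    have d: "0 < d" using e by (simp add: d_def)
    obtain M where M: "\<And>m n. M \<le> m \<Longrightarrow> M \<le> n \<Longrightarrow> nrm A (?X m \<ominus> ?X n) < d"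
      using cauchy_seqsE[OF R(1) d] by metis
    have "dist (\<phi> (?X m)) (\<phi> (?X n)) < e" if "M \<le> m" "M \<le> n" for m n
    proof -
      have "dist (\<phi> (?X m)) (\<phi> (?X n)) \<le> \<bar>Re (\<phi> \<one>)\<bar> * d"
        using lip[OF cauchy_seqsD[OF R(1)] cauchy_seqsD[OF R(1)], of m n]
          mult_left_mono[OF less_imp_le[OF M[OF that]], of "\<bar>Re (\<phi> \<one>)\<bar>"] by (simp add: dist_norm)
      also have "\<dots> < (\<bar>Re (\<phi> \<one>)\<bar> + 1) * d" using d by (intro mult_strict_right_mono) auto
      also have "\<dots> = e" by (simp add: d_def)
      finally show ?thesis .
    qed
    then show "\<exists>M. \<forall>m\<ge>M. \<forall>n\<ge>M. dist (\<phi> (?X m)) (\<phi> (?X n)) < e" by blast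
  qed
  then have "(\<lambda>n. \<phi> (?X n)) \<longlonglongrightarrow> lim (\<lambda>n. \<phi> (?X n))"
    by (simp add: Cauchy_convergent_iff convergent_LIMSEQ_iff)
  moreover have "(\<lambda>n. \<phi> (X n) - \<phi> (?X n)) \<longlonglongrightarrow> 0"
    by (rule Lim_null_comparison[of _ "\<lambda>n. \<bar>Re (\<phi> \<one>)\<bar> * nrm A (X n \<ominus> ?X n)"])
      (use lip cauchy_seqsD[OF R(1)] cauchy_seqsD[OF X] R(2) in
        \<open>auto simp: null_diff_def intro!: tendsto_mult_right_zero\<close>)
  ultimately show ?thesis using tendsto_add by fastforce
qed

lemma completion_pos_functional:
  assumes \<phi>: "pos_functional A \<phi>"
  defines "\<psi> \<equiv> \<lambda>U. lim (\<lambda>n. \<phi> (cauchy_rep U n))"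
  shows "pos_functional (completion A) \<psi>"
    and "X \<in> cauchy_seqs A \<Longrightarrow> (\<lambda>n. \<phi> (X n)) \<longlonglongrightarrow> \<psi> (cauchy_class A X)"
proof -
  show T: "(\<lambda>n. \<phi> (X n)) \<longlonglongrightarrow> \<psi> (cauchy_class A X)" if "X \<in> cauchy_seqs A" for X
    unfolding \<psi>_def by (rule pos_functional_tendsto[OF \<phi> that])
  interpret \<phi>: pos_functional_form A \<phi> using \<phi> by (rule pos_functional_form)
  note cs = cauchy_seqs_add cauchy_seqs_mult cauchy_seqs_smult cauchy_seqs_star
  show "pos_functional (completion A) \<psi>"
    unfolding pos_functional_def
  proof (intro conjI ballI allI)
    fix x assume "x \<in> carrier (completion A)"
    then obtain X where X: "X \<in> cauchy_seqs A" "x = cauchy_class A X" by (auto simp: completion_carrier)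
    note [simp] = cauchy_seqsD[OF X(1)]
    show "\<psi> (c \<odot>\<^bsub>completion A\<^esub> x) = c * \<psi> x" for c
    proof (rule LIMSEQ_unique)
      show "(\<lambda>n. \<phi> (c \<odot> X n)) \<longlonglongrightarrow> \<psi> (c \<odot>\<^bsub>completion A\<^esub> x)"
        using T[OF cauchy_seqs_smult[OF X(1)], of c] X by (simp add: completion_smult)
      show "(\<lambda>n. \<phi> (c \<odot> X n)) \<longlonglongrightarrow> c * \<psi> x"
        using tendsto_mult_left[OF T[OF X(1)], of c] X by (simp add: \<phi>.smult)
    qed
    show "\<psi> (star (completion A) x) = cnj (\<psi> x)"
    proof (rule LIMSEQ_unique)
      show "(\<lambda>n. \<phi> (star A (X n))) \<longlonglongrightarrow> \<psi> (star (completion A) x)"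
        using T[OF cauchy_seqs_star[OF X(1)]] X by (simp add: completion_star)
      show "(\<lambda>n. \<phi> (star A (X n))) \<longlonglongrightarrow> cnj (\<psi> x)"
        using tendsto_cnj[OF T[OF X(1)]] X by (simp add: \<phi>.herm)
    qed
    have TX: "(\<lambda>n. Re (\<phi> (star A (X n) \<otimes> X n))) \<longlonglongrightarrow> Re (\<psi> (star (completion A) x \<otimes>\<^bsub>completion A\<^esub> x))"
      using tendsto_Re[OF T[OF cauchy_seqs_mult[OF cauchy_seqs_star[OF X(1)] X(1)]]] X
      by (simp add: completion_mult completion_star cauchy_seqs_star)
    show "0 \<le> Re (\<psi> (star (completion A) x \<otimes>\<^bsub>completion A\<^esub> x))"
      by (rule LIMSEQ_le_const[OF TX]) (auto intro!: \<phi>.pos)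
    fix y assume "y \<in> carrier (completion A)"
    then obtain Y where Y: "Y \<in> cauchy_seqs A" "y = cauchy_class A Y" by (auto simp: completion_carrier)
    note [simp] = cauchy_seqsD[OF Y(1)]
    show "\<psi> (x \<oplus>\<^bsub>completion A\<^esub> y) = \<psi> x + \<psi> y"
    proof (rule LIMSEQ_unique)
      show "(\<lambda>n. \<phi> (X n \<oplus> Y n)) \<longlonglongrightarrow> \<psi> (x \<oplus>\<^bsub>completion A\<^esub> y)"
        using T[OF cauchy_seqs_add[OF X(1) Y(1)]] X Y by (simp add: completion_add)
      show "(\<lambda>n. \<phi> (X n \<oplus> Y n)) \<longlonglongrightarrow> \<psi> x + \<psi> y"
        using tendsto_add[OF T[OF X(1)] T[OF Y(1)]] X Y by (simp add: \<phi>.add)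
    qed
    have TY: "(\<lambda>n. Re (\<phi> (star A (Y n) \<otimes> Y n))) \<longlonglongrightarrow> Re (\<psi> (star (completion A) y \<otimes>\<^bsub>completion A\<^esub> y))"
      using tendsto_Re[OF T[OF cauchy_seqs_mult[OF cauchy_seqs_star[OF Y(1)] Y(1)]]] Y
      by (simp add: completion_mult completion_star cauchy_seqs_star)
    have TXY: "(\<lambda>n. Re (\<phi> (star A (X n \<otimes> Y n) \<otimes> (X n \<otimes> Y n)))) \<longlonglongrightarrow>
        Re (\<psi> (star (completion A) (x \<otimes>\<^bsub>completion A\<^esub> y) \<otimes>\<^bsub>completion A\<^esub> (x \<otimes>\<^bsub>completion A\<^esub> y)))"
      using tendsto_Re[OF T[OF cauchy_seqs_mult[OF cauchy_seqs_star cauchy_seqs_mult], of "\<lambda>n. X n \<otimes> Y n" X Y]] X Y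
      by (simp add: completion_mult completion_star cauchy_seqs_star cauchy_seqs_mult)
    show "Re (\<psi> (star (completion A) (x \<otimes>\<^bsub>completion A\<^esub> y) \<otimes>\<^bsub>completion A\<^esub> (x \<otimes>\<^bsub>completion A\<^esub> y)))
      \<le> (nrm (completion A) x)\<^sup>2 * Re (\<psi> (star (completion A) y \<otimes>\<^bsub>completion A\<^esub> y))"
      by (rule LIMSEQ_le[OF TXY tendsto_mult[OF tendsto_power TY]], unfold X(2), rule completion_nrm[OF X(1)])
        (use \<phi> in \<open>auto simp: pos_functional_def\<close>)
  qed
qed

text \<open>An element is replaced by a late term \<open>X M\<close> of its Cauchy sequence; an
  almost norming functional is chosen for that term and extended to the completion. The GNS seminorm
  drops by at most \<open>d\<close> between \<open>X M\<close> and later terms, so the functional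
  almost norms the limit as well.\<close>

lemma completion_pre_cstar: "pre_cstar (completion A)"
proof -
  interpret c: star_algebra "completion A" by (rule completion_star_algebra)
  show ?thesis
  proof
    fix x assume "x \<in> carrier (completion A)"
    then obtain X where X: "X \<in> cauchy_seqs A" "x = cauchy_class A X" by (auto simp: completion_carrier)
    note [simp] = cauchy_seqsD[OF X(1)]
    show nn: "0 \<le> nrm (completion A) x"
      unfolding X(2) by (rule LIMSEQ_le_const[OF completion_nrm[OF X(1)]]) (simp add: nrm_nonneg)
    let ?N = "nrm (completion A) x"
    fix e :: real assume e: "0 < e"
    \<comment> \<open>The losses below add up to
      \<open>2 * d * ?N + d\<^sup>2 + 2 * d * (?N + d)\<close>; for \<open>d\<close> at most 1 this
      is at most \<open>4 * d * (?N + 1)\<close>, hence at most \<open>e\<close>.\<close>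
    define d where "d = min 1 (e / (4 * (?N + 1)))"
    have "d \<le> e / (4 * (?N + 1))" by (simp add: d_def)
    then have d: "4 * d * (?N + 1) \<le> e" "0 < d" "d \<le> 1"
      using e nn by (simp_all add: pos_le_divide_eq mult_ac, auto simp: d_def)
    note d = d(2,3,1)
    obtain M where M: "\<And>m n. M \<le> m \<Longrightarrow> M \<le> n \<Longrightarrow> nrm A (X m \<ominus> X n) < d"
      using cauchy_seqsE[OF X(1) d(1)] by metis
    have close: "?N \<le> nrm A (X M) + d"
      unfolding X(2)
    proof (rule LIMSEQ_le_const2[OF completion_nrm[OF X(1)]], intro exI allI impI)
      fix n assume "M \<le> n"
      then show "nrm A (X n) \<le> nrm A (X M) + d"
        using M[of n M] nrm_diff_le[of "X n" "X M"] by simp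
    qed
    have sq: "?N\<^sup>2 - 2 * d * ?N \<le> (nrm A (X M))\<^sup>2"
    \<comment> \<open>If \<open>?N \<le> d\<close>, then \<open>?N - d\<close> is not positive and
      squaring is not monotone there, but the left side is already nonpositive.\<close>
    proof (cases "?N \<le> d")
      case True
      have "?N\<^sup>2 - 2 * d * ?N = ?N * (?N - 2 * d)" by (simp add: power2_eq_square algebra_simps)
      also have "\<dots> \<le> 0" using True nn d by (intro mult_nonneg_nonpos) auto
      finally show ?thesis using zero_le_power2[of "nrm A (X M)"] by linarith
    next
      case False
      have "?N\<^sup>2 - 2 * d * ?N \<le> (?N - d)\<^sup>2" by (simp add: power2_diff)
      also have "\<dots> \<le> (nrm A (X M))\<^sup>2" using close False by (intro power_mono) auto
      finally show ?thesis .
    qed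
    obtain \<phi> where \<phi>: "pos_functional A \<phi>" "Re (\<phi> \<one>) \<le> 1" "(nrm A (X M))\<^sup>2 - d\<^sup>2 < Re (\<phi> (star A (X M) \<otimes> X M))"
      using norming[of "X M" "d\<^sup>2"] d by auto
    interpret \<phi>: pos_functional_form A \<phi> using \<phi>(1) by (rule pos_functional_form)
    define \<psi> where "\<psi> = (\<lambda>U. lim (\<lambda>n. \<phi> (cauchy_rep U n)))"
    note \<psi> = completion_pos_functional[OF \<phi>(1), folded \<psi>_def]
    have T: "(\<lambda>n. \<phi> (X n)) \<longlonglongrightarrow> \<psi> (cauchy_class A X)" if "X \<in> cauchy_seqs A" for X
      unfolding \<psi>_def by (rule \<psi>(2)[OF that])
    interpret \<psi>: pos_functional_form "completion A" \<psi> using \<psi>(1) by (rule c.pos_functional_form)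
    have one: "\<psi> \<one>\<^bsub>completion A\<^esub> = \<phi> \<one>"
      using \<psi>(2)[OF cauchy_seqs_const[OF one_closed]] by (simp add: completion_one LIMSEQ_const_iff \<psi>_def)
    have lim: "(\<lambda>n. \<phi>.q (X n)) \<longlonglongrightarrow> \<psi>.q x"
      using tendsto_Re[OF T[OF cauchy_seqs_mult[OF cauchy_seqs_star[OF X(1)] X(1)]]] X
      by (simp add: completion_mult completion_star cauchy_seqs_star \<phi>.q_def \<phi>.form_def \<psi>.q_def \<psi>.form_def)
    have "\<phi>.q (X M) - 2 * d * (?N + d) \<le> \<psi>.q x"
    proof (rule LIMSEQ_le_const[OF lim], intro exI allI impI)
      fix n assume n: "M \<le> n"
      have 1: "sqrt (\<phi>.q (X M)) \<le> sqrt (\<phi>.q (X n)) + d"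
      proof -
        have "X M = X n \<oplus> (X M \<ominus> X n)" by (simp add: a_minus_def a_lcomm r_neg)
        then have "sqrt (\<phi>.q (X M)) \<le> sqrt (\<phi>.q (X n)) + sqrt (\<phi>.q (X M \<ominus> X n))"
          by (metis \<phi>.minkowski \<open>\<And>n. X n \<in> carrier A\<close> minus_closed)
        then show ?thesis using sqrt_q_le_nrm[OF \<phi>(1,2), of "X M \<ominus> X n"] M[of M n] n by simp
      qed
      have 2: "sqrt (\<phi>.q (X M)) \<le> ?N + d"
      proof -
        have "nrm A (X M) \<le> ?N + d"
          unfolding X(2)
        proof (rule LIMSEQ_le_const[OF tendsto_add[OF completion_nrm[OF X(1)] tendsto_const]], intro exI allI impI)
          fix n assume "M \<le> n"
          then show "nrm A (X M) \<le> nrm A (X n) + d"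
            using M[of n M] nrm_diff_le[of "X n" "X M"] by simp
        qed
        then show ?thesis using sqrt_q_le_nrm[OF \<phi>(1,2), of "X M"] by simp
      qed
      have nnM: "0 \<le> \<phi>.q (X M)" "0 \<le> \<phi>.q (X n)" by (auto intro: \<phi>.q_nonneg)
      show "\<phi>.q (X M) - 2 * d * (?N + d) \<le> \<phi>.q (X n)"
      \<comment> \<open>The same split: squaring \<open>sqrt (\<phi>.q (X M)) - d\<close> preserves
        the order only when this number is nonnegative.\<close>
      proof (cases "sqrt (\<phi>.q (X M)) \<le> d")
        case True
        have "\<phi>.q (X M) = sqrt (\<phi>.q (X M)) * sqrt (\<phi>.q (X M))" using nnM by simp
        also have "\<dots> \<le> d * (?N + d)" using True 2 d nnM by (intro mult_mono) auto
        also have "\<dots> \<le> 2 * d * (?N + d)" using d nn by simp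
        finally show ?thesis using nnM by simp
      next
        case False
        have "(sqrt (\<phi>.q (X M)) - d)\<^sup>2 \<le> (sqrt (\<phi>.q (X n)))\<^sup>2"
          using 1 False by (intro power_mono) auto
        moreover have "(sqrt (\<phi>.q (X M)) - d)\<^sup>2 = \<phi>.q (X M) - 2 * d * sqrt (\<phi>.q (X M)) + d\<^sup>2"
          using nnM by (simp add: power2_diff algebra_simps)
        ultimately have "\<phi>.q (X M) - 2 * d * sqrt (\<phi>.q (X M)) \<le> \<phi>.q (X n)"
          using real_sqrt_pow2[OF nnM(2)] zero_le_power2[of d] by linarith
        moreover have "2 * d * sqrt (\<phi>.q (X M)) \<le> 2 * d * (?N + d)" using 2 d by (intro mult_left_mono) auto
        ultimately show ?thesis by simp
      qed
    qed
    moreover have "(nrm A (X M))\<^sup>2 - d\<^sup>2 < \<phi>.q (X M)" using \<phi>(3) by (simp add: \<phi>.q_def \<phi>.form_def)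
    ultimately have "?N\<^sup>2 - 2 * d * ?N - d\<^sup>2 - 2 * d * (?N + d) < \<psi>.q x" using sq by linarith
    moreover have "2 * d * ?N + d\<^sup>2 + 2 * d * (?N + d) \<le> 4 * d * (?N + 1)"
      using d by (simp add: algebra_simps power2_eq_square)
    ultimately have "?N\<^sup>2 - e < \<psi>.q x" using d(3) by linarith
    then show "\<exists>\<phi>. pos_functional (completion A) \<phi> \<and> Re (\<phi> \<one>\<^bsub>completion A\<^esub>) \<le> 1 \<and>
        ?N\<^sup>2 - e < Re (\<phi> (star (completion A) x \<otimes>\<^bsub>completion A\<^esub> x))"
      using \<psi>(1) one \<phi>(2) by (intro exI[of _ \<psi>]) (auto simp: \<psi>.q_def \<psi>.form_def)
  qed
qed

end


section \<open>Complete algebras, limits and *-homomorphisms\<close>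

locale op_cstar = pre_cstar +
  assumes nrm_eq_0D: "x \<in> carrier A \<Longrightarrow> nrm A x = 0 \<Longrightarrow> x = \<zero>"
    and complete: "X \<in> cauchy_seqs A \<Longrightarrow> \<exists>x\<in>carrier A. (\<lambda>n. nrm A (X n \<ominus> x)) \<longlonglongrightarrow> 0"

text \<open>The C*-algebras below are handled through \<open>op_cstar\<close>, where norming
  functionals replace the C*-identity; this lemma returns to the axioms, as the definition of a
  compact quantum group asks for them.\<close>

lemma (in op_cstar) unital_cstar_algebra: "unital_cstar_algebra A"
  by (rule unital_cstar_algebraI[OF pre_cstar_axioms nrm_eq_0D complete])

lemma star_homD:
  assumes "star_hom A B f" "x \<in> carrier A"
  shows "f x \<in> carrier B" "y \<in> carrier A \<Longrightarrow> f (x \<oplus>\<^bsub>A\<^esub> y) = f x \<oplus>\<^bsub>B\<^esub> f y"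
    "y \<in> carrier A \<Longrightarrow> f (x \<otimes>\<^bsub>A\<^esub> y) = f x \<otimes>\<^bsub>B\<^esub> f y" "f \<one>\<^bsub>A\<^esub> = \<one>\<^bsub>B\<^esub>"
    "f (c \<odot>\<^bsub>A\<^esub> x) = c \<odot>\<^bsub>B\<^esub> f x" "f (star A x) = star B (f x)"
  using assms by (auto simp: star_hom_def ring_hom_def)

lemma star_hom_one: "star_hom A B f \<Longrightarrow> f \<one>\<^bsub>A\<^esub> = \<one>\<^bsub>B\<^esub>"
  by (auto simp: star_hom_def ring_hom_def)

lemma star_homI:
  assumes "\<And>x. x \<in> carrier A \<Longrightarrow> f x \<in> carrier B" "f \<one>\<^bsub>A\<^esub> = \<one>\<^bsub>B\<^esub>"
    "\<And>x y. x \<in> carrier A \<Longrightarrow> y \<in> carrier A \<Longrightarrow> f (x \<oplus>\<^bsub>A\<^esub> y) = f x \<oplus>\<^bsub>B\<^esub> f y"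
    "\<And>x y. x \<in> carrier A \<Longrightarrow> y \<in> carrier A \<Longrightarrow> f (x \<otimes>\<^bsub>A\<^esub> y) = f x \<otimes>\<^bsub>B\<^esub> f y"
    "\<And>c x. x \<in> carrier A \<Longrightarrow> f (c \<odot>\<^bsub>A\<^esub> x) = c \<odot>\<^bsub>B\<^esub> f x"
    "\<And>x. x \<in> carrier A \<Longrightarrow> f (star A x) = star B (f x)"
  shows "star_hom A B f"
  unfolding star_hom_def by (intro conjI ballI allI ring_hom_memI assms)

lemma star_hom_compose:
  assumes "star_hom A B f" "star_hom B C g" shows "star_hom A C (\<lambda>x. g (f x))"
  by (rule star_homI)
    (simp_all add: star_homD[OF assms(1)] star_homD[OF assms(2)] star_hom_one[OF assms(1)] star_hom_one[OF assms(2)])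

lemma star_hom_ident: "star_hom A A (\<lambda>x. x)"
  by (rule star_homI) auto

lemma star_hom_minus:
  assumes "star_algebra A" "star_algebra B" "star_hom A B f" "x \<in> carrier A" "y \<in> carrier A"
  shows "f (x \<ominus>\<^bsub>A\<^esub> y) = f x \<ominus>\<^bsub>B\<^esub> f y"
  using assms star_homD[OF assms(3)]
  by (simp add: star_algebra.minus_eq_smult star_algebra.smult_closed)

context pre_cstar begin

lemma completion_emb_cauchy: "completion_emb A x = cauchy_class A (\<lambda>_. x)"
  by (simp add: completion_emb_def)

lemma completion_emb_closed: "x \<in> carrier A \<Longrightarrow> completion_emb A x \<in> carrier (completion A)"
  by (simp add: completion_emb_def completion_carrier cauchy_seqs_const)

lemma completion_emb_star_hom: "star_hom A (completion A) (completion_emb A)"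
  unfolding star_hom_def
  by (auto intro!: ring_hom_memI
    simp: completion_carrier completion_emb_cauchy completion_ops)

lemma completion_emb_approx:
  assumes "X \<in> cauchy_seqs A" "0 < e"
  shows "\<exists>M. \<forall>m\<ge>M. nrm (completion A) (cauchy_class A X \<ominus>\<^bsub>completion A\<^esub> completion_emb A (X m)) \<le> e"
proof -
  obtain M where M: "\<And>m n. M \<le> m \<Longrightarrow> M \<le> n \<Longrightarrow> nrm A (X m \<ominus> X n) < e"
    using cauchy_seqsE[OF assms] by metis
  have "nrm (completion A) (cauchy_class A X \<ominus>\<^bsub>completion A\<^esub> completion_emb A (X m)) \<le> e" if "M \<le> m" for m
  proof -
    note c = cauchy_seqs_const[OF cauchy_seqsD[OF assms(1), of m]]
    show ?thesis
      unfolding completion_emb_cauchy completion_minus(1)[OF assms(1) c]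
      by (rule LIMSEQ_le_const2[OF completion_nrm[OF completion_minus(2)[OF assms(1) c]]])
        (use M that in \<open>auto intro!: exI[of _ M] less_imp_le\<close>)
  qed
  then show ?thesis by blast
qed

lemma completion_emb_dense: "dense_in (completion A) (completion_emb A ` carrier A)"
  unfolding dense_in_def
proof (intro conjI ballI allI impI)
  show "completion_emb A ` carrier A \<subseteq> carrier (completion A)" by (auto simp: completion_emb_closed)
  fix x e assume "x \<in> carrier (completion A)" and e: "0 < (e::real)"
  then obtain X where X: "X \<in> cauchy_seqs A" "x = cauchy_class A X" by (auto simp: completion_carrier)
  obtain M where "nrm (completion A) (x \<ominus>\<^bsub>completion A\<^esub> completion_emb A (X M)) \<le> e / 2"
    using completion_emb_approx[OF X(1), of "e / 2"] e X by auto
  then show "\<exists>y\<in>completion_emb A ` carrier A. nrm (completion A) (x \<ominus>\<^bsub>completion A\<^esub> y) < e"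
    using e cauchy_seqsD[OF X(1), of M] by force
qed

text \<open>For completeness, approximate the \<open>n\<close>-th term of a Cauchy sequence of
  classes to within \<open>1 / Suc n\<close> by an element of \<open>A\<close>. These elements form
  a Cauchy sequence in \<open>A\<close>, and its class is the limit.\<close>

lemma completion_op_cstar: "op_cstar (completion A)"
proof -
  interpret c: pre_cstar "completion A" by (rule completion_pre_cstar)
  note eh = completion_emb_star_hom
  show ?thesis
  proof
    fix x assume "x \<in> carrier (completion A)" and 0: "nrm (completion A) x = 0"
    then obtain X where X: "X \<in> cauchy_seqs A" "x = cauchy_class A X" by (auto simp: completion_carrier)
    have "null_diff X (\<lambda>_. \<zero>)"
      unfolding null_diff_def using completion_nrm[OF X(1)] 0 X cauchy_seqsD[OF X(1)]
      by (simp add: a_minus_def)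
    then show "x = \<zero>\<^bsub>completion A\<^esub>"
      unfolding X completion_zero by (subst cauchy_class_eq_iff) (auto intro: X cauchy_seqs_const)
  next
    fix U assume U: "U \<in> cauchy_seqs (completion A)"
    note Uc = c.cauchy_seqsD[OF U]
    have "\<exists>x\<in>carrier A. nrm (completion A) (U n \<ominus>\<^bsub>completion A\<^esub> completion_emb A x) < 1 / Suc n" for n
      using completion_emb_dense Uc[of n] unfolding dense_in_def by force
    then obtain x where x: "\<And>n. x n \<in> carrier A"
      "\<And>n. nrm (completion A) (U n \<ominus>\<^bsub>completion A\<^esub> completion_emb A (x n)) < 1 / Suc n"
      by metis
    note ex = completion_emb_closed[OF x(1)]
    have X: "x \<in> cauchy_seqs A"
    proof (rule cauchy_seqsI[OF x(1)])
      fix e :: real assume e: "0 < e"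
      obtain M where M: "\<And>m n. M \<le> m \<Longrightarrow> M \<le> n \<Longrightarrow> nrm (completion A) (U m \<ominus>\<^bsub>completion A\<^esub> U n) < e / 3"
        using c.cauchy_seqsE[OF U, of "e / 3"] e by auto
      obtain N where N: "1 / Suc N < e / 3" using e nat_approx_posE[of "e / 3"] by auto
      have "nrm A (x m \<ominus> x n) < e" if mn: "max M N \<le> m" "max M N \<le> n" for m n
      proof -
        have small: "1 / Suc k < e / 3" if "max M N \<le> k" for k
          using N that by (intro le_less_trans[OF _ N]) (simp add: frac_le)
        have "nrm A (x m \<ominus> x n)
            = nrm (completion A) (completion_emb A (x m) \<ominus>\<^bsub>completion A\<^esub> completion_emb A (x n))"
          using star_hom_minus[OF star_algebra_axioms c.star_algebra_axioms eh x(1) x(1), of m n] x(1)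
          by (simp flip: completion_nrm_const)
        also have "\<dots> \<le> nrm (completion A) (completion_emb A (x m) \<ominus>\<^bsub>completion A\<^esub> U m)
            + (nrm (completion A) (U m \<ominus>\<^bsub>completion A\<^esub> U n)
            + nrm (completion A) (U n \<ominus>\<^bsub>completion A\<^esub> completion_emb A (x n)))"
          using c.nrm_triangle_minus[OF ex[of m] Uc[of m] ex[of n]]
            c.nrm_triangle_minus[OF Uc[of m] Uc[of n] ex[of n]] by linarith
        also have "\<dots> < e"
          using M[of m n] x(2)[of m] x(2)[of n] small[of m] small[of n] mn
            c.nrm_minus_commute[OF ex[of m] Uc[of m]] by simp
        finally show ?thesis .
      qed
      then show "\<exists>M. \<forall>m\<ge>M. \<forall>n\<ge>M. nrm A (x m \<ominus> x n) < e" by blast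
    qed
    let ?x = "cauchy_class A x"
    have xc: "?x \<in> carrier (completion A)" using X by (simp add: completion_carrier)
    have "(\<lambda>n. nrm (completion A) (U n \<ominus>\<^bsub>completion A\<^esub> ?x)) \<longlonglongrightarrow> 0"
    proof (rule LIMSEQ_I)
      fix e :: real assume e: "0 < e"
      obtain M where M: "\<And>m. m \<ge> M \<Longrightarrow> nrm (completion A) (?x \<ominus>\<^bsub>completion A\<^esub> completion_emb A (x m)) \<le> e / 3"
        using completion_emb_approx[OF X, of "e / 3"] e by auto
      obtain N where N: "1 / Suc N < e / 3" using e nat_approx_posE[of "e / 3"] by auto
      have "nrm (completion A) (U n \<ominus>\<^bsub>completion A\<^esub> ?x) < e" if "max M N \<le> n" for n
      proof -
        have "1 / Suc n < e / 3"
          using N that by (intro le_less_trans[OF _ N]) (simp add: frac_le)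
        then show ?thesis
          using c.nrm_triangle_minus[OF Uc[of n] ex[of n] xc] M[of n] x(2)[of n] that e
            c.nrm_minus_commute[OF xc ex[of n]] by simp
      qed
      then show "\<exists>N. \<forall>n\<ge>N. norm (nrm (completion A) (U n \<ominus>\<^bsub>completion A\<^esub> ?x) - 0) < e"
        using c.nrm_nonneg Uc xc by (intro exI[of _ "max M N"]) auto
    qed
    then show "\<exists>x\<in>carrier (completion A). (\<lambda>n. nrm (completion A) (U n \<ominus>\<^bsub>completion A\<^esub> x)) \<longlonglongrightarrow> 0"
      using xc by blast
  qed
qed

definition lims :: "(nat \<Rightarrow> 'a) \<Rightarrow> 'a \<Rightarrow> bool" where
  "lims X x \<longleftrightarrow> (\<lambda>n. nrm A (X n \<ominus> x)) \<longlonglongrightarrow> 0"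

lemma limsI:
  assumes "\<And>n. nrm A (X n \<ominus> x) \<le> f n" "f \<longlonglongrightarrow> 0" "\<And>n. X n \<in> carrier A" "x \<in> carrier A"
  shows "lims X x"
  unfolding lims_def using assms by (intro nrm_tendsto_0I[OF assms(2)]) auto

lemma lims_add:
  assumes "\<And>n. X n \<in> carrier A" "\<And>n. Y n \<in> carrier A" "x \<in> carrier A" "y \<in> carrier A" "lims X x" "lims Y y"
  shows "lims (\<lambda>n. X n \<oplus> Y n) (x \<oplus> y)"
proof (rule limsI)
  show "nrm A (X n \<oplus> Y n \<ominus> (x \<oplus> y)) \<le> nrm A (X n \<ominus> x) + nrm A (Y n \<ominus> y)" for n
    using assms nrm_triangle[of "X n \<ominus> x" "Y n \<ominus> y"] by (simp add: add_minus_add)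
  show "(\<lambda>n. nrm A (X n \<ominus> x) + nrm A (Y n \<ominus> y)) \<longlonglongrightarrow> 0"
    using tendsto_add[OF assms(5,6)[unfolded lims_def]] by simp
qed (use assms in auto)

lemma lims_smult:
  assumes "\<And>n. X n \<in> carrier A" "x \<in> carrier A" "lims X x"
  shows "lims (\<lambda>n. c \<odot> X n) (c \<odot> x)"
proof (rule limsI)
  show "nrm A (c \<odot> X n \<ominus> c \<odot> x) \<le> cmod c * nrm A (X n \<ominus> x)" for n
    using assms by (simp flip: smult_minus_right add: nrm_smult)
  show "(\<lambda>n. cmod c * nrm A (X n \<ominus> x)) \<longlonglongrightarrow> 0"
    using assms(3) unfolding lims_def by (rule tendsto_mult_right_zero)
qed (use assms in \<open>auto intro: smult_closed\<close>)

lemma lims_star: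
  assumes "\<And>n. X n \<in> carrier A" "x \<in> carrier A" "lims X x"
  shows "lims (\<lambda>n. star A (X n)) (star A x)"
  using assms unfolding lims_def by (simp flip: star_minus add: nrm_star)

lemma lims_cauchy:
  assumes "\<And>n. X n \<in> carrier A" "x \<in> carrier A" "lims X x"
  shows "X \<in> cauchy_seqs A"
proof (rule cauchy_seqsI[OF assms(1)])
  fix e :: real assume "0 < e"
  then obtain M where M: "\<And>n. n \<ge> M \<Longrightarrow> \<bar>nrm A (X n \<ominus> x)\<bar> < e / 2"
    using LIMSEQ_D[OF assms(3)[unfolded lims_def], of "e / 2"] by auto
  have "nrm A (X m \<ominus> X n) < e" if "M \<le> m" "M \<le> n" for m n
    using nrm_triangle_minus[of "X m" x "X n"] nrm_minus_commute[of x "X n"] M[OF that(1)] M[OF that(2)] assms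
    by simp
  then show "\<exists>M. \<forall>m\<ge>M. \<forall>n\<ge>M. nrm A (X m \<ominus> X n) < e" by blast
qed

lemma lims_mult:
  assumes "\<And>n. X n \<in> carrier A" "\<And>n. Y n \<in> carrier A" "x \<in> carrier A" "y \<in> carrier A" "lims X x" "lims Y y"
  shows "lims (\<lambda>n. X n \<otimes> Y n) (x \<otimes> y)"
proof -
  obtain C where C: "\<And>n. nrm A (Y n) \<le> C"
    using cauchy_seqs_bounded[OF lims_cauchy[OF assms(2,4,6)]] by auto
  show ?thesis
  proof (rule limsI)
    show "nrm A (X n \<otimes> Y n \<ominus> (x \<otimes> y)) \<le> C * nrm A (X n \<ominus> x) + nrm A x * nrm A (Y n \<ominus> y)" for n
      using nrm_mult_minus_mult_le[of "X n" "Y n" x y] mult_right_mono[OF C, of "nrm A (X n \<ominus> x)" n]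
        nrm_nonneg[of "X n \<ominus> x"] assms by simp
    show "(\<lambda>n. C * nrm A (X n \<ominus> x) + nrm A x * nrm A (Y n \<ominus> y)) \<longlonglongrightarrow> 0"
      using assms(5,6) unfolding lims_def by (intro tendsto_add_zero tendsto_mult_right_zero)
  qed (use assms in auto)
qed

lemma lims_const: "x \<in> carrier A \<Longrightarrow> lims (\<lambda>_. x) x"
  by (simp add: lims_def a_minus_def r_neg nrm_zero)

lemma dense_in_lims:
  assumes "dense_in A S" "x \<in> carrier A"
  shows "\<exists>X. (\<forall>n. X n \<in> S) \<and> lims X x"
proof -
  have "\<exists>y\<in>S. nrm A (x \<ominus> y) < 1 / Suc n" for n
    using assms unfolding dense_in_def by force
  then obtain X where X: "\<And>n. X n \<in> S" "\<And>n. nrm A (x \<ominus> X n) < 1 / Suc n" by metis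
  then have c: "X n \<in> carrier A" for n using assms unfolding dense_in_def by auto
  have "lims X x"
    by (rule limsI[OF _ LIMSEQ_inverse_real_of_nat c assms(2)])
      (use X(2) nrm_minus_commute[OF c assms(2)] in \<open>simp add: inverse_eq_divide less_imp_le\<close>)
  then show ?thesis using X by blast
qed

lemma lims_suffix: "lims X x \<Longrightarrow> lims (\<lambda>n. X (Suc n)) x"
  unfolding lims_def by (rule LIMSEQ_Suc)

end

context op_cstar begin

lemma lims_unique:
  assumes "\<And>n. X n \<in> carrier A" "x \<in> carrier A" "y \<in> carrier A" "lims X x" "lims X y"
  shows "x = y"
proof -
  have "(\<lambda>n. nrm A (X n \<ominus> x) + nrm A (X n \<ominus> y)) \<longlonglongrightarrow> 0"
    using assms(4,5) unfolding lims_def by (rule tendsto_add_zero)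
  moreover have "nrm A (x \<ominus> y) \<le> nrm A (X n \<ominus> x) + nrm A (X n \<ominus> y)" for n
    using nrm_triangle_minus[of x "X n" y] nrm_minus_commute[of x "X n"] assms by simp
  ultimately have "nrm A (x \<ominus> y) \<le> 0"
    by (intro LIMSEQ_le_const[of _ 0]) auto
  then have "x \<ominus> y = \<zero>"
    using nrm_eq_0D[of "x \<ominus> y"] nrm_nonneg[of "x \<ominus> y"] assms by simp
  moreover have "x = (x \<ominus> y) \<oplus> y" using assms(2,3) by (simp add: a_minus_def a_assoc l_neg)
  ultimately show ?thesis using assms(3) by simp
qed

lemma cauchy_lims: "X \<in> cauchy_seqs A \<Longrightarrow> \<exists>x\<in>carrier A. lims X x"
  using complete by (simp add: lims_def)

text \<open>The partial sums of the geometric series satisfy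
  \<open>S (Suc n) = S n \<otimes> h \<oplus> \<one>\<close>, so their limit \<open>c\<close> solves
  \<open>c = c \<otimes> h \<oplus> \<one>\<close>, which is the claim. A left inverse is what
  yields the lower bound for \<open>\<one> \<ominus> h\<close> in the next lemma.\<close>

lemma neumann:
  assumes h: "h \<in> carrier A" and small: "nrm A h < 1"
  shows "\<exists>c\<in>carrier A. c \<otimes> (\<one> \<ominus> h) = \<one>"
proof -
  define r where "r = nrm A h"
  have r: "0 \<le> r" "r < 1" using small nrm_nonneg[OF h] by (auto simp: r_def)
  define S where "S = rec_nat \<zero> (\<lambda>_ s. s \<otimes> h \<oplus> \<one>)"
  have S0: "S 0 = \<zero>" and SS: "S (Suc n) = S n \<otimes> h \<oplus> \<one>" for n by (simp_all add: S_def)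
  have Sc: "S n \<in> carrier A" for n by (induction n) (auto simp: S0 SS h)
  let ?K = "nrm A \<one>"
  have step: "nrm A (S (Suc n) \<ominus> S n) \<le> ?K * r ^ n" for n
  proof (induction n)
    case 0 then show ?case using h by (simp add: S0 SS a_minus_def)
  next
    case (Suc n)
    have "S (Suc (Suc n)) \<ominus> S (Suc n) = (S (Suc n) \<ominus> S n) \<otimes> h"
      unfolding SS[of "Suc n"] SS[of n] using h Sc[of n]
      by (subst add_minus_add) (auto simp: a_minus_def l_distr l_minus r_neg)
    then have "nrm A (S (Suc (Suc n)) \<ominus> S (Suc n)) \<le> nrm A (S (Suc n) \<ominus> S n) * r"
      using nrm_mult[of "S (Suc n) \<ominus> S n" h] Sc h by (simp add: r_def)
    also have "\<dots> \<le> ?K * r ^ n * r" using Suc r by (intro mult_right_mono) auto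
    finally show ?case by (simp add: mult_ac)
  qed
  \<comment> \<open>Telescoping form of the geometric tail. The norm of the unit appears because the
    first increment is \<open>\<one>\<close>.\<close>
  have diff: "nrm A (S (n + k) \<ominus> S n) \<le> ?K / (1 - r) * (r ^ n - r ^ (n + k))" for n k
  proof (induction k)
    case 0 then show ?case using Sc by (simp add: a_minus_def r_neg nrm_zero)
  next
    case (Suc k)
    have "nrm A (S (n + Suc k) \<ominus> S n) \<le> nrm A (S (Suc (n + k)) \<ominus> S (n + k)) + nrm A (S (n + k) \<ominus> S n)"
      using nrm_triangle_minus[OF Sc Sc Sc] by simp
    also have "\<dots> \<le> ?K * r ^ (n + k) + ?K / (1 - r) * (r ^ n - r ^ (n + k))"
      using step Suc by (intro add_mono) auto
    also have "?K * r ^ (n + k) = ?K / (1 - r) * ((1 - r) * r ^ (n + k))"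
      using r by simp
    also have "(1 - r) * r ^ (n + k) = r ^ (n + k) - r ^ (n + Suc k)" by (simp add: left_diff_distrib)
    also have "?K / (1 - r) * (r ^ (n + k) - r ^ (n + Suc k)) + ?K / (1 - r) * (r ^ n - r ^ (n + k))
        = ?K / (1 - r) * (r ^ n - r ^ (n + Suc k))"
      unfolding distrib_left[symmetric] by simp
    finally show ?case .
  qed
  have K: "0 \<le> ?K / (1 - r)" using r nrm_nonneg[OF one_closed] by simp
  have "S \<in> cauchy_seqs A"
  proof (rule cauchy_seqsI[OF Sc])
    fix e :: real assume e: "0 < e"
    have "(\<lambda>n. ?K / (1 - r) * r ^ n) \<longlonglongrightarrow> 0"
      using r by (intro tendsto_mult_right_zero LIMSEQ_power_zero) auto
    from LIMSEQ_D[OF this e] obtain M where "\<forall>n\<ge>M. norm (?K / (1 - r) * r ^ n - 0) < e" by blast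
    then have M: "\<bar>?K / (1 - r) * r ^ n\<bar> < e" if "n \<ge> M" for n using that by simp
    have le: "nrm A (S m \<ominus> S n) < e" if mn: "M \<le> n" "n \<le> m" for m n
    proof -
      obtain k where k: "m = n + k" using le_Suc_ex[OF mn(2)] by blast
      have "nrm A (S m \<ominus> S n) \<le> ?K / (1 - r) * (r ^ n - r ^ (n + k))" unfolding k by (rule diff)
      also have "\<dots> \<le> ?K / (1 - r) * r ^ n" using K r by (intro mult_left_mono) auto
      finally show ?thesis using M[OF mn(1)] by linarith
    qed
    have "nrm A (S m \<ominus> S n) < e" if "M \<le> n" "M \<le> m" for m n
    proof (cases "n \<le> m")
      case True
      then show ?thesis using that by (intro le)
    next
      case False
      have "nrm A (S m \<ominus> S n) = nrm A (S n \<ominus> S m)" by (rule nrm_minus_commute[OF Sc Sc])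
      also have "\<dots> < e" using that False by (intro le) auto
      finally show ?thesis .
    qed
    then show "\<exists>M. \<forall>m\<ge>M. \<forall>n\<ge>M. nrm A (S m \<ominus> S n) < e" by blast
  qed
  then obtain c where c: "c \<in> carrier A" "lims S c" using cauchy_lims by auto
  have "lims (\<lambda>n. S (Suc n)) (c \<otimes> h \<oplus> \<one>)"
    unfolding SS using c h Sc by (intro lims_add lims_mult lims_const) auto
  then have eq: "c \<otimes> h \<oplus> \<one> = c"
    using lims_suffix[OF c(2)] c h by (intro lims_unique[OF Sc]) simp_all
  have "c \<otimes> (\<one> \<ominus> h) = c \<ominus> c \<otimes> h"
    using c h by (simp add: a_minus_def r_distr r_minus)
  also have "\<dots> = (c \<otimes> h \<oplus> \<one>) \<ominus> c \<otimes> h" using eq by simp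
  also have "\<dots> = \<one>" using c h a_comm[of "c \<otimes> h" \<one>] by (simp add: a_minus_def a_assoc r_neg)
  finally show ?thesis using c by blast
qed

text \<open>
  If \<open>R\<close>, the squared norm of \<open>a\<close> in the GNS representation, exceeded \<open>\<parallel>a\<parallel>\<^sup>2\<close>, then \<open>1 - a\<^sup>2/R\<close>
  would be invertible, although it is small on almost maximising vectors.
\<close>

lemma self_adjoint_bound:
  assumes \<psi>: "pos_functional_form A \<psi>" and a: "a \<in> carrier A" "star A a = a"
    and bd: "\<And>x. x \<in> carrier A \<Longrightarrow> \<exists>C. \<forall>y\<in>carrier A.
      pos_functional_form.q A \<psi> (x \<otimes> y) \<le> C * pos_functional_form.q A \<psi> y"
    and y: "y \<in> carrier A"
  shows "pos_functional_form.q A \<psi> (a \<otimes> y) \<le> (nrm A a)\<^sup>2 * pos_functional_form.q A \<psi> y"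
proof -
  interpret pos_functional_form A \<psi> by fact
  obtain C where C: "\<And>y. y \<in> carrier A \<Longrightarrow> q (a \<otimes> y) \<le> C * q y" using bd[OF a(1)] by auto
  let ?S = "{q (a \<otimes> y) | y. y \<in> carrier A \<and> q y \<le> 1}"
  define R where "R = Sup ?S"
  have q0: "q \<zero> = 0" using q_smult[OF zero_closed, of 0] by (simp add: smult_zero)
  have ne: "?S \<noteq> {}" using q0 by (auto intro!: exI[of _ \<zero>])
  have bdd: "bdd_above ?S"
  proof (rule bdd_aboveI)
    fix z assume "z \<in> ?S"
    then obtain y where y: "z = q (a \<otimes> y)" "y \<in> carrier A" "q y \<le> 1" by auto
    have "z \<le> C * q y" using C y by auto
    also have "\<dots> \<le> \<bar>C\<bar> * 1" using y q_nonneg by (intro mult_mono) auto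
    finally show "z \<le> \<bar>C\<bar>" by simp
  qed
  have le_R: "q (a \<otimes> y) \<le> R" if "y \<in> carrier A" "q y \<le> 1" for y
    unfolding R_def using that by (intro cSup_upper[OF _ bdd]) auto
  have scaled: "q (a \<otimes> y) \<le> R * q y" if y: "y \<in> carrier A" for y
  proof (cases "q y = 0")
    case True then show ?thesis using C[OF y] q_nonneg[of "a \<otimes> y"] a y by simp
  next
    case False
    then have pos: "q y > 0" using q_nonneg[OF y] by simp
    define t where "t = complex_of_real (1 / sqrt (q y))"
    have t: "(cmod t)\<^sup>2 = 1 / q y" using pos by (simp add: t_def norm_divide power_divide)
    have "q (a \<otimes> (t \<odot> y)) \<le> R"
      using pos y by (intro le_R smult_closed) (simp_all add: q_smult t)
    moreover have "q (a \<otimes> (t \<odot> y)) = q (a \<otimes> y) / q y"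
      using a y by (simp add: smult_mult q_smult t)
    ultimately show ?thesis using pos by (simp add: field_simps)
  qed
  have R0: "0 \<le> R" using le_R[of \<zero>] q0 a by simp
  have "R \<le> (nrm A a)\<^sup>2"
  proof (rule ccontr)
    assume "\<not> R \<le> (nrm A a)\<^sup>2"
    then have R: "(nrm A a)\<^sup>2 < R" by simp
    then have Rpos: "0 < R" by (smt (verit) zero_le_power2)
    define h where "h = of_real (1 / R) \<odot> (a \<otimes> a)"
    have h: "h \<in> carrier A" using a by (simp add: h_def smult_closed)
    have "nrm A h \<le> (nrm A a)\<^sup>2 / R"
      using nrm_mult[OF a(1) a(1)] Rpos a
      by (simp add: h_def nrm_smult power2_eq_square norm_divide divide_right_mono)
    also have "\<dots> < 1" using R Rpos by simp
    finally have "nrm A h < 1" .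
    then obtain c where c: "c \<in> carrier A" "c \<otimes> (\<one> \<ominus> h) = \<one>" using neumann[OF h] by auto
    obtain D where D: "\<And>y. y \<in> carrier A \<Longrightarrow> q (c \<otimes> y) \<le> D * q y" using bd[OF c(1)] by auto
    \<comment> \<open>The maximum with 1 keeps the constant positive, so that dividing by
      \<open>E\<close> below is legitimate.\<close>
    define E where "E = max D 1"
    have E1: "1 \<le> E" by (simp add: E_def)
    have E2: "q (c \<otimes> y) \<le> E * q y" if "y \<in> carrier A" for y
      using D[OF that] mult_right_mono[OF max.cobounded1[of D 1] q_nonneg[OF that]] by (simp add: E_def)
    note E = E1 E2
    have "q (a \<otimes> y) \<le> R * (1 - 1 / E)" if y: "y \<in> carrier A" "q y \<le> 1" for y
    proof -
      define w where "w = (\<one> \<ominus> h) \<otimes> y"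
      have hy: "h \<otimes> y = of_real (1 / R) \<odot> (a \<otimes> (a \<otimes> y))"
        using a y by (simp add: h_def smult_mult m_assoc)
      have w: "w = y \<oplus> (-1) \<odot> (h \<otimes> y)" "w \<in> carrier A"
        using h y by (simp_all add: w_def minus_eq_smult l_distr smult_mult smult_closed)
      have "form (h \<otimes> y) y = of_real (1 / R) * form (a \<otimes> y) (a \<otimes> y)"
        using a y by (simp add: hy form_smult) (simp add: form_mult a(2))
      then have f1: "Re (form (h \<otimes> y) y) = q (a \<otimes> y) / R" by (simp add: q_def)
      have "q (h \<otimes> y) = q (a \<otimes> (a \<otimes> y)) / R\<^sup>2"
        using a y Rpos by (simp add: hy q_smult norm_divide power_divide)
      also have "\<dots> \<le> R * q (a \<otimes> y) / R\<^sup>2" using scaled[of "a \<otimes> y"] a y by (simp add: divide_right_mono)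
      finally have f2: "q (h \<otimes> y) \<le> q (a \<otimes> y) / R" using Rpos by (simp add: power2_eq_square)
      \<comment> \<open>Expansion of the square of \<open>y - h y\<close>. By \<open>f2\<close> the
        last term gives back at most half of the cross term.\<close>
      have "q w = q y - 2 * (q (a \<otimes> y) / R) + q (h \<otimes> y)"
        unfolding w(1) using y h f1 by (subst q_add_smult) auto
      then have qw: "q w \<le> q y - q (a \<otimes> y) / R" using f2 by simp
      have "c \<otimes> w = y" using c y h by (simp add: w_def flip: m_assoc)
      then have "q y \<le> E * q w" using E(2)[OF w(2)] by simp
      also have "\<dots> \<le> E * (q y - q (a \<otimes> y) / R)" using qw E(1) by (intro mult_left_mono) auto
      finally have "q (a \<otimes> y) \<le> R * ((1 - 1 / E) * q y)" using E(1) Rpos by (simp add: field_simps)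
      also have "\<dots> \<le> R * ((1 - 1 / E) * 1)" using E(1) Rpos y by (intro mult_left_mono) auto
      finally show ?thesis by simp
    qed
    \<comment> \<open>The left inverse of \<open>\<one> \<ominus> h\<close> keeps
      \<open>q (a \<otimes> y)\<close> a fixed factor below \<open>R\<close> on the whole unit ball,
      although \<open>R\<close> is the supremum there.\<close>
    then have "R \<le> R * (1 - 1 / E)" unfolding R_def[symmetric] by (subst (1) R_def, intro cSup_least[OF ne]) auto
    then show False using Rpos E(1) by (simp add: field_simps)
  qed
  then show ?thesis using scaled[OF y] mult_right_mono[OF _ q_nonneg[OF y]] order_trans by blast
qed

text \<open>Left multiplication by \<open>x\<close> is reduced to the self-adjoint element
  \<open>star A x \<otimes> x\<close> by Cauchy-Schwarz, and \<open>self_adjoint_bound\<close>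
  replaces the unknown constants by the norm. In this way every bounded GNS action is automatically
  contractive.\<close>

lemma pos_functionalI_bounded:
  assumes \<psi>: "pos_functional_form A \<psi>"
    and bd: "\<And>x. x \<in> carrier A \<Longrightarrow> \<exists>C. \<forall>y\<in>carrier A.
      pos_functional_form.q A \<psi> (x \<otimes> y) \<le> C * pos_functional_form.q A \<psi> y"
  shows "pos_functional A \<psi>"
proof -
  interpret pos_functional_form A \<psi> by fact
  have "q (x \<otimes> y) \<le> (nrm A x)\<^sup>2 * q y" if x: "x \<in> carrier A" and y: "y \<in> carrier A" for x y
  proof -
    define a where "a = star A x \<otimes> x"
    have a: "a \<in> carrier A" "star A a = a"
      using x by (simp_all add: a_def star_closed star_mult star_star)
    have na: "nrm A a = (nrm A x)\<^sup>2" using x by (simp add: a_def cstar_identity)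
    have "q (x \<otimes> y) = Re (form (a \<otimes> y) y)"
      unfolding q_def a_def using x y by (simp add: m_assoc star_closed form_mult star_star)
    also have "\<dots> \<le> sqrt (q (a \<otimes> y)) * sqrt (q y)"
      using cauchy_schwarz'[of "a \<otimes> y" y] complex_Re_le_cmod[of "form (a \<otimes> y) y"] a y by simp
    also have "\<dots> \<le> sqrt ((nrm A a)\<^sup>2 * q y) * sqrt (q y)"
      using self_adjoint_bound[OF \<psi> a bd y] q_nonneg[OF y] by (intro mult_right_mono) auto
    also have "\<dots> = (nrm A x)\<^sup>2 * q y" using q_nonneg[OF y] nrm_nonneg[OF a(1)] by (simp add: real_sqrt_mult mult.assoc) (simp add: na)
    finally show ?thesis .
  qed
  then show ?thesis
    unfolding pos_functional_def using add smult herm pos by (auto simp: q_def form_def)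
qed

end

text \<open>A functional on \<open>B\<close> pulled back along \<open>f\<close> has bounded left
  multiplications, with constant \<open>nrm B (f x)\<close>. By
  \<open>pos_functionalI_bounded\<close> the constant improves to \<open>nrm A x\<close>, and
  evaluation at the unit gives the claim.\<close>

lemma star_hom_contractive:
  assumes "op_cstar A" "pre_cstar B" and f: "star_hom A B f" and a: "a \<in> carrier A"
  shows "nrm B (f a) \<le> nrm A a"
proof -
  interpret A: op_cstar A by fact
  interpret B: pre_cstar B by fact
  note fD = star_homD[OF f]
  show ?thesis
  proof (rule B.nrm_leI)
    fix \<phi> assume \<phi>: "pos_functional B \<phi>" "Re (\<phi> \<one>\<^bsub>B\<^esub>) \<le> 1"
    interpret \<phi>: pos_functional_form B \<phi> using \<phi>(1) by (rule B.pos_functional_form)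
    interpret \<psi>: pos_functional_form A "\<lambda>x. \<phi> (f x)"
      by unfold_locales (simp_all add: fD \<phi>.add \<phi>.smult \<phi>.herm \<phi>.pos A.star_closed)
    have q: "\<psi>.q x = \<phi>.q (f x)" if "x \<in> carrier A" for x
      using that by (simp add: \<psi>.q_def \<psi>.form_def \<phi>.q_def \<phi>.form_def fD A.star_closed)
    have pf: "pos_functional A (\<lambda>x. \<phi> (f x))"
    proof (rule A.pos_functionalI_bounded[OF \<psi>.pos_functional_form_axioms])
      fix x assume x: "x \<in> carrier A"
      show "\<exists>C. \<forall>y\<in>carrier A. \<psi>.q (x \<otimes>\<^bsub>A\<^esub> y) \<le> C * \<psi>.q y"
        using x B.pos_functional_bound[OF \<phi>(1) fD(1)[OF x] fD(1)]
        by (intro exI[of _ "(nrm B (f x))\<^sup>2"]) (auto simp: q fD)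
    qed
    have "\<psi>.q a \<le> (nrm A a)\<^sup>2"
      by (rule A.q_le_nrm[OF pf _ a]) (use \<phi>(2) fD(4)[OF a] in simp)
    then show "Re (\<phi> (star B (f a) \<otimes>\<^bsub>B\<^esub> f a)) \<le> (nrm A a)\<^sup>2"
      using a by (simp add: q \<phi>.q_def \<phi>.form_def)
  qed (use a A.nrm_nonneg fD in auto)
qed

lemma star_hom_lims:
  assumes "op_cstar A" "pre_cstar B" and f: "star_hom A B f"
    and "\<And>n. X n \<in> carrier A" "x \<in> carrier A" "pre_cstar.lims A X x"
  shows "pre_cstar.lims B (\<lambda>n. f (X n)) (f x)"
proof -
  interpret A: op_cstar A by fact
  interpret B: pre_cstar B by fact
  show ?thesis
  proof (rule B.limsI[OF _ assms(6)[unfolded A.lims_def]])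
    show "nrm B (f (X n) \<ominus>\<^bsub>B\<^esub> f x) \<le> nrm A (X n \<ominus>\<^bsub>A\<^esub> x)" for n
      using star_hom_contractive[OF assms(1-3), of "X n \<ominus>\<^bsub>A\<^esub> x"] assms(4,5)
      by (simp add: star_hom_minus[OF A.star_algebra_axioms B.star_algebra_axioms f])
  qed (use star_homD[OF f] assms in auto)
qed

lemma star_hom_eq_dense:
  assumes "op_cstar A" "op_cstar B" and f: "star_hom A B f" and g: "star_hom A B g"
    and S: "dense_in A S" and eq: "\<And>s. s \<in> S \<Longrightarrow> f s = g s" and x: "x \<in> carrier A"
  shows "f x = g x"
proof -
  interpret A: op_cstar A by fact
  interpret B: op_cstar B by fact
  obtain X where X: "\<And>n. X n \<in> S" "A.lims X x" using A.dense_in_lims[OF S x] by auto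
  have c: "X n \<in> carrier A" for n using S X unfolding dense_in_def by auto
  have "B.lims (\<lambda>n. f (X n)) (f x)" "B.lims (\<lambda>n. f (X n)) (g x)"
    using star_hom_lims[OF assms(1) B.pre_cstar_axioms f c x X(2)]
      star_hom_lims[OF assms(1) B.pre_cstar_axioms g c x X(2)] eq[OF X(1)] by auto
  then show ?thesis
    using B.lims_unique[of "\<lambda>n. f (X n)"] star_homD(1)[OF f] star_homD(1)[OF g] c x by blast
qed

section \<open>Linear spans and the extension of *-homomorphisms\<close>

context star_algebra begin

lemma submoduleI:
  assumes "V \<subseteq> carrier A" "\<zero> \<in> V" "\<And>x y. x \<in> V \<Longrightarrow> y \<in> V \<Longrightarrow> x \<oplus> y \<in> V"
    "\<And>c x. x \<in> V \<Longrightarrow> c \<odot> x \<in> V"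
  shows "submodule V complex_ring A"
proof (rule module.submoduleI[OF is_module])
  fix x assume "x \<in> V"
  then show "\<ominus> x \<in> V" using assms(4)[of x "-1"] assms(1) by (auto simp: smult_minus_one)
qed (use assms in auto)

lemma submoduleD:
  assumes "submodule V complex_ring A"
  shows "V \<subseteq> carrier A" "\<zero> \<in> V" "x \<in> V \<Longrightarrow> y \<in> V \<Longrightarrow> x \<oplus> y \<in> V" "x \<in> V \<Longrightarrow> c \<odot> x \<in> V"
proof -
  show *: "V \<subseteq> carrier A" and "x \<in> V \<Longrightarrow> y \<in> V \<Longrightarrow> x \<oplus> y \<in> V"
    using module.submoduleE(1,5)[OF is_module assms] by auto
  show s: "x \<in> V \<Longrightarrow> c \<odot> x \<in> V" for c x
    using module.submoduleE(4)[OF is_module assms, of c x] by (simp add: complex_ring_def)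
  obtain v where "v \<in> V" using module.submoduleE(2)[OF is_module assms] by auto
  then show "\<zero> \<in> V" using s[of v 0] * smult_zero by auto
qed

lemma linear_span_least: "submodule V complex_ring A \<Longrightarrow> S \<subseteq> V \<Longrightarrow> linear_span A S \<subseteq> V"
  by (auto simp: linear_span_def)

lemma linear_span_superset: "S \<subseteq> linear_span A S"
  by (auto simp: linear_span_def)

lemma carrier_submodule: "submodule (carrier A) complex_ring A"
  by (rule submoduleI) (auto intro: smult_closed)

lemma linear_span_closed: "S \<subseteq> carrier A \<Longrightarrow> linear_span A S \<subseteq> carrier A"
  by (rule linear_span_least[OF carrier_submodule])

lemma linear_span_submodule:
  assumes "S \<subseteq> carrier A" shows "submodule (linear_span A S) complex_ring A"
  using linear_span_closed[OF assms] submoduleD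
  by (intro submoduleI) (auto simp: linear_span_def)

lemma linear_span_mono: "S \<subseteq> T \<Longrightarrow> linear_span A S \<subseteq> linear_span A T"
  by (auto simp: linear_span_def)

end

lemma star_hom_eq_span:
  assumes "op_cstar A" "op_cstar B" and f: "star_hom A B f" and g: "star_hom A B g"
    and S: "S \<subseteq> carrier A" "dense_in A (linear_span A S)" and eq: "\<And>s. s \<in> S \<Longrightarrow> f s = g s"
    and x: "x \<in> carrier A"
  shows "f x = g x"
proof (rule star_hom_eq_dense[OF assms(1-4) S(2) _ x])
  interpret A: op_cstar A by fact
  interpret B: op_cstar B by fact
  have z: "f \<zero>\<^bsub>A\<^esub> = g \<zero>\<^bsub>A\<^esub>"
    using star_homD(5)[OF f A.zero_closed, of 0] star_homD(5)[OF g A.zero_closed, of 0]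
      star_homD(1)[OF f A.zero_closed] star_homD(1)[OF g A.zero_closed]
    by (simp add: A.smult_zero B.smult_zero)
  have "submodule {x \<in> carrier A. f x = g x} complex_ring A"
    by (rule A.submoduleI)
      (auto simp: z star_homD[OF f] star_homD[OF g] A.smult_closed)
  then have "linear_span A S \<subseteq> {x \<in> carrier A. f x = g x}"
    by (rule A.linear_span_least) (use S eq in auto)
  then show "f s = g s" if "s \<in> linear_span A S" for s using that by auto
qed

text \<open>Elements of \<open>B\<close> are limits of sequences \<open>e (X n)\<close>. The
  inequality, applied to differences, makes the corresponding \<open>e' (X n)\<close> Cauchy and
  their limit independent of the sequence, which defines the extension.\<close>

lemma star_hom_extension:
  assumes "star_algebra P" "op_cstar B" "op_cstar C" and e: "star_hom P B e" and e': "star_hom P C e'"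
    and dense: "dense_in B (e ` carrier P)"
    and le: "\<And>x. x \<in> carrier P \<Longrightarrow> nrm C (e' x) \<le> nrm B (e x)"
  shows "\<exists>\<alpha>. star_hom B C \<alpha> \<and> (\<forall>x\<in>carrier P. \<alpha> (e x) = e' x)"
proof -
  interpret P: star_algebra P by fact
  interpret B: op_cstar B by fact
  interpret C: op_cstar C by fact
  note eD = star_homD[OF e] and e'D = star_homD[OF e']
  have seq: "\<exists>X. (\<forall>n. X n \<in> carrier P) \<and> B.lims (\<lambda>n. e (X n)) b" if b: "b \<in> carrier B" for b
  proof -
    obtain Y where Y: "\<forall>n. Y n \<in> e ` carrier P" "B.lims Y b" using B.dense_in_lims[OF dense b] by auto
    from Y(1) obtain X where "\<And>n. X n \<in> carrier P \<and> Y n = e (X n)" unfolding image_iff by metis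
    moreover from this have "Y = (\<lambda>n. e (X n))" by auto
    ultimately show ?thesis using Y(2) by (intro exI[of _ X]) simp
  qed
  have diff: "nrm C (e' x \<ominus>\<^bsub>C\<^esub> e' y) \<le> nrm B (e x \<ominus>\<^bsub>B\<^esub> e y)" if "x \<in> carrier P" "y \<in> carrier P" for x y
    using le[of "x \<ominus>\<^bsub>P\<^esub> y"] that
    by (simp add: star_hom_minus[OF P.star_algebra_axioms B.star_algebra_axioms e]
      star_hom_minus[OF P.star_algebra_axioms C.star_algebra_axioms e'])
  have conv: "\<exists>z\<in>carrier C. C.lims (\<lambda>n. e' (X n)) z"
    if X: "\<And>n. X n \<in> carrier P" "b \<in> carrier B" "B.lims (\<lambda>n. e (X n)) b" for X b
  proof (rule C.cauchy_lims[OF C.cauchy_seqsI])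
    show "e' (X n) \<in> carrier C" for n using X e'D by auto
    fix d :: real assume "0 < d"
    moreover have "(\<lambda>n. e (X n)) \<in> cauchy_seqs B" using X eD by (intro B.lims_cauchy) auto
    ultimately obtain M where "\<And>m n. M \<le> m \<Longrightarrow> M \<le> n \<Longrightarrow> nrm B (e (X m) \<ominus>\<^bsub>B\<^esub> e (X n)) < d"
      using B.cauchy_seqsE by metis
    then show "\<exists>M. \<forall>m\<ge>M. \<forall>n\<ge>M. nrm C (e' (X m) \<ominus>\<^bsub>C\<^esub> e' (X n)) < d"
      using diff[OF X(1) X(1)] le_less_trans by blast
  qed
  \<comment> \<open>The choice fixes one approximating sequence for each \<open>b\<close>;
    \<open>lim\<close> below shows that every other sequence gives the same value.\<close>
  define \<alpha> where "\<alpha> b = (SOME z. z \<in> carrier C \<and>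
    (\<exists>X. (\<forall>n. X n \<in> carrier P) \<and> B.lims (\<lambda>n. e (X n)) b \<and> C.lims (\<lambda>n. e' (X n)) z))" for b
  have \<alpha>: "\<alpha> b \<in> carrier C"
      "\<exists>X. (\<forall>n. X n \<in> carrier P) \<and> B.lims (\<lambda>n. e (X n)) b \<and> C.lims (\<lambda>n. e' (X n)) (\<alpha> b)"
    if b: "b \<in> carrier B" for b
  proof -
    have "\<exists>z. z \<in> carrier C \<and>
        (\<exists>X. (\<forall>n. X n \<in> carrier P) \<and> B.lims (\<lambda>n. e (X n)) b \<and> C.lims (\<lambda>n. e' (X n)) z)"
      using seq[OF b] conv[OF _ b] by metis
    from someI_ex[OF this, folded \<alpha>_def] show "\<alpha> b \<in> carrier C"
      "\<exists>X. (\<forall>n. X n \<in> carrier P) \<and> B.lims (\<lambda>n. e (X n)) b \<and> C.lims (\<lambda>n. e' (X n)) (\<alpha> b)" by auto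
  qed
  have lim: "C.lims (\<lambda>n. e' (X n)) (\<alpha> b)"
    if X: "\<And>n. X n \<in> carrier P" "b \<in> carrier B" "B.lims (\<lambda>n. e (X n)) b" for X b
  proof -
    obtain Y where Y: "\<And>n. Y n \<in> carrier P" "B.lims (\<lambda>n. e (Y n)) b" "C.lims (\<lambda>n. e' (Y n)) (\<alpha> b)"
      using \<alpha>(2)[OF X(2)] by auto
    note c = eD(1)[OF X(1)] eD(1)[OF Y(1)] e'D(1)[OF X(1)] e'D(1)[OF Y(1)] \<alpha>(1)[OF X(2)] X(2)
    show ?thesis
    proof (rule C.limsI)
      fix n
      have "nrm C (e' (X n) \<ominus>\<^bsub>C\<^esub> \<alpha> b) \<le> nrm C (e' (X n) \<ominus>\<^bsub>C\<^esub> e' (Y n)) + nrm C (e' (Y n) \<ominus>\<^bsub>C\<^esub> \<alpha> b)"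
        using c by (intro C.nrm_triangle_minus)
      also have "\<dots> \<le> nrm B (e (X n) \<ominus>\<^bsub>B\<^esub> e (Y n)) + nrm C (e' (Y n) \<ominus>\<^bsub>C\<^esub> \<alpha> b)"
        using diff[OF X(1) Y(1)] by simp
      also have "\<dots> \<le> nrm B (e (X n) \<ominus>\<^bsub>B\<^esub> b) + nrm B (e (Y n) \<ominus>\<^bsub>B\<^esub> b) + nrm C (e' (Y n) \<ominus>\<^bsub>C\<^esub> \<alpha> b)"
        using B.nrm_triangle_minus[OF c(1)[of n] X(2) c(2)[of n]] B.nrm_minus_commute[OF X(2) c(2)[of n]] by simp
      finally show "nrm C (e' (X n) \<ominus>\<^bsub>C\<^esub> \<alpha> b) \<le> \<dots>" .
    next
      show "(\<lambda>n. nrm B (e (X n) \<ominus>\<^bsub>B\<^esub> b) + nrm B (e (Y n) \<ominus>\<^bsub>B\<^esub> b) + nrm C (e' (Y n) \<ominus>\<^bsub>C\<^esub> \<alpha> b)) \<longlonglongrightarrow> 0"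
        using X(3) Y(2,3) unfolding B.lims_def C.lims_def by (intro tendsto_add_zero)
    qed (use c in auto)
  qed
  have \<alpha>e: "\<alpha> (e x) = e' x" if "x \<in> carrier P" for x
    using lim[of "\<lambda>_. x" "e x"] that eD e'D \<alpha>(1)
    by (intro C.lims_unique[of "\<lambda>_. e' x"]) (auto intro: B.lims_const C.lims_const)
  have "star_hom B C \<alpha>"
    unfolding star_hom_def
  proof (intro conjI ballI allI ring_hom_memI)
    show "\<alpha> \<one>\<^bsub>B\<^esub> = \<one>\<^bsub>C\<^esub>"
      using \<alpha>e[OF P.one_closed] eD(4)[OF P.one_closed] e'D(4)[OF P.one_closed] by simp
  next
    fix x y assume x: "x \<in> carrier B" and y: "y \<in> carrier B"
    obtain X Y where X: "\<And>n. X n \<in> carrier P" "B.lims (\<lambda>n. e (X n)) x"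
      and Y: "\<And>n. Y n \<in> carrier P" "B.lims (\<lambda>n. e (Y n)) y" using seq x y by metis
    note c = eD[OF X(1)] eD[OF Y(1)] e'D[OF X(1)] e'D[OF Y(1)] X(1) Y(1) x y \<alpha>(1)
    have "C.lims (\<lambda>n. e' (X n \<oplus>\<^bsub>P\<^esub> Y n)) (\<alpha> (x \<oplus>\<^bsub>B\<^esub> y))"
      using B.lims_add[OF c(1) eD(1)[OF Y(1)] x y X(2) Y(2)] c by (intro lim) auto
    moreover have "C.lims (\<lambda>n. e' (X n \<oplus>\<^bsub>P\<^esub> Y n)) (\<alpha> x \<oplus>\<^bsub>C\<^esub> \<alpha> y)"
      using C.lims_add[OF _ _ _ _ lim[OF X(1) x X(2)] lim[OF Y(1) y Y(2)]] c by simp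
    ultimately show "\<alpha> (x \<oplus>\<^bsub>B\<^esub> y) = \<alpha> x \<oplus>\<^bsub>C\<^esub> \<alpha> y"
      using c by (intro C.lims_unique[of "\<lambda>n. e' (X n \<oplus>\<^bsub>P\<^esub> Y n)"]) auto
    have "C.lims (\<lambda>n. e' (X n \<otimes>\<^bsub>P\<^esub> Y n)) (\<alpha> (x \<otimes>\<^bsub>B\<^esub> y))"
      using B.lims_mult[OF c(1) eD(1)[OF Y(1)] x y X(2) Y(2)] c by (intro lim) auto
    moreover have "C.lims (\<lambda>n. e' (X n \<otimes>\<^bsub>P\<^esub> Y n)) (\<alpha> x \<otimes>\<^bsub>C\<^esub> \<alpha> y)"
      using C.lims_mult[OF _ _ _ _ lim[OF X(1) x X(2)] lim[OF Y(1) y Y(2)]] c by simp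
    ultimately show "\<alpha> (x \<otimes>\<^bsub>B\<^esub> y) = \<alpha> x \<otimes>\<^bsub>C\<^esub> \<alpha> y"
      using c by (intro C.lims_unique[of "\<lambda>n. e' (X n \<otimes>\<^bsub>P\<^esub> Y n)"]) auto
  next
    fix x assume x: "x \<in> carrier B"
    then show "\<alpha> x \<in> carrier C" by (rule \<alpha>(1))
    obtain X where X: "\<And>n. X n \<in> carrier P" "B.lims (\<lambda>n. e (X n)) x" using seq x by metis
    note c = eD[OF X(1)] e'D[OF X(1)] X(1) x \<alpha>(1)
    show "\<alpha> (k \<odot>\<^bsub>B\<^esub> x) = k \<odot>\<^bsub>C\<^esub> \<alpha> x" for k
    proof (rule C.lims_unique[of "\<lambda>n. e' (k \<odot>\<^bsub>P\<^esub> X n)"])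
      show "C.lims (\<lambda>n. e' (k \<odot>\<^bsub>P\<^esub> X n)) (\<alpha> (k \<odot>\<^bsub>B\<^esub> x))"
        using B.lims_smult[OF c(1) x X(2), of k] c by (intro lim) (auto intro: P.smult_closed B.smult_closed)
      show "C.lims (\<lambda>n. e' (k \<odot>\<^bsub>P\<^esub> X n)) (k \<odot>\<^bsub>C\<^esub> \<alpha> x)"
        using C.lims_smult[OF _ _ lim[OF X(1) x X(2)], of k] c by simp
    qed (simp_all add: x \<alpha>(1) B.smult_closed C.smult_closed e'D(1)[OF P.smult_closed[OF X(1)]])
    show "\<alpha> (star B x) = star C (\<alpha> x)"
    proof (rule C.lims_unique[of "\<lambda>n. e' (star P (X n))"])
      show "C.lims (\<lambda>n. e' (star P (X n))) (\<alpha> (star B x))"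
        using B.lims_star[OF c(1) x X(2)] c by (intro lim) (auto intro: P.star_closed B.star_closed)
      show "C.lims (\<lambda>n. e' (star P (X n))) (star C (\<alpha> x))"
        using C.lims_star[OF _ _ lim[OF X(1) x X(2)]] c by simp
    qed (simp_all add: x \<alpha>(1) B.star_closed C.star_closed e'D(1)[OF P.star_closed[OF X(1)]])
  qed
  then show ?thesis using \<alpha>e by blast
qed

lemma star_iso_extension:
  assumes "star_algebra P" "op_cstar B" "op_cstar C" and e: "star_hom P B e" and e': "star_hom P C e'"
    and dense: "dense_in B (e ` carrier P)" "dense_in C (e' ` carrier P)"
    and eq: "\<And>x. x \<in> carrier P \<Longrightarrow> nrm C (e' x) = nrm B (e x)"
  shows "\<exists>\<alpha>. star_iso B C \<alpha> \<and> (\<forall>x\<in>carrier P. \<alpha> (e x) = e' x)"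
proof -
  have "\<exists>\<alpha>. star_hom B C \<alpha> \<and> (\<forall>x\<in>carrier P. \<alpha> (e x) = e' x)"
    by (rule star_hom_extension[OF assms(1-3) e e' dense(1)]) (simp add: eq)
  then obtain \<alpha> where \<alpha>: "star_hom B C \<alpha>" "\<And>x. x \<in> carrier P \<Longrightarrow> \<alpha> (e x) = e' x" by blast
  have "\<exists>\<beta>. star_hom C B \<beta> \<and> (\<forall>x\<in>carrier P. \<beta> (e' x) = e x)"
    by (rule star_hom_extension[OF assms(1,3,2) e' e dense(2)]) (simp add: eq)
  then obtain \<beta> where \<beta>: "star_hom C B \<beta>" "\<And>x. x \<in> carrier P \<Longrightarrow> \<beta> (e' x) = e x" by blast
  have "\<beta> (\<alpha> x) = x" if "x \<in> carrier B" for x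
    by (rule star_hom_eq_dense[OF assms(2,2) star_hom_compose[OF \<alpha>(1) \<beta>(1)] star_hom_ident dense(1) _ that]) (auto simp: \<alpha> \<beta>)
  moreover have "\<alpha> (\<beta> x) = x" if "x \<in> carrier C" for x
    by (rule star_hom_eq_dense[OF assms(3,3) star_hom_compose[OF \<beta>(1) \<alpha>(1)] star_hom_ident dense(2) _ that]) (auto simp: \<alpha> \<beta>)
  ultimately have "bij_betw \<alpha> (carrier B) (carrier C)"
    using star_homD(1)[OF \<alpha>(1)] star_homD(1)[OF \<beta>(1)] by (intro bij_betwI[of _ _ _ \<beta>]) auto
  then show ?thesis using \<alpha> by (auto simp: star_iso_def)
qed


section \<open>Seminorms given by representations\<close>

text \<open>Allows \<open>lincomb\<close> with scalar values; these test functionals separate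
  finitely supported functions, see \<open>fin_supp_on_eqI\<close>.\<close>

instantiation complex :: complex_hilbert
begin
definition scaleC_complex :: "complex \<Rightarrow> complex \<Rightarrow> complex" where "scaleC_complex a x = a * x"
definition cinner_complex :: "complex \<Rightarrow> complex \<Rightarrow> complex" where "cinner_complex x y = x * cnj y"
instance
  by standard (auto simp: scaleC_complex_def cinner_complex_def algebra_simps scaleR_conv_of_real inner_complex_def)
end

lemma lincomb_eval: "x \<in> fin_supp_on S \<Longrightarrow> lincomb (\<lambda>s. if s = t then 1 else 0 :: complex) x = x t"
  by (subst lincomb_superset[of "insert t {s. x s \<noteq> 0}"])
    (auto simp: fin_supp_on_def scaleC_complex_def sum.remove[of _ t])

text \<open>Indicator functions recover the values. With this criterion an identity in a monoid
  algebra is checked by evaluating both sides on an arbitrary \<open>c\<close>, where convolution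
  and pushforward turn into nested linear combinations.\<close>

lemma fin_supp_on_eqI:
  assumes "x \<in> fin_supp_on S" "y \<in> fin_supp_on S'" "\<And>c :: _ \<Rightarrow> complex. lincomb c x = lincomb c y"
  shows "x = y"
  using lincomb_eval[OF assms(1)] lincomb_eval[OF assms(2)] assms(3) by (metis ext)

lemma lincomb_swap:
  "lincomb (\<lambda>s. lincomb (\<lambda>r. f s r) y) x = lincomb (\<lambda>r. lincomb (\<lambda>s. f s r) x) y"
  unfolding lincomb_def scaleC.sum_right scaleC_scaleC
  by (subst sum.swap) (simp add: mult.commute)

text \<open>Pushforward of a finitely supported measure. Convolution, involution, slice maps and the
  maps between monoid algebras below are built from it.\<close>

definition push :: "('a \<Rightarrow> 'b) \<Rightarrow> ('a \<Rightarrow> complex) \<Rightarrow> 'b \<Rightarrow> complex" where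
  "push f x = (\<lambda>t. \<Sum>s | x s \<noteq> 0 \<and> f s = t. x s)"

lemma push_fin_supp:
  assumes "x \<in> fin_supp_on S" "\<And>s. s \<in> S \<Longrightarrow> f s \<in> S'" shows "push f x \<in> fin_supp_on S'"
proof -
  have "{t. push f x t \<noteq> 0} \<subseteq> f ` {s. x s \<noteq> 0}"
    by (auto simp: push_def elim!: sum.not_neutral_contains_not_neutral)
  then show ?thesis using assms by (auto simp: fin_supp_on_def intro: finite_subset)
qed

lemma lincomb_push:
  assumes "x \<in> fin_supp_on S" shows "lincomb v (push f x) = lincomb (\<lambda>s. v (f s)) x"
proof -
  let ?F = "{s. x s \<noteq> 0}"
  have F: "finite ?F" using assms by (auto simp: fin_supp_on_def)
  have sub: "{t. push f x t \<noteq> 0} \<subseteq> f ` ?F"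
    by (auto simp: push_def elim!: sum.not_neutral_contains_not_neutral)
  have "lincomb v (push f x) = (\<Sum>t\<in>f ` ?F. scaleC (push f x t) (v t))"
    using F sub by (intro lincomb_superset) auto
  also have "\<dots> = (\<Sum>t\<in>f ` ?F. \<Sum>s | s \<in> ?F \<and> f s = t. scaleC (x s) (v (f s)))"
    by (intro sum.cong) (auto simp: push_def scaleC.sum_left)
  also have "\<dots> = lincomb (\<lambda>s. v (f s)) x"
    unfolding lincomb_def using F by (intro sum.group) auto
  finally show ?thesis .
qed

lemma convolve_eq_push:
  "convolve g x y = push (\<lambda>(s, r). g s r) (\<lambda>(s, r). x s * y r)"
  unfolding convolve_def push_def by (intro ext sum.cong) auto

lemma fin_supp_on_prod:
  assumes "x \<in> fin_supp_on S" "y \<in> fin_supp_on R"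
  shows "(\<lambda>(s, r). x s * y r) \<in> fin_supp_on (S \<times> R)"
proof -
  have "{p. (case p of (s, r) \<Rightarrow> x s * y r) \<noteq> 0} = {s. x s \<noteq> 0} \<times> {r. y r \<noteq> 0}" by auto
  then show ?thesis using assms by (auto simp: fin_supp_on_def)
qed

lemma convolve_fin_supp:
  assumes "x \<in> fin_supp_on S" "y \<in> fin_supp_on R" "\<And>s r. s \<in> S \<Longrightarrow> r \<in> R \<Longrightarrow> g s r \<in> T"
  shows "convolve g x y \<in> fin_supp_on T"
  unfolding convolve_eq_push by (rule push_fin_supp[OF fin_supp_on_prod[OF assms(1,2)]]) (use assms in auto)

lemma lincomb_prod:
  assumes "x \<in> fin_supp_on S" "y \<in> fin_supp_on R"
  shows "lincomb v (\<lambda>(s, r). x s * y r) = lincomb (\<lambda>s. lincomb (\<lambda>r. v (s, r)) y) x"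
proof -
  have F: "finite {s. x s \<noteq> 0}" "finite {r. y r \<noteq> 0}" using assms by (auto simp: fin_supp_on_def)
  have "lincomb v (\<lambda>(s, r). x s * y r)
      = (\<Sum>p\<in>{s. x s \<noteq> 0} \<times> {r. y r \<noteq> 0}. scaleC (case p of (s, r) \<Rightarrow> x s * y r) (v p))"
    using F by (intro lincomb_superset) auto
  also have "\<dots> = lincomb (\<lambda>s. lincomb (\<lambda>r. v (s, r)) y) x"
    unfolding lincomb_def scaleC.sum_right scaleC_scaleC sum.cartesian_product by (intro sum.cong) auto
  finally show ?thesis .
qed

text \<open>Fubini for formal sums; the rule by which \<open>convolve\<close> is eliminated from the
  identities below.\<close>

lemma lincomb_convolve:
  assumes "x \<in> fin_supp_on S" "y \<in> fin_supp_on R"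
  shows "lincomb v (convolve g x y) = lincomb (\<lambda>s. lincomb (\<lambda>r. v (g s r)) y) x"
  unfolding convolve_eq_push lincomb_push[OF fin_supp_on_prod[OF assms]]
  by (subst lincomb_prod[OF assms]) simp

lemma fin_supp_on_cnj: "x \<in> fin_supp_on S \<Longrightarrow> (\<lambda>s. cnj (x s)) \<in> fin_supp_on S"
  by (simp add: fin_supp_on_def)

lemma lincomb_cnj: "lincomb (v :: _ \<Rightarrow> complex) (\<lambda>s. cnj (x s)) = cnj (lincomb (\<lambda>s. cnj (v s)) x)"
  by (simp add: lincomb_def scaleC_complex_def)

lemma star_eq_push: "(\<lambda>t. \<Sum>s | x s \<noteq> 0 \<and> j s = t. cnj (x s)) = push j (\<lambda>s. cnj (x s))"
  by (simp add: push_def)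

text \<open>Covers groups with inversion, the multiplicative monoid of a *-algebra with its adjoint,
  and direct products of these. Group rings and formal tensor products thereby become the same
  construction.\<close>

locale star_monoid = monoid M for M :: "('a, 'm) monoid_scheme" (structure) +
  fixes j :: "'a \<Rightarrow> 'a"
  assumes j_closed: "x \<in> carrier M \<Longrightarrow> j x \<in> carrier M"
    and j_mult: "x \<in> carrier M \<Longrightarrow> y \<in> carrier M \<Longrightarrow> j (x \<otimes> y) = j y \<otimes> j x"
    and j_j: "x \<in> carrier M \<Longrightarrow> j (j x) = x"

lemma monoid_star_algebra_sel:
  "carrier (monoid_star_algebra M j N) = fin_supp_on (carrier M)"
  "mult (monoid_star_algebra M j N) = convolve (mult M)"
  "one (monoid_star_algebra M j N) = delta \<one>\<^bsub>M\<^esub>"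
  "zero (monoid_star_algebra M j N) = (\<lambda>_. 0)"
  "add (monoid_star_algebra M j N) = (\<lambda>x y t. x t + y t)"
  "smult (monoid_star_algebra M j N) = (\<lambda>c x t. c * x t)"
  "star (monoid_star_algebra M j N) = (\<lambda>x. push j (\<lambda>s. cnj (x s)))"
  "nrm (monoid_star_algebra M j N) = N"
  by (simp_all add: monoid_star_algebra_def star_eq_push)

context star_monoid begin

abbreviation fs :: "('a \<Rightarrow> complex) set" where "fs \<equiv> fin_supp_on (carrier M)"

lemma convolve_closed: "x \<in> fs \<Longrightarrow> y \<in> fs \<Longrightarrow> convolve (mult M) x y \<in> fs"
  by (rule convolve_fin_supp) auto

lemma star_closed: "x \<in> fs \<Longrightarrow> push j (\<lambda>s. cnj (x s)) \<in> fs"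
  by (rule push_fin_supp[OF fin_supp_on_cnj]) (auto intro: j_closed)

lemma convolve_assoc:
  assumes "x \<in> fs" "y \<in> fs" "z \<in> fs"
  shows "convolve (mult M) (convolve (mult M) x y) z = convolve (mult M) x (convolve (mult M) y z)"
proof (rule fin_supp_on_eqI)
  fix c :: "'a \<Rightarrow> complex"
  show "lincomb c (convolve (mult M) (convolve (mult M) x y) z) = lincomb c (convolve (mult M) x (convolve (mult M) y z))"
    unfolding lincomb_convolve[OF convolve_closed[OF assms(1,2)] assms(3)] lincomb_convolve[OF assms(1,2)]
      lincomb_convolve[OF assms(1) convolve_closed[OF assms(2,3)]] lincomb_convolve[OF assms(2,3)]
    by (intro lincomb_cong[OF assms(1)] lincomb_cong[OF assms(2)] lincomb_cong[OF assms(3)]) (simp add: m_assoc)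
qed (rule convolve_closed assms)+

lemma star_algebra_ring: "Ring.ring (monoid_star_algebra M j N)" (is "Ring.ring ?P")
proof (rule ringI)
  show "abelian_group ?P"
  proof (rule abelian_groupI, unfold monoid_star_algebra_sel)
    fix x assume "x \<in> fs"
    then show "\<exists>y\<in>fs. (\<lambda>t. y t + x t) = (\<lambda>_. 0)"
      by (intro bexI[of _ "\<lambda>t. (-1) * x t"] fin_supp_on_scale) auto
  qed (auto intro: fin_supp_on_add fin_supp_on_zero)
  show "monoid ?P"
  proof (rule monoidI, unfold monoid_star_algebra_sel)
    fix x assume x: "x \<in> fs"
    have d: "delta \<one> \<in> fs" by (rule fin_supp_on_delta) simp
    show "convolve (mult M) (delta \<one>) x = x"
      by (rule fin_supp_on_eqI[OF convolve_closed[OF d x] x], unfold lincomb_convolve[OF d x] lincomb_delta)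
        (intro lincomb_cong[OF x], simp)
    show "convolve (mult M) x (delta \<one>) = x"
      by (rule fin_supp_on_eqI[OF convolve_closed[OF x d] x], unfold lincomb_convolve[OF x d] lincomb_delta)
        (intro lincomb_cong[OF x], simp)
  qed (auto intro: convolve_closed convolve_assoc fin_supp_on_delta)
next
  fix x y z assume "x \<in> carrier ?P" "y \<in> carrier ?P" "z \<in> carrier ?P"
  then have x: "x \<in> fs" and y: "y \<in> fs" and z: "z \<in> fs" by (simp_all add: monoid_star_algebra_sel)
  note cl = convolve_closed fin_supp_on_add
  show "(x \<oplus>\<^bsub>?P\<^esub> y) \<otimes>\<^bsub>?P\<^esub> z = x \<otimes>\<^bsub>?P\<^esub> z \<oplus>\<^bsub>?P\<^esub> y \<otimes>\<^bsub>?P\<^esub> z"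
    unfolding monoid_star_algebra_sel
    by (rule fin_supp_on_eqI[where S = "carrier M" and S' = "carrier M"])
      (intro cl x y z, intro cl x y z, simp add: lincomb_convolve[OF fin_supp_on_add[OF x y] z]
        lincomb_add[OF convolve_closed[OF x z] convolve_closed[OF y z]] lincomb_convolve[OF x z]
        lincomb_convolve[OF y z] lincomb_add[OF x y])
  show "z \<otimes>\<^bsub>?P\<^esub> (x \<oplus>\<^bsub>?P\<^esub> y) = z \<otimes>\<^bsub>?P\<^esub> x \<oplus>\<^bsub>?P\<^esub> z \<otimes>\<^bsub>?P\<^esub> y"
    unfolding monoid_star_algebra_sel
    by (rule fin_supp_on_eqI[where S = "carrier M" and S' = "carrier M"])
      (intro cl x y z, intro cl x y z, simp add: lincomb_convolve[OF z fin_supp_on_add[OF x y]]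
        lincomb_add[OF convolve_closed[OF z x] convolve_closed[OF z y]] lincomb_convolve[OF z x]
        lincomb_convolve[OF z y] lincomb_add[OF x y] lincomb_sum_op[OF z])
qed

lemma star_algebra_monoid_star_algebra: "star_algebra (monoid_star_algebra M j N)" (is "star_algebra ?P")
proof (rule star_algebra.intro)
  show R: "Ring.ring ?P" by (rule star_algebra_ring)
  show "module complex_ring ?P"
  proof (rule moduleI)
    show "cring complex_ring"
    proof (rule cringI)
      show "abelian_group complex_ring"
        by (rule abelian_groupI) (auto simp: complex_ring_def intro!: exI[of _ "- _"])
      show "Group.comm_monoid complex_ring"
        by (rule comm_monoidI) (auto simp: complex_ring_def)
    qed (auto simp: complex_ring_def ring_distribs)
    show "abelian_group ?P" by (rule ring.is_abelian_group[OF R])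
  qed (auto simp: monoid_star_algebra_sel complex_ring_def ring_distribs mult.assoc intro: fin_supp_on_scale)
next
  fix x assume "x \<in> carrier ?P"
  then have x: "x \<in> fs" by (simp add: monoid_star_algebra_sel)
  note xs = star_closed[OF x]
  show "star ?P x \<in> carrier ?P" using xs by (simp add: monoid_star_algebra_sel)
  show "star ?P (star ?P x) = x"
    unfolding monoid_star_algebra_sel
  proof (rule fin_supp_on_eqI[OF star_closed[OF xs] x])
    fix c :: "'a \<Rightarrow> complex"
    show "lincomb c (push j (\<lambda>s. cnj (push j (\<lambda>s. cnj (x s)) s))) = lincomb c x"
      unfolding lincomb_push[OF fin_supp_on_cnj[OF xs]] lincomb_cnj lincomb_push[OF fin_supp_on_cnj[OF x]]
      by (simp add: j_j cong: lincomb_cong[OF x])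
  qed
  fix c
  show "star ?P (c \<odot>\<^bsub>?P\<^esub> x) = cnj c \<odot>\<^bsub>?P\<^esub> star ?P x"
    unfolding monoid_star_algebra_sel
  proof (rule fin_supp_on_eqI[OF star_closed[OF fin_supp_on_scale[OF x]] fin_supp_on_scale[OF xs]])
    fix d :: "'a \<Rightarrow> complex"
    show "lincomb d (push j (\<lambda>s. cnj (c * x s))) = lincomb d (\<lambda>t. cnj c * push j (\<lambda>s. cnj (x s)) t)"
      unfolding lincomb_push[OF fin_supp_on_cnj[OF fin_supp_on_scale[OF x]]] lincomb_cnj
        lincomb_scale[OF xs] lincomb_push[OF fin_supp_on_cnj[OF x]] lincomb_scale[OF x]
      by (simp add: scaleC_complex_def)
  qed
  fix y assume "y \<in> carrier ?P"
  then have y: "y \<in> fs" by (simp add: monoid_star_algebra_sel)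
  note ys = star_closed[OF y]
  note xy = convolve_closed[OF x y]
  show "star ?P (x \<oplus>\<^bsub>?P\<^esub> y) = star ?P x \<oplus>\<^bsub>?P\<^esub> star ?P y"
    unfolding monoid_star_algebra_sel
  proof (rule fin_supp_on_eqI[OF star_closed[OF fin_supp_on_add[OF x y]] fin_supp_on_add[OF xs ys]])
    fix d :: "'a \<Rightarrow> complex"
    show "lincomb d (push j (\<lambda>s. cnj (x s + y s)))
        = lincomb d (\<lambda>t. push j (\<lambda>s. cnj (x s)) t + push j (\<lambda>s. cnj (y s)) t)"
      unfolding lincomb_push[OF fin_supp_on_cnj[OF fin_supp_on_add[OF x y]]] lincomb_cnj
        lincomb_add[OF xs ys] lincomb_push[OF fin_supp_on_cnj[OF x]] lincomb_push[OF fin_supp_on_cnj[OF y]]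
        lincomb_add[OF x y] by simp
  qed
  show "star ?P (x \<otimes>\<^bsub>?P\<^esub> y) = star ?P y \<otimes>\<^bsub>?P\<^esub> star ?P x"
    unfolding monoid_star_algebra_sel
  proof (rule fin_supp_on_eqI[OF star_closed[OF xy] convolve_closed[OF ys xs]])
    fix d :: "'a \<Rightarrow> complex"
    have "lincomb d (push j (\<lambda>s. cnj (convolve (\<otimes>) x y s)))
        = cnj (lincomb (\<lambda>s. lincomb (\<lambda>r. cnj (d (j (s \<otimes> r)))) y) x)"
      unfolding lincomb_push[OF fin_supp_on_cnj[OF xy]] lincomb_cnj lincomb_convolve[OF x y] ..
    also have "\<dots> = cnj (lincomb (\<lambda>s. lincomb (\<lambda>r. cnj (d (j r \<otimes> j s))) y) x)"
      by (intro arg_cong[of _ _ cnj] lincomb_cong[OF x] lincomb_cong[OF y]) (simp add: j_mult)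
    also have "\<dots> = lincomb (\<lambda>r. lincomb (\<lambda>s. d (r \<otimes> s)) (push j (\<lambda>s. cnj (x s)))) (push j (\<lambda>s. cnj (y s)))"
      unfolding lincomb_push[OF fin_supp_on_cnj[OF x]] lincomb_push[OF fin_supp_on_cnj[OF y]] lincomb_cnj
      by (subst lincomb_swap) simp
    also have "\<dots> = lincomb d (convolve (\<otimes>) (push j (\<lambda>s. cnj (y s))) (push j (\<lambda>s. cnj (x s))))"
      unfolding lincomb_convolve[OF ys xs] ..
    finally show "lincomb d (push j (\<lambda>s. cnj (convolve (\<otimes>) x y s)))
      = lincomb d (convolve (\<otimes>) (push j (\<lambda>s. cnj (y s))) (push j (\<lambda>s. cnj (x s))))" .
  qed
  have e1: "convolve (\<otimes>) (\<lambda>t. c * x t) y = (\<lambda>t. c * convolve (\<otimes>) x y t)"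
    by (rule fin_supp_on_eqI[OF convolve_closed[OF fin_supp_on_scale[OF x] y] fin_supp_on_scale[OF xy]])
      (simp add: lincomb_convolve[OF fin_supp_on_scale[OF x] y] lincomb_convolve[OF x y] lincomb_scale[OF xy]
        lincomb_scale[OF x])
  have e2: "convolve (\<otimes>) x (\<lambda>t. c * y t) = (\<lambda>t. c * convolve (\<otimes>) x y t)"
    by (rule fin_supp_on_eqI[OF convolve_closed[OF x fin_supp_on_scale[OF y]] fin_supp_on_scale[OF xy]])
      (simp add: lincomb_convolve[OF x fin_supp_on_scale[OF y]] lincomb_convolve[OF x y] lincomb_scale[OF xy]
        lincomb_scale[OF y] lincomb_sum_op[OF x])
  show "(c \<odot>\<^bsub>?P\<^esub> x) \<otimes>\<^bsub>?P\<^esub> y = c \<odot>\<^bsub>?P\<^esub> (x \<otimes>\<^bsub>?P\<^esub> y) \<and> x \<otimes>\<^bsub>?P\<^esub> (c \<odot>\<^bsub>?P\<^esub> y) = c \<odot>\<^bsub>?P\<^esub> (x \<otimes>\<^bsub>?P\<^esub> y)"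
    unfolding monoid_star_algebra_sel e1 e2 by simp
qed

end

text \<open>A *-representation of the monoid by bounded operators, on a space that need not be
  closed. Even when the monoid is that of an algebra, only multiplication and adjoint are recorded;
  linear combinations act through \<open>group_algebra_op\<close>.\<close>

definition star_act ::
  "('a, 'm) monoid_scheme \<Rightarrow> ('a \<Rightarrow> 'a) \<Rightarrow> 'h::complex_hilbert set \<Rightarrow> ('a \<Rightarrow> 'h \<Rightarrow> 'h) \<Rightarrow> bool" where
  "star_act M j V W \<longleftrightarrow> csubspace V \<and> (\<forall>m\<in>carrier M. bounded_op_on V (W m))
     \<and> (\<forall>u\<in>V. W \<one>\<^bsub>M\<^esub> u = u)
     \<and> (\<forall>m\<in>carrier M. \<forall>n\<in>carrier M. \<forall>u\<in>V. W (m \<otimes>\<^bsub>M\<^esub> n) u = W m (W n u))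
     \<and> (\<forall>m\<in>carrier M. \<forall>u\<in>V. \<forall>v\<in>V. cinner (W m u) v = cinner u (W (j m) v))"

lemma star_actD:
  assumes "star_act M j V W"
  shows "csubspace V" "m \<in> carrier M \<Longrightarrow> bounded_op_on V (W m)" "m \<in> carrier M \<Longrightarrow> linear_op_on V (W m)"
    "m \<in> carrier M \<Longrightarrow> u \<in> V \<Longrightarrow> W m u \<in> V" "u \<in> V \<Longrightarrow> W \<one>\<^bsub>M\<^esub> u = u"
    "m \<in> carrier M \<Longrightarrow> n \<in> carrier M \<Longrightarrow> u \<in> V \<Longrightarrow> W (m \<otimes>\<^bsub>M\<^esub> n) u = W m (W n u)"
    "m \<in> carrier M \<Longrightarrow> u \<in> V \<Longrightarrow> v \<in> V \<Longrightarrow> cinner (W m u) v = cinner u (W (j m) v)"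
  using assms by (auto simp: star_act_def bounded_op_on_def linear_op_on_def)

lemma bounded_op_onE:
  assumes "bounded_op_on V T"
  obtains B where "0 \<le> B" "\<And>x. x \<in> V \<Longrightarrow> norm (T x) \<le> B * norm x"
proof -
  obtain B where B: "\<And>x. x \<in> V \<Longrightarrow> norm (T x) \<le> B * norm x" using assms by (auto simp: bounded_op_on_def)
  show thesis
  proof (rule that[of "\<bar>B\<bar>"])
    show "norm (T x) \<le> \<bar>B\<bar> * norm x" if "x \<in> V" for x
      using B[OF that] mult_right_mono[OF abs_ge_self[of B] norm_ge_zero[of x]] by simp
  qed simp
qed

lemma bounded_op_on_group_algebra_op:
  assumes "csubspace V" "\<And>s. s \<in> S \<Longrightarrow> bounded_op_on V (W s)" "x \<in> fin_supp_on S"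
  shows "bounded_op_on V (group_algebra_op W x)"
proof -
  have lin: "linear_op_on V (W s)" if "s \<in> S" for s using assms(2)[OF that] by (simp add: bounded_op_on_def)
  have "\<exists>B. \<forall>s\<in>S. \<forall>u\<in>V. norm (W s u) \<le> B s * norm u"
    using assms(2) unfolding bounded_op_on_def by metis
  then obtain B where B: "\<And>s u. s \<in> S \<Longrightarrow> u \<in> V \<Longrightarrow> norm (W s u) \<le> B s * norm u" by blast
  have "norm (group_algebra_op W x u) \<le> (\<Sum>s | x s \<noteq> 0. cmod (x s) * B s) * norm u" if u: "u \<in> V" for u
    unfolding group_algebra_op_lincomb
    using norm_lincomb_le[OF B[OF _ u] assms(3)] by (simp add: sum_distrib_right mult.assoc)
  moreover have "linear_op_on V (group_algebra_op W x)"
    unfolding linear_op_on_def group_algebra_op_lincomb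
  proof (intro conjI ballI allI)
    fix u assume u: "u \<in> V"
    show "lincomb (\<lambda>s. W s u) x \<in> V"
      by (rule lincomb_in[OF assms(1,3)]) (rule linear_op_onD(1)[OF lin u])
    show "lincomb (\<lambda>s. W s (scaleC a u)) x = scaleC a (lincomb (\<lambda>s. W s u) x)" for a
      unfolding lincomb_sum_op[OF assms(3), symmetric]
      by (intro lincomb_cong[OF assms(3)] linear_op_onD(3)[OF lin u])
    fix v assume v: "v \<in> V"
    show "lincomb (\<lambda>s. W s (u + v)) x = lincomb (\<lambda>s. W s u) x + lincomb (\<lambda>s. W s v) x"
      unfolding lincomb_sum_op[OF assms(3), symmetric]
      by (intro lincomb_cong[OF assms(3)] linear_op_onD(2)[OF lin u v])
  qed
  ultimately show ?thesis by (auto simp: bounded_op_on_def)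
qed

context star_monoid begin

lemma star_act_op:
  assumes W: "star_act M j V W" and x: "x \<in> fs"
  shows "bounded_op_on V (group_algebra_op W x)" "linear_op_on V (group_algebra_op W x)"
    "u \<in> V \<Longrightarrow> group_algebra_op W x u \<in> V"
proof -
  show "bounded_op_on V (group_algebra_op W x)"
    by (rule bounded_op_on_group_algebra_op[OF star_actD(1,2)[OF W] x])
  then show lin: "linear_op_on V (group_algebra_op W x)" by (simp add: bounded_op_on_def)
  show "u \<in> V \<Longrightarrow> group_algebra_op W x u \<in> V" by (rule linear_op_onD(1)[OF lin])
qed

lemma star_act_mult:
  assumes W: "star_act M j V W" and x: "x \<in> fs" and y: "y \<in> fs" and u: "u \<in> V"
  shows "group_algebra_op W (convolve (mult M) x y) u = group_algebra_op W x (group_algebra_op W y u)"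
proof -
  have "group_algebra_op W (convolve (mult M) x y) u = lincomb (\<lambda>s. lincomb (\<lambda>r. W (s \<otimes> r) u) y) x"
    unfolding group_algebra_op_lincomb lincomb_convolve[OF x y] ..
  also have "\<dots> = lincomb (\<lambda>s. W s (lincomb (\<lambda>r. W r u) y)) x"
  proof (rule lincomb_cong[OF x])
    fix s assume s: "s \<in> carrier M"
    have "W s (lincomb (\<lambda>r. W r u) y) = lincomb (\<lambda>r. W s (W r u)) y"
      by (rule lincomb_linear_op(1)[OF star_actD(3,1)[OF W] y]) (auto intro: s star_actD(4)[OF W] u)
    also have "\<dots> = lincomb (\<lambda>r. W (s \<otimes> r) u) y"
      by (rule lincomb_cong[OF y]) (simp add: star_actD(6)[OF W s _ u])
    finally show "lincomb (\<lambda>r. W (s \<otimes> r) u) y = W s (lincomb (\<lambda>r. W r u) y)" ..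
  qed
  finally show ?thesis unfolding group_algebra_op_lincomb .
qed

lemma star_act_adjoint:
  assumes W: "star_act M j V W" and x: "x \<in> fs" and u: "u \<in> V" and v: "v \<in> V"
  shows "cinner (group_algebra_op W x u) v = cinner u (group_algebra_op W (push j (\<lambda>s. cnj (x s))) v)"
  unfolding group_algebra_op_lincomb lincomb_push[OF fin_supp_on_cnj[OF x]] cinner_lincomb
  using x by (auto intro!: sum.cong simp: star_actD(7)[OF W _ u v] fin_supp_on_def)

lemma star_act_square:
  assumes W: "star_act M j V W" and x: "x \<in> fs" and u: "u \<in> V"
  shows "cinner (group_algebra_op W (convolve (mult M) (push j (\<lambda>s. cnj (x s))) x) u) u
    = of_real ((norm (group_algebra_op W x u))\<^sup>2)"
proof -
  have xs: "push j (\<lambda>s. cnj (x s)) \<in> fs" by (rule star_closed[OF x])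
  have "cinner (group_algebra_op W (convolve (mult M) (push j (\<lambda>s. cnj (x s))) x) u) u
      = cinner (group_algebra_op W (push j (\<lambda>s. cnj (x s))) (group_algebra_op W x u)) u"
    unfolding star_act_mult[OF W xs x u] ..
  also have "\<dots> = cnj (cinner u (group_algebra_op W (push j (\<lambda>s. cnj (x s))) (group_algebra_op W x u)))"
    by (rule cinner_commute)
  also have "\<dots> = cnj (cinner (group_algebra_op W x u) (group_algebra_op W x u))"
    unfolding star_act_adjoint[OF W x u star_act_op(3)[OF W x u]] ..
  finally show ?thesis by (simp add: cinner_self)
qed

text \<open>Characterises \<open>N x\<close> as the least common operator bound over the family
  \<open>R\<close>, by an equivalence for every \<open>B\<close>. Suprema then occur only where a
  concrete norm is shown to have this property.\<close>

definition dominated_norm :: "('h::complex_hilbert set \<times> ('a \<Rightarrow> 'h \<Rightarrow> 'h)) set \<Rightarrow> (('a \<Rightarrow> complex) \<Rightarrow> real) \<Rightarrow> bool" where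
  "dominated_norm R N \<longleftrightarrow> (\<forall>(V, W)\<in>R. star_act M j V W)
     \<and> (\<forall>x\<in>fs. 0 \<le> N x \<and> (\<forall>B\<ge>0. N x \<le> B \<longleftrightarrow>
          (\<forall>(V, W)\<in>R. \<forall>u\<in>V. norm (group_algebra_op W x u) \<le> B * norm u)))"

lemma dominated_normD:
  assumes "dominated_norm R N"
  shows "(V, W) \<in> R \<Longrightarrow> star_act M j V W" "x \<in> fs \<Longrightarrow> 0 \<le> N x"
    "x \<in> fs \<Longrightarrow> (V, W) \<in> R \<Longrightarrow> u \<in> V \<Longrightarrow> norm (group_algebra_op W x u) \<le> N x * norm u"
    "x \<in> fs \<Longrightarrow> 0 \<le> B \<Longrightarrow> (\<And>V W u. (V, W) \<in> R \<Longrightarrow> u \<in> V \<Longrightarrow> norm (group_algebra_op W x u) \<le> B * norm u) \<Longrightarrow> N x \<le> B"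
proof -
  show "(V, W) \<in> R \<Longrightarrow> star_act M j V W" and n: "x \<in> fs \<Longrightarrow> 0 \<le> N x"
    using assms by (auto simp: dominated_norm_def)
  have iff: "N x \<le> B \<longleftrightarrow> (\<forall>(V, W)\<in>R. \<forall>u\<in>V. norm (group_algebra_op W x u) \<le> B * norm u)"
    if "x \<in> fs" "0 \<le> B" for B
    using assms that unfolding dominated_norm_def by blast
  show "x \<in> fs \<Longrightarrow> (V, W) \<in> R \<Longrightarrow> u \<in> V \<Longrightarrow> norm (group_algebra_op W x u) \<le> N x * norm u"
    using iff[of "N x"] n by auto
  show "x \<in> fs \<Longrightarrow> 0 \<le> B \<Longrightarrow> (\<And>V W u. (V, W) \<in> R \<Longrightarrow> u \<in> V \<Longrightarrow> norm (group_algebra_op W x u) \<le> B * norm u) \<Longrightarrow> N x \<le> B"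
    using iff[of B] by auto
qed

text \<open>For a vector functional of an action, the assumed bound by \<open>N\<close> is exactly
  the condition on left multiplication in \<open>pos_functional\<close>.\<close>

lemma pos_functional_star_act:
  assumes W: "star_act M j V W" and u: "u \<in> V"
    and N: "\<And>x v. x \<in> fs \<Longrightarrow> v \<in> V \<Longrightarrow> norm (group_algebra_op W x v) \<le> N x * norm v"
  defines "\<phi> \<equiv> \<lambda>x. cinner (group_algebra_op W x u) u"
  shows "pos_functional (monoid_star_algebra M j N) \<phi>"
    "\<And>x. x \<in> fs \<Longrightarrow> \<phi> (convolve (mult M) (push j (\<lambda>s. cnj (x s))) x) = of_real ((norm (group_algebra_op W x u))\<^sup>2)"
proof -
  have adj: "\<phi> (convolve (mult M) (push j (\<lambda>s. cnj (x s))) x) = of_real ((norm (group_algebra_op W x u))\<^sup>2)"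
    if x: "x \<in> fs" for x
    unfolding \<phi>_def by (rule star_act_square[OF W x u])
  then show "\<And>x. x \<in> fs \<Longrightarrow> \<phi> (convolve (mult M) (push j (\<lambda>s. cnj (x s))) x) = of_real ((norm (group_algebra_op W x u))\<^sup>2)" .
  show "pos_functional (monoid_star_algebra M j N) \<phi>"
    unfolding pos_functional_def monoid_star_algebra_sel
  proof (intro conjI ballI allI)
    fix x assume x: "x \<in> fs"
    show "\<phi> (\<lambda>t. c * x t) = c * \<phi> x" for c
      unfolding \<phi>_def group_algebra_op_lincomb lincomb_scale[OF x] by (rule cinner_scaleC_left)
    show "\<phi> (push j (\<lambda>s. cnj (x s))) = cnj (\<phi> x)"
      unfolding \<phi>_def star_act_adjoint[OF W x u u] by (rule cinner_commute)
    show "0 \<le> Re (\<phi> (convolve (\<otimes>) (push j (\<lambda>s. cnj (x s))) x))" by (simp add: adj[OF x])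
    fix y assume y: "y \<in> fs"
    show "\<phi> (\<lambda>t. x t + y t) = \<phi> x + \<phi> y"
      unfolding \<phi>_def group_algebra_op_lincomb lincomb_add[OF x y] by (rule cinner_add_left)
    note xy = convolve_closed[OF x y]
    have "norm (group_algebra_op W (convolve (\<otimes>) x y) u) \<le> N x * norm (group_algebra_op W y u)"
      unfolding star_act_mult[OF W x y u] by (rule N[OF x star_act_op(3)[OF W y u]])
    then have "(norm (group_algebra_op W (convolve (\<otimes>) x y) u))\<^sup>2 \<le> (N x * norm (group_algebra_op W y u))\<^sup>2"
      by (intro power_mono) auto
    then show "Re (\<phi> (convolve (\<otimes>) (push j (\<lambda>s. cnj (convolve (\<otimes>) x y s))) (convolve (\<otimes>) x y)))
        \<le> (N x)\<^sup>2 * Re (\<phi> (convolve (\<otimes>) (push j (\<lambda>s. cnj (y s))) y))"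
      by (simp only: adj[OF xy] adj[OF y] Re_complex_of_real power_mult_distrib)
  qed
qed

text \<open>As the least common bound is nearly attained at some unit vector, the vector functionals
  of the actions in \<open>R\<close> are norming.\<close>

lemma pre_cstar_dominated_norm:
  assumes "dominated_norm R N" shows "pre_cstar (monoid_star_algebra M j N)" (is "pre_cstar ?P")
proof (rule pre_cstar.intro[OF star_algebra_monoid_star_algebra], unfold_locales)
  note D = dominated_normD[OF assms]
  fix x assume "x \<in> carrier ?P"
  then have x: "x \<in> fs" by (simp add: monoid_star_algebra_sel)
  show "0 \<le> nrm ?P x" using D(2)[OF x] by (simp add: monoid_star_algebra_sel)
  fix e :: real assume e: "0 < e"
  show "\<exists>\<phi>. pos_functional ?P \<phi> \<and> Re (\<phi> \<one>\<^bsub>?P\<^esub>) \<le> 1 \<and> (nrm ?P x)\<^sup>2 - e < Re (\<phi> (star ?P x \<otimes>\<^bsub>?P\<^esub> x))"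
  \<comment> \<open>In the first case the zero functional already satisfies the estimate; this
    includes families of zero spaces, where there is no unit vector.\<close>
  proof (cases "(N x)\<^sup>2 < e")
    case True
    then show ?thesis by (intro exI[of _ "\<lambda>_. 0"]) (simp add: pos_functional_def monoid_star_algebra_sel)
  next
    case False
    \<comment> \<open>Strictly below \<open>N x\<close>, hence not a common bound, so some vector
      violates it.\<close>
    define B where "B = sqrt ((N x)\<^sup>2 - e)"
    have B: "0 \<le> B" "B\<^sup>2 = (N x)\<^sup>2 - e" "B < N x"
      using False e D(2)[OF x] by (auto simp: B_def intro!: real_less_lsqrt)
    obtain V W u where u: "(V, W) \<in> R" "u \<in> V" "B * norm u < norm (group_algebra_op W x u)"
      using D(4)[OF x B(1)] B(3) by (meson not_le)
    note W = D(1)[OF u(1)]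
    have u0: "u \<noteq> 0"
      using u linear_op_on_0[OF star_act_op(2)[OF W x] star_actD(1)[OF W]] by auto
    define v where "v = scaleC (of_real (inverse (norm u))) u"
    have v: "v \<in> V" using u csubspace_scaleC[OF star_actD(1)[OF W]] by (simp add: v_def)
    have nv: "norm v = 1" using u0 by (simp add: v_def norm_scaleC norm_inverse)
    have Wv: "norm (group_algebra_op W x v) = norm (group_algebra_op W x u) / norm u"
      unfolding v_def linear_op_onD(3)[OF star_act_op(2)[OF W x] u(2)]
      using u0 by (simp add: norm_scaleC norm_inverse norm_divide field_simps)
    have "B < norm (group_algebra_op W x v)" using u(3) u0 by (simp add: Wv pos_less_divide_eq)
    then have lt: "B\<^sup>2 < (norm (group_algebra_op W x v))\<^sup>2" using B(1) by (intro power_strict_mono) auto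
    have d: "delta \<one> \<in> fs" by (rule fin_supp_on_delta) simp
    have "group_algebra_op W (delta \<one>) v = v"
      unfolding group_algebra_op_lincomb lincomb_delta by (rule star_actD(5)[OF W v])
    then show ?thesis
      using pos_functional_star_act[OF W v D(3)[OF _ u(1)]] lt x
      by (intro exI[of _ "\<lambda>x. cinner (group_algebra_op W x v) v"])
        (simp add: monoid_star_algebra_sel B(2) cinner_self nv)
  qed
qed

text \<open>The constant \<open>C\<close> bounds all operator norms at once, so the supremum exists,
  and nonemptiness of \<open>R\<close> makes \<open>cSup_le_iff\<close> applicable.\<close>

lemma dominated_norm_Sup:
  assumes R: "\<And>V W. (V, W) \<in> R \<Longrightarrow> star_act M j V W" "R \<noteq> {}"
    and bd: "\<And>x. x \<in> fs \<Longrightarrow> \<exists>C\<ge>0. \<forall>(V, W)\<in>R. \<forall>u\<in>V. norm (group_algebra_op W x u) \<le> C * norm u"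
    and N: "\<And>x. x \<in> fs \<Longrightarrow> N x = Sup {op_norm_on V (group_algebra_op W x) | V W. (V, W) \<in> R}"
  shows "dominated_norm R N"
  unfolding dominated_norm_def
proof (intro conjI ballI allI impI)
  show "case p of (V, W) \<Rightarrow> star_act M j V W" if "p \<in> R" for p using R that by auto
  fix x assume x: "x \<in> fs"
  let ?S = "{op_norm_on V (group_algebra_op W x) | V W. (V, W) \<in> R}"
  obtain C where C: "0 \<le> C" "\<And>V W u. (V, W) \<in> R \<Longrightarrow> u \<in> V \<Longrightarrow> norm (group_algebra_op W x u) \<le> C * norm u"
    using bd[OF x] by blast
  have iff: "op_norm_on V (group_algebra_op W x) \<le> B \<longleftrightarrow> (\<forall>u\<in>V. norm (group_algebra_op W x u) \<le> B * norm u)"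
    if "(V, W) \<in> R" "0 \<le> B" for V W B
    by (rule op_norm_on_le_iff[OF star_act_op(2)[OF R(1)[OF that(1)] x] star_actD(1)[OF R(1)[OF that(1)]] C(2)[OF that(1)] that(2)])
  have ne: "?S \<noteq> {}" using R(2) by auto
  have bdd: "bdd_above ?S" using iff[OF _ C(1)] C(2) by (intro bdd_aboveI[of _ C]) auto
  have nonneg: "0 \<le> op_norm_on V (group_algebra_op W x)" if "(V, W) \<in> R" for V W
  proof (rule ccontr)
    assume neg: "\<not> ?thesis"
    then have "\<forall>u\<in>V. norm (group_algebra_op W x u) \<le> 0 * norm u" using iff[OF that, of 0] by simp
    then have "{norm (group_algebra_op W x u) | u. u \<in> V \<and> norm u \<le> 1} = {0}"
      using csubspace_0[OF star_actD(1)[OF R(1)[OF that]]] by (auto intro!: exI[of _ 0])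
    then show False using neg by (simp add: op_norm_on_def)
  qed
  show "0 \<le> N x" unfolding N[OF x]
    using ne nonneg by (auto intro!: cSup_upper2[OF _ _ bdd])
  fix B :: real assume B: "0 \<le> B"
  show "N x \<le> B \<longleftrightarrow> (\<forall>(V, W)\<in>R. \<forall>u\<in>V. norm (group_algebra_op W x u) \<le> B * norm u)"
    unfolding N[OF x] cSup_le_iff[OF ne bdd] using iff[OF _ B] by blast
qed

end


section \<open>Tensor products inside the universe\<close>

lemma closure_cspan_induct [consumes 1, case_names base zero add scale lim]:
  assumes "f \<in> closure (cspan S)" and "\<And>x. x \<in> S \<Longrightarrow> P x" "P 0"
    and add: "\<And>x y. P x \<Longrightarrow> P y \<Longrightarrow> P (x + y)" and scale: "\<And>c x. P x \<Longrightarrow> P (scaleC c x)"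
    and lim: "\<And>g x. (\<And>n. g n \<in> cspan S) \<Longrightarrow> (\<And>n. P (g n)) \<Longrightarrow> g \<longlonglongrightarrow> x \<Longrightarrow> P x"
  shows "P f"
proof -
  have "cspan S \<subseteq> {x. P x}"
    using assms(2-5) by (intro cspan_least) (auto simp: csubspace_def)
  then have P: "P x" if "x \<in> cspan S" for x using that by auto
  from assms(1) obtain g where "\<And>n. g n \<in> cspan S" "g \<longlonglongrightarrow> f" unfolding closure_sequential by metis
  then show ?thesis using P lim by blast
qed

lemma in_closure_cspan: "x \<in> S \<Longrightarrow> x \<in> closure (cspan S)"
  using cspan_superset[of S] closure_subset[of "cspan S"] by blast

lemma closure_cspan_subset:
  assumes "closed_csubspace V" "S \<subseteq> V" shows "closure (cspan S) \<subseteq> V"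
  using assms cspan_least[of V S] closure_minimal[of "cspan S" V] by (simp add: closed_csubspace_def)

lemma cinner_lincomb_lincomb:
  "cinner (lincomb v x) (lincomb w y) = (\<Sum>s | x s \<noteq> 0. \<Sum>r | y r \<noteq> 0. x s * (cnj (y r) * cinner (v s) (w r)))"
  unfolding cinner_lincomb(1) unfolding cinner_lincomb(2) sum_distrib_left ..

lemma lincomb_gram:
  assumes "x \<in> fin_supp_on I" "y \<in> fin_supp_on I"
    and "\<And>i j. i \<in> I \<Longrightarrow> j \<in> I \<Longrightarrow> cinner (v i) (v' j) = cinner (w i) (w' j)"
  shows "cinner (lincomb v x) (lincomb v' y) = cinner (lincomb w x) (lincomb w' y)"
  unfolding cinner_lincomb_lincomb
  by (intro sum.cong refl) (use assms in \<open>auto simp: fin_supp_on_def subset_iff\<close>)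

lemma norm_eq_cinnerI: "cinner x x = cinner y y \<Longrightarrow> norm x = norm y"
  unfolding cinner_self of_real_eq_iff by (simp add: power2_eq_iff_nonneg)

lemma norm_lincomb_gram:
  assumes "x \<in> fin_supp_on I" "\<And>i j. i \<in> I \<Longrightarrow> j \<in> I \<Longrightarrow> cinner (v i) (v j) = cinner (w i) (w j)"
  shows "norm (lincomb v x) = norm (lincomb w x)"
  by (rule norm_eq_cinnerI, rule lincomb_gram[OF assms(1,1,2)])

lemma fin_supp_on_diff: "x \<in> fin_supp_on S \<Longrightarrow> y \<in> fin_supp_on S \<Longrightarrow> (\<lambda>t. x t - y t) \<in> fin_supp_on S"
  using fin_supp_on_add[of x S "\<lambda>t. (-1) * y t"] fin_supp_on_scale[of y S "-1"] by simp

lemma lincomb_diff: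
  assumes "x \<in> fin_supp_on S" "y \<in> fin_supp_on S"
  shows "lincomb v (\<lambda>t. x t - y t) = lincomb v x - lincomb v y"
  using lincomb_add[OF assms(1) fin_supp_on_scale[OF assms(2), of "-1"], of v]
    lincomb_scale[OF assms(2), of v "-1"] by (simp add: scaleC.minus_left)

text \<open>The inequality sends every linear relation among the \<open>v i\<close> to one among the
  \<open>w i\<close>, so \<open>v i \<mapsto> w i\<close> is well defined on the span and extends by
  continuity to its closure.\<close>

lemma bounded_extension:
  fixes v w :: "'a \<Rightarrow> 'h::complex_hilbert"
  assumes B: "\<And>u. u \<in> fin_supp_on I \<Longrightarrow> norm (lincomb w u) \<le> B * norm (lincomb v u)"
    and w: "\<And>i. i \<in> I \<Longrightarrow> w i \<in> closure (cspan (v ` I))"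
  shows "\<exists>X. linear_op_on (closure (cspan (v ` I))) X \<and> (\<forall>i\<in>I. X (v i) = w i)
    \<and> (\<forall>f\<in>closure (cspan (v ` I)). norm (X f) \<le> B * norm f)"
proof -
  let ?V = "closure (cspan (v ` I))"
  have V: "csubspace ?V" "closed ?V" by (auto intro: csubspace_closure csubspace_cspan)
  have approx: "\<exists>u. (\<forall>n. u n \<in> fin_supp_on I) \<and> (\<lambda>n. lincomb v (u n)) \<longlonglongrightarrow> f" if f: "f \<in> ?V" for f
  proof -
    from f obtain g where g: "\<And>n. g n \<in> cspan (v ` I)" "g \<longlonglongrightarrow> f" unfolding closure_sequential by metis
    have "\<exists>u. u \<in> fin_supp_on I \<and> g n = lincomb v u" for n
      using g(1)[of n] unfolding cspan_eq_lincomb by auto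
    then obtain u where u: "\<And>n. u n \<in> fin_supp_on I" "\<And>n. g n = lincomb v (u n)" by metis
    then have "g = (\<lambda>n. lincomb v (u n))" by auto
    then show ?thesis using u(1) g(2) by auto
  qed
  have diff: "norm (lincomb w a - lincomb w b) \<le> B * norm (lincomb v a - lincomb v b)"
    if "a \<in> fin_supp_on I" "b \<in> fin_supp_on I" for a b
    using B[OF fin_supp_on_diff[OF that]] by (simp add: lincomb_diff[OF that])
  have conv: "convergent (\<lambda>n. lincomb w (u n))"
    if u: "\<And>n. u n \<in> fin_supp_on I" "(\<lambda>n. lincomb v (u n)) \<longlonglongrightarrow> f" for u f
  proof (rule Cauchy_convergent, rule metric_CauchyI)
    fix e :: real assume e: "0 < e"
    define d where "d = e / (\<bar>B\<bar> + 1)"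
    have d: "0 < d" using e by (simp add: d_def)
    obtain M where M: "\<And>m n. M \<le> m \<Longrightarrow> M \<le> n \<Longrightarrow> dist (lincomb v (u m)) (lincomb v (u n)) < d"
      using metric_CauchyD[OF LIMSEQ_imp_Cauchy[OF u(2)] d] by auto
    have "dist (lincomb w (u m)) (lincomb w (u n)) < e" if mn: "M \<le> m" "M \<le> n" for m n
    proof -
      have "dist (lincomb w (u m)) (lincomb w (u n)) \<le> B * norm (lincomb v (u m) - lincomb v (u n))"
        unfolding dist_norm by (rule diff[OF u(1) u(1)])
      also have "\<dots> \<le> \<bar>B\<bar> * d"
        using less_imp_le[OF M[OF mn]] by (intro mult_mono) (auto simp: dist_norm)
      also have "\<dots> < (\<bar>B\<bar> + 1) * d" using d by (intro mult_strict_right_mono) auto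
      also have "\<dots> = e" by (simp add: d_def)
      finally show ?thesis .
    qed
    then show "\<exists>M. \<forall>m\<ge>M. \<forall>n\<ge>M. dist (lincomb w (u m)) (lincomb w (u n)) < e" by blast
  qed
  \<comment> \<open>The limit along one chosen approximating sequence; the fact \<open>X\<close>
    below shows that any other sequence gives the same value.\<close>
  define X where "X f = lim (\<lambda>n. lincomb w ((SOME u. (\<forall>n. u n \<in> fin_supp_on I) \<and> (\<lambda>n. lincomb v (u n)) \<longlonglongrightarrow> f) n))" for f
  have X: "(\<lambda>n. lincomb w (u n)) \<longlonglongrightarrow> X f"
    if f: "f \<in> ?V" and u: "\<And>n. u n \<in> fin_supp_on I" "(\<lambda>n. lincomb v (u n)) \<longlonglongrightarrow> f" for u f
  proof -
    define a where "a = (SOME u. (\<forall>n. u n \<in> fin_supp_on I) \<and> (\<lambda>n. lincomb v (u n)) \<longlonglongrightarrow> f)"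
    have "(\<forall>n. a n \<in> fin_supp_on I) \<and> (\<lambda>n. lincomb v (a n)) \<longlonglongrightarrow> f"
      unfolding a_def by (rule someI_ex[OF approx[OF f]])
    then have a: "\<And>n. a n \<in> fin_supp_on I" "(\<lambda>n. lincomb v (a n)) \<longlonglongrightarrow> f" by auto
    have "(\<lambda>n. lincomb w (a n)) \<longlonglongrightarrow> X f"
      unfolding X_def a_def[symmetric] using conv[OF a] by (simp add: convergent_LIMSEQ_iff)
    moreover have "(\<lambda>n. lincomb w (u n) - lincomb w (a n)) \<longlonglongrightarrow> 0"
    proof (rule Lim_null_comparison)
      show "\<forall>\<^sub>F n in sequentially. norm (lincomb w (u n) - lincomb w (a n)) \<le> B * norm (lincomb v (u n) - lincomb v (a n))"
        by (simp add: diff[OF u(1) a(1)])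
      show "(\<lambda>n. B * norm (lincomb v (u n) - lincomb v (a n))) \<longlonglongrightarrow> 0"
        using tendsto_diff[OF u(2) a(2)] by (intro tendsto_mult_right_zero tendsto_norm_zero) simp
    qed
    ultimately show ?thesis using tendsto_add by fastforce
  qed
  have inV: "lincomb w u \<in> ?V" if "u \<in> fin_supp_on I" for u
    by (rule lincomb_in[OF V(1) that w])
  have "linear_op_on ?V X"
    unfolding linear_op_on_def
  proof (intro conjI ballI allI)
    fix f assume f: "f \<in> ?V"
    obtain u where u: "\<And>n. u n \<in> fin_supp_on I" "(\<lambda>n. lincomb v (u n)) \<longlonglongrightarrow> f" using approx[OF f] by auto
    show "X f \<in> ?V" by (rule closed_sequentially[OF V(2) inV[OF u(1)] X[OF f u]])
    show "X (scaleC c f) = scaleC c (X f)" for c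
    proof (rule LIMSEQ_unique)
      show "(\<lambda>n. lincomb w (\<lambda>t. c * u n t)) \<longlonglongrightarrow> X (scaleC c f)"
        using scaleC.tendsto[OF tendsto_const u(2), of c] csubspace_scaleC[OF V(1) f]
        by (intro X fin_supp_on_scale u) (auto simp: lincomb_scale[OF u(1)])
      show "(\<lambda>n. lincomb w (\<lambda>t. c * u n t)) \<longlonglongrightarrow> scaleC c (X f)"
        using scaleC.tendsto[OF tendsto_const X[OF f u], of c] by (simp add: lincomb_scale[OF u(1)])
    qed
    fix g assume g: "g \<in> ?V"
    obtain a where a: "\<And>n. a n \<in> fin_supp_on I" "(\<lambda>n. lincomb v (a n)) \<longlonglongrightarrow> g" using approx[OF g] by auto
    show "X (f + g) = X f + X g"
    proof (rule LIMSEQ_unique)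
      show "(\<lambda>n. lincomb w (\<lambda>t. u n t + a n t)) \<longlonglongrightarrow> X (f + g)"
        using tendsto_add[OF u(2) a(2)] csubspace_add[OF V(1) f g]
        by (intro X fin_supp_on_add u a) (auto simp: lincomb_add[OF u(1) a(1)])
      show "(\<lambda>n. lincomb w (\<lambda>t. u n t + a n t)) \<longlonglongrightarrow> X f + X g"
        using tendsto_add[OF X[OF f u] X[OF g a]] by (simp add: lincomb_add[OF u(1) a(1)])
    qed
  qed
  moreover have "X (v i) = w i" if i: "i \<in> I" for i
    using X[OF in_closure_cspan, of "v i" "\<lambda>_. delta i"] i fin_supp_on_delta[OF i]
    by (simp add: lincomb_delta LIMSEQ_const_iff)
  moreover have "norm (X f) \<le> B * norm f" if f: "f \<in> ?V" for f
  proof -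
    obtain u where u: "\<And>n. u n \<in> fin_supp_on I" "(\<lambda>n. lincomb v (u n)) \<longlonglongrightarrow> f" using approx[OF f] by auto
    show ?thesis
      by (rule LIMSEQ_le[OF tendsto_norm[OF X[OF f u]] tendsto_mult_left[OF tendsto_norm[OF u(2)]]])
        (use B u in auto)
  qed
  ultimately show ?thesis by blast
qed

text \<open>Identifies the Hilbert space tensor square of \<open>'i ell2\<close> with
  \<open>'i ell2\<close> itself, so that tensor products of representations stay in the universe.
  The bijection exists because \<open>'i\<close> is infinite.\<close>

definition pair_index :: "'i::infinite \<times> 'i \<Rightarrow> 'i" where
  "pair_index = (SOME f. bij f)"

lemma bij_pair_index: "bij (pair_index :: 'i::infinite \<times> 'i \<Rightarrow> 'i)"
proof -
  have "\<exists>f :: 'i \<times> 'i \<Rightarrow> 'i. bij f"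
    using card_of_ordIso[THEN iffD2, OF card_of_Times_same_infinite[OF infinite_UNIV[where 'a = 'i]]] by simp
  then show ?thesis unfolding pair_index_def by (rule someI_ex)
qed

definition tensor_fun :: "('i::infinite \<Rightarrow> complex) \<Rightarrow> ('i \<Rightarrow> complex) \<Rightarrow> 'i \<Rightarrow> complex" where
  "tensor_fun x y k = (case inv_into UNIV pair_index k of (a, b) \<Rightarrow> x a * y b)"

lemma tensor_fun_pair: "tensor_fun x y (pair_index (a, b)) = x a * y b"
  unfolding tensor_fun_def by (simp add: inv_f_f[OF bij_is_inj[OF bij_pair_index]])

text \<open>A finite set of pairs lies in the product of its projections, where the sum
  factorises.\<close>

lemma square_summable_prod:
  fixes x y :: "'i \<Rightarrow> complex"
  assumes "(\<lambda>i. (cmod (x i))\<^sup>2) summable_on UNIV" "(\<lambda>i. (cmod (y i))\<^sup>2) summable_on UNIV"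
  shows "(\<lambda>(a, b). (cmod (x a))\<^sup>2 * (cmod (y b))\<^sup>2) summable_on UNIV"
proof (rule nonneg_bdd_above_summable_on)
  let ?s = "\<lambda>z. infsum (\<lambda>i. (cmod (z i))\<^sup>2) UNIV"
  show "bdd_above (sum (\<lambda>(a, b). (cmod (x a))\<^sup>2 * (cmod (y b))\<^sup>2) ` {F. F \<subseteq> UNIV \<and> finite F})"
  proof (rule bdd_aboveI)
    fix z assume "z \<in> sum (\<lambda>(a, b). (cmod (x a))\<^sup>2 * (cmod (y b))\<^sup>2) ` {F. F \<subseteq> UNIV \<and> finite F}"
    then obtain F :: "('i \<times> 'i) set" where F: "finite F" "z = sum (\<lambda>(a, b). (cmod (x a))\<^sup>2 * (cmod (y b))\<^sup>2) F" by auto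
    have "z \<le> sum (\<lambda>(a, b). (cmod (x a))\<^sup>2 * (cmod (y b))\<^sup>2) (fst ` F \<times> snd ` F)"
      unfolding F(2) using F(1) by (intro sum_mono2) (auto simp: image_iff Bex_def)
    also have "\<dots> = (\<Sum>a\<in>fst ` F. (cmod (x a))\<^sup>2) * (\<Sum>b\<in>snd ` F. (cmod (y b))\<^sup>2)"
      by (simp add: sum_product sum.cartesian_product)
    also have "\<dots> \<le> ?s x * ?s y"
      using F(1) assms by (intro mult_mono finite_sum_le_infsum sum_nonneg infsum_nonneg) auto
    finally show "z \<le> ?s x * ?s y" .
  qed
qed auto

lemma tensor_fun_summable:
  fixes x y :: "'i::infinite \<Rightarrow> complex"
  assumes "(\<lambda>i. (cmod (x i))\<^sup>2) summable_on UNIV" "(\<lambda>i. (cmod (y i))\<^sup>2) summable_on UNIV"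
  shows "(\<lambda>k. (cmod (tensor_fun x y k))\<^sup>2) summable_on UNIV"
proof -
  have "(\<lambda>p. (cmod (tensor_fun x y (pair_index p)))\<^sup>2) summable_on UNIV"
    by (rule summable_on_cong[THEN iffD1, OF _ square_summable_prod[OF assms]])
      (auto simp: tensor_fun_pair norm_mult power_mult_distrib)
  then show ?thesis by (rule summable_on_reindex_bij_betw[OF bij_pair_index, THEN iffD1])
qed

lift_definition tensor :: "'i::infinite ell2 \<Rightarrow> 'i ell2 \<Rightarrow> 'i ell2" is tensor_fun
  by (rule tensor_fun_summable)

lemma cinner_tensor: "cinner (tensor x y) (tensor x' y') = cinner x x' * cinner y y'"
proof -
  let ?x = "\<lambda>a. Rep_ell2 x a * cnj (Rep_ell2 x' a)" and ?y = "\<lambda>a. Rep_ell2 y a * cnj (Rep_ell2 y' a)"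
  have s: "(\<lambda>k. Rep_ell2 (tensor x y) k * cnj (Rep_ell2 (tensor x' y') k)) summable_on UNIV"
    by (intro square_summable_mult ell2_summable)
  have p: "Rep_ell2 (tensor x y) (pair_index p) * cnj (Rep_ell2 (tensor x' y') (pair_index p))
      = (case p of (a, b) \<Rightarrow> ?x a * ?y b)" for p
    by (cases p) (simp add: tensor.rep_eq tensor_fun_pair)
  let ?h = "\<lambda>k. Rep_ell2 (tensor x y) k * cnj (Rep_ell2 (tensor x' y') k)"
  have s': "(\<lambda>(a, b). ?x a * ?y b) summable_on UNIV \<times> UNIV"
    using summable_on_reindex_bij_betw[OF bij_pair_index, of ?h, THEN iffD2, OF s] unfolding p by simp
  have "cinner (tensor x y) (tensor x' y') = infsum (\<lambda>k. Rep_ell2 (tensor x y) k * cnj (Rep_ell2 (tensor x' y') k)) UNIV"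
    by (simp add: cinner_ell2_def ell2_cinner.rep_eq)
  also have "\<dots> = infsum (\<lambda>(a, b). ?x a * ?y b) (UNIV \<times> UNIV)"
    using infsum_reindex_bij_betw[OF bij_pair_index, of ?h, symmetric] unfolding p by simp
  also have "\<dots> = infsum (\<lambda>a. infsum (\<lambda>b. ?x a * ?y b) UNIV) UNIV"
    by (rule infsum_Sigma'_banach[OF s', symmetric])
  also have "\<dots> = infsum ?x UNIV * infsum ?y UNIV"
    by (simp add: infsum_cmult_right infsum_cmult_left square_summable_mult ell2_summable)
  finally show ?thesis by (simp add: cinner_ell2_def ell2_cinner.rep_eq)
qed

lemma norm_tensor: "norm (tensor x y) = norm x * norm y"
proof -
  have "complex_of_real ((norm (tensor x y))\<^sup>2) = of_real ((norm x * norm y)\<^sup>2)"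
    unfolding cinner_self[symmetric] cinner_tensor by (simp add: cinner_self power_mult_distrib)
  then show ?thesis unfolding of_real_eq_iff by (simp add: power2_eq_iff_nonneg)
qed

lemma Rep_ell2_scaleC: "Rep_ell2 (scaleC c x) i = c * Rep_ell2 x i"
  by (simp add: scaleC_ell2_def ell2_scaleC.rep_eq)

lemma Rep_ell2_sum: "Rep_ell2 (sum f F) i = (\<Sum>k\<in>F. Rep_ell2 (f k) i)"
  by (induction F rule: infinite_finite_induct) (auto simp: zero_ell2.rep_eq plus_ell2.rep_eq)

lemma tensor_add_left: "tensor (x + x') y = tensor x y + tensor x' y"
  and tensor_add_right: "tensor x (y + y') = tensor x y + tensor x y'"
  and tensor_scale_left: "tensor (scaleC c x) y = scaleC c (tensor x y)"
  and tensor_scale_right: "tensor x (scaleC c y) = scaleC c (tensor x y)"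
  by (auto simp: Rep_ell2_inject[symmetric] fun_eq_iff tensor.rep_eq plus_ell2.rep_eq Rep_ell2_scaleC
    tensor_fun_def ring_distribs split: prod.splits)

lemma tensor_tendsto_left: "f \<longlonglongrightarrow> x \<Longrightarrow> (\<lambda>n. tensor (f n) y) \<longlonglongrightarrow> tensor x y"
proof -
  assume f: "f \<longlonglongrightarrow> x"
  have "tensor (f n) y - tensor x y = tensor (f n - x) y" for n
    using tensor_add_left[of "f n - x" x y] by simp
  then have "(\<lambda>n. tensor (f n) y - tensor x y) \<longlonglongrightarrow> 0"
    using tendsto_mult_left_zero[OF tendsto_norm_zero[OF LIM_zero[OF f]], of "norm y"]
    by (subst tendsto_norm_zero_iff[symmetric]) (simp add: norm_tensor)
  then show ?thesis by (simp add: LIM_zero_iff)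
qed

definition tensor_pair :: "'i::infinite ell2 \<times> 'i ell2 \<Rightarrow> 'i ell2" where
  "tensor_pair = (\<lambda>(x, y). tensor x y)"

lemma cinner_tensor_pair: "cinner (tensor_pair p) (tensor_pair q) = cinner (fst p) (fst q) * cinner (snd p) (snd q)"
  by (simp add: tensor_pair_def cinner_tensor case_prod_beta)

lemma has_sum_finite_sum:
  assumes "\<And>k. k \<in> F \<Longrightarrow> (f k has_sum (s k :: complex)) A"
  shows "((\<lambda>j. \<Sum>k\<in>F. f k j) has_sum (\<Sum>k\<in>F. s k)) A"
  using assms by (induction F rule: infinite_finite_induct) (auto intro: has_sum_add has_sum_0)

text \<open>Expands the second leg in coordinates: the combination becomes an orthogonal sum, over
  the indices \<open>j\<close>, of vectors in the first leg. An operator on the first leg acts on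
  these components separately.\<close>

lemma lincomb_tensor_norm:
  assumes "u \<in> fin_supp_on I"
  shows "((\<lambda>j. (norm (lincomb (\<lambda>(x, y). scaleC (Rep_ell2 y j) x) u))\<^sup>2) has_sum (norm (lincomb tensor_pair u))\<^sup>2) UNIV"
proof -
  let ?F = "{p. u p \<noteq> 0}" and ?s = "\<lambda>j. lincomb (\<lambda>(x, y). scaleC (Rep_ell2 y j) x) u"
  let ?t = "\<lambda>p q j. u p * (cnj (u q) * (cinner (fst p) (fst q) * (Rep_ell2 (snd p) j * cnj (Rep_ell2 (snd q) j))))"
  have "((\<lambda>j. \<Sum>p\<in>?F. \<Sum>q\<in>?F. ?t p q j) has_sum
      (\<Sum>p\<in>?F. \<Sum>q\<in>?F. u p * (cnj (u q) * (cinner (fst p) (fst q) * cinner (snd p) (snd q))))) UNIV"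
    by (intro has_sum_finite_sum has_sum_cmult_right)
      (simp add: cinner_ell2_def ell2_cinner.rep_eq square_summable_mult ell2_summable)
  moreover have "(\<Sum>p\<in>?F. \<Sum>q\<in>?F. ?t p q j) = of_real ((norm (?s j))\<^sup>2)" for j
    unfolding cinner_self[symmetric] cinner_lincomb_lincomb
    by (intro sum.cong refl) (simp add: case_prod_beta cinner_scaleC_left cinner_scaleC_right mult_ac)
  moreover have "(\<Sum>p\<in>?F. \<Sum>q\<in>?F. u p * (cnj (u q) * (cinner (fst p) (fst q) * cinner (snd p) (snd q))))
      = of_real ((norm (lincomb tensor_pair u))\<^sup>2)"
    unfolding cinner_self[symmetric] cinner_lincomb_lincomb cinner_tensor_pair ..
  ultimately have "((\<lambda>j. complex_of_real ((norm (?s j))\<^sup>2)) has_sum of_real ((norm (lincomb tensor_pair u))\<^sup>2)) UNIV"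
    by simp
  from has_sum_Re[OF this] show ?thesis by simp
qed

text \<open>The operator \<open>U\<close> commutes with taking the \<open>j\<close>-th component of
  \<open>lincomb_tensor_norm\<close>, so its bound holds componentwise and can be summed.\<close>

lemma norm_lincomb_tensor_left:
  assumes U: "linear_op_on H U" "csubspace H" "\<And>x. x \<in> H \<Longrightarrow> norm (U x) \<le> B * norm x" and B: "0 \<le> B"
    and u: "u \<in> fin_supp_on (H \<times> K)"
  shows "norm (lincomb (\<lambda>(x, y). tensor (U x) y) u) \<le> B * norm (lincomb tensor_pair u)"
proof -
  define u' where "u' = push (\<lambda>(x, y). (U x, y)) u"
  have u': "u' \<in> fin_supp_on UNIV" unfolding u'_def by (rule push_fin_supp[OF u]) auto
  have eq: "lincomb g u' = lincomb (\<lambda>(x, y). g (U x, y)) u" for g :: "_ \<Rightarrow> 'a ell2"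
    unfolding u'_def lincomb_push[OF u] by (simp add: case_prod_beta')
  have le: "(norm (lincomb (\<lambda>(x, y). scaleC (Rep_ell2 y j) x) u'))\<^sup>2
      \<le> B\<^sup>2 * (norm (lincomb (\<lambda>(x, y). scaleC (Rep_ell2 y j) x) u))\<^sup>2" for j
  proof -
    have "lincomb (\<lambda>(x, y). scaleC (Rep_ell2 y j) x) u' = lincomb (\<lambda>p. U (scaleC (Rep_ell2 (snd p) j) (fst p))) u"
      unfolding eq using linear_op_onD(3)[OF U(1)] by (intro lincomb_cong[OF u]) auto
    also have "\<dots> = U (lincomb (\<lambda>p. scaleC (Rep_ell2 (snd p) j) (fst p)) u)"
      by (rule lincomb_linear_op(1)[OF U(1,2) u, symmetric]) (auto intro: csubspace_scaleC[OF U(2)])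
    finally have "norm (lincomb (\<lambda>(x, y). scaleC (Rep_ell2 y j) x) u')
        \<le> B * norm (lincomb (\<lambda>p. scaleC (Rep_ell2 (snd p) j) (fst p)) u)"
      using U(3)[OF lincomb_linear_op(2)[OF U(1,2) u]] csubspace_scaleC[OF U(2)] by auto
    then show ?thesis by (simp add: power_mono case_prod_beta' flip: power_mult_distrib)
  qed
  have "(norm (lincomb tensor_pair u'))\<^sup>2 \<le> B\<^sup>2 * (norm (lincomb tensor_pair u))\<^sup>2"
    by (rule has_sum_mono[OF lincomb_tensor_norm[OF u'] has_sum_cmult_right[OF lincomb_tensor_norm[OF u]] le])
  then have "(norm (lincomb tensor_pair u'))\<^sup>2 \<le> (B * norm (lincomb tensor_pair u))\<^sup>2"
    by (simp add: power_mult_distrib)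
  then have "norm (lincomb tensor_pair u') \<le> B * norm (lincomb tensor_pair u)"
    by (rule power2_le_imp_le) (use B in simp)
  then show ?thesis unfolding eq by (simp add: tensor_pair_def)
qed

lemma norm_lincomb_tensor_swap:
  assumes "u \<in> fin_supp_on I"
  shows "norm (lincomb (\<lambda>(x, y). tensor (f x) (g y)) u) = norm (lincomb (\<lambda>(x, y). tensor (g y) (f x)) u)"
  by (rule norm_lincomb_gram[OF assms]) (simp add: case_prod_beta cinner_tensor mult.commute)

text \<open>Reduced to the left leg by exchanging the legs, which preserves inner products of
  elementary tensors.\<close>

lemma norm_lincomb_tensor_right:
  assumes V: "linear_op_on K V" "csubspace K" "\<And>x. x \<in> K \<Longrightarrow> norm (V x) \<le> B * norm x" and B: "0 \<le> B"
    and u: "u \<in> fin_supp_on (H \<times> K)"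
  shows "norm (lincomb (\<lambda>(x, y). tensor x (V y)) u) \<le> B * norm (lincomb tensor_pair u)"
proof -
  let ?u = "push prod.swap u"
  have u': "?u \<in> fin_supp_on (K \<times> H)" by (rule push_fin_supp[OF u]) auto
  have "norm (lincomb (\<lambda>(x, y). tensor (V x) y) ?u) \<le> B * norm (lincomb tensor_pair ?u)"
    by (rule norm_lincomb_tensor_left[OF V B u'])
  moreover have "norm (lincomb (\<lambda>(x, y). tensor x (V y)) u) = norm (lincomb (\<lambda>(x, y). tensor (V x) y) ?u)"
    using norm_lincomb_tensor_swap[OF u, of "\<lambda>x. x" V]
    by (simp add: lincomb_push[OF u] case_prod_beta')
  moreover have "norm (lincomb tensor_pair u) = norm (lincomb tensor_pair ?u)"
    using norm_lincomb_tensor_swap[OF u, of "\<lambda>x. x" "\<lambda>x. x"]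
    by (simp add: lincomb_push[OF u] case_prod_beta' tensor_pair_def)
  ultimately show ?thesis by simp
qed

lemma norm_lincomb_tensor:
  assumes U: "linear_op_on H U" "csubspace H" "\<And>x. x \<in> H \<Longrightarrow> norm (U x) \<le> B * norm x" "0 \<le> B"
    and V: "linear_op_on K V" "csubspace K" "\<And>x. x \<in> K \<Longrightarrow> norm (V x) \<le> C * norm x" "0 \<le> C"
    and u: "u \<in> fin_supp_on (H \<times> K)"
  shows "norm (lincomb (\<lambda>(x, y). tensor (U x) (V y)) u) \<le> (C * B) * norm (lincomb tensor_pair u)"
proof -
  let ?u = "push (\<lambda>(x, y). (U x, y)) u"
  have u': "?u \<in> fin_supp_on (H \<times> K)"
    by (rule push_fin_supp[OF u]) (auto intro: linear_op_onD(1)[OF U(1)])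
  have "norm (lincomb (\<lambda>(x, y). tensor x (V y)) ?u) \<le> C * norm (lincomb tensor_pair ?u)"
    by (rule norm_lincomb_tensor_right[OF V u'])
  also have "\<dots> \<le> C * (B * norm (lincomb tensor_pair u))"
    using norm_lincomb_tensor_left[OF U u] V(4)
    by (intro mult_left_mono) (simp_all add: lincomb_push[OF u] case_prod_beta' tensor_pair_def)
  finally show ?thesis by (simp add: lincomb_push[OF u] case_prod_beta' mult.assoc)
qed

section \<open>Tensor products of operators and of actions\<close>

definition tensor_space :: "'i::infinite ell2 set \<Rightarrow> 'i ell2 set \<Rightarrow> 'i ell2 set" where
  "tensor_space H K = closure (cspan (tensor_pair ` (H \<times> K)))"

lemma closed_csubspace_tensor_space: "closed_csubspace (tensor_space H K)"
  unfolding tensor_space_def by (rule closed_csubspace_closure_cspan)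

lemma csubspace_tensor_space: "csubspace (tensor_space H K)"
  using closed_csubspace_tensor_space unfolding closed_csubspace_def by auto

lemma tensor_in_space: "x \<in> H \<Longrightarrow> y \<in> K \<Longrightarrow> tensor x y \<in> tensor_space H K"
  unfolding tensor_space_def by (rule in_closure_cspan) (auto simp: tensor_pair_def)

text \<open>For bounded \<open>U\<close> and \<open>V\<close> the choice is justified by
  \<open>bounded_extension\<close>, and the operator is then determined on
  \<open>tensor_space H K\<close> by its values on elementary tensors.\<close>

definition tensor_op ::
  "'i::infinite ell2 set \<Rightarrow> 'i ell2 set \<Rightarrow> ('i ell2 \<Rightarrow> 'i ell2) \<Rightarrow> ('i ell2 \<Rightarrow> 'i ell2) \<Rightarrow> 'i ell2 \<Rightarrow> 'i ell2" where
  "tensor_op H K U V = (SOME X. bounded_op_on (tensor_space H K) X \<and> (\<forall>x\<in>H. \<forall>y\<in>K. X (tensor x y) = tensor (U x) (V y)))"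

lemma tensor_op:
  assumes "csubspace H" "csubspace K" "bounded_op_on H U" "bounded_op_on K V"
  shows "bounded_op_on (tensor_space H K) (tensor_op H K U V)"
    "x \<in> H \<Longrightarrow> y \<in> K \<Longrightarrow> tensor_op H K U V (tensor x y) = tensor (U x) (V y)"
proof -
  obtain B where B: "0 \<le> B" "\<And>x. x \<in> H \<Longrightarrow> norm (U x) \<le> B * norm x" using bounded_op_onE[OF assms(3)] by metis
  obtain C where C: "0 \<le> C" "\<And>x. x \<in> K \<Longrightarrow> norm (V x) \<le> C * norm x" using bounded_op_onE[OF assms(4)] by metis
  have lin: "linear_op_on H U" "linear_op_on K V" using assms by (auto simp: bounded_op_on_def)
  have est: "norm (lincomb (\<lambda>(x, y). tensor (U x) (V y)) u) \<le> (C * B) * norm (lincomb tensor_pair u)"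
    if u: "u \<in> fin_supp_on (H \<times> K)" for u
    by (rule norm_lincomb_tensor[OF lin(1) assms(1) B(2,1) lin(2) assms(2) C(2,1) u])
  have "\<exists>X. linear_op_on (tensor_space H K) X \<and> (\<forall>p\<in>H \<times> K. X (tensor_pair p) = (case p of (x, y) \<Rightarrow> tensor (U x) (V y)))
      \<and> (\<forall>f\<in>tensor_space H K. norm (X f) \<le> (C * B) * norm f)"
    unfolding tensor_space_def
  proof (rule bounded_extension[OF est])
    fix p assume "p \<in> H \<times> K"
    then show "(case p of (x, y) \<Rightarrow> tensor (U x) (V y)) \<in> closure (cspan (tensor_pair ` (H \<times> K)))"
      using linear_op_onD(1)[OF lin(1)] linear_op_onD(1)[OF lin(2)]
      by (auto intro!: tensor_in_space[unfolded tensor_space_def])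
  qed
  then have "\<exists>X. bounded_op_on (tensor_space H K) X \<and> (\<forall>x\<in>H. \<forall>y\<in>K. X (tensor x y) = tensor (U x) (V y))"
    unfolding bounded_op_on_def by (auto simp: tensor_pair_def)
  from someI_ex[OF this, folded tensor_op_def]
  show "bounded_op_on (tensor_space H K) (tensor_op H K U V)"
    "x \<in> H \<Longrightarrow> y \<in> K \<Longrightarrow> tensor_op H K U V (tensor x y) = tensor (U x) (V y)" by auto
qed

lemma norm_tensor_op_le:
  assumes "csubspace H" "csubspace K" "bounded_op_on H U" "bounded_op_on K V"
    and B: "\<And>x. x \<in> H \<Longrightarrow> norm (U x) \<le> B * norm x" "0 \<le> B"
    and C: "\<And>x. x \<in> K \<Longrightarrow> norm (V x) \<le> C * norm x" "0 \<le> C"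
    and f: "f \<in> tensor_space H K"
  shows "norm (tensor_op H K U V f) \<le> (C * B) * norm f"
proof (rule bounded_op_on_bound_closure[OF tensor_op(1)[OF assms(1-4)] csubspace_tensor_space _ _ _ f])
  show "cspan (tensor_pair ` (H \<times> K)) \<subseteq> tensor_space H K"
    unfolding tensor_space_def by (rule closure_subset)
  show "tensor_space H K \<subseteq> closure (cspan (tensor_pair ` (H \<times> K)))" by (simp add: tensor_space_def)
  fix g assume "g \<in> cspan (tensor_pair ` (H \<times> K))"
  then obtain u where u: "u \<in> fin_supp_on (H \<times> K)" "g = lincomb tensor_pair u"
    unfolding cspan_eq_lincomb by auto
  have lin: "linear_op_on H U" "linear_op_on K V" using assms by (auto simp: bounded_op_on_def)
  have linT: "linear_op_on (tensor_space H K) (tensor_op H K U V)"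
    using tensor_op(1)[OF assms(1-4)] by (simp add: bounded_op_on_def)
  have "tensor_op H K U V g = lincomb (\<lambda>p. tensor_op H K U V (tensor_pair p)) u"
    unfolding u(2) by (rule lincomb_linear_op(1)[OF linT csubspace_tensor_space u(1)])
      (auto simp: tensor_pair_def intro: tensor_in_space)
  also have "\<dots> = lincomb (\<lambda>(x, y). tensor (U x) (V y)) u"
    by (rule lincomb_cong[OF u(1)]) (auto simp: tensor_pair_def tensor_op(2)[OF assms(1-4)])
  finally show "norm (tensor_op H K U V g) \<le> C * B * norm g"
    using norm_lincomb_tensor[OF lin(1) assms(1) B lin(2) assms(2) C u(1)] u(2) by simp
qed

lemma bounded_op_on_compose:
  assumes "bounded_op_on V S" "bounded_op_on V T" shows "bounded_op_on V (\<lambda>x. S (T x))"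
proof -
  obtain B where B: "0 \<le> B" "\<And>x. x \<in> V \<Longrightarrow> norm (S x) \<le> B * norm x" using bounded_op_onE[OF assms(1)] by metis
  obtain C where C: "0 \<le> C" "\<And>x. x \<in> V \<Longrightarrow> norm (T x) \<le> C * norm x" using bounded_op_onE[OF assms(2)] by metis
  have lin: "linear_op_on V S" "linear_op_on V T" using assms by (auto simp: bounded_op_on_def)
  have "norm (S (T x)) \<le> (B * C) * norm x" if x: "x \<in> V" for x
    using B(2)[OF linear_op_onD(1)[OF lin(2) x]] mult_left_mono[OF C(2)[OF x] B(1)] by simp
  then show ?thesis using lin by (auto simp: bounded_op_on_def linear_op_on_def)
qed

lemma bounded_op_on_ident: "bounded_op_on V (\<lambda>x. x)"
  by (auto simp: bounded_op_on_def linear_op_on_def intro!: exI[of _ 1])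

text \<open>The passage to the closure is made twice, once for each argument, because the induction
  treats one vector at a time.\<close>

lemma adjoint_closure_cspan:
  assumes X: "bounded_op_on V X" and Y: "bounded_op_on V Y" and V: "V = closure (cspan S)"
    and adj: "\<And>s t. s \<in> S \<Longrightarrow> t \<in> S \<Longrightarrow> cinner (X s) t = cinner s (Y t)"
    and f: "f \<in> V" and g: "g \<in> V"
  shows "cinner (X f) g = cinner f (Y g)"
proof -
  have cs: "csubspace V" unfolding V by (rule csubspace_closure[OF csubspace_cspan])
  have lin: "linear_op_on V X" "linear_op_on V Y" using X Y by (auto simp: bounded_op_on_def)
  note X0 = linear_op_on_0[OF lin(1) cs] and Y0 = linear_op_on_0[OF lin(2) cs]
  have SV: "s \<in> V" if "s \<in> S" for s using in_closure_cspan[OF that] V by simp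
  have sub: "cspan S \<subseteq> V" unfolding V by (rule closure_subset)
  have 1: "g \<in> V \<and> cinner (X s) g = cinner s (Y g)" if s: "s \<in> S" and g: "g \<in> closure (cspan S)" for s g
    using g
  proof (induction rule: closure_cspan_induct)
    case (lim h x)
    then have x: "x \<in> V" unfolding V by (auto simp: closure_sequential)
    have "(\<lambda>n. cinner (X s) (h n)) \<longlonglongrightarrow> cinner (X s) x" by (intro cinner.tendsto tendsto_const lim)
    moreover have "(\<lambda>n. cinner s (Y (h n))) \<longlonglongrightarrow> cinner s (Y x)"
      using lim(1,2) sub x by (intro cinner.tendsto tendsto_const bounded_op_on_tendsto[OF Y cs]) auto
    ultimately show ?case using lim(3) x by (simp add: LIMSEQ_unique)
  qed (auto simp: adj[OF s] SV X0 Y0 csubspace_0[OF cs] csubspace_add[OF cs] csubspace_scaleC[OF cs]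
    cinner_add_right cinner_scaleC_right linear_op_onD[OF lin(2)])
  have "f \<in> V \<and> cinner (X f) g = cinner f (Y g)"
    using f[unfolded V]
  proof (induction rule: closure_cspan_induct)
    case (lim h x)
    then have x: "x \<in> V" unfolding V by (auto simp: closure_sequential)
    have "(\<lambda>n. cinner (h n) (Y g)) \<longlonglongrightarrow> cinner x (Y g)" by (intro cinner.tendsto tendsto_const lim)
    moreover have "(\<lambda>n. cinner (X (h n)) g) \<longlonglongrightarrow> cinner (X x) g"
      using lim(1,2) sub x by (intro cinner.tendsto tendsto_const bounded_op_on_tendsto[OF X cs]) auto
    ultimately show ?case using lim(3) x by (simp add: LIMSEQ_unique)
  qed (auto simp: 1[OF _ g[unfolded V]] SV X0 Y0 csubspace_0[OF cs] csubspace_add[OF cs] csubspace_scaleC[OF cs]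
    cinner_add_left cinner_scaleC_left linear_op_onD[OF lin(1)])
  then show ?thesis ..
qed

definition tensor_act ::
  "'i::infinite ell2 set \<Rightarrow> 'i ell2 set \<Rightarrow> ('a \<Rightarrow> 'i ell2 \<Rightarrow> 'i ell2) \<Rightarrow> ('b \<Rightarrow> 'i ell2 \<Rightarrow> 'i ell2) \<Rightarrow> 'a \<times> 'b \<Rightarrow> 'i ell2 \<Rightarrow> 'i ell2" where
  "tensor_act H K W W' = (\<lambda>(a, b). tensor_op H K (W a) (W' b))"

lemma tensor_act_tensor:
  assumes "star_act M j H W" "star_act M' j' K W'" "a \<in> carrier M" "b \<in> carrier M'" "x \<in> H" "y \<in> K"
  shows "tensor_act H K W W' (a, b) (tensor x y) = tensor (W a x) (W' b y)"
  unfolding tensor_act_def prod.case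
  by (rule tensor_op(2)[OF star_actD(1)[OF assms(1)] star_actD(1)[OF assms(2)]
    star_actD(2)[OF assms(1,3)] star_actD(2)[OF assms(2,4)] assms(5,6)])

text \<open>Both sides of each identity are continuous on \<open>tensor_space H K\<close>, so it is
  enough to compare them on elementary tensors, where each leg satisfies its own identity.\<close>

lemma star_act_tensor:
  assumes W: "star_act M j H W" and W': "star_act M' j' K W'" and M: "star_monoid M j" "star_monoid M' j'"
  shows "star_act (M \<times>\<times> M') (\<lambda>(a, b). (j a, j' b)) (tensor_space H K) (tensor_act H K W W')"
proof -
  let ?T = "tensor_act H K W W'" and ?V = "tensor_space H K"
  interpret M: star_monoid M j by fact
  interpret M': star_monoid M' j' by fact
  note T = tensor_act_tensor[OF W W']
  have bd: "bounded_op_on ?V (?T (a, b))" if "a \<in> carrier M" "b \<in> carrier M'" for a b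
    unfolding tensor_act_def prod.case
    by (rule tensor_op(1)[OF star_actD(1)[OF W] star_actD(1)[OF W'] star_actD(2)[OF W that(1)] star_actD(2)[OF W' that(2)]])
  show ?thesis
    unfolding star_act_def
  proof (intro conjI ballI)
    show "csubspace ?V" by (rule csubspace_tensor_space)
    fix m assume "m \<in> carrier (M \<times>\<times> M')"
    then obtain a b where m: "m = (a, b)" "a \<in> carrier M" "b \<in> carrier M'" by (auto simp: DirProd_def)
    show "bounded_op_on ?V (?T m)" unfolding m(1) by (rule bd[OF m(2,3)])
    fix u v assume u: "u \<in> ?V" and v: "v \<in> ?V"
    show "cinner (?T m u) v = cinner u (?T (case m of (a, b) \<Rightarrow> (j a, j' b)) v)"
      unfolding m(1) prod.case
    proof (rule adjoint_closure_cspan[OF bd[OF m(2,3)] bd[OF M.j_closed[OF m(2)] M'.j_closed[OF m(3)]] tensor_space_def _ u v])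
      fix s t assume "s \<in> tensor_pair ` (H \<times> K)" "t \<in> tensor_pair ` (H \<times> K)"
      then show "cinner (?T (a, b) s) t = cinner s (?T (j a, j' b) t)"
        using m by (auto simp: tensor_pair_def T M.j_closed M'.j_closed cinner_tensor
          star_actD(7)[OF W] star_actD(7)[OF W'])
    qed
  next
    fix u assume u: "u \<in> ?V"
    show "?T \<one>\<^bsub>M \<times>\<times> M'\<^esub> u = u"
      unfolding one_DirProd
      by (rule bounded_op_on_eq_closure_cspan[OF bd bounded_op_on_ident tensor_space_def _ u])
        (auto simp: tensor_pair_def T star_actD(5)[OF W] star_actD(5)[OF W'])
    fix m n assume "m \<in> carrier (M \<times>\<times> M')" "n \<in> carrier (M \<times>\<times> M')"
    then obtain a b c d where m: "m = (a, b)" "a \<in> carrier M" "b \<in> carrier M'"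
      and n: "n = (c, d)" "c \<in> carrier M" "d \<in> carrier M'" by (auto simp: DirProd_def)
    have "?T (a \<otimes>\<^bsub>M\<^esub> c, b \<otimes>\<^bsub>M'\<^esub> d) u = ?T (a, b) (?T (c, d) u)"
      by (rule bounded_op_on_eq_closure_cspan[OF bd bounded_op_on_compose[OF bd[OF m(2,3)] bd[OF n(2,3)]] tensor_space_def _ u])
        (use m n in \<open>auto simp: tensor_pair_def T star_actD[OF W] star_actD[OF W']\<close>)
    then show "?T (m \<otimes>\<^bsub>M \<times>\<times> M'\<^esub> n) u = ?T m (?T n u)"
      by (simp add: m n)
  qed
qed

lemma star_monoid_DirProd:
  assumes "star_monoid M j" "star_monoid M' j'"
  shows "star_monoid (M \<times>\<times> M') (\<lambda>(a, b). (j a, j' b))"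
proof -
  interpret M: star_monoid M j by fact
  interpret M': star_monoid M' j' by fact
  show ?thesis
    by (intro star_monoid.intro DirProd_monoid M.monoid_axioms M'.monoid_axioms, unfold_locales)
      (auto simp: M.j_closed M'.j_closed M.j_mult M'.j_mult M.j_j M'.j_j)
qed

text \<open>Unitarity says that the inverse acts as the adjoint. In this form unitary
  representations fall under the general theory of \<open>star_act\<close>.\<close>

lemma unitary_rep_iff_star_act:
  assumes G: "group G"
  shows "unitary_rep G H \<pi> \<longleftrightarrow> closed H \<and> star_act G (m_inv G) H \<pi>"
proof -
  interpret group G by fact
  show ?thesis
  proof (intro iffI conjI)
    assume u: "unitary_rep G H \<pi>"
    then have U: "\<And>s. s \<in> carrier G \<Longrightarrow> unitary_op_on H (\<pi> s)" and cs: "csubspace H"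
      and mult: "\<And>s t x. s \<in> carrier G \<Longrightarrow> t \<in> carrier G \<Longrightarrow> x \<in> H \<Longrightarrow> \<pi> (s \<otimes>\<^bsub>G\<^esub> t) x = \<pi> s (\<pi> t x)"
      unfolding unitary_rep_def closed_csubspace_def by auto
    show "closed H" using u by (auto simp: unitary_rep_def closed_csubspace_def)
    have lin: "linear_op_on H (\<pi> s)" and iso: "\<And>x y. x \<in> H \<Longrightarrow> y \<in> H \<Longrightarrow> cinner (\<pi> s x) (\<pi> s y) = cinner x y"
      and surj: "\<pi> s ` H = H" if "s \<in> carrier G" for s
      using U[OF that] unfolding unitary_op_on_def by auto
    \<comment> \<open>The operator of the identity is idempotent and surjective, hence the identity;
      \<open>unitary_rep\<close> does not ask for this directly.\<close>
    have one: "\<pi> \<one>\<^bsub>G\<^esub> x = x" if x: "x \<in> H" for x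
    proof -
      obtain y where y: "y \<in> H" "x = \<pi> \<one>\<^bsub>G\<^esub> y" using surj[OF one_closed] x by blast
      then show ?thesis using mult[OF one_closed one_closed y(1)] by simp
    qed
    show "star_act G (m_inv G) H \<pi>"
      unfolding star_act_def
    proof (intro conjI ballI)
      fix s assume s: "s \<in> carrier G"
      have "norm (\<pi> s x) = norm x" if "x \<in> H" for x by (rule norm_eq_cinnerI) (rule iso[OF s that that])
      then show "bounded_op_on H (\<pi> s)" unfolding bounded_op_on_def using lin[OF s] by (auto intro!: exI[of _ 1])
      fix x y assume x: "x \<in> H" and y: "y \<in> H"
      have "y = \<pi> s (\<pi> (inv\<^bsub>G\<^esub> s) y)" using mult[OF s inv_closed[OF s] y] s one[OF y] by simp
      then show "cinner (\<pi> s x) y = cinner x (\<pi> (inv\<^bsub>G\<^esub> s) y)"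
        using iso[OF s x linear_op_onD(1)[OF lin[OF inv_closed[OF s]] y]] by simp
    qed (use cs one mult in auto)
  next
    assume "closed H \<and> star_act G (m_inv G) H \<pi>"
    then have cl: "closed H" and W: "star_act G (m_inv G) H \<pi>" by auto
    have inv1: "\<pi> (inv\<^bsub>G\<^esub> s) (\<pi> s x) = x" "\<pi> s (\<pi> (inv\<^bsub>G\<^esub> s) x) = x" if s: "s \<in> carrier G" and x: "x \<in> H" for s x
      using star_actD(6)[OF W inv_closed[OF s] s x] star_actD(6)[OF W s inv_closed[OF s] x] s x star_actD(5)[OF W x] by auto
    show "unitary_rep G H \<pi>"
      unfolding unitary_rep_def closed_csubspace_def unitary_op_on_def
    proof (intro conjI ballI)
      fix s assume s: "s \<in> carrier G"
      show "\<pi> s ` H = H"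
        proof (intro equalityI subsetI)
        fix x assume x: "x \<in> H"
        then show "x \<in> \<pi> s ` H"
          using inv1(2)[OF s x] star_actD(4)[OF W inv_closed[OF s] x] by (intro image_eqI[of _ _ "\<pi> (inv\<^bsub>G\<^esub> s) x"]) simp
      qed (use star_actD(4)[OF W s] in auto)
      fix x y assume "x \<in> H" "y \<in> H"
      then show "cinner (\<pi> s x) (\<pi> s y) = cinner x y"
        using star_actD(7)[OF W s _ star_actD(4)[OF W s]] inv1(1)[OF s] by simp
    qed (use cl star_actD[OF W] in auto)
  qed
qed

lemma star_monoid_group: "group G \<Longrightarrow> star_monoid G (m_inv G)"
proof -
  assume "group G"
  then interpret group G .
  show ?thesis by unfold_locales (auto simp: inv_mult_group)
qed


section \<open>Representations of C*-algebras\<close>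

lemma (in star_algebra) star_monoid: "star_monoid A (star A)"
  by (rule star_monoid.intro[OF monoid_axioms], unfold_locales) (auto simp: star_closed star_mult star_star)

lemma cstar_rep_star_act: "cstar_rep A H \<pi> \<Longrightarrow> star_act A (star A) H \<pi>"
  unfolding cstar_rep_def star_act_def closed_csubspace_def by auto

lemma cstar_repD:
  assumes "cstar_rep A H \<pi>" "\<xi> \<in> H" "a \<in> carrier A"
  shows "b \<in> carrier A \<Longrightarrow> \<pi> (a \<oplus>\<^bsub>A\<^esub> b) \<xi> = \<pi> a \<xi> + \<pi> b \<xi>" "\<pi> (c \<odot>\<^bsub>A\<^esub> a) \<xi> = scaleC c (\<pi> a \<xi>)"
  using assms by (auto simp: cstar_rep_def)

text \<open>The argument of \<open>star_hom_contractive\<close> for a single vector: its vector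
  functional has bounded left multiplications because each \<open>\<pi> x\<close> is a bounded
  operator, and \<open>pos_functionalI_bounded\<close> replaces the bounds by the norm.\<close>

lemma cstar_rep_contractive:
  assumes "op_cstar A" and \<pi>: "cstar_rep A H \<pi>" and a: "a \<in> carrier A" and \<xi>: "\<xi> \<in> H"
  shows "norm (\<pi> a \<xi>) \<le> nrm A a * norm \<xi>"
proof -
  interpret A: op_cstar A by fact
  note W = cstar_rep_star_act[OF \<pi>]
  note WD = star_actD[OF W] and piD = cstar_repD[OF \<pi> \<xi>]
  define \<psi> where "\<psi> x = cinner (\<pi> x \<xi>) \<xi>" for x
  have sq: "\<psi> (star A x \<otimes>\<^bsub>A\<^esub> x) = of_real ((norm (\<pi> x \<xi>))\<^sup>2)" if x: "x \<in> carrier A" for x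
    unfolding \<psi>_def using x WD(7)[OF A.star_closed[OF x] WD(4)[OF x \<xi>] \<xi>]
    by (simp add: WD(6) A.star_closed \<xi> A.star_star cinner_self)
  have "cinner \<xi> (\<pi> (star A x) \<xi>) = cinner (\<pi> x \<xi>) \<xi>" if "x \<in> carrier A" for x
    using WD(7)[OF that \<xi> \<xi>] by simp
  then have herm: "\<psi> (star A x) = cnj (\<psi> x)" if "x \<in> carrier A" for x
    unfolding \<psi>_def using that cinner_commute[of "\<pi> (star A x) \<xi>" \<xi>] by simp
  interpret \<psi>: pos_functional_form A \<psi>
    by unfold_locales (auto simp: \<psi>_def piD cinner_add_left cinner_scaleC_left herm[unfolded \<psi>_def] sq[unfolded \<psi>_def])
  have q: "\<psi>.q x = (norm (\<pi> x \<xi>))\<^sup>2" if "x \<in> carrier A" for x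
    using sq[OF that] by (simp add: \<psi>.q_def \<psi>.form_def)
  have pf: "pos_functional A \<psi>"
  proof (rule A.pos_functionalI_bounded[OF \<psi>.pos_functional_form_axioms])
    fix x assume x: "x \<in> carrier A"
    obtain B where B: "0 \<le> B" "\<And>u. u \<in> H \<Longrightarrow> norm (\<pi> x u) \<le> B * norm u"
      using bounded_op_onE[OF WD(2)[OF x]] by metis
    have "\<psi>.q (x \<otimes>\<^bsub>A\<^esub> y) \<le> B\<^sup>2 * \<psi>.q y" if y: "y \<in> carrier A" for y
      using power_mono[OF B(2)[OF WD(4)[OF y \<xi>]], of 2] x y
      by (simp add: q WD(6) \<xi> power_mult_distrib)
    then show "\<exists>C. \<forall>y\<in>carrier A. \<psi>.q (x \<otimes>\<^bsub>A\<^esub> y) \<le> C * \<psi>.q y" by blast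
  qed
  have "(norm (\<pi> a \<xi>))\<^sup>2 \<le> (nrm A a * norm \<xi>)\<^sup>2"
    using A.pos_functional_bound[OF pf a A.one_closed] a by (simp add: q WD(5) \<xi> power_mult_distrib)
  then show ?thesis by (rule power2_le_imp_le) (use A.nrm_nonneg[OF a] in simp)
qed

context star_monoid begin

lemma group_algebra_op_linear:
  "x \<in> fs \<Longrightarrow> y \<in> fs \<Longrightarrow> group_algebra_op W (\<lambda>t. x t + y t) u = group_algebra_op W x u + group_algebra_op W y u"
  "x \<in> fs \<Longrightarrow> group_algebra_op W (\<lambda>t. c * x t) u = scaleC c (group_algebra_op W x u)"
  "group_algebra_op W (delta s) u = W s u"
  unfolding group_algebra_op_lincomb by (simp_all add: lincomb_add lincomb_scale lincomb_delta)

lemma fs_induct [consumes 1, case_names zero delta add scale]: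
  assumes x: "x \<in> fs" and P0: "P (\<lambda>_. 0)" and Pd: "\<And>s. s \<in> carrier M \<Longrightarrow> P (delta s)"
    and Pa: "\<And>x y. x \<in> fs \<Longrightarrow> y \<in> fs \<Longrightarrow> P x \<Longrightarrow> P y \<Longrightarrow> P (\<lambda>t. x t + y t)"
    and Ps: "\<And>c x. x \<in> fs \<Longrightarrow> P x \<Longrightarrow> P (\<lambda>t. c * x t)"
  shows "P x"
proof -
  have "\<forall>x\<in>fs. {s. x s \<noteq> 0} \<subseteq> F \<longrightarrow> P x" if "finite F" for F
    using that
  proof (induction F rule: finite_induct)
    case empty
    have "x = (\<lambda>_. 0)" if "{s. x s \<noteq> 0} \<subseteq> {}" for x :: "'a \<Rightarrow> complex" using that by auto
    then show ?case using P0 by blast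
  next
    case (insert a F)
    show ?case
    proof (intro ballI impI)
      fix x assume x: "x \<in> fs" "{s. x s \<noteq> 0} \<subseteq> insert a F"
      show "P x"
      proof (cases "x a = 0")
        case True
        then show ?thesis using x insert by (metis (mono_tags, lifting) mem_Collect_eq subset_insert)
      next
        case False
        then have a: "a \<in> carrier M" using x(1) by (rule fin_supp_onD(2)[rotated])
        define y where "y = (\<lambda>t. if t = a then 0 else x t)"
        have y: "y \<in> fs" "{s. y s \<noteq> 0} \<subseteq> F"
          using x by (auto simp: y_def fin_supp_on_def elim: rev_finite_subset)
        have d: "(\<lambda>t. x a * delta a t) \<in> fs" by (intro fin_supp_on_scale fin_supp_on_delta a)
        have "P (\<lambda>t. x a * delta a t + y t)"
          using insert.IH y Ps[OF fin_supp_on_delta[OF a] Pd[OF a]] by (intro Pa d y(1)) auto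
        moreover have "(\<lambda>t. x a * delta a t + y t) = x" by (auto simp: y_def delta_def)
        ultimately show ?thesis by simp
      qed
    qed
  qed
  then show ?thesis using x by (auto simp: fin_supp_on_def)
qed

text \<open>For a fixed vector the estimate turns Cauchy sequences of algebra elements into Cauchy
  sequences of vectors. The limits define the representation, and its algebraic axioms are
  identities that pass to the limit.\<close>

lemma star_act_extension:
  assumes P: "pre_cstar (monoid_star_algebra M j N)" and W: "star_act M j V W" and V: "closed V"
    and N: "\<And>x u. x \<in> fs \<Longrightarrow> u \<in> V \<Longrightarrow> norm (group_algebra_op W x u) \<le> N x * norm u"
  defines "C \<equiv> completion (monoid_star_algebra M j N)"
  shows "\<exists>\<Theta>. cstar_rep C V \<Theta>
    \<and> (\<forall>x\<in>fs. \<forall>u\<in>V. \<Theta> (completion_emb (monoid_star_algebra M j N) x) u = group_algebra_op W x u)"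
proof -
  let ?P = "monoid_star_algebra M j N"
  interpret P: pre_cstar ?P by fact
  note WD = star_actD[OF W]
  note op = star_act_op[OF W]
  have fsX: "X n \<in> fs" if "X \<in> cauchy_seqs ?P" for X n
    using P.cauchy_seqsD[OF that] by (simp add: monoid_star_algebra_sel)
  have diff: "norm (group_algebra_op W x u - group_algebra_op W y u) \<le> N (x \<ominus>\<^bsub>?P\<^esub> y) * norm u"
    if "x \<in> fs" "y \<in> fs" "u \<in> V" for x y u
  proof -
    have eq: "x \<ominus>\<^bsub>?P\<^esub> y = (\<lambda>t. x t + (-1) * y t)"
      using that P.minus_eq_smult[of x y] by (simp add: monoid_star_algebra_sel)
    have "group_algebra_op W (x \<ominus>\<^bsub>?P\<^esub> y) u = group_algebra_op W x u - group_algebra_op W y u"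
      unfolding eq using that fin_supp_on_scale[OF that(2), of "-1"]
      by (subst group_algebra_op_linear(1)) (simp_all only: group_algebra_op_linear(2) scaleC.minus_left scaleC_one, simp)
    then show ?thesis
      using N[of "x \<ominus>\<^bsub>?P\<^esub> y" u] that fin_supp_on_add[OF that(1) fin_supp_on_scale[OF that(2), of "-1"]] eq by simp
  qed
  define \<Theta> where "\<Theta> U u = lim (\<lambda>n. group_algebra_op W (cauchy_rep U n) u)" for U u
  have lim: "(\<lambda>n. group_algebra_op W (X n) u) \<longlonglongrightarrow> \<Theta> (cauchy_class ?P X) u"
    if X: "X \<in> cauchy_seqs ?P" and u: "u \<in> V" for X u
  proof -
    let ?X = "cauchy_rep (cauchy_class ?P X)"
    note R = P.cauchy_rep_class[OF X]
    have "Cauchy (\<lambda>n. group_algebra_op W (?X n) u)"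
    proof (rule metric_CauchyI)
      fix e :: real assume e: "0 < e"
      define d where "d = e / (norm u + 1)"
      have d: "0 < d" using e by (simp add: d_def add_nonneg_pos)
      obtain K where K: "\<And>m n. K \<le> m \<Longrightarrow> K \<le> n \<Longrightarrow> nrm ?P (?X m \<ominus>\<^bsub>?P\<^esub> ?X n) < d"
        using P.cauchy_seqsE[OF R(1) d] by metis
      have "dist (group_algebra_op W (?X m) u) (group_algebra_op W (?X n) u) < e" if mn: "K \<le> m" "K \<le> n" for m n
      proof -
        have "dist (group_algebra_op W (?X m) u) (group_algebra_op W (?X n) u) \<le> N (?X m \<ominus>\<^bsub>?P\<^esub> ?X n) * norm u"
          unfolding dist_norm by (rule diff[OF fsX[OF R(1)] fsX[OF R(1)] u])
        also have "\<dots> \<le> d * norm u"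
          using K[OF mn] by (intro mult_right_mono) (auto simp: monoid_star_algebra_sel)
        also have "\<dots> < d * (norm u + 1)" using d by (intro mult_strict_left_mono) auto
        also have "\<dots> = e"
        proof -
          have "norm u + 1 \<noteq> 0" using norm_ge_zero[of u] by linarith
          then show ?thesis by (simp add: d_def)
        qed
        finally show ?thesis .
      qed
      then show "\<exists>K. \<forall>m\<ge>K. \<forall>n\<ge>K. dist (group_algebra_op W (?X m) u) (group_algebra_op W (?X n) u) < e" by blast
    qed
    then have "(\<lambda>n. group_algebra_op W (?X n) u) \<longlonglongrightarrow> \<Theta> (cauchy_class ?P X) u"
      unfolding \<Theta>_def by (simp add: Cauchy_convergent_iff convergent_LIMSEQ_iff)
    moreover have "(\<lambda>n. group_algebra_op W (X n) u - group_algebra_op W (?X n) u) \<longlonglongrightarrow> 0"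
    proof (rule Lim_null_comparison)
      show "\<forall>\<^sub>F n in sequentially. norm (group_algebra_op W (X n) u - group_algebra_op W (?X n) u)
          \<le> N (X n \<ominus>\<^bsub>?P\<^esub> ?X n) * norm u"
        by (simp add: diff[OF fsX[OF X] fsX[OF R(1)] u])
      show "(\<lambda>n. N (X n \<ominus>\<^bsub>?P\<^esub> ?X n) * norm u) \<longlonglongrightarrow> 0"
        using R(2) unfolding P.null_diff_def monoid_star_algebra_sel by (rule tendsto_mult_left_zero)
    qed
    ultimately show ?thesis using tendsto_add by fastforce
  qed
  have emb: "\<Theta> (completion_emb ?P x) u = group_algebra_op W x u" if "x \<in> fs" "u \<in> V" for x u
    using lim[OF P.cauchy_seqs_const, of x u] that
    by (simp add: completion_emb_def LIMSEQ_const_iff monoid_star_algebra_sel)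
  have bound: "norm (\<Theta> (cauchy_class ?P X) u) \<le> nrm C (cauchy_class ?P X) * norm u"
    if X: "X \<in> cauchy_seqs ?P" and u: "u \<in> V" for X u
    by (rule LIMSEQ_le[OF tendsto_norm[OF lim[OF X u]] tendsto_mult_right[OF P.completion_nrm[OF X]], folded C_def])
      (use N[OF fsX[OF X] u] in \<open>auto simp: monoid_star_algebra_sel\<close>)
  have cl: "\<Theta> (cauchy_class ?P X) u \<in> V" if X: "X \<in> cauchy_seqs ?P" and u: "u \<in> V" for X u
    by (rule closed_sequentially[OF V op(3)[OF fsX[OF X] u] lim[OF X u]])
  have "cstar_rep C V \<Theta>"
    unfolding cstar_rep_def
  proof (intro conjI ballI allI)
    show "closed_csubspace V" using V WD(1) by (simp add: closed_csubspace_def)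
    show "\<Theta> \<one>\<^bsub>C\<^esub> u = u" if "u \<in> V" for u
      using emb[OF fin_supp_on_delta[OF one_closed] that] WD(5)[OF that]
      by (simp add: C_def P.completion_one completion_emb_def monoid_star_algebra_sel group_algebra_op_linear)
  next
    fix U assume "U \<in> carrier C"
    then obtain X where X: "X \<in> cauchy_seqs ?P" "U = cauchy_class ?P X"
      unfolding C_def P.completion_carrier by auto
    note x = fsX[OF X(1)]
    show "bounded_op_on V (\<Theta> U)"
      unfolding bounded_op_on_def linear_op_on_def
    proof (intro conjI ballI allI)
      show "\<exists>B. \<forall>u\<in>V. norm (\<Theta> U u) \<le> B * norm u" using bound[OF X(1)] X(2) by blast
      fix u assume u: "u \<in> V"
      show "\<Theta> U u \<in> V" unfolding X(2) by (rule cl[OF X(1) u])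
      show "\<Theta> U (scaleC c u) = scaleC c (\<Theta> U u)" for c
        by (rule LIMSEQ_unique[OF lim[OF X(1) csubspace_scaleC[OF WD(1) u], folded X(2)]])
          (simp add: linear_op_onD(3)[OF op(2)[OF x] u] scaleC.tendsto[OF tendsto_const lim[OF X(1) u, folded X(2)]])
      fix v assume v: "v \<in> V"
      show "\<Theta> U (u + v) = \<Theta> U u + \<Theta> U v"
        by (rule LIMSEQ_unique[OF lim[OF X(1) csubspace_add[OF WD(1) u v], folded X(2)]])
          (simp add: linear_op_onD(2)[OF op(2)[OF x] u v] tendsto_add[OF lim[OF X(1) u, folded X(2)] lim[OF X(1) v, folded X(2)]])
    qed
    fix u assume u: "u \<in> V"
    note lu = lim[OF X(1) u, folded X(2)]
    show "\<Theta> (c \<odot>\<^bsub>C\<^esub> U) u = scaleC c (\<Theta> U u)" for c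
    proof (rule LIMSEQ_unique)
      show "(\<lambda>n. group_algebra_op W (\<lambda>t. c * X n t) u) \<longlonglongrightarrow> \<Theta> (c \<odot>\<^bsub>C\<^esub> U) u"
        using lim[OF P.cauchy_seqs_smult[OF X(1)] u, of c]
        by (simp add: C_def X(2) P.completion_smult[OF X(1)] monoid_star_algebra_sel)
      show "(\<lambda>n. group_algebra_op W (\<lambda>t. c * X n t) u) \<longlonglongrightarrow> scaleC c (\<Theta> U u)"
        by (simp add: group_algebra_op_linear(2)[OF x] scaleC.tendsto[OF tendsto_const lu])
    qed
    fix v assume v: "v \<in> V"
    show "cinner (\<Theta> U u) v = cinner u (\<Theta> (star C U) v)"
    proof (rule LIMSEQ_unique)
      show "(\<lambda>n. cinner (group_algebra_op W (X n) u) v) \<longlonglongrightarrow> cinner (\<Theta> U u) v"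
        by (rule cinner.tendsto[OF lu tendsto_const])
      have "(\<lambda>n. group_algebra_op W (push j (\<lambda>s. cnj (X n s))) v) \<longlonglongrightarrow> \<Theta> (star C U) v"
        using lim[OF P.cauchy_seqs_star[OF X(1)] v]
        by (simp add: C_def X(2) P.completion_star[OF X(1)] monoid_star_algebra_sel)
      from cinner.tendsto[OF tendsto_const this, of u]
      show "(\<lambda>n. cinner (group_algebra_op W (X n) u) v) \<longlonglongrightarrow> cinner u (\<Theta> (star C U) v)"
        by (simp add: star_act_adjoint[OF W x u v])
    qed
  next
    fix U U' u assume "U \<in> carrier C" "U' \<in> carrier C" and u: "u \<in> V"
    then obtain X Y where X: "X \<in> cauchy_seqs ?P" "U = cauchy_class ?P X"
      and Y: "Y \<in> cauchy_seqs ?P" "U' = cauchy_class ?P Y"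
      unfolding C_def P.completion_carrier by auto
    note x = fsX[OF X(1)] and y = fsX[OF Y(1)]
    note lu = lim[OF X(1) u, folded X(2)] and lu' = lim[OF Y(1) u, folded Y(2)]
    show "\<Theta> (U \<oplus>\<^bsub>C\<^esub> U') u = \<Theta> U u + \<Theta> U' u"
    proof (rule LIMSEQ_unique)
      show "(\<lambda>n. group_algebra_op W (\<lambda>t. X n t + Y n t) u) \<longlonglongrightarrow> \<Theta> (U \<oplus>\<^bsub>C\<^esub> U') u"
        using lim[OF P.cauchy_seqs_add[OF X(1) Y(1)] u]
        by (simp add: C_def X(2) Y(2) P.completion_add[OF X(1) Y(1)] monoid_star_algebra_sel)
      show "(\<lambda>n. group_algebra_op W (\<lambda>t. X n t + Y n t) u) \<longlonglongrightarrow> \<Theta> U u + \<Theta> U' u"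
        by (simp add: group_algebra_op_linear(1)[OF x y] tendsto_add[OF lu lu'])
    qed
    have w: "\<Theta> U' u \<in> V" unfolding Y(2) by (rule cl[OF Y(1) u])
    note lw = lim[OF X(1) w, folded X(2)]
    show "\<Theta> (U \<otimes>\<^bsub>C\<^esub> U') u = \<Theta> U (\<Theta> U' u)"
    proof (rule LIMSEQ_unique)
      show "(\<lambda>n. group_algebra_op W (convolve (\<otimes>) (X n) (Y n)) u) \<longlonglongrightarrow> \<Theta> (U \<otimes>\<^bsub>C\<^esub> U') u"
        using lim[OF P.cauchy_seqs_mult[OF X(1) Y(1)] u]
        by (simp add: C_def X(2) Y(2) P.completion_mult[OF X(1) Y(1)] monoid_star_algebra_sel)
      \<comment> \<open>In a product both the operator and the vector vary; replacing the vector by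
        its limit changes nothing asymptotically, because the norms \<open>N (X n)\<close>
        converge.\<close>
      have d: "(\<lambda>n. group_algebra_op W (X n) (group_algebra_op W (Y n) u) - group_algebra_op W (X n) (\<Theta> U' u)) \<longlonglongrightarrow> 0"
      proof (rule Lim_null_comparison)
        show "\<forall>\<^sub>F n in sequentially. norm (group_algebra_op W (X n) (group_algebra_op W (Y n) u) - group_algebra_op W (X n) (\<Theta> U' u))
            \<le> N (X n) * norm (group_algebra_op W (Y n) u - \<Theta> U' u)"
          using N[OF x csubspace_diff[OF WD(1) op(3)[OF y u] w]]
          by (simp add: linear_op_on_diff[OF op(2)[OF x] WD(1) op(3)[OF y u] w])
        show "(\<lambda>n. N (X n) * norm (group_algebra_op W (Y n) u - \<Theta> U' u)) \<longlonglongrightarrow> 0"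
          using tendsto_mult[OF P.completion_nrm[OF X(1)] tendsto_norm_zero[OF LIM_zero[OF lu']]]
          by (simp add: monoid_star_algebra_sel)
      qed
      show "(\<lambda>n. group_algebra_op W (convolve (\<otimes>) (X n) (Y n)) u) \<longlonglongrightarrow> \<Theta> U (\<Theta> U' u)"
        using tendsto_add[OF d lw] by (simp add: star_act_mult[OF W x y u])
    qed
  qed
  then show ?thesis using emb by blast
qed

text \<open>The bound \<open>D\<close> for \<open>y\<close> holds for its adjoint as well, so the
  composite has the bound \<open>D\<close> squared.\<close>

lemma star_act_square_bound:
  assumes W: "star_act M j V W" and y: "y \<in> fs" and D: "0 \<le> D"
    and bd: "\<And>u. u \<in> V \<Longrightarrow> norm (group_algebra_op W y u) \<le> D * norm u" and u: "u \<in> V"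
  shows "norm (group_algebra_op W (convolve (mult M) (push j (\<lambda>s. cnj (y s))) y) u) \<le> D\<^sup>2 * norm u"
proof -
  let ?s = "push j (\<lambda>s. cnj (y s))"
  note s = star_closed[OF y]
  have "norm (group_algebra_op W ?s g) \<le> D * norm g" if g: "g \<in> V" for g
  proof (rule norm_le_of_cinner)
    let ?w = "group_algebra_op W ?s g"
    have w: "?w \<in> V" by (rule star_act_op(3)[OF W s g])
    have "cmod (cinner ?w ?w) = cmod (cinner (group_algebra_op W y ?w) g)"
      unfolding star_act_adjoint[OF W y w g] ..
    also have "\<dots> \<le> norm (group_algebra_op W y ?w) * norm g" by (rule cmod_cinner_le)
    also have "\<dots> \<le> D * norm ?w * norm g" by (intro mult_right_mono bd w) simp
    finally show "cmod (cinner ?w ?w) \<le> D * norm g * norm ?w" by (simp add: mult_ac)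
  qed (use D in simp)
  from this[OF star_act_op(3)[OF W y u]] mult_left_mono[OF bd[OF u] D]
  show ?thesis unfolding star_act_mult[OF W s y u] by (simp add: power2_eq_square mult.assoc)
qed

end

section \<open>Weak containment and tensor products\<close>

text \<open>Otherwise the powers of \<open>a / b\<close> eventually exceed \<open>C\<close>. The
  exponents are powers of two because the elements to be compared arise by repeatedly multiplying an
  element by its adjoint.\<close>

lemma le_of_power_two_power_le:
  assumes "0 \<le> (a::real)" "0 \<le> b" "\<And>n. a ^ (2 ^ n) \<le> C * b ^ (2 ^ n)"
  shows "a \<le> b"
proof (rule ccontr)
  assume ab: "\<not> a \<le> b"
  show False
  proof (cases "b = 0")
    case True then show False using assms(3)[of 0] ab by simp
  next
    case False
    then have b: "0 < b" using assms by simp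
    then have r: "1 < a / b" using ab by simp
    obtain n where n: "C < (a / b) ^ n" using real_arch_pow[OF r] by auto
    have "(a / b) ^ n \<le> (a / b) ^ (2 ^ n)" using r by (intro power_increasing) auto
    also have "\<dots> \<le> C" using assms(3)[of n] b by (simp add: power_divide divide_le_eq)
    finally show False using n by simp
  qed
qed

text \<open>The slice map \<open>id \<otimes> c\<close> of tensor products, on formal
  combinations.\<close>

definition slice :: "('b \<Rightarrow> complex) \<Rightarrow> ('a \<times> 'b \<Rightarrow> complex) \<Rightarrow> 'a \<Rightarrow> complex" where
  "slice c z = push fst (\<lambda>p. z p * c (snd p))"

lemma slice_fin_supp: "z \<in> fin_supp_on (S \<times> R) \<Longrightarrow> slice c z \<in> fin_supp_on S"
  unfolding slice_def
  by (rule push_fin_supp[of _ "S \<times> R"]) (auto simp: fin_supp_on_def elim!: rev_finite_subset)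

lemma lincomb_slice:
  assumes "z \<in> fin_supp_on (S \<times> R)"
  shows "lincomb v (slice c z) = lincomb (\<lambda>(s, r). scaleC (c r) (v s)) z"
proof -
  have f: "finite {p. z p \<noteq> 0}" using assms by (simp add: fin_supp_on_def)
  have z: "(\<lambda>p. z p * c (snd p)) \<in> fin_supp_on (S \<times> R)"
    using assms by (auto simp: fin_supp_on_def elim!: rev_finite_subset)
  show ?thesis
    unfolding slice_def lincomb_push[OF z]
    by (subst (1 2) lincomb_superset[OF f]) (auto simp: scaleC_scaleC case_prod_beta)
qed

lemma cinner_slice:
  assumes M: "star_monoid M j" "star_monoid M' j'"
    and W: "star_act M j V W" and \<tau>: "star_act M' j' K \<tau>" and z: "z \<in> fin_supp_on (carrier M \<times> carrier M')"
    and v: "v \<in> V" "v' \<in> V" and \<eta>: "\<eta> \<in> K" "\<eta>' \<in> K"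
  shows "cinner (group_algebra_op W (slice (\<lambda>t. cinner (\<tau> t \<eta>) \<eta>') z) v) v'
    = cinner (group_algebra_op (tensor_act V K W \<tau>) z (tensor v \<eta>)) (tensor v' \<eta>')"
  unfolding group_algebra_op_lincomb lincomb_slice[OF z] cinner_lincomb
  using z by (intro sum.cong refl)
    (auto simp: fin_supp_on_def cinner_scaleC_left tensor_act_tensor[OF W \<tau> _ _ v(1) \<eta>(1)] cinner_tensor mult.commute)

text \<open>
  Matrix coefficients of \<open>\<sigma> \<otimes> \<tau>\<close> at an elementary tensor are coefficients of \<open>\<sigma>\<close> at a slice of the
  algebra element, and are therefore controlled up to a constant that depends on the vector only.
  Applying this to the powers \<open>(z* z)\<^sup>k\<close>, \<open>k = 2\<^sup>n\<close>, and taking roots removes the constant.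
\<close>

lemma tensor_act_weak_containment:
  assumes M: "star_monoid M j" "star_monoid M' j'"
    and \<sigma>: "star_act M j H \<sigma>" and \<tau>: "star_act M' j' K \<tau>"
    and R: "\<And>V W. (V, W) \<in> R \<Longrightarrow> star_act M j V W"
    and dom: "\<And>x B \<xi>. x \<in> fin_supp_on (carrier M) \<Longrightarrow> 0 \<le> B
      \<Longrightarrow> (\<And>V W v. (V, W) \<in> R \<Longrightarrow> v \<in> V \<Longrightarrow> norm (group_algebra_op W x v) \<le> B * norm v)
      \<Longrightarrow> \<xi> \<in> H \<Longrightarrow> norm (group_algebra_op \<sigma> x \<xi>) \<le> B * norm \<xi>"
    and z: "z \<in> fin_supp_on (carrier M \<times> carrier M')" and B: "0 \<le> B"
    and bd: "\<And>V W f. (V, W) \<in> R \<Longrightarrow> f \<in> tensor_space V K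
      \<Longrightarrow> norm (group_algebra_op (tensor_act V K W \<tau>) z f) \<le> B * norm f"
    and f: "f \<in> tensor_space H K"
  shows "norm (group_algebra_op (tensor_act H K \<sigma> \<tau>) z f) \<le> B * norm f"
proof -
  let ?M = "M \<times>\<times> M'" and ?j = "\<lambda>(a, b). (j a, j' b)"
  interpret D: star_monoid ?M ?j by (rule star_monoid_DirProd[OF M])
  have car: "carrier ?M = carrier M \<times> carrier M'" by (simp add: DirProd_def)
  let ?T = "tensor_act H K \<sigma> \<tau>"
  have T: "star_act ?M ?j (tensor_space H K) ?T" by (rule star_act_tensor[OF \<sigma> \<tau> M])
  have TR: "star_act ?M ?j (tensor_space V K) (tensor_act V K W \<tau>)" if "(V, W) \<in> R" for V W
    by (rule star_act_tensor[OF R[OF that] \<tau> M])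
  \<comment> \<open>Each term is multiplied from the left by its adjoint, so a bound
    \<open>B\<close> for \<open>z\<close> becomes \<open>B ^ (2 ^ n)\<close> for \<open>y n\<close>,
    without any additional constant.\<close>
  define y where "y = rec_nat z (\<lambda>_ w. convolve (mult ?M) (push ?j (\<lambda>s. cnj (w s))) w)"
  have y0: "y 0 = z" and ySuc: "y (Suc n) = convolve (mult ?M) (push ?j (\<lambda>s. cnj (y n s))) (y n)" for n
    by (simp_all add: y_def)
  have yfs: "y n \<in> fin_supp_on (carrier ?M)" for n
    by (induction n) (auto simp: y0 ySuc z car intro!: D.convolve_closed[unfolded car] D.star_closed[unfolded car])
  have ybd: "norm (group_algebra_op (tensor_act V K W \<tau>) (y n) f) \<le> B ^ (2 ^ n) * norm f"
    if "(V, W) \<in> R" "f \<in> tensor_space V K" for V W f n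
    using that(2)
  proof (induction n arbitrary: f)
    case 0 then show ?case using bd[OF that(1)] by (simp add: y0)
  next
    case (Suc n)
    have "norm (group_algebra_op (tensor_act V K W \<tau>) (y (Suc n)) f) \<le> (B ^ (2 ^ n))\<^sup>2 * norm f"
      unfolding ySuc by (rule D.star_act_square_bound[OF TR[OF that(1)] yfs _ Suc.IH Suc.prems]) (use B in simp_all)
    then show ?case by (simp add: power_mult[symmetric] mult.commute)
  qed
  have coeff: "cmod (cinner (group_algebra_op ?T w (tensor x \<eta>)) (tensor x' \<eta>')) \<le> D * (norm x * norm \<eta> * (norm x' * norm \<eta>'))"
    if w: "w \<in> fin_supp_on (carrier ?M)" and D: "0 \<le> D"
      and wbd: "\<And>V W f. (V, W) \<in> R \<Longrightarrow> f \<in> tensor_space V K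
        \<Longrightarrow> norm (group_algebra_op (tensor_act V K W \<tau>) w f) \<le> D * norm f"
      and x: "x \<in> H" "x' \<in> H" and \<eta>: "\<eta> \<in> K" "\<eta>' \<in> K" for w D x x' \<eta> \<eta>'
  proof -
    note w' = w[unfolded car]
    let ?s = "slice (\<lambda>t. cinner (\<tau> t \<eta>) \<eta>') w"
    have s: "?s \<in> fin_supp_on (carrier M)" by (rule slice_fin_supp[OF w'])
    \<comment> \<open>The vector \<open>?v\<close> itself serves as test vector in the coefficient.
      This gives an operator bound for the slice over all of \<open>R\<close>, which
      \<open>dom\<close> then carries over to \<open>\<sigma>\<close>.\<close>
    have "norm (group_algebra_op W ?s v) \<le> D * norm \<eta> * norm \<eta>' * norm v" if VW: "(V, W) \<in> R" and v: "v \<in> V" for V W v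
    proof (rule norm_le_of_cinner)
      let ?v = "group_algebra_op W ?s v"
      have v': "?v \<in> V" by (rule star_monoid.star_act_op(3)[OF M(1) R[OF VW] s v])
      have "cmod (cinner ?v ?v) \<le> norm (group_algebra_op (tensor_act V K W \<tau>) w (tensor v \<eta>)) * norm (tensor ?v \<eta>')"
        unfolding cinner_slice[OF M R[OF VW] \<tau> w' v v' \<eta>] by (rule cmod_cinner_le)
      also have "\<dots> \<le> D * norm (tensor v \<eta>) * norm (tensor ?v \<eta>')"
        by (intro mult_right_mono wbd[OF VW] tensor_in_space v \<eta>) simp
      finally show "cmod (cinner ?v ?v) \<le> D * norm \<eta> * norm \<eta>' * norm v * norm ?v"
        by (simp add: norm_tensor mult_ac)
    qed (use D in simp)
    then have "norm (group_algebra_op \<sigma> ?s x) \<le> D * norm \<eta> * norm \<eta>' * norm x"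
      using D by (intro dom[OF s _ _ x(1)]) auto
    moreover have "cmod (cinner (group_algebra_op ?T w (tensor x \<eta>)) (tensor x' \<eta>')) \<le> norm (group_algebra_op \<sigma> ?s x) * norm x'"
      unfolding cinner_slice[OF M \<sigma> \<tau> w' x \<eta>, symmetric] by (rule cmod_cinner_le)
    ultimately have "cmod (cinner (group_algebra_op ?T w (tensor x \<eta>)) (tensor x' \<eta>')) \<le> D * norm \<eta> * norm \<eta>' * norm x * norm x'"
      by (meson mult_right_mono norm_ge_zero order_trans)
    then show ?thesis by (simp add: mult_ac)
  qed
  have span: "norm (group_algebra_op ?T z f) \<le> B * norm f" if "f \<in> cspan (tensor_pair ` (H \<times> K))" for f
  proof (cases "f = 0")
    case True
    then show ?thesis using linear_op_on_0[OF D.star_act_op(2)[OF T yfs[of 0]] csubspace_tensor_space] by (simp add: y0)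
  next
    case False
    obtain u where u: "u \<in> fin_supp_on (H \<times> K)" "f = lincomb tensor_pair u"
      using \<open>f \<in> cspan _\<close> unfolding cspan_eq_lincomb by auto
    have fV: "f \<in> tensor_space H K" using \<open>f \<in> cspan _\<close> closure_subset[of "cspan (tensor_pair ` (H \<times> K))"] by (auto simp: tensor_space_def)
    let ?b = "\<lambda>p q. norm (fst p) * norm (snd p) * (norm (fst q) * norm (snd q))"
    \<comment> \<open>Collects the coefficient bounds at the finitely many elementary tensors of
      \<open>f\<close>. It depends on the presentation of \<open>f\<close> but not on
      \<open>n\<close>.\<close>
    define C where "C = (\<Sum>p | u p \<noteq> 0. \<Sum>q | u q \<noteq> 0. cmod (u p) * (cmod (u q) * ?b p q))"
    have C: "0 \<le> C" unfolding C_def by (intro sum_nonneg mult_nonneg_nonneg) auto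
    let ?q = "\<lambda>n. norm (group_algebra_op ?T (y n) f)"
    have sq: "complex_of_real ((?q n)\<^sup>2) = cinner (group_algebra_op ?T (y (Suc n)) f) f" for n
      unfolding ySuc by (rule D.star_act_square[OF T yfs fV, symmetric])
    have q1: "(?q n)\<^sup>2 \<le> ?q (Suc n) * norm f" for n
    proof -
      have "(?q n)\<^sup>2 = cmod (complex_of_real ((?q n)\<^sup>2))" by (simp only: norm_of_real abs_power2)
      also have "\<dots> \<le> ?q (Suc n) * norm f" unfolding sq by (rule cmod_cinner_le)
      finally show ?thesis .
    qed
    have q2: "(?q n)\<^sup>2 \<le> C * B ^ (2 ^ Suc n)" for n
    proof -
      let ?w = "y (Suc n)"
      have lin: "group_algebra_op ?T ?w f = lincomb (\<lambda>p. group_algebra_op ?T ?w (tensor_pair p)) u"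
        unfolding u(2) by (rule lincomb_linear_op(1)[OF D.star_act_op(2)[OF T yfs] csubspace_tensor_space u(1)])
          (auto simp: tensor_pair_def intro: tensor_in_space)
      have "(?q n)\<^sup>2 = cmod (complex_of_real ((?q n)\<^sup>2))" by (simp only: norm_of_real abs_power2)
      also have "\<dots> = cmod (\<Sum>p | u p \<noteq> 0. \<Sum>q | u q \<noteq> 0. u p * (cnj (u q) *
          cinner (group_algebra_op ?T ?w (tensor_pair p)) (tensor_pair q)))"
        unfolding sq lin by (subst u(2)) (simp only: cinner_lincomb_lincomb)
      also have "\<dots> \<le> (\<Sum>p | u p \<noteq> 0. \<Sum>q | u q \<noteq> 0. cmod (u p) * (cmod (u q) * (B ^ (2 ^ Suc n) * ?b p q)))"
      proof (intro sum_norm_le)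
        fix p q assume "p \<in> {p. u p \<noteq> 0}" "q \<in> {q. u q \<noteq> 0}"
        then have pq: "fst p \<in> H" "snd p \<in> K" "fst q \<in> H" "snd q \<in> K"
          using u(1) by (auto simp: fin_supp_on_def)
        have "cmod (cinner (group_algebra_op ?T ?w (tensor_pair p)) (tensor_pair q)) \<le> B ^ (2 ^ Suc n) * ?b p q"
          unfolding tensor_pair_def case_prod_beta
          by (rule coeff[OF yfs _ ybd pq(1,3,2,4)]) (use B in auto)
        then show "cmod (u p * (cnj (u q) * cinner (group_algebra_op ?T ?w (tensor_pair p)) (tensor_pair q)))
            \<le> cmod (u p) * (cmod (u q) * (B ^ (2 ^ Suc n) * ?b p q))"
          by (simp add: norm_mult mult_left_mono)
      qed
      also have "\<dots> = C * B ^ (2 ^ Suc n)"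
        unfolding C_def sum_distrib_right by (intro sum.cong refl) simp
      finally show ?thesis .
    qed
    \<comment> \<open>After normalisation the sequence is at least squared at every step, while
      \<open>q2\<close> lets it grow at most like a constant times
      \<open>B ^ (2 ^ n)\<close>.\<close>
    let ?r = "\<lambda>n. ?q n / norm f"
    have nf: "norm f > 0" using False by simp
    have r1: "(?r n)\<^sup>2 \<le> ?r (Suc n)" for n
      using q1[of n] nf by (simp add: power2_eq_square divide_le_eq mult.commute)
    have "?r 0 ^ (2 ^ n) \<le> ?r n" for n
    proof (induction n)
      case (Suc n)
      have "?r 0 ^ (2 ^ Suc n) = (?r 0 ^ (2 ^ n))\<^sup>2" by (simp add: power_mult[symmetric] mult.commute)
      also have "\<dots> \<le> (?r n)\<^sup>2" using Suc by (intro power_mono) auto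
      finally show ?case using r1[of n] by simp
    qed simp
    moreover have "?r n \<le> (sqrt C / norm f) * B ^ (2 ^ n)" for n
    proof -
      have "(?q n)\<^sup>2 \<le> (sqrt C * B ^ (2 ^ n))\<^sup>2"
        using q2[of n] C by (simp add: power_mult_distrib power_mult[symmetric] mult.commute)
      then have "?q n \<le> sqrt C * B ^ (2 ^ n)" by (rule power2_le_imp_le) (use B C in simp)
      then show ?thesis using nf by (simp add: field_simps)
    qed
    ultimately have "?r 0 \<le> B" using nf B by (intro le_of_power_two_power_le[of "?r 0" B "sqrt C / norm f"]) (auto intro: order_trans)
    then show ?thesis using nf by (simp add: y0 field_simps)
  qed
  show ?thesis
    by (rule bounded_op_on_bound_closure[OF D.star_act_op(1)[OF T yfs[of 0, unfolded y0]] csubspace_tensor_space _ _ span f])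
      (auto simp: tensor_space_def closure_subset[of "cspan (tensor_pair ` (H \<times> K))", THEN subsetD])
qed


section \<open>Spatial tensor products\<close>

lemma push_star_hom:
  assumes M: "star_monoid M j" and M': "star_monoid M' j'"
    and cl: "\<And>s. s \<in> carrier M \<Longrightarrow> \<phi> s \<in> carrier M'" and one: "\<phi> \<one>\<^bsub>M\<^esub> = \<one>\<^bsub>M'\<^esub>"
    and mult: "\<And>s t. s \<in> carrier M \<Longrightarrow> t \<in> carrier M \<Longrightarrow> \<phi> (s \<otimes>\<^bsub>M\<^esub> t) = \<phi> s \<otimes>\<^bsub>M'\<^esub> \<phi> t"
    and star: "\<And>s. s \<in> carrier M \<Longrightarrow> \<phi> (j s) = j' (\<phi> s)"
  shows "star_hom (monoid_star_algebra M j N) (monoid_star_algebra M' j' N') (push \<phi>)"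
proof -
  interpret M: star_monoid M j by fact
  interpret M': star_monoid M' j' by fact
  have pcl: "push \<phi> x \<in> fin_supp_on (carrier M')" if "x \<in> fin_supp_on (carrier M)" for x
    by (rule push_fin_supp[OF that cl])
  show ?thesis
  proof (rule star_homI, unfold monoid_star_algebra_sel)
    fix x assume x: "x \<in> fin_supp_on (carrier M)"
    show "push \<phi> x \<in> fin_supp_on (carrier M')" by (rule pcl[OF x])
    show "push \<phi> (\<lambda>t. c * x t) = (\<lambda>t. c * push \<phi> x t)" for c
      by (rule fin_supp_on_eqI[OF pcl[OF fin_supp_on_scale[OF x]] fin_supp_on_scale[OF pcl[OF x]]])
        (simp add: lincomb_push[OF fin_supp_on_scale[OF x]] lincomb_scale[OF x] lincomb_scale[OF pcl[OF x]] lincomb_push[OF x])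
    show "push \<phi> (push j (\<lambda>s. cnj (x s))) = push j' (\<lambda>s. cnj (push \<phi> x s))"
    proof (rule fin_supp_on_eqI[OF pcl[OF M.star_closed[OF x]] M'.star_closed[OF pcl[OF x]]])
      fix c :: "_ \<Rightarrow> complex"
      have "lincomb (\<lambda>s. cnj (c (\<phi> (j s)))) x = lincomb (\<lambda>s. cnj (c (j' (\<phi> s)))) x"
        by (rule lincomb_cong[OF x]) (simp add: star)
      then show "lincomb c (push \<phi> (push j (\<lambda>s. cnj (x s)))) = lincomb c (push j' (\<lambda>s. cnj (push \<phi> x s)))"
        by (simp add: lincomb_push[OF M.star_closed[OF x]] lincomb_push[OF fin_supp_on_cnj[OF x]] lincomb_cnj
          lincomb_push[OF fin_supp_on_cnj[OF pcl[OF x]]] lincomb_push[OF x])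
    qed
    fix y assume y: "y \<in> fin_supp_on (carrier M)"
    note xy = M.convolve_closed[OF x y]
    show "push \<phi> (\<lambda>t. x t + y t) = (\<lambda>t. push \<phi> x t + push \<phi> y t)"
      by (rule fin_supp_on_eqI[OF pcl[OF fin_supp_on_add[OF x y]] fin_supp_on_add[OF pcl[OF x] pcl[OF y]]])
        (simp add: lincomb_push[OF fin_supp_on_add[OF x y]] lincomb_add[OF x y]
          lincomb_add[OF pcl[OF x] pcl[OF y]] lincomb_push[OF x] lincomb_push[OF y])
    show "push \<phi> (convolve (\<otimes>\<^bsub>M\<^esub>) x y) = convolve (\<otimes>\<^bsub>M'\<^esub>) (push \<phi> x) (push \<phi> y)"
    proof (rule fin_supp_on_eqI[OF pcl[OF xy] M'.convolve_closed[OF pcl[OF x] pcl[OF y]]])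
      fix c :: "_ \<Rightarrow> complex"
      have "lincomb (\<lambda>s. lincomb (\<lambda>r. c (\<phi> (s \<otimes>\<^bsub>M\<^esub> r))) y) x = lincomb (\<lambda>s. lincomb (\<lambda>r. c (\<phi> s \<otimes>\<^bsub>M'\<^esub> \<phi> r)) y) x"
        by (intro lincomb_cong[OF x] lincomb_cong[OF y]) (simp add: mult)
      then show "lincomb c (push \<phi> (convolve (\<otimes>\<^bsub>M\<^esub>) x y)) = lincomb c (convolve (\<otimes>\<^bsub>M'\<^esub>) (push \<phi> x) (push \<phi> y))"
        by (simp add: lincomb_push[OF xy] lincomb_convolve[OF x y] lincomb_convolve[OF pcl[OF x] pcl[OF y]]
          lincomb_push[OF x] lincomb_push[OF y])
    qed
  next
    show "push \<phi> (delta \<one>\<^bsub>M\<^esub>) = delta \<one>\<^bsub>M'\<^esub>"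
      by (rule fin_supp_on_eqI[OF pcl[OF fin_supp_on_delta[OF M.one_closed]] fin_supp_on_delta[OF M'.one_closed]])
        (simp add: lincomb_push[OF fin_supp_on_delta[OF M.one_closed]] lincomb_delta one)
  qed
qed

lemma push_delta: "push \<phi> (delta s) = delta (\<phi> s)"
proof (rule fin_supp_on_eqI[of _ UNIV _ UNIV])
  show "push \<phi> (delta s) \<in> fin_supp_on UNIV" by (rule push_fin_supp[of _ UNIV]) (auto intro: fin_supp_on_delta)
  fix c :: "_ \<Rightarrow> complex"
  show "lincomb c (push \<phi> (delta s)) = lincomb c (delta (\<phi> s))"
    using lincomb_push[OF fin_supp_on_delta[of s UNIV], of c \<phi>] by (simp add: lincomb_delta)
qed (auto intro: fin_supp_on_delta)

lemma (in star_monoid) monoid_star_algebra_delta: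
  assumes "s \<in> carrier M" "t \<in> carrier M"
  shows "convolve (mult M) (delta s) (delta t) = delta (s \<otimes> t)" "push j (\<lambda>u. cnj (delta s u)) = delta (j s)"
proof -
  note d = fin_supp_on_delta[OF assms(1)] fin_supp_on_delta[OF assms(2)]
  show "convolve (mult M) (delta s) (delta t) = delta (s \<otimes> t)"
    by (rule fin_supp_on_eqI[OF convolve_closed[OF d] fin_supp_on_delta[OF m_closed[OF assms]]])
      (simp add: lincomb_convolve[OF d] lincomb_delta)
  have "(\<lambda>u. cnj (delta s u)) = delta s" by (auto simp: delta_def)
  then show "push j (\<lambda>u. cnj (delta s u)) = delta (j s)" by (simp add: push_delta)
qed

lemma cstar_rep_compose:
  assumes f: "star_hom A A' f" and \<pi>: "cstar_rep A' H \<pi>" shows "cstar_rep A H (\<lambda>a. \<pi> (f a))"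
  using \<pi> star_homD[OF f] star_hom_one[OF f] unfolding cstar_rep_def by simp

text \<open>Keeps the family of representation pairs nonempty, so that the supremum in
  \<open>spatial_norm\<close> is meaningful.\<close>

lemma cstar_rep_zero: "cstar_rep A {0} (\<lambda>_ _. 0 :: 'h::complex_hilbert)"
  by (auto simp: cstar_rep_def closed_csubspace_def csubspace_def bounded_op_on_def linear_op_on_def)

lemma linear_op_on_zero_nonneg:
  assumes "csubspace H" "bounded_op_on H T" shows "0 \<le> op_norm_on H T"
proof -
  obtain B where B: "0 \<le> B" "\<And>x. x \<in> H \<Longrightarrow> norm (T x) \<le> B * norm x" using bounded_op_onE[OF assms(2)] by metis
  have "norm (T x) \<le> B" if "x \<in> H" "norm x \<le> 1" for x
    using B(2)[OF that(1)] mult_left_mono[OF that(2) B(1)] by simp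
  then have bdd: "bdd_above {norm (T x) | x. x \<in> H \<and> norm x \<le> 1}" by (auto intro!: bdd_aboveI[of _ B])
  have "norm (T 0) \<in> {norm (T x) | x. x \<in> H \<and> norm x \<le> 1}"
    using csubspace_0[OF assms(1)] by (intro CollectI exI[of _ 0]) simp
  then have "norm (T 0) \<le> op_norm_on H T" unfolding op_norm_on_def by (rule cSup_upper[OF _ bdd])
  then show ?thesis by (rule order_trans[OF norm_ge_zero])
qed

text \<open>Allows an operator norm taken over the algebraic tensor product, as in
  \<open>tensor_op_norm\<close>, to be computed on its closure.\<close>

lemma op_norm_on_dense:
  assumes V: "csubspace V" and S: "csubspace S" "S \<subseteq> V" "V \<subseteq> closure S"
    and T: "bounded_op_on V T" and TS: "\<And>x. x \<in> S \<Longrightarrow> T x \<in> S"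
  shows "op_norm_on S T = op_norm_on V T"
proof -
  obtain C where C: "0 \<le> C" "\<And>x. x \<in> V \<Longrightarrow> norm (T x) \<le> C * norm x" using bounded_op_onE[OF T] by metis
  have linV: "linear_op_on V T" using T by (simp add: bounded_op_on_def)
  have linS: "linear_op_on S T" using linV S(2) TS unfolding linear_op_on_def by blast
  have T': "bounded_op_on S T" using linS C S(2) unfolding bounded_op_on_def by blast
  have iffV: "op_norm_on V T \<le> B \<longleftrightarrow> (\<forall>x\<in>V. norm (T x) \<le> B * norm x)" if "0 \<le> B" for B
    by (rule op_norm_on_le_iff[OF linV V C(2) that])
  have iffS: "op_norm_on S T \<le> B \<longleftrightarrow> (\<forall>x\<in>S. norm (T x) \<le> B * norm x)" if "0 \<le> B" for B
    by (rule op_norm_on_le_iff[OF linS S(1) C(2)[OF subsetD[OF S(2)]] that])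
  note nV = linear_op_on_zero_nonneg[OF V T] and nS = linear_op_on_zero_nonneg[OF S(1) T']
  have "\<forall>x\<in>V. norm (T x) \<le> op_norm_on S T * norm x"
    using bounded_op_on_bound_closure[OF T V S(2,3)] iffS[OF nS] by auto
  moreover have "\<forall>x\<in>S. norm (T x) \<le> op_norm_on V T * norm x"
    using iffV[OF nV] S(2) by auto
  ultimately show ?thesis using iffV[OF nS] iffS[OF nV] by (intro order.antisym) auto
qed

lemma tensor_norm_lincomb: "tensor_norm u = norm (lincomb tensor_pair u)"
proof -
  have "complex_of_real ((norm (lincomb tensor_pair u))\<^sup>2) = (\<Sum>(\<xi>, \<eta>) \<in> {p. u p \<noteq> 0}. \<Sum>(\<xi>', \<eta>') \<in> {p. u p \<noteq> 0}.
     u (\<xi>, \<eta>) * cnj (u (\<xi>', \<eta>')) * cinner \<xi> \<xi>' * cinner \<eta> \<eta>')"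
    unfolding cinner_self[symmetric] cinner_lincomb_lincomb cinner_tensor_pair
    by (intro sum.cong refl) (simp add: case_prod_beta mult_ac)
  from arg_cong[OF this, of Re] show ?thesis
    unfolding tensor_norm_def Re_complex_of_real by (simp flip: \<open>complex_of_real _ = _\<close>)
qed

text \<open>A formal combination \<open>u\<close> enters only through the vector
  \<open>lincomb tensor_pair u\<close>, and convolving with \<open>x\<close> corresponds to applying
  the operator of \<open>x\<close> to that vector. The formal description of the spatial norm is
  thus replaced by operators on a Hilbert space.\<close>

lemma tensor_op_norm_eq:
  assumes \<pi>: "star_act M j H \<pi>" and \<rho>: "star_act M' j' K \<rho>" and M: "star_monoid M j" "star_monoid M' j'"
    and x: "x \<in> fin_supp_on (carrier M \<times> carrier M')"
  shows "tensor_op_norm H \<pi> K \<rho> x = op_norm_on (tensor_space H K) (group_algebra_op (tensor_act H K \<pi> \<rho>) x)"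
proof -
  let ?S = "cspan (tensor_pair ` (H \<times> K))" and ?V = "tensor_space H K"
  let ?T = "group_algebra_op (tensor_act H K \<pi> \<rho>) x"
  interpret D: star_monoid "M \<times>\<times> M'" "\<lambda>(a, b). (j a, j' b)" by (rule star_monoid_DirProd[OF M])
  have W: "star_act (M \<times>\<times> M') (\<lambda>(a, b). (j a, j' b)) ?V (tensor_act H K \<pi> \<rho>)"
    by (rule star_act_tensor[OF \<pi> \<rho> M])
  have x': "x \<in> fin_supp_on (carrier (M \<times>\<times> M'))" using x by (simp add: DirProd_def)
  let ?c = "\<lambda>u. convolve (\<lambda>(a, b) (\<xi>, \<eta>). (\<pi> a \<xi>, \<rho> b \<eta>)) x u"
  have cu: "?c u \<in> fin_supp_on (H \<times> K)" "lincomb tensor_pair (?c u) = ?T (lincomb tensor_pair u)"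
    if u: "u \<in> fin_supp_on (H \<times> K)" for u
  proof -
    show "?c u \<in> fin_supp_on (H \<times> K)"
      by (rule convolve_fin_supp[OF x u]) (auto intro: star_actD(4)[OF \<pi>] star_actD(4)[OF \<rho>])
    have "lincomb tensor_pair (?c u) = lincomb (\<lambda>s. lincomb (\<lambda>p. tensor_act H K \<pi> \<rho> s (tensor_pair p)) u) x"
      unfolding lincomb_convolve[OF x u]
      by (intro lincomb_cong[OF x] lincomb_cong[OF u]) (auto simp: tensor_pair_def tensor_act_tensor[OF \<pi> \<rho>])
    also have "\<dots> = lincomb (\<lambda>s. tensor_act H K \<pi> \<rho> s (lincomb tensor_pair u)) x"
      by (rule lincomb_cong[OF x'], rule lincomb_linear_op(1)[OF star_actD(3)[OF W] csubspace_tensor_space u, symmetric])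
        (auto simp: tensor_pair_def tensor_in_space)
    finally show "lincomb tensor_pair (?c u) = ?T (lincomb tensor_pair u)" unfolding group_algebra_op_lincomb .
  qed
  have "{tensor_norm (?c u) | u. u \<in> fin_supp_on (H \<times> K) \<and> tensor_norm u \<le> 1} = {norm (?T f) | f. f \<in> ?S \<and> norm f \<le> 1}"
    unfolding cspan_eq_lincomb tensor_norm_lincomb
  proof (intro equalityI subsetI)
    fix y assume "y \<in> {norm (lincomb tensor_pair (?c u)) | u. u \<in> fin_supp_on (H \<times> K) \<and> norm (lincomb tensor_pair u) \<le> 1}"
    then obtain u where u: "y = norm (lincomb tensor_pair (?c u))" "u \<in> fin_supp_on (H \<times> K)" "norm (lincomb tensor_pair u) \<le> 1"
      by blast
    then show "y \<in> {norm (?T f) | f. f \<in> {lincomb tensor_pair u | u. u \<in> fin_supp_on (H \<times> K)} \<and> norm f \<le> 1}"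
      unfolding cu(2)[OF u(2)] by blast
  next
    fix y assume "y \<in> {norm (?T f) | f. f \<in> {lincomb tensor_pair u | u. u \<in> fin_supp_on (H \<times> K)} \<and> norm f \<le> 1}"
    then obtain u where u: "y = norm (?T (lincomb tensor_pair u))" "u \<in> fin_supp_on (H \<times> K)" "norm (lincomb tensor_pair u) \<le> 1"
      by blast
    then show "y \<in> {norm (lincomb tensor_pair (?c u)) | u. u \<in> fin_supp_on (H \<times> K) \<and> norm (lincomb tensor_pair u) \<le> 1}"
      unfolding cu(2)[OF u(2), symmetric] by blast
  qed
  then have "tensor_op_norm H \<pi> K \<rho> x = op_norm_on ?S ?T"
    unfolding tensor_op_norm_def op_norm_on_def by simp
  also have "\<dots> = op_norm_on ?V ?T"
  proof (rule op_norm_on_dense[OF csubspace_tensor_space csubspace_cspan _ _ D.star_act_op(1)[OF W x']])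
    fix f assume "f \<in> ?S"
    then obtain u where u: "u \<in> fin_supp_on (H \<times> K)" "f = lincomb tensor_pair u" unfolding cspan_eq_lincomb by auto
    show "?T f \<in> ?S" unfolding u(2) cu(2)[OF u(1), symmetric] cspan_eq_lincomb using cu(1)[OF u(1)] by blast
  qed (simp_all add: tensor_space_def closure_subset)
  finally show ?thesis .
qed

declare carrier_DirProd [simp del]

locale spatial =
  fixes h :: "'i::infinite ell2 itself"
    and A :: "('a, 'm) normed_star_algebra_scheme" and B :: "('b, 'n) normed_star_algebra_scheme"
  assumes A: "op_cstar A" and B: "op_cstar B"
begin

sublocale A: op_cstar A by (rule A)
sublocale B: op_cstar B by (rule B)

abbreviation "M \<equiv> A \<times>\<times> B"
abbreviation "jj \<equiv> \<lambda>(a, b). (star A a, star B b)"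
abbreviation "N \<equiv> spatial_norm h A B"
abbreviation "P \<equiv> formal_tensor h A B"
abbreviation "AB \<equiv> spatial_tensor h A B"
abbreviation "E \<equiv> elem_tensor h A B"
abbreviation "emb \<equiv> completion_emb P"

sublocale D: star_monoid M jj by (rule star_monoid_DirProd[OF A.star_monoid B.star_monoid])

definition R :: "('i ell2 set \<times> ('a \<times> 'b \<Rightarrow> 'i ell2 \<Rightarrow> 'i ell2)) set" where
  "R = {(tensor_space H K, tensor_act H K \<pi> \<rho>) | H \<pi> K \<rho>. cstar_rep A H \<pi> \<and> cstar_rep B K \<rho>}"

lemma car: "carrier M = carrier A \<times> carrier B" by (simp add: DirProd_def)

lemma act:
  assumes "cstar_rep A H \<pi>" "cstar_rep B K \<rho>"
  shows "star_act M jj (tensor_space H K) (tensor_act H K \<pi> \<rho>)"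
  by (rule star_act_tensor[OF cstar_rep_star_act[OF assms(1)] cstar_rep_star_act[OF assms(2)] A.star_monoid B.star_monoid])

lemma act_tensor:
  assumes "cstar_rep A H \<pi>" "cstar_rep B K \<rho>" "a \<in> carrier A" "b \<in> carrier B" "\<xi> \<in> H" "\<eta> \<in> K"
  shows "tensor_act H K \<pi> \<rho> (a, b) (tensor \<xi> \<eta>) = tensor (\<pi> a \<xi>) (\<rho> b \<eta>)"
  by (rule tensor_act_tensor[OF cstar_rep_star_act[OF assms(1)] cstar_rep_star_act[OF assms(2)] assms(3-6)])

text \<open>A crude bound, uniform over all pairs of representations by
  \<open>cstar_rep_contractive\<close>; it makes the supremum in \<open>spatial_norm\<close>
  finite.\<close>

lemma act_bound:
  assumes \<pi>: "cstar_rep A H \<pi>" and \<rho>: "cstar_rep B K \<rho>" and x: "x \<in> D.fs" and f: "f \<in> tensor_space H K"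
  shows "norm (group_algebra_op (tensor_act H K \<pi> \<rho>) x f)
    \<le> (\<Sum>s | x s \<noteq> 0. cmod (x s) * (nrm B (snd s) * nrm A (fst s))) * norm f"
proof -
  note \<pi>' = cstar_rep_star_act[OF \<pi>] and \<rho>' = cstar_rep_star_act[OF \<rho>]
  have "norm (tensor_act H K \<pi> \<rho> s f) \<le> nrm B (snd s) * nrm A (fst s) * norm f" if "s \<in> carrier M" for s
    using that unfolding tensor_act_def car case_prod_beta
    by (intro norm_tensor_op_le[OF star_actD(1)[OF \<pi>'] star_actD(1)[OF \<rho>'] star_actD(2)[OF \<pi>'] star_actD(2)[OF \<rho>'] _ _ _ _ f]
      cstar_rep_contractive[OF A \<pi>] cstar_rep_contractive[OF B \<rho>] A.nrm_nonneg B.nrm_nonneg) auto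
  from norm_lincomb_le[OF this x] show ?thesis
    unfolding group_algebra_op_lincomb by (simp add: sum_distrib_right mult.assoc)
qed

lemma R_E:
  assumes "(V, W) \<in> R"
  obtains H \<pi> K \<rho> where "V = tensor_space H K" "W = tensor_act H K \<pi> \<rho>" "cstar_rep A H \<pi>" "cstar_rep B K \<rho>"
  using assms unfolding R_def by blast

lemma R_I: "cstar_rep A H \<pi> \<Longrightarrow> cstar_rep B K \<rho> \<Longrightarrow> (tensor_space H K, tensor_act H K \<pi> \<rho>) \<in> R"
  unfolding R_def by blast

lemma dominated: "D.dominated_norm R N"
proof (rule D.dominated_norm_Sup)
  fix V W assume "(V, W) \<in> R"
  then show "star_act M jj V W" by (rule R_E) (simp add: act)
next
  show "R \<noteq> {}" using R_I[OF cstar_rep_zero[of A] cstar_rep_zero[of B]] by blast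
next
  fix x assume x: "x \<in> D.fs"
  let ?C = "\<Sum>s | x s \<noteq> 0. cmod (x s) * (nrm B (snd s) * nrm A (fst s))"
  have C: "0 \<le> ?C"
  proof (rule sum_nonneg)
    fix s assume "s \<in> {s. x s \<noteq> 0}"
    then have "fst s \<in> carrier A" "snd s \<in> carrier B" using x by (auto simp: fin_supp_on_def car)
    then show "0 \<le> cmod (x s) * (nrm B (snd s) * nrm A (fst s))"
      by (intro mult_nonneg_nonneg A.nrm_nonneg B.nrm_nonneg) simp_all
  qed
  have bd: "norm (group_algebra_op W x u) \<le> ?C * norm u" if "(V, W) \<in> R" "u \<in> V" for V W u
    using that(1) by (rule R_E) (use that(2) act_bound[OF _ _ x] in simp)
  show "\<exists>C\<ge>0. \<forall>(V, W)\<in>R. \<forall>u\<in>V. norm (group_algebra_op W x u) \<le> C * norm u"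
  proof (intro exI[of _ ?C] conjI C ballI)
    fix p assume "p \<in> R"
    then show "case p of (V, W) \<Rightarrow> \<forall>u\<in>V. norm (group_algebra_op W x u) \<le> ?C * norm u"
      using bd by (cases p) blast
  qed
  have eq: "tensor_op_norm H \<pi> K \<rho> x = op_norm_on (tensor_space H K) (group_algebra_op (tensor_act H K \<pi> \<rho>) x)"
    if "cstar_rep A H \<pi>" "cstar_rep B K \<rho>" for H K :: "'i ell2 set" and \<pi> \<rho>
    using tensor_op_norm_eq[OF cstar_rep_star_act[OF that(1)] cstar_rep_star_act[OF that(2)] A.star_monoid B.star_monoid] x
    by (simp add: car)
  have "{tensor_op_norm H \<pi> K \<rho> x | (H :: 'i ell2 set) \<pi> (K :: 'i ell2 set) \<rho>. cstar_rep A H \<pi> \<and> cstar_rep B K \<rho>}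
      = {op_norm_on V (group_algebra_op W x) | V W. (V, W) \<in> R}" (is "?L = ?R")
  proof (intro equalityI subsetI)
    fix y assume "y \<in> ?L"
    then obtain H K :: "'i ell2 set" and \<pi> \<rho> where y: "y = tensor_op_norm H \<pi> K \<rho> x"
      and r: "cstar_rep A H \<pi>" "cstar_rep B K \<rho>" by blast
    show "y \<in> ?R" unfolding y eq[OF r] using R_I[OF r] by blast
  next
    fix y assume "y \<in> ?R"
    then obtain V W where y: "y = op_norm_on V (group_algebra_op W x)" and VW: "(V, W) \<in> R" by blast
    obtain H \<pi> K \<rho> where "V = tensor_space H K" "W = tensor_act H K \<pi> \<rho>" and r: "cstar_rep A H \<pi>" "cstar_rep B K \<rho>"
      using VW by (rule R_E)
    then have "y = tensor_op_norm H \<pi> K \<rho> x" using y eq[OF r] by simp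
    then show "y \<in> ?L" using r by blast
  qed
  then show "N x = Sup {op_norm_on V (group_algebra_op W x) | V W. (V, W) \<in> R}"
    unfolding spatial_norm_def by (rule arg_cong)
qed

lemmas dominatedD = D.dominated_normD[OF dominated]

lemma norm_le_N:
  fixes H K :: "'i ell2 set"
  assumes "cstar_rep A H \<pi>" "cstar_rep B K \<rho>" "x \<in> D.fs" "f \<in> tensor_space H K"
  shows "norm (group_algebra_op (tensor_act H K \<pi> \<rho>) x f) \<le> N x * norm f"
by (rule dominatedD(3)[OF assms(3) R_I[OF assms(1,2)] assms(4)])

lemma N_leI:
  assumes "x \<in> D.fs" "0 \<le> C" "\<And>(H :: 'i ell2 set) \<pi> K \<rho> f. cstar_rep A H \<pi> \<Longrightarrow> cstar_rep B K \<rho> \<Longrightarrow> f \<in> tensor_space H K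
    \<Longrightarrow> norm (group_algebra_op (tensor_act H K \<pi> \<rho>) x f) \<le> C * norm f"
  shows "N x \<le> C"
  proof (rule dominatedD(4)[OF assms(1,2)])
  fix V W u assume "(V, W) \<in> R" and u: "u \<in> V"
  obtain H \<pi> K \<rho> where "V = tensor_space H K" "W = tensor_act H K \<pi> \<rho>" "cstar_rep A H \<pi>" "cstar_rep B K \<rho>"
    using \<open>(V, W) \<in> R\<close> by (rule R_E)
  then show "norm (group_algebra_op W x u) \<le> C * norm u" using u assms(3) by simp
qed

lemma P_eq: "P = monoid_star_algebra M jj N" by (simp add: formal_tensor_def)

sublocale P: pre_cstar P unfolding P_eq by (rule D.pre_cstar_dominated_norm[OF dominated])

lemma AB_eq: "AB = completion P" by (simp add: spatial_tensor_def)

lemma op_cstar_AB: "op_cstar AB" unfolding AB_eq by (rule P.completion_op_cstar)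

sublocale AB: op_cstar AB by (rule op_cstar_AB)

lemma car_P: "carrier P = D.fs" by (simp add: P_eq monoid_star_algebra_sel)

lemma emb_star_hom: "star_hom P AB emb" unfolding AB_eq by (rule P.completion_emb_star_hom)

lemma emb_dense: "dense_in AB (emb ` D.fs)" using P.completion_emb_dense by (simp add: AB_eq car_P)

lemma nrm_emb: "x \<in> D.fs \<Longrightarrow> nrm AB (emb x) = N x"
  using P.completion_nrm_const[of x] by (simp add: AB_eq car_P) (simp add: P_eq monoid_star_algebra_sel)

text \<open>Agreement on elementary tensors in all representation pairs means that the difference
  has spatial seminorm zero, which the completion divides out. The bilinearity of elementary tensors
  is obtained from this.\<close>

lemma emb_eqI:
  assumes x: "x \<in> D.fs" and y: "y \<in> D.fs"
    and eq: "\<And>(H :: 'i ell2 set) \<pi> K \<rho> \<xi> \<eta>. cstar_rep A H \<pi> \<Longrightarrow> cstar_rep B K \<rho> \<Longrightarrow> \<xi> \<in> H \<Longrightarrow> \<eta> \<in> K \<Longrightarrow>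
      group_algebra_op (tensor_act H K \<pi> \<rho>) x (tensor \<xi> \<eta>) = group_algebra_op (tensor_act H K \<pi> \<rho>) y (tensor \<xi> \<eta>)"
  shows "emb x = emb y"
proof -
  have d: "x \<ominus>\<^bsub>P\<^esub> y = (\<lambda>t. x t + (-1) * y t)"
    using x y P.minus_eq_smult[of x y] by (simp add: car_P) (simp add: P_eq monoid_star_algebra_sel)
  have y': "(\<lambda>t. (-1) * y t) \<in> D.fs" by (rule fin_supp_on_scale[OF y])
  have "N (x \<ominus>\<^bsub>P\<^esub> y) \<le> 0"
  proof (rule N_leI)
    show "x \<ominus>\<^bsub>P\<^esub> y \<in> D.fs" unfolding d by (rule fin_supp_on_add[OF x y'])
    fix H K :: "'i ell2 set" and \<pi> \<rho> f
    assume r: "cstar_rep A H \<pi>" "cstar_rep B K \<rho>" and f: "f \<in> tensor_space H K"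
    note W = act[OF r]
    have "group_algebra_op (tensor_act H K \<pi> \<rho>) x f = group_algebra_op (tensor_act H K \<pi> \<rho>) y f"
      by (rule bounded_op_on_eq_closure_cspan[OF D.star_act_op(1)[OF W x] D.star_act_op(1)[OF W y] tensor_space_def _ f])
        (auto simp: tensor_pair_def eq[OF r])
    then show "norm (group_algebra_op (tensor_act H K \<pi> \<rho>) (x \<ominus>\<^bsub>P\<^esub> y) f) \<le> 0 * norm f"
      unfolding d D.group_algebra_op_linear(1)[OF x y'] D.group_algebra_op_linear(2)[OF y]
      by (simp add: scaleC.minus_left)
  qed simp
  moreover have nP: "nrm P z = N z" for z by (simp add: P_eq monoid_star_algebra_sel)
  moreover have "0 \<le> nrm P (x \<ominus>\<^bsub>P\<^esub> y)" using x y by (intro P.nrm_nonneg P.minus_closed) (simp_all add: car_P)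
  ultimately have "nrm P (x \<ominus>\<^bsub>P\<^esub> y) = 0" by simp
  then show ?thesis
    unfolding completion_emb_def using x y
    by (subst P.cauchy_class_eq_iff) (auto simp: car_P P.null_diff_def intro!: P.cauchy_seqs_const)
qed

lemma delta_fs: "a \<in> carrier A \<Longrightarrow> b \<in> carrier B \<Longrightarrow> delta (a, b) \<in> D.fs"
  by (rule fin_supp_on_delta) (simp add: car)

lemma E_emb: "E a b = emb (delta (a, b))" by (simp add: elem_tensor_def)

lemma E_closed: "a \<in> carrier A \<Longrightarrow> b \<in> carrier B \<Longrightarrow> E a b \<in> carrier AB"
  unfolding E_emb using star_homD(1)[OF emb_star_hom] delta_fs by (simp add: car_P)

lemma emb_add: "x \<in> D.fs \<Longrightarrow> y \<in> D.fs \<Longrightarrow> emb (\<lambda>t. x t + y t) = emb x \<oplus>\<^bsub>AB\<^esub> emb y"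
  and emb_smult: "x \<in> D.fs \<Longrightarrow> emb (\<lambda>t. c * x t) = c \<odot>\<^bsub>AB\<^esub> emb x"
  and emb_zero: "emb (\<lambda>_. 0) = \<zero>\<^bsub>AB\<^esub>"
  using star_homD(2)[OF emb_star_hom, of x y] star_homD(5)[OF emb_star_hom, of x c]
    P.completion_zero
  by (simp_all add: car_P AB_eq completion_emb_def) (simp_all add: P_eq monoid_star_algebra_sel)

lemma E_mult:
  assumes "a \<in> carrier A" "b \<in> carrier B" "a' \<in> carrier A" "b' \<in> carrier B"
  shows "E a b \<otimes>\<^bsub>AB\<^esub> E a' b' = E (a \<otimes>\<^bsub>A\<^esub> a') (b \<otimes>\<^bsub>B\<^esub> b')"
proof -
  have "convolve (mult M) (delta (a, b)) (delta (a', b')) = delta (a \<otimes>\<^bsub>A\<^esub> a', b \<otimes>\<^bsub>B\<^esub> b')"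
    using D.monoid_star_algebra_delta(1)[of "(a, b)" "(a', b')"] assms by (simp add: car)
  then show ?thesis
    unfolding E_emb using star_homD(3)[OF emb_star_hom, of "delta (a, b)" "delta (a', b')"] assms
    by (simp add: car_P delta_fs) (simp add: P_eq monoid_star_algebra_sel)
qed

lemma E_star:
  assumes "a \<in> carrier A" "b \<in> carrier B" shows "star AB (E a b) = E (star A a) (star B b)"
proof -
  have "push jj (\<lambda>u. cnj (delta (a, b) u)) = delta (star A a, star B b)"
    using D.monoid_star_algebra_delta(2)[of "(a, b)" "(a, b)"] assms by (simp add: car)
  then show ?thesis
    unfolding E_emb using star_homD(6)[OF emb_star_hom, of "delta (a, b)"] assms
    by (simp add: car_P delta_fs) (simp add: P_eq monoid_star_algebra_sel)
qed

lemma E_one: "E \<one>\<^bsub>A\<^esub> \<one>\<^bsub>B\<^esub> = \<one>\<^bsub>AB\<^esub>"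
  unfolding E_emb using star_hom_one[OF emb_star_hom] by (simp add: P_eq monoid_star_algebra_sel)

lemma E_add_left:
  assumes "a \<in> carrier A" "a' \<in> carrier A" "b \<in> carrier B"
  shows "E (a \<oplus>\<^bsub>A\<^esub> a') b = E a b \<oplus>\<^bsub>AB\<^esub> E a' b"
proof -
  note d = delta_fs[OF assms(1,3)] delta_fs[OF assms(2,3)]
  show ?thesis
    unfolding E_emb emb_add[OF d, symmetric]
    by (rule emb_eqI)
      (use assms d in \<open>simp_all add: delta_fs fin_supp_on_add D.group_algebra_op_linear act_tensor cstar_repD tensor_add_left\<close>)
qed

lemma E_add_right:
  assumes "a \<in> carrier A" "b \<in> carrier B" "b' \<in> carrier B"
  shows "E a (b \<oplus>\<^bsub>B\<^esub> b') = E a b \<oplus>\<^bsub>AB\<^esub> E a b'"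
proof -
  note d = delta_fs[OF assms(1,2)] delta_fs[OF assms(1,3)]
  show ?thesis
    unfolding E_emb emb_add[OF d, symmetric]
    by (rule emb_eqI)
      (use assms d in \<open>simp_all add: delta_fs fin_supp_on_add D.group_algebra_op_linear act_tensor cstar_repD tensor_add_right\<close>)
qed

lemma E_smult_left:
  assumes "a \<in> carrier A" "b \<in> carrier B" shows "E (c \<odot>\<^bsub>A\<^esub> a) b = c \<odot>\<^bsub>AB\<^esub> E a b"
  unfolding E_emb emb_smult[OF delta_fs[OF assms], symmetric]
  by (rule emb_eqI) (use assms in \<open>simp_all add: delta_fs fin_supp_on_scale A.smult_closed
    D.group_algebra_op_linear act_tensor cstar_repD tensor_scale_left\<close>)

lemma E_smult_right:
  assumes "a \<in> carrier A" "b \<in> carrier B" shows "E a (c \<odot>\<^bsub>B\<^esub> b) = c \<odot>\<^bsub>AB\<^esub> E a b"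
  unfolding E_emb emb_smult[OF delta_fs[OF assms], symmetric]
  by (rule emb_eqI) (use assms in \<open>simp_all add: delta_fs fin_supp_on_scale B.smult_closed
    D.group_algebra_op_linear act_tensor cstar_repD tensor_scale_right\<close>)

lemma E_left_star_hom: "star_hom A AB (\<lambda>a. E a \<one>\<^bsub>B\<^esub>)"
  by (rule star_homI) (simp_all add: E_closed E_one E_add_left E_smult_left E_mult E_star B.star_one)

lemma E_right_star_hom: "star_hom B AB (\<lambda>b. E \<one>\<^bsub>A\<^esub> b)"
  by (rule star_homI) (simp_all add: E_closed E_one E_add_right E_smult_right E_mult E_star A.star_one)

end

context op_cstar begin

definition cl :: "'a set \<Rightarrow> 'a set" where
  "cl V = {z \<in> carrier A. \<forall>e>0. \<exists>y\<in>V. nrm A (z \<ominus> y) < e}"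

lemma cl_lims:
  assumes V: "V \<subseteq> carrier A" and X: "\<And>n. X n \<in> cl V" "lims X z" "z \<in> carrier A"
  shows "z \<in> cl V"
  unfolding cl_def
proof (intro CollectI conjI allI impI)
  fix e :: real assume e: "0 < e"
  have c: "X n \<in> carrier A" for n using X(1)[of n] by (simp add: cl_def)
  obtain n where n: "\<bar>nrm A (X n \<ominus> z)\<bar> < e / 2" using LIMSEQ_D[OF X(2)[unfolded lims_def], of "e / 2"] e by auto
  obtain y where y: "y \<in> V" "nrm A (X n \<ominus> y) < e / 2" using X(1)[of n] half_gt_zero[OF e] unfolding cl_def by blast
  have "nrm A (z \<ominus> y) < e"
    using nrm_triangle_minus[of z "X n" y] nrm_minus_commute[of z "X n"] n y X(3) c[of n] V by force
  then show "\<exists>y\<in>V. nrm A (z \<ominus> y) < e" using y by blast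
qed (rule X(3))

lemma cl_superset: "V \<subseteq> carrier A \<Longrightarrow> V \<subseteq> cl V"
proof
  fix x assume "V \<subseteq> carrier A" and x: "x \<in> V"
  then have c: "x \<in> carrier A" by auto
  have "nrm A (x \<ominus> x) = 0" using c by (simp add: a_minus_def r_neg nrm_zero)
  then show "x \<in> cl V" unfolding cl_def using c x by (intro CollectI conjI allI impI bexI[of _ x]) auto
qed

lemma cl_submodule:
  assumes V: "submodule V complex_ring A" shows "submodule (cl V) complex_ring A"
proof -
  note VD = submoduleD[OF V]
  have seq: "\<exists>X. (\<forall>n. X n \<in> V) \<and> lims X z" if z: "z \<in> cl V" for z
  proof -
    have "\<exists>y\<in>V. nrm A (z \<ominus> y) < 1 / Suc n" for n using z unfolding cl_def by force
    then obtain X where X: "\<And>n. X n \<in> V" "\<And>n. nrm A (z \<ominus> X n) < 1 / Suc n" by metis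
    have c: "X n \<in> carrier A" "z \<in> carrier A" for n using X(1) VD(1) z by (auto simp: cl_def)
    have "lims X z"
      by (rule limsI[OF _ LIMSEQ_inverse_real_of_nat c])
        (use X(2) nrm_minus_commute[OF c] in \<open>simp add: inverse_eq_divide less_imp_le\<close>)
    then show ?thesis using X by blast
  qed
  have car: "z \<in> carrier A" if "z \<in> cl V" for z using that by (simp add: cl_def)
  note sup = cl_superset[OF VD(1)]
  show ?thesis
  proof (rule submoduleI)
    show "cl V \<subseteq> carrier A" using car by auto
    show "\<zero> \<in> cl V" using VD(2) sup by auto
    fix x assume x: "x \<in> cl V"
    obtain X where X: "\<And>n. X n \<in> V" "lims X x" using seq[OF x] by auto
    have Xc: "X n \<in> carrier A" for n using X VD(1) by auto
    show "c \<odot> x \<in> cl V" for c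
      by (rule cl_lims[OF VD(1) _ lims_smult[OF Xc car[OF x] X(2)] smult_closed[OF car[OF x]]])
        (use VD(4) X(1) sup in auto)
    fix y assume y: "y \<in> cl V"
    obtain Y where Y: "\<And>n. Y n \<in> V" "lims Y y" using seq[OF y] by auto
    have Yc: "Y n \<in> carrier A" for n using Y VD(1) by auto
    show "x \<oplus> y \<in> cl V"
      by (rule cl_lims[OF VD(1) _ lims_add[OF Xc Yc car[OF x] car[OF y] X(2) Y(2)] a_closed[OF car[OF x] car[OF y]]])
        (use VD(3) X(1) Y(1) sup in auto)
  qed
qed

end

text \<open>Linearity and continuity spread membership in a closed subspace from a spanning set to
  all of \<open>A\<close>. It is used for one leg of an elementary tensor at a time, the other being
  fixed.\<close>

lemma span_dense_lift:
  assumes "op_cstar A" "op_cstar C" and S: "S \<subseteq> carrier A" "dense_in A (linear_span A S)"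
    and V: "V \<subseteq> carrier C" "submodule (op_cstar.cl C V) complex_ring C"
    and f: "\<And>a. a \<in> carrier A \<Longrightarrow> f a \<in> carrier C"
    and add: "\<And>a a'. a \<in> carrier A \<Longrightarrow> a' \<in> carrier A \<Longrightarrow> f (a \<oplus>\<^bsub>A\<^esub> a') = f a \<oplus>\<^bsub>C\<^esub> f a'"
    and smult: "\<And>c a. a \<in> carrier A \<Longrightarrow> f (c \<odot>\<^bsub>A\<^esub> a) = c \<odot>\<^bsub>C\<^esub> f a"
    and lims: "\<And>X a. (\<And>n. X n \<in> carrier A) \<Longrightarrow> a \<in> carrier A \<Longrightarrow> pre_cstar.lims A X a \<Longrightarrow> pre_cstar.lims C (\<lambda>n. f (X n)) (f a)"
    and fS: "\<And>s. s \<in> S \<Longrightarrow> f s \<in> op_cstar.cl C V" and a: "a \<in> carrier A"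
  shows "f a \<in> op_cstar.cl C V"
proof -
  interpret A: op_cstar A by fact
  interpret C: op_cstar C by fact
  note clD = C.submoduleD[OF V(2)]
  have z: "f \<zero>\<^bsub>A\<^esub> = \<zero>\<^bsub>C\<^esub>"
    using smult[OF A.zero_closed, of 0] f[OF A.zero_closed] by (simp add: A.smult_zero C.smult_zero)
  have "submodule {a \<in> carrier A. f a \<in> C.cl V} complex_ring A"
    by (rule A.submoduleI) (auto simp: z clD(2,3,4) add smult A.smult_closed)
  then have sub: "linear_span A S \<subseteq> {a \<in> carrier A. f a \<in> C.cl V}"
    by (rule A.linear_span_least) (use S fS in auto)
  obtain X where X: "\<And>n. X n \<in> linear_span A S" "A.lims X a" using A.dense_in_lims[OF S(2) a] by auto
  have c: "X n \<in> carrier A" "f (X n) \<in> C.cl V" for n using X(1)[of n] sub by auto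
  show ?thesis by (rule C.cl_lims[OF V(1) c(2) lims[OF c(1) a X(2)] f[OF a]])
qed

context spatial begin

text \<open>Factoring \<open>E a b\<close> as \<open>E a \<one> \<otimes> E \<one> b\<close> reduces
  continuity in one leg to that of the *-homomorphism \<open>a \<mapsto> E a \<one>\<close>, which
  is contractive.\<close>

lemma E_lims_left:
  assumes "\<And>n. X n \<in> carrier A" "a \<in> carrier A" "A.lims X a" "b \<in> carrier B"
  shows "AB.lims (\<lambda>n. E (X n) b) (E a b)"
proof -
  have "AB.lims (\<lambda>n. E (X n) \<one>\<^bsub>B\<^esub> \<otimes>\<^bsub>AB\<^esub> E \<one>\<^bsub>A\<^esub> b) (E a \<one>\<^bsub>B\<^esub> \<otimes>\<^bsub>AB\<^esub> E \<one>\<^bsub>A\<^esub> b)"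
    using star_hom_lims[OF A AB.pre_cstar_axioms E_left_star_hom assms(1,2,3)] assms
    by (intro AB.lims_mult AB.lims_const) (auto intro: E_closed)
  then show ?thesis using assms by (simp add: E_mult)
qed

lemma E_lims_right:
  assumes "\<And>n. X n \<in> carrier B" "b \<in> carrier B" "B.lims X b" "a \<in> carrier A"
  shows "AB.lims (\<lambda>n. E a (X n)) (E a b)"
proof -
  have "AB.lims (\<lambda>n. E a \<one>\<^bsub>B\<^esub> \<otimes>\<^bsub>AB\<^esub> E \<one>\<^bsub>A\<^esub> (X n)) (E a \<one>\<^bsub>B\<^esub> \<otimes>\<^bsub>AB\<^esub> E \<one>\<^bsub>A\<^esub> b)"
    using star_hom_lims[OF B AB.pre_cstar_axioms E_right_star_hom assms(1,2,3)] assms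
    by (intro AB.lims_mult AB.lims_const) (auto intro: E_closed)
  then show ?thesis using assms by (simp add: E_mult)
qed

text \<open>Both legs are extended in turn: first the second leg, with the first still in
  \<open>S\<close>, then the first leg, with the second already arbitrary.\<close>

lemma dense_span:
  assumes S: "S \<subseteq> carrier A" "dense_in A (linear_span A S)"
    and T: "T \<subseteq> carrier B" "dense_in B (linear_span B T)"
  shows "dense_in AB (linear_span AB {E a b | a b. a \<in> S \<and> b \<in> T})"
proof -
  let ?G = "{E a b | a b. a \<in> S \<and> b \<in> T}" and ?V = "linear_span AB {E a b | a b. a \<in> S \<and> b \<in> T}"
  have G: "?G \<subseteq> carrier AB" using S(1) T(1) E_closed by auto
  note V = AB.linear_span_submodule[OF G] and Vc = AB.linear_span_closed[OF G]
  note cl = AB.cl_submodule[OF V]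
  note clD = AB.submoduleD[OF cl]
  have 1: "E a b \<in> AB.cl ?V" if "a \<in> S" "b \<in> carrier B" for a b
  proof (rule span_dense_lift[OF B op_cstar_AB T Vc cl _ _ _ _ _ that(2)])
    fix s assume "s \<in> T"
    then have "E a s \<in> ?V" using that(1) AB.linear_span_superset[of ?G] by blast
    then show "E a s \<in> AB.cl ?V" using AB.cl_superset[OF Vc] by blast
  qed (simp_all add: E_closed E_add_right E_smult_right E_lims_right subsetD[OF S(1)] that)
  have 2: "E a b \<in> AB.cl ?V" if "a \<in> carrier A" "b \<in> carrier B" for a b
    by (rule span_dense_lift[OF A op_cstar_AB S Vc cl _ _ _ _ _ that(1)])
      (simp_all add: E_closed E_add_left E_smult_left E_lims_left 1 that)
  have 3: "emb x \<in> AB.cl ?V" if "x \<in> D.fs" for x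
    using that
  proof (induction rule: D.fs_induct)
    case zero
    show ?case unfolding emb_zero by (rule clD(2))
  next
    case (delta s)
    then obtain a b where "s = (a, b)" "a \<in> carrier A" "b \<in> carrier B" by (auto simp: car)
    then show ?case using 2[of a b] by (simp add: E_emb)
  next
    case (add x y)
    then show ?case unfolding emb_add[OF add(1,2)] by (intro clD(3))
  next
    case (scale c x)
    then show ?case unfolding emb_smult[OF scale(1)] by (intro clD(4))
  qed
  have "z \<in> AB.cl ?V" if z: "z \<in> carrier AB" for z
  proof -
    obtain X where X: "\<And>n. X n \<in> emb ` D.fs" "AB.lims X z" using AB.dense_in_lims[OF emb_dense z] by auto
    have "X n \<in> AB.cl ?V" for n using X(1)[of n] by (rule imageE) (simp add: 3)
    then show ?thesis by (rule AB.cl_lims[OF Vc _ X(2) z])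
  qed
  then show ?thesis using Vc unfolding dense_in_def AB.cl_def by auto
qed

text \<open>The spatial norm bounds the operators of \<open>\<pi> \<otimes> \<rho>\<close>, so the
  action extends to the completion. A pair of representations can thereby serve as one leg of a
  triple tensor product.\<close>

lemma rep_extension:
  fixes H K :: "'i ell2 set"
  assumes r: "cstar_rep A H \<pi>" "cstar_rep B K \<rho>"
  shows "\<exists>\<Theta>. cstar_rep AB (tensor_space H K) \<Theta>
    \<and> (\<forall>a\<in>carrier A. \<forall>b\<in>carrier B. \<forall>f\<in>tensor_space H K. \<Theta> (E a b) f = tensor_act H K \<pi> \<rho> (a, b) f)"
proof -
  have cl: "closed (tensor_space H K)" by (simp add: tensor_space_def)
  have P': "pre_cstar (monoid_star_algebra M jj N)" by (rule D.pre_cstar_dominated_norm[OF dominated])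
  have "\<exists>\<Theta>. cstar_rep (completion (monoid_star_algebra M jj N)) (tensor_space H K) \<Theta> \<and>
    (\<forall>x\<in>D.fs. \<forall>u\<in>tensor_space H K.
      \<Theta> (completion_emb (monoid_star_algebra M jj N) x) u = group_algebra_op (tensor_act H K \<pi> \<rho>) x u)"
    by (rule D.star_act_extension[OF P' act[OF r] cl]) (rule norm_le_N[OF r])
  note ext = this[folded P_eq, folded AB_eq]
  from ext obtain \<Theta> where \<Theta>: "cstar_rep AB (tensor_space H K) \<Theta>"
    "\<forall>x\<in>D.fs. \<forall>f\<in>tensor_space H K. \<Theta> (emb x) f = group_algebra_op (tensor_act H K \<pi> \<rho>) x f"
    by (elim exE conjE)
  show ?thesis
  proof (intro exI[of _ \<Theta>] conjI ballI \<Theta>(1))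
    fix a b f assume "a \<in> carrier A" "b \<in> carrier B" "f \<in> tensor_space H K"
    then show "\<Theta> (E a b) f = tensor_act H K \<pi> \<rho> (a, b) f"
      using \<Theta>(2) by (simp add: E_emb delta_fs D.group_algebra_op_linear(3))
  qed
qed

lemma star_hom_lift:
  assumes Q: "star_algebra Q" "op_cstar C" and e: "star_hom Q C e" "dense_in C (e ` carrier Q)"
    and \<phi>: "star_hom Q P \<phi>" and le: "\<And>x. x \<in> carrier Q \<Longrightarrow> N (\<phi> x) \<le> nrm C (e x)"
  shows "\<exists>F. star_hom C AB F \<and> (\<forall>x\<in>carrier Q. F (e x) = emb (\<phi> x))"
proof (rule star_hom_extension[OF Q op_cstar_AB e(1) star_hom_compose[OF \<phi> emb_star_hom] e(2)])
  fix x assume x: "x \<in> carrier Q"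
  show "nrm AB (emb (\<phi> x)) \<le> nrm C (e x)"
    using le[OF x] nrm_emb[of "\<phi> x"] star_homD(1)[OF \<phi> x] by (simp add: car_P)
qed

end

text \<open>A pair of representations of \<open>A'\<close> and \<open>B'\<close> pulls back to one
  of \<open>A\<close> and \<open>B\<close>, so the spatial norm can only decrease under
  \<open>f \<otimes> g\<close>.\<close>

lemma tensor_star_hom:
  fixes h :: "'i::infinite ell2 itself"
  assumes "op_cstar A" "op_cstar B" "op_cstar A'" "op_cstar B'" and f: "star_hom A A' f" and g: "star_hom B B' g"
  shows "\<exists>F. star_hom (spatial_tensor h A B) (spatial_tensor h A' B') F
    \<and> (\<forall>a\<in>carrier A. \<forall>b\<in>carrier B. F (elem_tensor h A B a b) = elem_tensor h A' B' (f a) (g b))"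
proof -
  interpret S: spatial h A B by (rule spatial.intro) fact+
  interpret S': spatial h A' B' by (rule spatial.intro) fact+
  let ?\<phi> = "\<lambda>(a, b). (f a, g b)"
  have \<phi>: "star_hom S.P S'.P (push ?\<phi>)"
    unfolding S.P_eq S'.P_eq
    by (rule push_star_hom[OF S.D.star_monoid_axioms S'.D.star_monoid_axioms])
      (auto simp: S.car S'.car star_homD[OF f] star_homD[OF g] star_hom_one[OF f] star_hom_one[OF g] DirProd_def)
  have "\<exists>F. star_hom S.AB S'.AB F \<and> (\<forall>x\<in>carrier S.P. F (S.emb x) = S'.emb (push ?\<phi> x))"
  proof (rule S'.star_hom_lift[OF S.P.star_algebra_axioms S.op_cstar_AB S.emb_star_hom _ \<phi>])
    show "dense_in S.AB (S.emb ` carrier S.P)" unfolding S.car_P by (rule S.emb_dense)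
    fix x assume "x \<in> carrier S.P"
    then have x: "x \<in> S.D.fs" by (simp add: S.car_P)
    have x': "push ?\<phi> x \<in> S'.D.fs"
      by (rule push_fin_supp[OF x]) (auto simp: S.car S'.car star_homD[OF f] star_homD[OF g])
    show "spatial_norm h A' B' (push ?\<phi> x) \<le> nrm S.AB (S.emb x)"
      unfolding S.nrm_emb[OF x]
    proof (rule S'.N_leI[OF x' S.dominatedD(2)[OF x]])
      fix H K :: "'i ell2 set" and \<pi> \<rho> u
      assume r: "cstar_rep A' H \<pi>" "cstar_rep B' K \<rho>" and u: "u \<in> tensor_space H K"
      have "group_algebra_op (tensor_act H K \<pi> \<rho>) (push ?\<phi> x) u
          = group_algebra_op (tensor_act H K (\<lambda>a. \<pi> (f a)) (\<lambda>b. \<rho> (g b))) x u"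
        unfolding group_algebra_op_lincomb lincomb_push[OF x] by (simp add: tensor_act_def case_prod_beta')
      then show "norm (group_algebra_op (tensor_act H K \<pi> \<rho>) (push ?\<phi> x) u) \<le> spatial_norm h A B x * norm u"
        using S.norm_le_N[OF cstar_rep_compose[OF f r(1)] cstar_rep_compose[OF g r(2)] x u] by simp
    qed
  qed
  then obtain F where F: "star_hom S.AB S'.AB F" "\<forall>x\<in>carrier S.P. F (S.emb x) = S'.emb (push ?\<phi> x)"
    by (elim exE conjE)
  show ?thesis
  proof (intro exI[of _ F] conjI ballI F(1))
    fix a b assume "a \<in> carrier A" "b \<in> carrier B"
    then show "F (S.E a b) = S'.E (f a) (g b)"
      using F(2) S.delta_fs[of a b] unfolding S.car_P S.E_emb S'.E_emb by (simp add: push_delta)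
  qed
qed


section \<open>The compact quantum group of a tensor absorbing family of representations\<close>

lemma group_algebra_op_permuting:
  assumes x: "x \<in> fin_supp_on S" and u: "u \<in> fin_supp_on I"
    and V: "csubspace V" "\<forall>i\<in>I. z i \<in> V" and Z: "\<forall>m\<in>S. bounded_op_on V (Z m)"
    and Zz: "\<forall>m\<in>S. \<forall>i\<in>I. Z m (z i) = z (act m i)"
  shows "group_algebra_op Z x (lincomb z u) = lincomb z (convolve act x u)"
proof -
  have "lincomb (\<lambda>m. Z m (lincomb z u)) x = lincomb (\<lambda>m. lincomb (\<lambda>i. z (act m i)) u) x"
  proof (rule lincomb_cong[OF x])
    fix m assume m: "m \<in> S"
    have "linear_op_on V (Z m)" using Z m by (simp add: bounded_op_on_def)
    then have "Z m (lincomb z u) = lincomb (\<lambda>i. Z m (z i)) u"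
      by (rule lincomb_linear_op(1)[OF _ V(1) u]) (use V(2) in blast)
    also have "\<dots> = lincomb (\<lambda>i. z (act m i)) u" by (rule lincomb_cong[OF u]) (use Zz m in blast)
    finally show "Z m (lincomb z u) = lincomb (\<lambda>i. z (act m i)) u" .
  qed
  then show ?thesis unfolding group_algebra_op_lincomb lincomb_convolve[OF x u] .
qed

text \<open>Equal Gram matrices make \<open>v i \<mapsto> w i\<close> isometric on spans, and both
  actions move the two families in the same way. Norm estimates therefore pass from \<open>Y\<close>
  to \<open>X\<close> without constructing the intertwining unitary. It is applied to rebracketing
  and to the exchange of tensor factors.\<close>

lemma gram_transfer:
  assumes x: "x \<in> fin_supp_on S"
    and VX: "csubspace VX" "VX \<subseteq> closure (cspan (v ` I))" "\<And>i. i \<in> I \<Longrightarrow> v i \<in> VX"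
    and VY: "csubspace VY" "\<And>i. i \<in> I \<Longrightarrow> w i \<in> VY"
    and X: "\<And>m. m \<in> S \<Longrightarrow> bounded_op_on VX (X m)" and Y: "\<And>m. m \<in> S \<Longrightarrow> bounded_op_on VY (Y m)"
    and act: "\<And>m i. m \<in> S \<Longrightarrow> i \<in> I \<Longrightarrow> act m i \<in> I"
    and Xv: "\<And>m i. m \<in> S \<Longrightarrow> i \<in> I \<Longrightarrow> X m (v i) = v (act m i)"
    and Yw: "\<And>m i. m \<in> S \<Longrightarrow> i \<in> I \<Longrightarrow> Y m (w i) = w (act m i)"
    and gram: "\<And>i j. i \<in> I \<Longrightarrow> j \<in> I \<Longrightarrow> cinner (v i) (v j) = cinner (w i) (w j)"
    and bd: "\<And>g. g \<in> VY \<Longrightarrow> norm (group_algebra_op Y x g) \<le> B * norm g" and f: "f \<in> VX"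
  shows "norm (group_algebra_op X x f) \<le> B * norm f"
proof (rule bounded_op_on_bound_closure[OF bounded_op_on_group_algebra_op[OF VX(1) X x] VX(1) _ VX(2) _ f])
  show "cspan (v ` I) \<subseteq> VX" using VX(3) by (intro cspan_least[OF VX(1)]) auto
  fix g assume "g \<in> cspan (v ` I)"
  then obtain u where u: "u \<in> fin_supp_on I" "g = lincomb v u" unfolding cspan_eq_lincomb by auto
  have cu: "convolve act x u \<in> fin_supp_on I" by (rule convolve_fin_supp[OF x u(1) act])
  have 1: "group_algebra_op X x (lincomb v u) = lincomb v (convolve act x u)"
    by (rule group_algebra_op_permuting[OF x u(1) VX(1)]) (use VX(3) X Xv in blast)+
  have 2: "group_algebra_op Y x (lincomb w u) = lincomb w (convolve act x u)"
    by (rule group_algebra_op_permuting[OF x u(1) VY(1)]) (use VY(2) Y Yw in blast)+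
  have "norm (group_algebra_op X x g) = norm (lincomb w (convolve act x u))"
    unfolding u(2) 1 by (rule norm_lincomb_gram[OF cu gram])
  also have "\<dots> \<le> B * norm (lincomb w u)"
    unfolding 2[symmetric] by (rule bd[OF lincomb_in[OF VY(1) u(1) VY(2)]])
  also have "norm (lincomb w u) = norm g" unfolding u(2) by (rule norm_lincomb_gram[OF u(1) gram, symmetric])
  finally show "norm (group_algebra_op X x g) \<le> B * norm g" .
qed

lemma tensor_space_left_assoc_dense:
  "tensor_space (tensor_space H K) L \<subseteq> closure (cspan ((\<lambda>(x, y, z). tensor (tensor x y) z) ` (H \<times> K \<times> L)))"
  (is "_ \<subseteq> closure (cspan ?T)")
  unfolding tensor_space_def[of "tensor_space H K"]
proof (rule closure_cspan_subset[OF closed_csubspace_closure_cspan])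
  note cs = csubspace_closure[OF csubspace_cspan[of ?T]]
  show "tensor_pair ` (tensor_space H K \<times> L) \<subseteq> closure (cspan ?T)"
  proof
    fix p assume "p \<in> tensor_pair ` (tensor_space H K \<times> L)"
    then obtain f z where f: "p = tensor f z" "f \<in> closure (cspan (tensor_pair ` (H \<times> K)))" and z: "z \<in> L"
      by (auto simp: tensor_pair_def tensor_space_def)
    have "tensor f z \<in> closure (cspan ?T)"
      using f(2)
    proof (induction rule: closure_cspan_induct)
      case (base y)
      then show ?case using z by (intro in_closure_cspan) (force simp: tensor_pair_def)
    next
      case zero
      have "tensor 0 z = (0 :: 'a ell2)" using tensor_scale_left[of 0 0 z] by simp
      then show ?case using csubspace_0[OF cs] by simp
    next
      case (add x y) then show ?case by (simp add: tensor_add_left csubspace_add[OF cs])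
    next
      case (scale c x) then show ?case by (simp add: tensor_scale_left csubspace_scaleC[OF cs])
    next
      case (lim g x)
      show ?case by (rule closed_sequentially[OF closed_closure lim(3) tensor_tendsto_left[OF lim(2)]])
    qed
    then show "p \<in> closure (cspan ?T)" using f(1) by simp
  qed
qed

lemma dense_in_superset: "dense_in A S \<Longrightarrow> S \<subseteq> T \<Longrightarrow> T \<subseteq> carrier A \<Longrightarrow> dense_in A T"
  unfolding dense_in_def by blast

lemma star_hom_image_submodule:
  assumes "star_algebra P" "star_algebra B" "star_hom P B e" shows "submodule (e ` carrier P) complex_ring B"
proof -
  interpret P: star_algebra P by fact
  interpret B: star_algebra B by fact
  note eD = star_homD[OF assms(3)]
  have "e \<zero>\<^bsub>P\<^esub> = \<zero>\<^bsub>B\<^esub>"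
    using eD(5)[OF P.zero_closed, of 0] eD(1)[OF P.zero_closed] by (simp add: P.smult_zero B.smult_zero)
  then show ?thesis
    using eD by (intro B.submoduleI) (auto simp flip: eD(2,5) intro!: imageI P.smult_closed intro: rev_image_eqI[OF P.zero_closed])
qed

text \<open>Isolates what the quantum group structure uses of the \<open>D1\<close>-representations:
  they determine the norm, and they absorb arbitrary unitary representations under tensor
  products.\<close>

locale tensor_absorbing = group G for G :: "('g, 'z) monoid_scheme" +
  fixes R :: "('i::infinite ell2 set \<times> ('g \<Rightarrow> 'i ell2 \<Rightarrow> 'i ell2)) set" and N :: "('g \<Rightarrow> complex) \<Rightarrow> real"
  assumes dominated: "star_monoid.dominated_norm G (m_inv G) R N"
    and absorb: "\<And>H \<pi> K \<tau>. (H, \<pi>) \<in> R \<Longrightarrow> unitary_rep G K \<tau> \<Longrightarrow> (tensor_space H K, \<lambda>s. tensor_act H K \<pi> \<tau> (s, s)) \<in> R"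
begin

sublocale S: star_monoid G "m_inv G" by (rule star_monoid_group) (rule group_axioms)

lemmas dominatedD = S.dominated_normD[OF dominated]

abbreviation "h \<equiv> TYPE('i ell2)"
abbreviation "P \<equiv> group_algebra G N"
abbreviation "A \<equiv> completion (group_algebra G N)"
abbreviation "emb \<equiv> completion_emb (group_algebra G N)"
abbreviation "\<iota> s \<equiv> completion_emb (group_algebra G N) (delta s)"

lemma P_eq: "P = monoid_star_algebra G (m_inv G) N" by (simp add: group_algebra_def)

sublocale P: pre_cstar P unfolding P_eq by (rule S.pre_cstar_dominated_norm[OF dominated])

lemma op_cstar_A: "op_cstar A" by (rule P.completion_op_cstar)

sublocale A: op_cstar A by (rule op_cstar_A)

lemma car_P: "carrier P = S.fs" by (simp add: P_eq monoid_star_algebra_sel)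

lemma delta_fs: "s \<in> carrier G \<Longrightarrow> delta s \<in> S.fs" by (rule fin_supp_on_delta)

lemmas emb_star_hom = P.completion_emb_star_hom

lemma nrm_emb: "x \<in> S.fs \<Longrightarrow> nrm A (emb x) = N x"
  using P.completion_nrm_const[of x] by (simp add: car_P) (simp add: P_eq monoid_star_algebra_sel)

lemma \<iota>_closed: "s \<in> carrier G \<Longrightarrow> \<iota> s \<in> carrier A"
  using star_homD(1)[OF emb_star_hom] delta_fs by (simp add: car_P)

lemma \<iota>_mult: "s \<in> carrier G \<Longrightarrow> t \<in> carrier G \<Longrightarrow> \<iota> (s \<otimes>\<^bsub>G\<^esub> t) = \<iota> s \<otimes>\<^bsub>A\<^esub> \<iota> t"
  using star_homD(3)[OF emb_star_hom, of "delta s" "delta t"] delta_fs S.monoid_star_algebra_delta(1)[of s t]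
  by (simp add: car_P) (simp add: P_eq monoid_star_algebra_sel)

lemma \<iota>_star: "s \<in> carrier G \<Longrightarrow> star A (\<iota> s) = \<iota> (inv\<^bsub>G\<^esub> s)"
  using star_homD(6)[OF emb_star_hom, of "delta s"] delta_fs S.monoid_star_algebra_delta(2)[of s s]
  by (simp add: car_P) (simp add: P_eq monoid_star_algebra_sel)

lemma \<iota>_one: "\<iota> \<one>\<^bsub>G\<^esub> = \<one>\<^bsub>A\<^esub>"
  using star_hom_one[OF emb_star_hom] by (simp add: P_eq monoid_star_algebra_sel)

lemma emb_linear:
  "x \<in> S.fs \<Longrightarrow> y \<in> S.fs \<Longrightarrow> emb (\<lambda>t. x t + y t) = emb x \<oplus>\<^bsub>A\<^esub> emb y"
  "x \<in> S.fs \<Longrightarrow> emb (\<lambda>t. c * x t) = c \<odot>\<^bsub>A\<^esub> emb x" "emb (\<lambda>_. 0) = \<zero>\<^bsub>A\<^esub>"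
  using star_homD(2)[OF emb_star_hom, of x y] star_homD(5)[OF emb_star_hom, of x c] P.completion_zero
  by (simp_all add: car_P completion_emb_def) (simp_all add: P_eq monoid_star_algebra_sel)

lemma emb_closed: "x \<in> S.fs \<Longrightarrow> emb x \<in> carrier A"
  using star_homD(1)[OF emb_star_hom] by (simp add: car_P)

lemma \<iota>_set: "\<iota> ` carrier G \<subseteq> carrier A" using \<iota>_closed by auto

lemma \<iota>_dense: "dense_in A (linear_span A (\<iota> ` carrier G))"
proof (rule dense_in_superset[OF P.completion_emb_dense])
  note D = A.submoduleD[OF A.linear_span_submodule[OF \<iota>_set]]
  show "emb ` carrier P \<subseteq> linear_span A (\<iota> ` carrier G)"
  proof
    fix y assume "y \<in> emb ` carrier P"
    then obtain x where x: "x \<in> S.fs" "y = emb x" by (auto simp: car_P)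
    have "emb x \<in> linear_span A (\<iota> ` carrier G)"
      using x(1)
    proof (induction rule: S.fs_induct)
      case zero show ?case unfolding emb_linear(3) by (rule D(2))
    next
      case (delta s) then show ?case using A.linear_span_superset[of "\<iota> ` carrier G"] by auto
    next
      case (add x y) then show ?case unfolding emb_linear(1)[OF add(1,2)] by (intro D(3))
    next
      case (scale c x) then show ?case unfolding emb_linear(2)[OF scale(1)] by (intro D(4))
    qed
    then show "y \<in> linear_span A (\<iota> ` carrier G)" using x(2) by simp
  qed
  show "linear_span A (\<iota> ` carrier G) \<subseteq> carrier A" by (rule D(1))
qed

lemma rep_\<iota>:
  assumes \<pi>: "cstar_rep A H \<pi>"
  shows "star_act G (m_inv G) H (\<lambda>s. \<pi> (\<iota> s))" "unitary_rep G H (\<lambda>s. \<pi> (\<iota> s))"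
    "x \<in> S.fs \<Longrightarrow> \<xi> \<in> H \<Longrightarrow> norm (group_algebra_op (\<lambda>s. \<pi> (\<iota> s)) x \<xi>) \<le> N x * norm \<xi>"
proof -
  note D = star_actD[OF cstar_rep_star_act[OF \<pi>]]
  show act: "star_act G (m_inv G) H (\<lambda>s. \<pi> (\<iota> s))"
    unfolding star_act_def using D(1,5) by (auto simp: \<iota>_mult \<iota>_one D(2,6) D(7) \<iota>_closed simp flip: \<iota>_star)
  show "unitary_rep G H (\<lambda>s. \<pi> (\<iota> s))"
    unfolding unitary_rep_iff_star_act[OF group_axioms] using act \<pi>
    by (simp add: cstar_rep_def closed_csubspace_def)
  assume x: "x \<in> S.fs" and \<xi>: "\<xi> \<in> H"
  have zero: "\<pi> \<zero>\<^bsub>A\<^esub> \<xi> = 0"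
    using cstar_repD(2)[OF \<pi> \<xi> A.zero_closed, of 0] by (simp add: A.smult_zero)
  have "\<pi> (emb x) \<xi> = group_algebra_op (\<lambda>s. \<pi> (\<iota> s)) x \<xi>"
    using x
  proof (induction rule: S.fs_induct)
    case zero show ?case unfolding emb_linear(3) \<open>\<pi> \<zero>\<^bsub>A\<^esub> \<xi> = 0\<close> by (simp add: group_algebra_op_def)
  next
    case (delta s) then show ?case by (simp add: S.group_algebra_op_linear(3))
  next
    case (add x y)
    then show ?case
      unfolding emb_linear(1)[OF add(1,2)] S.group_algebra_op_linear(1)[OF add(1,2)]
      using cstar_repD(1)[OF \<pi> \<xi> emb_closed emb_closed] by simp
  next
    case (scale c x)
    then show ?case
      unfolding emb_linear(2)[OF scale(1)] S.group_algebra_op_linear(2)[OF scale(1)]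
      using cstar_repD(2)[OF \<pi> \<xi> emb_closed] by simp
  qed
  then show "norm (group_algebra_op (\<lambda>s. \<pi> (\<iota> s)) x \<xi>) \<le> N x * norm \<xi>"
    using cstar_rep_contractive[OF op_cstar_A \<pi> emb_closed[OF x] \<xi>] nrm_emb[OF x] by simp
qed

text \<open>A bound over \<open>R\<close> bounds \<open>N x\<close>, and representations of the
  completion are contractive. This is weak containment in \<open>R\<close>, although the
  representation need not belong to \<open>R\<close>.\<close>

lemma rep_dominated:
  assumes \<pi>: "cstar_rep A H \<pi>" and x: "x \<in> S.fs" and B: "0 \<le> B"
    and bd: "\<And>V W v. (V, W) \<in> R \<Longrightarrow> v \<in> V \<Longrightarrow> norm (group_algebra_op W x v) \<le> B * norm v" and \<xi>: "\<xi> \<in> H"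
  shows "norm (group_algebra_op (\<lambda>s. \<pi> (\<iota> s)) x \<xi>) \<le> B * norm \<xi>"
proof -
  have "N x \<le> B" by (rule dominatedD(4)[OF x B]) (rule bd)
  from mult_right_mono[OF this norm_ge_zero[of \<xi>]] show ?thesis using rep_\<iota>(3)[OF \<pi> x \<xi>] by simp
qed


sublocale T: spatial h A A by (rule spatial.intro) (rule op_cstar_A)+

text \<open>By weak containment the first factor may be replaced by members of \<open>R\<close>. For
  these the diagonal action together with \<open>\<rho>\<close> lies in \<open>R\<close> again by
  absorption, so \<open>N x\<close> bounds it.\<close>

lemma comultiplication_bound:
  assumes x: "x \<in> S.fs" shows "spatial_norm h A A (push (\<lambda>s. (\<iota> s, \<iota> s)) x) \<le> N x"
proof (rule T.N_leI[OF push_fin_supp[OF x] dominatedD(2)[OF x]])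
  fix s assume "s \<in> carrier G"
  then show "(\<iota> s, \<iota> s) \<in> carrier (A \<times>\<times> A)" by (simp add: T.car \<iota>_closed)
next
  fix H K :: "'i ell2 set" and \<pi> \<rho> f
  assume \<pi>: "cstar_rep A H \<pi>" and \<rho>: "cstar_rep A K \<rho>" and f: "f \<in> tensor_space H K"
  let ?\<pi> = "\<lambda>s. \<pi> (\<iota> s)" and ?\<rho> = "\<lambda>s. \<rho> (\<iota> s)" and ?z = "push (\<lambda>s. (s, s)) x"
  have z: "?z \<in> fin_supp_on (carrier G \<times> carrier G)" by (rule push_fin_supp[OF x]) auto
  have "norm (group_algebra_op (tensor_act H K ?\<pi> ?\<rho>) ?z f) \<le> N x * norm f"
  proof (rule tensor_act_weak_containment[OF S.star_monoid_axioms S.star_monoid_axioms rep_\<iota>(1)[OF \<pi>] rep_\<iota>(1)[OF \<rho>]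
      dominatedD(1) rep_dominated[OF \<pi>] z dominatedD(2)[OF x] _ f])
    fix V W g assume VW: "(V, W) \<in> R" and g: "g \<in> tensor_space V K"
    show "norm (group_algebra_op (tensor_act V K W ?\<rho>) ?z g) \<le> N x * norm g"
      using dominatedD(3)[OF x absorb[OF VW rep_\<iota>(2)[OF \<rho>]] g]
      unfolding group_algebra_op_lincomb lincomb_push[OF x] .
  qed
  then show "norm (group_algebra_op (tensor_act H K \<pi> \<rho>) (push (\<lambda>s. (\<iota> s, \<iota> s)) x) f) \<le> N x * norm f"
    unfolding group_algebra_op_lincomb lincomb_push[OF x] by (simp add: tensor_act_def)
qed

lemma comultiplication: "\<exists>\<Delta>. star_hom A T.AB \<Delta> \<and> (\<forall>s\<in>carrier G. \<Delta> (\<iota> s) = T.E (\<iota> s) (\<iota> s))"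
proof -
  let ?\<phi> = "\<lambda>s. (\<iota> s, \<iota> s)"
  have "star_hom (monoid_star_algebra G (m_inv G) N) T.P (push ?\<phi>)"
    unfolding T.P_eq
    by (rule push_star_hom[OF S.star_monoid_axioms T.D.star_monoid_axioms])
      (simp_all add: T.car \<iota>_closed \<iota>_mult \<iota>_star \<iota>_one)
  then have \<phi>: "star_hom P T.P (push ?\<phi>)" unfolding P_eq .
  have "\<exists>F. star_hom A T.AB F \<and> (\<forall>x\<in>carrier P. F (emb x) = T.emb (push ?\<phi> x))"
    by (rule T.star_hom_lift[OF P.star_algebra_axioms op_cstar_A emb_star_hom P.completion_emb_dense \<phi>])
      (simp add: car_P nrm_emb comultiplication_bound)
  then obtain F where F: "star_hom A T.AB F" "\<forall>x\<in>carrier P. F (emb x) = T.emb (push ?\<phi> x)" by (elim exE conjE)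
  show ?thesis
  proof (intro exI[of _ F] conjI ballI F(1))
    fix s assume "s \<in> carrier G"
    then show "F (\<iota> s) = T.E (\<iota> s) (\<iota> s)"
      using F(2) delta_fs[of s] unfolding car_P T.E_emb by (simp add: push_delta)
  qed
qed


section \<open>Associativity of the triple tensor product\<close>

sublocale L: spatial h T.AB A by (rule spatial.intro) (rule T.op_cstar_AB op_cstar_A)+
sublocale Q: spatial h A T.AB by (rule spatial.intro) (rule T.op_cstar_AB op_cstar_A)+

abbreviation "G2 \<equiv> G \<times>\<times> G"
abbreviation "j2 \<equiv> \<lambda>(s, t). (inv\<^bsub>G\<^esub> s, inv\<^bsub>G\<^esub> t)"
abbreviation "G3 \<equiv> (G \<times>\<times> G) \<times>\<times> G"
abbreviation "j3 \<equiv> \<lambda>(p, r). (case p of (s, t) \<Rightarrow> (inv\<^bsub>G\<^esub> s, inv\<^bsub>G\<^esub> t), inv\<^bsub>G\<^esub> r)"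

sublocale S2: star_monoid G2 j2 by (rule star_monoid_DirProd) (rule S.star_monoid_axioms)+
sublocale S3: star_monoid G3 j3 by (rule star_monoid_DirProd) (rule S.star_monoid_axioms S2.star_monoid_axioms)+

lemma car2: "carrier G2 = carrier G \<times> carrier G" and car3: "carrier G3 = (carrier G \<times> carrier G) \<times> carrier G"
  by (simp_all add: carrier_DirProd)

text \<open>With \<open>pR\<close>, the two bracketings of a generator of the triple tensor product.
  The seminorms that they induce on the group ring of \<open>G3\<close> are shown to agree.\<close>

definition "pL = (\<lambda>((s, t), r). (T.E (\<iota> s) (\<iota> t), \<iota> r))"
definition "pR = (\<lambda>((s, t), r). (\<iota> s, T.E (\<iota> t) (\<iota> r)))"

lemma pL_closed: "m \<in> carrier G3 \<Longrightarrow> pL m \<in> carrier (T.AB \<times>\<times> A)"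
  and pR_closed: "m \<in> carrier G3 \<Longrightarrow> pR m \<in> carrier (A \<times>\<times> T.AB)"
  by (auto simp: car3 pL_def pR_def carrier_DirProd \<iota>_closed T.E_closed)

lemma pL_fs: "x \<in> S3.fs \<Longrightarrow> push pL x \<in> L.D.fs" and pR_fs: "x \<in> S3.fs \<Longrightarrow> push pR x \<in> Q.D.fs"
  by (auto intro: push_fin_supp pL_closed pR_closed)

lemma pL_star_hom: "star_hom (monoid_star_algebra G3 j3 N') L.P (push pL)"
  unfolding L.P_eq
  by (rule push_star_hom[OF S3.star_monoid_axioms L.D.star_monoid_axioms])
    (auto simp: car3 pL_def carrier_DirProd \<iota>_closed T.E_closed \<iota>_mult \<iota>_star \<iota>_one T.E_one T.E_mult T.E_star)

lemma pR_star_hom: "star_hom (monoid_star_algebra G3 j3 N') Q.P (push pR)"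
  unfolding Q.P_eq
  by (rule push_star_hom[OF S3.star_monoid_axioms Q.D.star_monoid_axioms])
    (auto simp: car3 pR_def carrier_DirProd \<iota>_closed T.E_closed \<iota>_mult \<iota>_star \<iota>_one T.E_one T.E_mult T.E_star)

text \<open>The norm of \<open>T.AB\<close> is the supremum over these representations.\<close>

definition R2 :: "('i ell2 set \<times> ('g \<times> 'g \<Rightarrow> 'i ell2 \<Rightarrow> 'i ell2)) set" where
  "R2 = {(tensor_space H K, tensor_act H K (\<lambda>s. \<pi> (\<iota> s)) (\<lambda>s. \<rho> (\<iota> s))) | H K \<pi> \<rho>. cstar_rep A H \<pi> \<and> cstar_rep A K \<rho>}"

lemma R2_E:
  assumes "(V, W) \<in> R2"
  obtains H K \<pi> \<rho> where "V = tensor_space H K" "W = tensor_act H K (\<lambda>s. \<pi> (\<iota> s)) (\<lambda>s. \<rho> (\<iota> s))"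
    "cstar_rep A H \<pi>" "cstar_rep A K \<rho>"
  using assms unfolding R2_def by blast

lemma R2_star_act: "(V, W) \<in> R2 \<Longrightarrow> star_act G2 j2 V W"
  by (erule R2_E) (simp add: star_act_tensor[OF rep_\<iota>(1) rep_\<iota>(1) S.star_monoid_axioms S.star_monoid_axioms])

lemma R2_I:
  "cstar_rep A H \<pi> \<Longrightarrow> cstar_rep A K \<rho> \<Longrightarrow> (tensor_space H K, tensor_act H K (\<lambda>s. \<pi> (\<iota> s)) (\<lambda>s. \<rho> (\<iota> s))) \<in> R2"
  unfolding R2_def by blast

definition "p2 = (\<lambda>(s, t). (\<iota> s, \<iota> t))"

text \<open>On combinations of generators the norm of \<open>T.AB\<close> is bounded by any bound
  over \<open>R2\<close>, and representations of \<open>T.AB\<close> are contractive. Hence their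
  restrictions to \<open>G2\<close> are weakly contained in \<open>R2\<close>, as
  \<open>tensor_act_weak_containment\<close> requires.\<close>

lemma AA_rep:
  assumes \<Pi>: "cstar_rep T.AB H \<Theta>"
  shows "star_act G2 j2 H (\<lambda>(s, t). \<Theta> (T.E (\<iota> s) (\<iota> t)))"
    "x \<in> S2.fs \<Longrightarrow> 0 \<le> B \<Longrightarrow> (\<And>V W v. (V, W) \<in> R2 \<Longrightarrow> v \<in> V \<Longrightarrow> norm (group_algebra_op W x v) \<le> B * norm v)
      \<Longrightarrow> \<xi> \<in> H \<Longrightarrow> norm (group_algebra_op (\<lambda>(s, t). \<Theta> (T.E (\<iota> s) (\<iota> t))) x \<xi>) \<le> B * norm \<xi>"
proof -
  note D = star_actD[OF cstar_rep_star_act[OF \<Pi>]]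
  show "star_act G2 j2 H (\<lambda>(s, t). \<Theta> (T.E (\<iota> s) (\<iota> t)))"
    unfolding star_act_def using D(1,5)
    by (auto simp: car2 \<iota>_mult \<iota>_one T.E_one D(2,6) D(7) \<iota>_closed T.E_closed simp flip: \<iota>_star T.E_star T.E_mult)
  assume x: "x \<in> S2.fs" and B: "0 \<le> B" and \<xi>: "\<xi> \<in> H"
    and bd: "\<And>V W v. (V, W) \<in> R2 \<Longrightarrow> v \<in> V \<Longrightarrow> norm (group_algebra_op W x v) \<le> B * norm v"
  have px: "push p2 y \<in> T.D.fs" if "y \<in> S2.fs" for y
    by (rule push_fin_supp[OF that]) (auto simp: p2_def car2 carrier_DirProd \<iota>_closed)
  have zero: "\<Theta> \<zero>\<^bsub>T.AB\<^esub> \<xi> = 0"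
    using cstar_repD(2)[OF \<Pi> \<xi> T.AB.zero_closed, of 0] by (simp add: T.AB.smult_zero)
  have p2h: "star_hom (monoid_star_algebra G2 j2 N') T.P (push p2)" for N'
    unfolding T.P_eq
    by (rule push_star_hom[OF S2.star_monoid_axioms T.D.star_monoid_axioms])
      (auto simp: car2 p2_def carrier_DirProd \<iota>_closed \<iota>_mult \<iota>_star \<iota>_one)
  note h = star_hom_compose[OF p2h T.emb_star_hom, of "\<lambda>_. 0"]
  note hD = star_homD[OF h, unfolded monoid_star_algebra_sel]
  have "\<Theta> (T.emb (push p2 x)) \<xi> = group_algebra_op (\<lambda>(s, t). \<Theta> (T.E (\<iota> s) (\<iota> t))) x \<xi>"
    using x
  proof (induction rule: S2.fs_induct)
    case zero
    have "push p2 (\<lambda>_. 0) = (\<lambda>_. 0)" by (simp add: push_def)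
    then show ?case using \<open>\<Theta> \<zero>\<^bsub>T.AB\<^esub> \<xi> = 0\<close> by (simp add: T.emb_zero group_algebra_op_def)
  next
    case (delta s) then show ?case
      by (cases s) (simp add: S2.group_algebra_op_linear(3) push_delta T.E_emb p2_def)
  next
    case (add x y)
    show ?case
      unfolding hD(2)[OF add(1,2)] S2.group_algebra_op_linear(1)[OF add(1,2)]
        cstar_repD(1)[OF \<Pi> \<xi> hD(1)[OF add(1)] hD(1)[OF add(2)]] add(3,4) ..
  next
    case (scale c x)
    show ?case
      unfolding hD(5)[OF scale(1)] S2.group_algebra_op_linear(2)[OF scale(1)]
        cstar_repD(2)[OF \<Pi> \<xi> hD(1)[OF scale(1)]] scale(2) ..
  qed
  then have "norm (group_algebra_op (\<lambda>(s, t). \<Theta> (T.E (\<iota> s) (\<iota> t))) x \<xi>) \<le> nrm T.AB (T.emb (push p2 x)) * norm \<xi>"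
    using cstar_rep_contractive[OF T.op_cstar_AB \<Pi> hD(1)[OF x] \<xi>] by simp
  also have "nrm T.AB (T.emb (push p2 x)) \<le> B"
    unfolding T.nrm_emb[OF px[OF x]]
  proof (rule T.N_leI[OF px[OF x] B])
    fix H K :: "'i ell2 set" and \<pi> \<rho> f
    assume r: "cstar_rep A H \<pi>" "cstar_rep A K \<rho>" and f: "f \<in> tensor_space H K"
    have "group_algebra_op (tensor_act H K \<pi> \<rho>) (push p2 x) f
        = group_algebra_op (tensor_act H K (\<lambda>s. \<pi> (\<iota> s)) (\<lambda>s. \<rho> (\<iota> s))) x f"
      unfolding group_algebra_op_lincomb lincomb_push[OF x] by (simp add: tensor_act_def p2_def case_prod_beta')
    then show "norm (group_algebra_op (tensor_act H K \<pi> \<rho>) (push p2 x) f) \<le> B * norm f"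
      using bd[OF R2_I[OF r] f] by simp
  qed
  finally show "norm (group_algebra_op (\<lambda>(s, t). \<Theta> (T.E (\<iota> s) (\<iota> t))) x \<xi>) \<le> B * norm \<xi>"
    by (simp add: mult_right_mono)
qed

lemma bounded_tensor_act:
  "star_act M j H W \<Longrightarrow> star_act M' j' K W' \<Longrightarrow> a \<in> carrier M \<Longrightarrow> b \<in> carrier M' \<Longrightarrow>
    bounded_op_on (tensor_space H K) (tensor_act H K W W' (a, b))"
  unfolding tensor_act_def prod.case by (intro tensor_op(1) star_actD(1,2))

text \<open>A representation \<open>\<Theta>\<close> of \<open>T.AB\<close> need not be a tensor
  product, but by weak containment it may be replaced by some \<open>\<pi> \<otimes> \<rho>\<close>.
  Then \<open>(\<pi> \<otimes> \<rho>) \<otimes> \<tau>\<close> is equivalent to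
  \<open>\<pi> \<otimes> (\<rho> \<otimes> \<tau>)\<close>, and
  \<open>\<rho> \<otimes> \<tau>\<close> extends to a representation of \<open>T.AB\<close>, so that
  the norm on the right applies.\<close>

lemma left_norm_le:
  assumes x: "x \<in> S3.fs"
  shows "spatial_norm h T.AB A (push pL x) \<le> spatial_norm h A T.AB (push pR x)" (is "_ \<le> ?B")
proof (rule L.N_leI[OF pL_fs[OF x]])
  show B: "0 \<le> ?B" by (rule Q.dominatedD(2)[OF pR_fs[OF x]])
  fix H K :: "'i ell2 set" and \<Theta> \<tau> f
  assume \<Theta>: "cstar_rep T.AB H \<Theta>" and \<tau>: "cstar_rep A K \<tau>" and f: "f \<in> tensor_space H K"
  let ?\<sigma> = "\<lambda>(s, t). \<Theta> (T.E (\<iota> s) (\<iota> t))" and ?\<tau> = "\<lambda>s. \<tau> (\<iota> s)"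
  have x': "x \<in> fin_supp_on (carrier G2 \<times> carrier G)" using x by (simp add: carrier_DirProd)
  have "norm (group_algebra_op (tensor_act H K ?\<sigma> ?\<tau>) x f) \<le> ?B * norm f"
  proof (rule tensor_act_weak_containment[OF S2.star_monoid_axioms S.star_monoid_axioms AA_rep(1)[OF \<Theta>] rep_\<iota>(1)[OF \<tau>]
      R2_star_act AA_rep(2)[OF \<Theta>] x' B _ f])
    fix V W g assume VW: "(V, W) \<in> R2" and g: "g \<in> tensor_space V K"
    obtain V1 V2 \<pi> \<rho> where V: "V = tensor_space V1 V2" and W: "W = tensor_act V1 V2 (\<lambda>s. \<pi> (\<iota> s)) (\<lambda>s. \<rho> (\<iota> s))"
      and \<pi>: "cstar_rep A V1 \<pi>" and \<rho>: "cstar_rep A V2 \<rho>" using VW by (rule R2_E)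
    obtain \<Psi> where \<Psi>: "cstar_rep T.AB (tensor_space V2 K) \<Psi>"
      "\<forall>a\<in>carrier A. \<forall>b\<in>carrier A. \<forall>f\<in>tensor_space V2 K. \<Psi> (T.E a b) f = tensor_act V2 K \<rho> \<tau> (a, b) f"
      using T.rep_extension[OF \<rho> \<tau>] by (elim exE conjE)
    let ?v = "\<lambda>(x, y, z). tensor (tensor x y) z" and ?w = "\<lambda>(x, y, z). tensor x (tensor y z)"
    let ?I = "V1 \<times> V2 \<times> K"
    let ?act = "\<lambda>((s, t), r) (x, y, z). (\<pi> (\<iota> s) x, \<rho> (\<iota> t) y, \<tau> (\<iota> r) z)"
    let ?Y = "\<lambda>m. tensor_act V1 (tensor_space V2 K) \<pi> \<Psi> (pR m)"
    note a = star_actD(4)[OF rep_\<iota>(1)[OF \<pi>]] star_actD(4)[OF rep_\<iota>(1)[OF \<rho>]] star_actD(4)[OF rep_\<iota>(1)[OF \<tau>]]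
    note aW = R2_star_act[OF VW] and a\<tau> = rep_\<iota>(1)[OF \<tau>]
    show "norm (group_algebra_op (tensor_act V K W ?\<tau>) x g) \<le> ?B * norm g"
    proof (rule gram_transfer[OF x, where v = ?v and w = ?w and I = ?I and Y = ?Y and act = ?act and VY = "tensor_space V1 (tensor_space V2 K)" and VX = "tensor_space V K"])
      show "tensor_space V K \<subseteq> closure (cspan (?v ` ?I))" unfolding V by (rule tensor_space_left_assoc_dense)
      show "?v i \<in> tensor_space V K" "?w i \<in> tensor_space V1 (tensor_space V2 K)" if "i \<in> ?I" for i
        using that by (auto simp: V intro!: tensor_in_space)
      fix m assume m: "m \<in> carrier G3"
      then obtain s t r where m': "m = ((s, t), r)" "s \<in> carrier G" "t \<in> carrier G" "r \<in> carrier G" by (auto simp: car3)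
      show "bounded_op_on (tensor_space V K) (tensor_act V K W ?\<tau> m)"
        unfolding m'(1) by (rule bounded_tensor_act[OF aW a\<tau>]) (use m' in \<open>auto simp: car2\<close>)
      show "bounded_op_on (tensor_space V1 (tensor_space V2 K)) (?Y m)"
        unfolding m'(1) pR_def prod.case
        by (rule bounded_tensor_act[OF cstar_rep_star_act[OF \<pi>] cstar_rep_star_act[OF \<Psi>(1)]]) (use m' in \<open>auto simp: \<iota>_closed T.E_closed\<close>)
      fix i assume "i \<in> ?I"
      then obtain x y z where i: "i = (x, y, z)" "x \<in> V1" "y \<in> V2" "z \<in> K" by auto
      show "?act m i \<in> ?I" using m' i a by auto
      show "tensor_act V K W ?\<tau> m (?v i) = ?v (?act m i)"
        unfolding i(1) m'(1) prod.case
        by (subst tensor_act_tensor[OF aW a\<tau>])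
          (use m' i in \<open>auto simp: car2 V W tensor_in_space tensor_act_tensor[OF rep_\<iota>(1)[OF \<pi>] rep_\<iota>(1)[OF \<rho>]]\<close>)
      show "?Y m (?w i) = ?w (?act m i)"
        unfolding i(1) m'(1) pR_def prod.case
        by (subst Q.act_tensor[OF \<pi> \<Psi>(1)])
          (use m' i \<Psi>(2) in \<open>auto simp: \<iota>_closed T.E_closed tensor_in_space T.act_tensor[OF \<rho> \<tau>]\<close>)
    next
      show "cinner (?v i) (?v j) = cinner (?w i) (?w j)" for i j by (cases i, cases j) (simp add: cinner_tensor)
      show "norm (group_algebra_op ?Y x g) \<le> ?B * norm g" if "g \<in> tensor_space V1 (tensor_space V2 K)" for g
        using Q.norm_le_N[OF \<pi> \<Psi>(1) pR_fs[OF x] that]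
        unfolding group_algebra_op_lincomb lincomb_push[OF x] .
    qed (rule csubspace_tensor_space g)+
  qed
  then show "norm (group_algebra_op (tensor_act H K \<Theta> \<tau>) (push pL x) f) \<le> ?B * norm f"
    unfolding group_algebra_op_lincomb lincomb_push[OF x] by (simp add: tensor_act_def pL_def case_prod_beta')
qed

text \<open>The weak containment estimate replaces the first tensor factor, whereas
  \<open>\<Theta>\<close> now stands in the second. The factors are therefore exchanged, which
  rotates the group triple, and exchanged back at the end.\<close>

lemma right_norm_le:
  assumes x: "x \<in> S3.fs"
  shows "spatial_norm h A T.AB (push pR x) \<le> spatial_norm h T.AB A (push pL x)" (is "_ \<le> ?B")
proof (rule Q.N_leI[OF pR_fs[OF x]])
  show B: "0 \<le> ?B" by (rule L.dominatedD(2)[OF pL_fs[OF x]])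
  fix K H :: "'i ell2 set" and \<tau> \<Theta> f
  assume \<tau>: "cstar_rep A K \<tau>" and \<Theta>: "cstar_rep T.AB H \<Theta>" and f: "f \<in> tensor_space K H"
  let ?\<sigma> = "\<lambda>(s, t). \<Theta> (T.E (\<iota> s) (\<iota> t))" and ?\<tau> = "\<lambda>s. \<tau> (\<iota> s)"
  let ?rot = "\<lambda>((s, t), r). ((t, r), s)" and ?z = "push (\<lambda>((s, t), r). ((t, r), s)) x"
  have z: "?z \<in> fin_supp_on (carrier G2 \<times> carrier G)" by (rule push_fin_supp[OF x]) (auto simp: car2 car3)
  have HK: "norm (group_algebra_op (tensor_act H K ?\<sigma> ?\<tau>) ?z g) \<le> ?B * norm g" if "g \<in> tensor_space H K" for g
  proof (rule tensor_act_weak_containment[OF S2.star_monoid_axioms S.star_monoid_axioms AA_rep(1)[OF \<Theta>] rep_\<iota>(1)[OF \<tau>]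
      R2_star_act AA_rep(2)[OF \<Theta>] z B _ that])
    fix V W g assume VW: "(V, W) \<in> R2" and g: "g \<in> tensor_space V K"
    obtain V1 V2 \<pi> \<rho> where V: "V = tensor_space V1 V2" and W: "W = tensor_act V1 V2 (\<lambda>s. \<pi> (\<iota> s)) (\<lambda>s. \<rho> (\<iota> s))"
      and \<pi>: "cstar_rep A V1 \<pi>" and \<rho>: "cstar_rep A V2 \<rho>" using VW by (rule R2_E)
    obtain \<Psi> where \<Psi>: "cstar_rep T.AB (tensor_space K V1) \<Psi>"
      "\<forall>a\<in>carrier A. \<forall>b\<in>carrier A. \<forall>f\<in>tensor_space K V1. \<Psi> (T.E a b) f = tensor_act K V1 \<tau> \<pi> (a, b) f"
      using T.rep_extension[OF \<tau> \<pi>] by (elim exE conjE)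
    \<comment> \<open>After the exchange the legs come in the order \<open>V1\<close>,
      \<open>V2\<close>, \<open>K\<close>; moving to \<open>(K \<otimes> V1) \<otimes> V2\<close>
      restores the order in which \<open>pL\<close> acts.\<close>
    let ?v = "\<lambda>(x, y, z). tensor (tensor x y) z" and ?w = "\<lambda>(x, y, z). tensor (tensor z x) y"
    let ?I = "V1 \<times> V2 \<times> K"
    let ?act = "\<lambda>((s, t), r) (x, y, z). (\<pi> (\<iota> t) x, \<rho> (\<iota> r) y, \<tau> (\<iota> s) z)"
    let ?Y = "\<lambda>m. tensor_act (tensor_space K V1) V2 \<Psi> \<rho> (pL m)"
    let ?X = "\<lambda>m. tensor_act V K W ?\<tau> (?rot m)"
    note a = star_actD(4)[OF rep_\<iota>(1)[OF \<pi>]] star_actD(4)[OF rep_\<iota>(1)[OF \<rho>]] star_actD(4)[OF rep_\<iota>(1)[OF \<tau>]]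
    note aW = R2_star_act[OF VW] and a\<tau> = rep_\<iota>(1)[OF \<tau>]
    have "norm (group_algebra_op ?X x g) \<le> ?B * norm g"
    proof (rule gram_transfer[OF x, where v = ?v and w = ?w and I = ?I and Y = ?Y and act = ?act and VY = "tensor_space (tensor_space K V1) V2" and VX = "tensor_space V K"])
      show "tensor_space V K \<subseteq> closure (cspan (?v ` ?I))" unfolding V by (rule tensor_space_left_assoc_dense)
      show "?v i \<in> tensor_space V K" "?w i \<in> tensor_space (tensor_space K V1) V2" if "i \<in> ?I" for i
        using that by (auto simp: V intro!: tensor_in_space)
      fix m assume m: "m \<in> carrier G3"
      then obtain s t r where m': "m = ((s, t), r)" "s \<in> carrier G" "t \<in> carrier G" "r \<in> carrier G" by (auto simp: car3)
      show "bounded_op_on (tensor_space V K) (?X m)"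
        unfolding m'(1) prod.case by (rule bounded_tensor_act[OF aW a\<tau>]) (use m' in \<open>auto simp: car2\<close>)
      show "bounded_op_on (tensor_space (tensor_space K V1) V2) (?Y m)"
        unfolding m'(1) pL_def prod.case
        by (rule bounded_tensor_act[OF cstar_rep_star_act[OF \<Psi>(1)] cstar_rep_star_act[OF \<rho>]]) (use m' in \<open>auto simp: \<iota>_closed T.E_closed\<close>)
      fix i assume "i \<in> ?I"
      then obtain x y z where i: "i = (x, y, z)" "x \<in> V1" "y \<in> V2" "z \<in> K" by auto
      show "?act m i \<in> ?I" using m' i a by auto
      show "?X m (?v i) = ?v (?act m i)"
        unfolding i(1) m'(1) prod.case
        by (subst tensor_act_tensor[OF aW a\<tau>])
          (use m' i in \<open>auto simp: car2 V W tensor_in_space tensor_act_tensor[OF rep_\<iota>(1)[OF \<pi>] rep_\<iota>(1)[OF \<rho>]]\<close>)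
      show "?Y m (?w i) = ?w (?act m i)"
        unfolding i(1) m'(1) pL_def prod.case
        by (subst L.act_tensor[OF \<Psi>(1) \<rho>])
          (use m' i \<Psi>(2) in \<open>auto simp: \<iota>_closed T.E_closed tensor_in_space T.act_tensor[OF \<tau> \<pi>]\<close>)
    next
      show "cinner (?v i) (?v j) = cinner (?w i) (?w j)" for i j by (cases i, cases j) (simp add: cinner_tensor)
      show "norm (group_algebra_op ?Y x g) \<le> ?B * norm g" if "g \<in> tensor_space (tensor_space K V1) V2" for g
        using L.norm_le_N[OF \<Psi>(1) \<rho> pL_fs[OF x] that]
        unfolding group_algebra_op_lincomb lincomb_push[OF x] .
    qed (rule csubspace_tensor_space g)+
    then show "norm (group_algebra_op (tensor_act V K W ?\<tau>) ?z g) \<le> ?B * norm g"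
      unfolding group_algebra_op_lincomb lincomb_push[OF x] .
  qed
  \<comment> \<open>Undoes the exchange: the estimate \<open>HK\<close> on
    \<open>H \<otimes> K\<close> is carried back to \<open>K \<otimes> H\<close>.\<close>
  let ?Y = "\<lambda>m. tensor_act H K ?\<sigma> ?\<tau> (?rot m)" and ?X = "\<lambda>m. tensor_act K H \<tau> \<Theta> (pR m)"
  let ?act = "\<lambda>((s, t), r) (x, y). (\<tau> (\<iota> s) x, \<Theta> (T.E (\<iota> t) (\<iota> r)) y)"
  note a\<sigma> = AA_rep(1)[OF \<Theta>] and a\<tau> = rep_\<iota>(1)[OF \<tau>]
  have "norm (group_algebra_op ?X x f) \<le> ?B * norm f"
  proof (rule gram_transfer[OF x, where v = tensor_pair and w = "\<lambda>(x, y). tensor y x" and I = "K \<times> H" and Y = ?Y and act = ?act and VY = "tensor_space H K" and VX = "tensor_space K H"])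
    show "tensor_space K H \<subseteq> closure (cspan (tensor_pair ` (K \<times> H)))" by (simp add: tensor_space_def)
    show "tensor_pair i \<in> tensor_space K H" "(case i of (x, y) \<Rightarrow> tensor y x) \<in> tensor_space H K" if "i \<in> K \<times> H" for i
      using that by (auto simp: tensor_pair_def intro!: tensor_in_space)
    fix m assume m: "m \<in> carrier G3"
    then obtain s t r where m': "m = ((s, t), r)" "s \<in> carrier G" "t \<in> carrier G" "r \<in> carrier G" by (auto simp: car3)
    show "bounded_op_on (tensor_space K H) (?X m)"
      unfolding m'(1) pR_def prod.case
      by (rule bounded_tensor_act[OF cstar_rep_star_act[OF \<tau>] cstar_rep_star_act[OF \<Theta>]]) (use m' in \<open>auto simp: \<iota>_closed T.E_closed\<close>)
    show "bounded_op_on (tensor_space H K) (?Y m)"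
      unfolding m'(1) prod.case(1) case_prod_conv by (rule bounded_tensor_act[OF a\<sigma> a\<tau>]) (use m' in \<open>auto simp: car2\<close>)
    fix i assume "i \<in> K \<times> H"
    then obtain x y where i: "i = (x, y)" "x \<in> K" "y \<in> H" by auto
    show "?act m i \<in> K \<times> H"
      using m' i star_actD(4)[OF a\<tau>] star_actD(4)[OF a\<sigma>, of "(t, r)"] by (auto simp: car2)
    show "?X m (tensor_pair i) = tensor_pair (?act m i)"
      unfolding i(1) m'(1) pR_def prod.case tensor_pair_def
      by (rule Q.act_tensor[OF \<tau> \<Theta>]) (use m' i in \<open>auto simp: \<iota>_closed T.E_closed\<close>)
    show "?Y m (case i of (x, y) \<Rightarrow> tensor y x) = (case ?act m i of (x, y) \<Rightarrow> tensor y x)"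
      using tensor_act_tensor[OF a\<sigma> a\<tau>, of "(t, r)" s y x] m' i by (simp add: car2)
  next
    show "cinner (tensor_pair i) (tensor_pair j) = cinner (case i of (x, y) \<Rightarrow> tensor y x) (case j of (x, y) \<Rightarrow> tensor y x)" for i j
      by (cases i, cases j) (simp add: tensor_pair_def cinner_tensor)
    show "norm (group_algebra_op ?Y x g) \<le> ?B * norm g" if "g \<in> tensor_space H K" for g
      using HK[OF that] unfolding group_algebra_op_lincomb lincomb_push[OF x] .
  qed (rule csubspace_tensor_space f)+
  then show "norm (group_algebra_op (tensor_act K H \<tau> \<Theta>) (push pR x) f) \<le> ?B * norm f"
    unfolding group_algebra_op_lincomb lincomb_push[OF x] .
qed

text \<open>The formal combinations of triples map with dense image into both bracketings, and the
  two preceding estimates make the induced seminorms equal.\<close>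

lemma associator:
  "\<exists>\<alpha>. star_iso L.AB Q.AB \<alpha> \<and> (\<forall>s\<in>carrier G. \<forall>t\<in>carrier G. \<forall>r\<in>carrier G.
    \<alpha> (L.E (T.E (\<iota> s) (\<iota> t)) (\<iota> r)) = Q.E (\<iota> s) (T.E (\<iota> t) (\<iota> r)))"
proof -
  \<comment> \<open>The zero function fills the norm field of the algebra of triples; the comparison
    is made between the norms of its two images.\<close>
  let ?P3 = "monoid_star_algebra G3 j3 (\<lambda>_. 0)"
  have P3: "star_algebra ?P3" by (rule S3.star_algebra_monoid_star_algebra)
  have c3: "carrier ?P3 = S3.fs" by (simp add: monoid_star_algebra_sel)
  have d3: "delta ((s, t), r) \<in> S3.fs" if "s \<in> carrier G" "t \<in> carrier G" "r \<in> carrier G" for s t r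
    using that by (intro fin_supp_on_delta) (simp add: car3)
  let ?eL = "\<lambda>x. L.emb (push pL x)" and ?eR = "\<lambda>x. Q.emb (push pR x)"
  have eL: "star_hom ?P3 L.AB ?eL" by (rule star_hom_compose[OF pL_star_hom L.emb_star_hom])
  have eR: "star_hom ?P3 Q.AB ?eR" by (rule star_hom_compose[OF pR_star_hom Q.emb_star_hom])
  have eLd: "?eL (delta ((s, t), r)) = L.E (T.E (\<iota> s) (\<iota> t)) (\<iota> r)" for s t r by (simp add: push_delta pL_def L.E_emb)
  have eRd: "?eR (delta ((s, t), r)) = Q.E (\<iota> s) (T.E (\<iota> t) (\<iota> r))" for s t r by (simp add: push_delta pR_def Q.E_emb)
  let ?SS = "{T.E a b | a b. a \<in> \<iota> ` carrier G \<and> b \<in> \<iota> ` carrier G}"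
  have SS: "?SS \<subseteq> carrier T.AB" using T.E_closed \<iota>_closed by auto
  have SSd: "dense_in T.AB (linear_span T.AB ?SS)" by (rule T.dense_span[OF \<iota>_set \<iota>_dense \<iota>_set \<iota>_dense])
  have dL: "dense_in L.AB (?eL ` S3.fs)"
  proof (rule dense_in_superset[OF L.dense_span[OF SS SSd \<iota>_set \<iota>_dense] L.AB.linear_span_least])
    show "submodule (?eL ` S3.fs) complex_ring L.AB"
      using star_hom_image_submodule[OF P3 L.AB.star_algebra_axioms eL] by (simp only: c3)
    show "?eL ` S3.fs \<subseteq> carrier L.AB" using star_homD(1)[OF eL] by (auto simp: c3)
    show "{L.E a b | a b. a \<in> ?SS \<and> b \<in> \<iota> ` carrier G} \<subseteq> ?eL ` S3.fs"
    proof
      fix y assume "y \<in> {L.E a b | a b. a \<in> ?SS \<and> b \<in> \<iota> ` carrier G}"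
      then obtain s t r where y: "y = L.E (T.E (\<iota> s) (\<iota> t)) (\<iota> r)" "s \<in> carrier G" "t \<in> carrier G" "r \<in> carrier G" by blast
      show "y \<in> ?eL ` S3.fs" unfolding y(1) eLd[symmetric] by (rule imageI[OF d3[OF y(2-4)]])
    qed
  qed
  have dR: "dense_in Q.AB (?eR ` S3.fs)"
  proof (rule dense_in_superset[OF Q.dense_span[OF \<iota>_set \<iota>_dense SS SSd] Q.AB.linear_span_least])
    show "submodule (?eR ` S3.fs) complex_ring Q.AB"
      using star_hom_image_submodule[OF P3 Q.AB.star_algebra_axioms eR] by (simp only: c3)
    show "?eR ` S3.fs \<subseteq> carrier Q.AB" using star_homD(1)[OF eR] by (auto simp: c3)
    show "{Q.E a b | a b. a \<in> \<iota> ` carrier G \<and> b \<in> ?SS} \<subseteq> ?eR ` S3.fs"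
    proof
      fix y assume "y \<in> {Q.E a b | a b. a \<in> \<iota> ` carrier G \<and> b \<in> ?SS}"
      then obtain s t r where y: "y = Q.E (\<iota> s) (T.E (\<iota> t) (\<iota> r))" "s \<in> carrier G" "t \<in> carrier G" "r \<in> carrier G" by blast
      show "y \<in> ?eR ` S3.fs" unfolding y(1) eRd[symmetric] by (rule imageI[OF d3[OF y(2-4)]])
    qed
  qed
  have "\<exists>\<alpha>. star_iso L.AB Q.AB \<alpha> \<and> (\<forall>x\<in>carrier ?P3. \<alpha> (?eL x) = ?eR x)"
  proof (rule star_iso_extension[OF P3 L.op_cstar_AB Q.op_cstar_AB eL eR dL[folded c3] dR[folded c3]])
    fix x assume "x \<in> carrier ?P3"
    then have x: "x \<in> S3.fs" by (simp add: c3)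
    show "nrm Q.AB (?eR x) = nrm L.AB (?eL x)"
      unfolding L.nrm_emb[OF pL_fs[OF x]] Q.nrm_emb[OF pR_fs[OF x]]
      using left_norm_le[OF x] right_norm_le[OF x] by (rule order.antisym[rotated])
  qed
  then obtain \<alpha> where \<alpha>: "star_iso L.AB Q.AB \<alpha>" "\<forall>x\<in>S3.fs. \<alpha> (?eL x) = ?eR x" unfolding c3 by (elim exE conjE)
  show ?thesis
  proof (intro exI[of _ \<alpha>] conjI ballI \<alpha>(1))
    fix s t r assume "s \<in> carrier G" "t \<in> carrier G" "r \<in> carrier G"
    then show "\<alpha> (L.E (T.E (\<iota> s) (\<iota> t)) (\<iota> r)) = Q.E (\<iota> s) (T.E (\<iota> t) (\<iota> r))"
      using bspec[OF \<alpha>(2) d3] unfolding eLd eRd by blast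
  qed
qed

lemma star_hom_eq_\<iota>:
  assumes "op_cstar B" "star_hom A B f" "star_hom A B g" "\<And>s. s \<in> carrier G \<Longrightarrow> f (\<iota> s) = g (\<iota> s)" "a \<in> carrier A"
  shows "f a = g a"
  by (rule star_hom_eq_span[OF op_cstar_A assms(1-3) \<iota>_set \<iota>_dense _ assms(5)]) (use assms(4) in auto)

text \<open>The elementary tensor is a product of three, each with at most one leg different from
  the unit. In that leg both sides are *-homomorphisms of \<open>A\<close>, so they agree once they
  agree on the group elements.\<close>

lemma associator_elem:
  assumes \<alpha>: "star_hom L.AB Q.AB \<alpha>" and \<alpha>\<iota>: "\<forall>s\<in>carrier G. \<forall>t\<in>carrier G. \<forall>r\<in>carrier G.
      \<alpha> (L.E (T.E (\<iota> s) (\<iota> t)) (\<iota> r)) = Q.E (\<iota> s) (T.E (\<iota> t) (\<iota> r))"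
    and a: "a \<in> carrier A" and b: "b \<in> carrier A" and c: "c \<in> carrier A"
  shows "\<alpha> (L.E (T.E a b) c) = Q.E a (T.E b c)"
proof -
  let ?o = "\<one>\<^bsub>A\<^esub>"
  note o = A.one_closed
  note cl = T.E_closed L.E_closed Q.E_closed
  have \<alpha>1: "\<alpha> (L.E (T.E (\<iota> s) (\<iota> t)) (\<iota> r)) = Q.E (\<iota> s) (T.E (\<iota> t) (\<iota> r))"
    if "s \<in> carrier G" "t \<in> carrier G" "r \<in> carrier G" for s t r using \<alpha>\<iota> that by blast
  have 1: "\<alpha> (L.E (T.E a ?o) ?o) = Q.E a (T.E ?o ?o)"
  proof (rule star_hom_eq_\<iota>[OF Q.op_cstar_AB _ _ _ a])
    show "star_hom A Q.AB (\<lambda>a. \<alpha> (L.E (T.E a ?o) ?o))"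
      by (rule star_hom_compose[OF star_hom_compose[OF T.E_left_star_hom L.E_left_star_hom] \<alpha>])
    show "star_hom A Q.AB (\<lambda>a. Q.E a (T.E ?o ?o))" unfolding T.E_one by (rule Q.E_left_star_hom)
  qed (use \<alpha>1[of _ "\<one>\<^bsub>G\<^esub>" "\<one>\<^bsub>G\<^esub>"] in \<open>simp add: \<iota>_one\<close>)
  have 2: "\<alpha> (L.E (T.E ?o b) ?o) = Q.E ?o (T.E b ?o)"
  proof (rule star_hom_eq_\<iota>[OF Q.op_cstar_AB _ _ _ b])
    show "star_hom A Q.AB (\<lambda>a. \<alpha> (L.E (T.E ?o a) ?o))"
      by (rule star_hom_compose[OF star_hom_compose[OF T.E_right_star_hom L.E_left_star_hom] \<alpha>])
    show "star_hom A Q.AB (\<lambda>a. Q.E ?o (T.E a ?o))" by (rule star_hom_compose[OF T.E_left_star_hom Q.E_right_star_hom])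
  qed (use \<alpha>1[of "\<one>\<^bsub>G\<^esub>" _ "\<one>\<^bsub>G\<^esub>"] in \<open>simp add: \<iota>_one\<close>)
  have 3: "\<alpha> (L.E (T.E ?o ?o) c) = Q.E ?o (T.E ?o c)"
  proof (rule star_hom_eq_\<iota>[OF Q.op_cstar_AB _ _ _ c])
    show "star_hom A Q.AB (\<lambda>a. \<alpha> (L.E (T.E ?o ?o) a))"
      unfolding T.E_one by (rule star_hom_compose[OF L.E_right_star_hom \<alpha>])
    show "star_hom A Q.AB (\<lambda>a. Q.E ?o (T.E ?o a))" by (rule star_hom_compose[OF T.E_right_star_hom Q.E_right_star_hom])
  qed (use \<alpha>1[of "\<one>\<^bsub>G\<^esub>" "\<one>\<^bsub>G\<^esub>"] in \<open>simp add: \<iota>_one\<close>)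
  have l: "L.E (T.E a b) c = L.E (T.E a ?o) ?o \<otimes>\<^bsub>L.AB\<^esub> (L.E (T.E ?o b) ?o \<otimes>\<^bsub>L.AB\<^esub> L.E (T.E ?o ?o) c)"
    using a b c o T.E_closed[OF a o] T.E_closed[OF o b] T.E_closed[OF o o] T.AB.m_closed
    by (simp only: L.E_mult T.E_mult A.l_one A.r_one A.m_closed)
  have r: "Q.E a (T.E b c) = Q.E a (T.E ?o ?o) \<otimes>\<^bsub>Q.AB\<^esub> (Q.E ?o (T.E b ?o) \<otimes>\<^bsub>Q.AB\<^esub> Q.E ?o (T.E ?o c))"
    using a b c o T.E_closed[OF b c] T.E_closed[OF b o] T.E_closed[OF o c] T.E_closed[OF o o] T.AB.m_closed
    by (simp only: Q.E_mult T.E_mult A.l_one A.r_one A.m_closed)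
  have m: "L.E (T.E a ?o) ?o \<in> carrier L.AB" "L.E (T.E ?o b) ?o \<in> carrier L.AB" "L.E (T.E ?o ?o) c \<in> carrier L.AB"
    using a b c o T.E_closed L.E_closed by blast+
  show ?thesis
    unfolding l r star_homD(3)[OF \<alpha> m(1) L.AB.m_closed[OF m(2,3)]] star_homD(3)[OF \<alpha> m(2,3)] 1 2 3 ..
qed

text \<open>Membership in \<open>extensional\<close> fixes the values of \<open>\<Delta>\<close>
  outside the carrier, so that uniqueness makes sense for total functions. On the carrier it follows
  from density of the span of the group elements.\<close>

theorem compact_quantum_group:
  "\<exists>!\<Delta>. \<Delta> \<in> extensional (carrier A) \<and> compact_quantum_group h A \<Delta>
    \<and> (\<forall>s\<in>carrier G. \<Delta> (\<iota> s) = T.E (\<iota> s) (\<iota> s))"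
proof -
  obtain \<Delta>0 where \<Delta>0: "star_hom A T.AB \<Delta>0" "\<forall>s\<in>carrier G. \<Delta>0 (\<iota> s) = T.E (\<iota> s) (\<iota> s)"
    using comultiplication by (elim exE conjE)
  define \<Delta> where "\<Delta> = restrict \<Delta>0 (carrier A)"
  have \<Delta>: "star_hom A T.AB \<Delta>"
    unfolding \<Delta>_def
    by (rule star_homI) (simp_all add: star_homD[OF \<Delta>0(1)] star_hom_one[OF \<Delta>0(1)] A.smult_closed A.star_closed)
  have \<Delta>\<iota>: "\<Delta> (\<iota> s) = T.E (\<iota> s) (\<iota> s)" if "s \<in> carrier G" for s using \<Delta>0(2) that \<iota>_closed by (simp add: \<Delta>_def)
  have coassoc: "coassociative h A \<Delta>"
  proof -
    obtain F where F: "star_hom T.AB L.AB F" "\<forall>a\<in>carrier A. \<forall>b\<in>carrier A. F (T.E a b) = L.E (\<Delta> a) b"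
      using tensor_star_hom[OF op_cstar_A op_cstar_A T.op_cstar_AB op_cstar_A \<Delta> star_hom_ident, where h = h] by (elim exE conjE)
    obtain F' where F': "star_hom T.AB Q.AB F'" "\<forall>a\<in>carrier A. \<forall>b\<in>carrier A. F' (T.E a b) = Q.E a (\<Delta> b)"
      using tensor_star_hom[OF op_cstar_A op_cstar_A op_cstar_A T.op_cstar_AB star_hom_ident \<Delta>, where h = h] by (elim exE conjE)
    obtain \<alpha> where \<alpha>: "star_iso L.AB Q.AB \<alpha>" "\<forall>s\<in>carrier G. \<forall>t\<in>carrier G. \<forall>r\<in>carrier G.
        \<alpha> (L.E (T.E (\<iota> s) (\<iota> t)) (\<iota> r)) = Q.E (\<iota> s) (T.E (\<iota> t) (\<iota> r))"
      using associator by (elim exE conjE)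
    have \<alpha>h: "star_hom L.AB Q.AB \<alpha>" using \<alpha>(1) by (simp add: star_iso_def)
    have co: "\<alpha> (F (\<Delta> a)) = F' (\<Delta> a)" if a: "a \<in> carrier A" for a
    proof (rule star_hom_eq_\<iota>[OF Q.op_cstar_AB _ _ _ a])
      show "star_hom A Q.AB (\<lambda>a. \<alpha> (F (\<Delta> a)))" by (rule star_hom_compose[OF star_hom_compose[OF \<Delta> F(1)] \<alpha>h])
      show "star_hom A Q.AB (\<lambda>a. F' (\<Delta> a))" by (rule star_hom_compose[OF \<Delta> F'(1)])
      fix s assume "s \<in> carrier G"
      note s = this \<iota>_closed[OF this]
      show "\<alpha> (F (\<Delta> (\<iota> s))) = F' (\<Delta> (\<iota> s))"
        using bspec[OF bspec[OF F(2) s(2)] s(2)] bspec[OF bspec[OF F'(2) s(2)] s(2)]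
          bspec[OF bspec[OF bspec[OF \<alpha>(2) s(1)] s(1)] s(1)] by (simp only: \<Delta>\<iota>[OF s(1)])
    qed
    show ?thesis
      unfolding coassociative_def Let_def
    proof (intro exI[of _ F] exI[of _ F'] exI[of _ \<alpha>] conjI F F' \<alpha>(1))
      show "\<forall>a\<in>carrier A. \<forall>b\<in>carrier A. \<forall>c\<in>carrier A. \<alpha> (L.E (T.E a b) c) = Q.E a (T.E b c)"
        by (intro ballI associator_elem[OF \<alpha>h \<alpha>(2)])
      show "\<forall>a\<in>carrier A. \<alpha> (F (\<Delta> a)) = F' (\<Delta> a)" by (intro ballI co)
    qed
  qed
  have G: "{T.E a b | a b. a \<in> \<iota> ` carrier G \<and> b \<in> \<iota> ` carrier G} \<subseteq> carrier T.AB" using T.E_closed \<iota>_closed by auto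
  note dense = T.dense_span[OF \<iota>_set \<iota>_dense \<iota>_set \<iota>_dense]
  have dl: "dense_in T.AB (linear_span T.AB {\<Delta> a \<otimes>\<^bsub>T.AB\<^esub> T.E b \<one>\<^bsub>A\<^esub> | a b. a \<in> carrier A \<and> b \<in> carrier A})"
    (is "dense_in T.AB (linear_span T.AB ?X)")
  proof (rule dense_in_superset[OF dense T.AB.linear_span_mono T.AB.linear_span_closed])
    show "?X \<subseteq> carrier T.AB"
      by (intro subsetI, elim CollectE exE conjE, hypsubst)
        (intro T.AB.m_closed T.E_closed A.one_closed star_homD(1)[OF \<Delta>])
    show "{T.E a b | a b. a \<in> \<iota> ` carrier G \<and> b \<in> \<iota> ` carrier G} \<subseteq> ?X"
    proof
      fix y assume "y \<in> {T.E a b | a b. a \<in> \<iota> ` carrier G \<and> b \<in> \<iota> ` carrier G}"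
      then obtain t s where y: "y = T.E (\<iota> t) (\<iota> s)" and ts: "t \<in> carrier G" "s \<in> carrier G" by blast
      have "\<iota> s \<otimes>\<^bsub>A\<^esub> \<iota> (inv\<^bsub>G\<^esub> s \<otimes>\<^bsub>G\<^esub> t) = \<iota> t" 
        using ts \<iota>_mult[of s "inv\<^bsub>G\<^esub> s \<otimes>\<^bsub>G\<^esub> t"] m_assoc[of s "inv\<^bsub>G\<^esub> s" t] by simp
      then have "y = \<Delta> (\<iota> s) \<otimes>\<^bsub>T.AB\<^esub> T.E (\<iota> (inv\<^bsub>G\<^esub> s \<otimes>\<^bsub>G\<^esub> t)) \<one>\<^bsub>A\<^esub>"

        using ts unfolding y \<Delta>\<iota>[OF ts(2)] by (simp only: T.E_mult \<iota>_closed A.one_closed m_closed inv_closed A.r_one)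
      moreover have "\<iota> (inv\<^bsub>G\<^esub> s \<otimes>\<^bsub>G\<^esub> t) \<in> carrier A" using ts by (intro \<iota>_closed) simp
      ultimately show "y \<in> ?X" using \<iota>_closed[OF ts(2)] by blast
    qed
  qed
  have dr: "dense_in T.AB (linear_span T.AB {\<Delta> a \<otimes>\<^bsub>T.AB\<^esub> T.E \<one>\<^bsub>A\<^esub> b | a b. a \<in> carrier A \<and> b \<in> carrier A})"
    (is "dense_in T.AB (linear_span T.AB ?X)")
  proof (rule dense_in_superset[OF dense T.AB.linear_span_mono T.AB.linear_span_closed])
    show "?X \<subseteq> carrier T.AB"
      by (intro subsetI, elim CollectE exE conjE, hypsubst)
        (intro T.AB.m_closed T.E_closed A.one_closed star_homD(1)[OF \<Delta>])
    show "{T.E a b | a b. a \<in> \<iota> ` carrier G \<and> b \<in> \<iota> ` carrier G} \<subseteq> ?X"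
    proof
      fix y assume "y \<in> {T.E a b | a b. a \<in> \<iota> ` carrier G \<and> b \<in> \<iota> ` carrier G}"
      then obtain s t where y: "y = T.E (\<iota> s) (\<iota> t)" and ts: "t \<in> carrier G" "s \<in> carrier G" by blast
      have "\<iota> s \<otimes>\<^bsub>A\<^esub> \<iota> (inv\<^bsub>G\<^esub> s \<otimes>\<^bsub>G\<^esub> t) = \<iota> t" 
        using ts \<iota>_mult[of s "inv\<^bsub>G\<^esub> s \<otimes>\<^bsub>G\<^esub> t"] m_assoc[of s "inv\<^bsub>G\<^esub> s" t] by simp
      then have "y = \<Delta> (\<iota> s) \<otimes>\<^bsub>T.AB\<^esub> T.E \<one>\<^bsub>A\<^esub> (\<iota> (inv\<^bsub>G\<^esub> s \<otimes>\<^bsub>G\<^esub> t))"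

        using ts unfolding y \<Delta>\<iota>[OF ts(2)] by (simp only: T.E_mult \<iota>_closed A.one_closed m_closed inv_closed A.r_one)
      moreover have "\<iota> (inv\<^bsub>G\<^esub> s \<otimes>\<^bsub>G\<^esub> t) \<in> carrier A" using ts by (intro \<iota>_closed) simp
      ultimately show "y \<in> ?X" using \<iota>_closed[OF ts(2)] by blast
    qed
  qed
  have cqg: "compact_quantum_group h A \<Delta>"
    unfolding compact_quantum_group_def Let_def using A.unital_cstar_algebra \<Delta> coassoc dl dr by blast
  show ?thesis
  proof (rule ex1I[of _ \<Delta>])
    show "\<Delta> \<in> extensional (carrier A) \<and> compact_quantum_group h A \<Delta> \<and> (\<forall>s\<in>carrier G. \<Delta> (\<iota> s) = T.E (\<iota> s) (\<iota> s))"
      using cqg \<Delta>\<iota> unfolding \<Delta>_def by (intro conjI ballI restrict_extensional)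
    fix \<Delta>' assume \<Delta>': "\<Delta>' \<in> extensional (carrier A) \<and> compact_quantum_group h A \<Delta>' \<and> (\<forall>s\<in>carrier G. \<Delta>' (\<iota> s) = T.E (\<iota> s) (\<iota> s))"
    then have h': "star_hom A T.AB \<Delta>'" by (simp add: compact_quantum_group_def Let_def)
    show "\<Delta>' = \<Delta>"
    proof (rule extensionalityI[of _ "carrier A"])
      show "\<Delta>' a = \<Delta> a" if "a \<in> carrier A" for a
        by (rule star_hom_eq_\<iota>[OF T.op_cstar_AB h' \<Delta> _ that]) (use \<Delta>' \<Delta>\<iota> in simp)
    qed (use \<Delta>' \<Delta>_def in simp_all)
  qed
qed

end


section \<open>Representations with coefficients in an ideal\<close>

text \<open>In the last item the multiplier is cut off to zero outside the carrier, so that it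
  becomes an element of \<open>linf G\<close>.\<close>

lemma ideal_linfD:
  assumes D: "ideal D (linf G)"
  shows "f \<in> D \<Longrightarrow> f \<in> carrier (linf G)" "(\<lambda>_. 0) \<in> D"
    "f \<in> D \<Longrightarrow> g \<in> D \<Longrightarrow> (\<lambda>s. f s + g s) \<in> D"
    "f \<in> D \<Longrightarrow> bounded (b ` carrier G) \<Longrightarrow> (\<lambda>s. if s \<in> carrier G then b s * f s else 0) \<in> D"
proof -
  interpret ideal D "linf G" by fact
  show D': "f \<in> carrier (linf G)" if "f \<in> D" for f using a_subset that by blast
  show "(\<lambda>_. 0) \<in> D" using additive_subgroup.zero_closed[OF is_additive_subgroup] by (simp add: linf_def)
  show "f \<in> D \<Longrightarrow> g \<in> D \<Longrightarrow> (\<lambda>s. f s + g s) \<in> D"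
    using additive_subgroup.a_closed[OF is_additive_subgroup, of f g] by (simp add: linf_def)
  assume f: "f \<in> D" and b: "bounded (b ` carrier G)"
  let ?b = "\<lambda>s. if s \<in> carrier G then b s else 0"
  have "range ?b \<subseteq> insert 0 (b ` carrier G)" by auto
  then have "bounded (range ?b)" by (rule bounded_subset[rotated]) (simp add: b)
  then have "?b \<in> carrier (linf G)" by (simp add: linf_def)
  from I_l_closed[OF f this] have "(\<lambda>s. ?b s * f s) \<in> D" by (simp add: linf_def)
  also have "(\<lambda>s. ?b s * f s) = (\<lambda>s. if s \<in> carrier G then b s * f s else 0)" by auto
  finally show "(\<lambda>s. if s \<in> carrier G then b s * f s else 0) \<in> D" .
qed

lemma ideal_linf_scale:
  assumes D: "ideal D (linf G)" and f: "f \<in> D" shows "(\<lambda>s. c * f s) \<in> D"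
proof -
  have "(\<lambda>s. if s \<in> carrier G then c * f s else 0) \<in> D"
    by (rule ideal_linfD(4)[OF D f]) (rule bounded_subset[of "{c}"], auto)
  moreover have "(\<lambda>s. if s \<in> carrier G then c * f s else 0) = (\<lambda>s. c * f s)"
    using ideal_linfD(1)[OF D f] by (auto simp: linf_def)
  ultimately show ?thesis by simp
qed

text \<open>Such an \<open>f\<close> is invertible in \<open>linf G\<close>: every \<open>g\<close>
  is the product of \<open>f\<close> with the bounded function \<open>g / f\<close>.\<close>

lemma ideal_linf_eq_carrier:
  assumes D: "ideal D (linf G)" and f: "f \<in> D" and b: "0 < b" "\<And>s. s \<in> carrier G \<Longrightarrow> b \<le> cmod (f s)"
  shows "D = carrier (linf G)"
proof
  show "D \<subseteq> carrier (linf G)" using ideal_linfD(1)[OF D] by blast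
  show "carrier (linf G) \<subseteq> D"
  proof
    fix g assume g: "g \<in> carrier (linf G)"
    then obtain C where C: "\<And>s. cmod (g s) \<le> C" by (auto simp: linf_def bounded_iff)
    have "cmod (g s / f s) \<le> C / b" if "s \<in> carrier G" for s
      unfolding norm_divide using b(1) b(2)[OF that] C[of s] order_trans[OF norm_ge_zero C[of s]]
      by (intro frac_le) auto
    then have "bounded ((\<lambda>s. g s / f s) ` carrier G)" unfolding bounded_iff by blast
    from ideal_linfD(4)[OF D f this] have "(\<lambda>s. if s \<in> carrier G then g s / f s * f s else 0) \<in> D" .
    also have "(\<lambda>s. if s \<in> carrier G then g s / f s * f s else 0) = g"
    proof
      fix s
      show "(if s \<in> carrier G then g s / f s * f s else 0) = g s"
        using g b(1) b(2)[of s] by (auto simp: linf_def)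
    qed
    finally show "g \<in> D" .
  qed
qed

definition matrix_coeff ::
  "('g, 'm) monoid_scheme \<Rightarrow> ('g \<Rightarrow> 'h \<Rightarrow> 'h::complex_hilbert) \<Rightarrow> 'h \<Rightarrow> 'h \<Rightarrow> 'g \<Rightarrow> complex" where
  "matrix_coeff G \<pi> \<xi> \<eta> = (\<lambda>s. if s \<in> carrier G then cinner (\<pi> s \<xi>) \<eta> else 0)"

lemma D_representation_iff:
  "D_representation G D H \<pi> \<longleftrightarrow> unitary_rep G H \<pi>
     \<and> (\<exists>H0. csubspace H0 \<and> H0 \<subseteq> H \<and> H \<subseteq> closure H0 \<and> (\<forall>\<xi>\<in>H0. \<forall>\<eta>\<in>H0. matrix_coeff G \<pi> \<xi> \<eta> \<in> D))"
  by (simp add: D_representation_def matrix_coeff_def)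

lemma unitary_rep_norm: "unitary_rep G H \<pi> \<Longrightarrow> s \<in> carrier G \<Longrightarrow> \<xi> \<in> H \<Longrightarrow> norm (\<pi> s \<xi>) = norm \<xi>"
  by (rule norm_eq_cinnerI) (simp add: unitary_rep_def unitary_op_on_def)

lemma unitary_rep_linear_op: "unitary_rep G H \<pi> \<Longrightarrow> s \<in> carrier G \<Longrightarrow> linear_op_on H (\<pi> s)"
  by (simp add: unitary_rep_def unitary_op_on_def)

lemma unitary_rep_csubspace: "unitary_rep G H \<pi> \<Longrightarrow> csubspace H"
  by (simp add: unitary_rep_def closed_csubspace_def)

lemma matrix_coeff_csubspace:
  assumes \<pi>: "unitary_rep G H \<pi>" and D: "ideal D (linf G)"
  shows "csubspace {\<xi> \<in> H. \<forall>\<eta>\<in>S. matrix_coeff G \<pi> \<xi> \<eta> \<in> D}" "csubspace {\<eta> \<in> H. \<forall>\<xi>\<in>S. matrix_coeff G \<pi> \<xi> \<eta> \<in> D}"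
proof -
  note H = unitary_rep_csubspace[OF \<pi>] and L = unitary_rep_linear_op[OF \<pi>]
  have l: "matrix_coeff G \<pi> (\<xi> + \<xi>') \<eta> = (\<lambda>s. matrix_coeff G \<pi> \<xi> \<eta> s + matrix_coeff G \<pi> \<xi>' \<eta> s)"
    "matrix_coeff G \<pi> (scaleC c \<xi>) \<eta> = (\<lambda>s. c * matrix_coeff G \<pi> \<xi> \<eta> s)" "matrix_coeff G \<pi> 0 \<eta> = (\<lambda>_. 0)"
    if "\<xi> \<in> H" "\<xi>' \<in> H" for \<xi> \<xi>' \<eta> c
    using that linear_op_onD(2,3)[OF L] linear_op_on_0[OF L H]
    by (auto simp: matrix_coeff_def cinner_add_left cinner_scaleC_left)
  have r: "matrix_coeff G \<pi> \<xi> (\<eta> + \<eta>') = (\<lambda>s. matrix_coeff G \<pi> \<xi> \<eta> s + matrix_coeff G \<pi> \<xi> \<eta>' s)"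
    "matrix_coeff G \<pi> \<xi> (scaleC c \<eta>) = (\<lambda>s. cnj c * matrix_coeff G \<pi> \<xi> \<eta> s)" "matrix_coeff G \<pi> \<xi> 0 = (\<lambda>_. 0)"
    for \<xi> \<eta> \<eta>' c
    by (auto simp: matrix_coeff_def cinner_add_right cinner_scaleC_right)
  show "csubspace {\<xi> \<in> H. \<forall>\<eta>\<in>S. matrix_coeff G \<pi> \<xi> \<eta> \<in> D}"
    unfolding csubspace_def using csubspace_0[OF H] csubspace_add[OF H] csubspace_scaleC[OF H]
    by (auto simp: l ideal_linfD(2,3)[OF D] ideal_linf_scale[OF D])
  show "csubspace {\<eta> \<in> H. \<forall>\<xi>\<in>S. matrix_coeff G \<pi> \<xi> \<eta> \<in> D}"
    unfolding csubspace_def using csubspace_0[OF H] csubspace_add[OF H] csubspace_scaleC[OF H]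
    by (auto simp: r ideal_linfD(2,3)[OF D] ideal_linf_scale[OF D])
qed

text \<open>Sesquilinearity allows the span to be formed in one argument at a time, the other
  running first through \<open>S\<close> and then through its span.\<close>

lemma matrix_coeff_cspan:
  assumes \<pi>: "unitary_rep G H \<pi>" and D: "ideal D (linf G)" and S: "S \<subseteq> H"
    and c: "\<And>\<xi> \<eta>. \<xi> \<in> S \<Longrightarrow> \<eta> \<in> S \<Longrightarrow> matrix_coeff G \<pi> \<xi> \<eta> \<in> D"
  shows "\<xi> \<in> cspan S \<Longrightarrow> \<eta> \<in> cspan S \<Longrightarrow> matrix_coeff G \<pi> \<xi> \<eta> \<in> D"
proof -
  have 1: "cspan S \<subseteq> {\<xi> \<in> H. \<forall>\<eta>\<in>S. matrix_coeff G \<pi> \<xi> \<eta> \<in> D}"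
    by (rule cspan_least[OF matrix_coeff_csubspace(1)[OF \<pi> D]]) (use S c in blast)
  have 2: "cspan S \<subseteq> {\<eta> \<in> H. \<forall>\<xi>\<in>cspan S. matrix_coeff G \<pi> \<xi> \<eta> \<in> D}"
    by (rule cspan_least[OF matrix_coeff_csubspace(2)[OF \<pi> D]]) (use S 1 in blast)
  show "\<xi> \<in> cspan S \<Longrightarrow> \<eta> \<in> cspan S \<Longrightarrow> matrix_coeff G \<pi> \<xi> \<eta> \<in> D" using 2 by blast
qed

lemma D_representation_cspan:
  assumes "unitary_rep G H \<pi>" "ideal D (linf G)" "S \<subseteq> H" "H \<subseteq> closure (cspan S)"
    and "\<And>\<xi> \<eta>. \<xi> \<in> S \<Longrightarrow> \<eta> \<in> S \<Longrightarrow> matrix_coeff G \<pi> \<xi> \<eta> \<in> D"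
  shows "D_representation G D H \<pi>"
  unfolding D_representation_iff
proof (intro conjI exI[of _ "cspan S"] ballI)
  show "csubspace (cspan S)" by (rule csubspace_cspan)
  show "cspan S \<subseteq> H" by (rule cspan_least[OF unitary_rep_csubspace[OF assms(1)] assms(3)])
  show "matrix_coeff G \<pi> \<xi> \<eta> \<in> D" if "\<xi> \<in> cspan S" "\<eta> \<in> cspan S" for \<xi> \<eta>
    by (rule matrix_coeff_cspan[OF assms(1-3) _ that]) (rule assms(5))
qed (rule assms)+

lemma star_act_pullback:
  assumes "star_act M j V W" "\<And>m. m \<in> carrier M' \<Longrightarrow> f m \<in> carrier M" "f \<one>\<^bsub>M'\<^esub> = \<one>\<^bsub>M\<^esub>"
    "\<And>m n. m \<in> carrier M' \<Longrightarrow> n \<in> carrier M' \<Longrightarrow> f (m \<otimes>\<^bsub>M'\<^esub> n) = f m \<otimes>\<^bsub>M\<^esub> f n"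
    "\<And>m. m \<in> carrier M' \<Longrightarrow> j (f m) = f (j' m)"
  shows "star_act M' j' V (\<lambda>m. W (f m))"
  using assms unfolding star_act_def by simp

lemma unitary_rep_tensor:
  assumes G: "group G" and \<pi>: "unitary_rep G H \<pi>" and \<tau>: "unitary_rep G K \<tau>"
  shows "unitary_rep G (tensor_space H K) (\<lambda>s. tensor_act H K \<pi> \<tau> (s, s))"
proof -
  have a: "star_act G (m_inv G) H \<pi>" "star_act G (m_inv G) K \<tau>"
    using \<pi> \<tau> unfolding unitary_rep_iff_star_act[OF G] by auto
  have "star_act G (m_inv G) (tensor_space H K) (\<lambda>s. tensor_act H K \<pi> \<tau> (s, s))"
    by (rule star_act_pullback[OF star_act_tensor[OF a star_monoid_group[OF G] star_monoid_group[OF G]]])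
      (simp_all add: carrier_DirProd)
  then show ?thesis
    unfolding unitary_rep_iff_star_act[OF G] using closed_csubspace_tensor_space[of H K] by (simp add: closed_csubspace_def)
qed

lemma D_representation_tensor:
  assumes G: "group G" and D: "ideal D (linf G)" and \<pi>: "D_representation G D H \<pi>" and \<tau>: "unitary_rep G K \<tau>"
  shows "D_representation G D (tensor_space H K) (\<lambda>s. tensor_act H K \<pi> \<tau> (s, s))"
proof -
  obtain H0 where u: "unitary_rep G H \<pi>" and H0: "H0 \<subseteq> H" "H \<subseteq> closure H0"
    and c: "\<And>\<xi> \<eta>. \<xi> \<in> H0 \<Longrightarrow> \<eta> \<in> H0 \<Longrightarrow> matrix_coeff G \<pi> \<xi> \<eta> \<in> D"
    using \<pi> unfolding D_representation_iff by blast
  have a: "star_act G (m_inv G) H \<pi>" "star_act G (m_inv G) K \<tau>"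
    using u \<tau> unfolding unitary_rep_iff_star_act[OF G] by auto
  \<comment> \<open>The first leg is taken from the dense subspace, where coefficients lie in
    \<open>D\<close>; in the second leg every vector gives a bounded coefficient, which the ideal
    absorbs.\<close>
  let ?S = "tensor_pair ` (H0 \<times> K)"
  show ?thesis
  proof (rule D_representation_cspan[OF unitary_rep_tensor[OF G u \<tau>] D, of ?S])
    show "?S \<subseteq> tensor_space H K" using H0(1) by (auto simp: tensor_pair_def intro!: tensor_in_space)
    show "tensor_space H K \<subseteq> closure (cspan ?S)"
      unfolding tensor_space_def
    proof (rule closure_cspan_subset[OF closed_csubspace_closure_cspan])
      show "tensor_pair ` (H \<times> K) \<subseteq> closure (cspan ?S)"
      proof
        fix p assume "p \<in> tensor_pair ` (H \<times> K)"
        then obtain x y where p: "p = tensor x y" "x \<in> H" "y \<in> K" by (auto simp: tensor_pair_def)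
        then have "x \<in> closure H0" using H0(2) by blast
        then obtain g where g: "\<And>n. g n \<in> H0" "g \<longlonglongrightarrow> x" unfolding closure_sequential by blast
        have "tensor (g n) y \<in> closure (cspan ?S)" for n
          by (rule in_closure_cspan) (use g(1) p(3) in \<open>force simp: tensor_pair_def\<close>)
        then show "p \<in> closure (cspan ?S)"
          unfolding p(1) by (rule closed_sequentially[OF closed_closure _ tensor_tendsto_left[OF g(2)]])
      qed
    qed
    fix p q assume "p \<in> ?S" "q \<in> ?S"
    then obtain x y x' y' where p: "p = tensor x y" "x \<in> H0" "y \<in> K" and q: "q = tensor x' y'" "x' \<in> H0" "y' \<in> K"
      by (auto simp: tensor_pair_def)
    have "cmod (cinner (\<tau> s y) y') \<le> norm y * norm y'" if "s \<in> carrier G" for s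
      using cmod_cinner_le[of "\<tau> s y" y'] unitary_rep_norm[OF \<tau> that p(3)] by simp
    then have "bounded ((\<lambda>s. cinner (\<tau> s y) y') ` carrier G)" unfolding bounded_iff by blast
    from ideal_linfD(4)[OF D c[OF p(2) q(2)] this]
    have "(\<lambda>s. if s \<in> carrier G then cinner (\<tau> s y) y' * matrix_coeff G \<pi> x x' s else 0) \<in> D" .
    also have "(\<lambda>s. if s \<in> carrier G then cinner (\<tau> s y) y' * matrix_coeff G \<pi> x x' s else 0)
        = matrix_coeff G (\<lambda>s. tensor_act H K \<pi> \<tau> (s, s)) p q"
    proof
      fix s
      have "x \<in> H" using p(2) H0(1) by blast
      then show "(if s \<in> carrier G then cinner (\<tau> s y) y' * matrix_coeff G \<pi> x x' s else 0)
        = matrix_coeff G (\<lambda>s. tensor_act H K \<pi> \<tau> (s, s)) p q s"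
        using p(3) by (simp add: matrix_coeff_def p(1) q(1) tensor_act_tensor[OF a] cinner_tensor)
    qed
    finally show "matrix_coeff G (\<lambda>s. tensor_act H K \<pi> \<tau> (s, s)) p q \<in> D" .
  qed
qed


section \<open>Norms defined by families of unitary representations\<close>

text \<open>Unitaries are isometric, so the sum of the absolute values of \<open>x\<close> bounds
  all representations at once and the supremum exists.\<close>

lemma unitary_family_dominated:
  assumes G: "group G" and R: "\<And>H \<pi>. (H, \<pi>) \<in> R \<Longrightarrow> unitary_rep G H \<pi>" "R \<noteq> {}"
    and N: "\<And>x. N x = Sup {op_norm_on H (group_algebra_op \<pi> x) | H \<pi>. (H, \<pi>) \<in> R}"
  shows "star_monoid.dominated_norm G (m_inv G) R N"
proof -
  interpret S: star_monoid G "m_inv G" by (rule star_monoid_group[OF G])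
  show ?thesis
  proof (rule S.dominated_norm_Sup[OF _ R(2) _ N])
    show "star_act G (m_inv G) V W" if "(V, W) \<in> R" for V W
      using R(1)[OF that] unfolding unitary_rep_iff_star_act[OF G] by blast
    fix x assume x: "x \<in> S.fs"
    let ?C = "\<Sum>s | x s \<noteq> 0. cmod (x s)"
    have "norm (group_algebra_op W x u) \<le> ?C * norm u" if "(V, W) \<in> R" "u \<in> V" for V W u
      unfolding group_algebra_op_lincomb sum_distrib_right
      by (rule norm_lincomb_le[OF _ x]) (simp add: unitary_rep_norm[OF R(1)[OF that(1)] _ that(2)])
    then show "\<exists>C\<ge>0. \<forall>(V, W)\<in>R. \<forall>u\<in>V. norm (group_algebra_op W x u) \<le> C * norm u"
      by (intro exI[of _ ?C] conjI) (auto simp: sum_nonneg)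
  qed
qed

lemma zero_unitary_rep: "unitary_rep G {0} (\<lambda>_ x. x)"
  by (simp add: unitary_rep_def closed_csubspace_def csubspace_def unitary_op_on_def linear_op_on_def)

lemma D_norm_dominated:
  assumes G: "group G" and D: "ideal D (linf G)"
  shows "star_monoid.dominated_norm G (m_inv G)
    {(H, \<pi>). D_representation G D (H :: 'h::complex_hilbert set) \<pi>} (D_norm TYPE('h) G D)"
proof (rule unitary_family_dominated[OF G])
  have "D_representation G D {0 :: 'h} (\<lambda>_ x. x)"
    unfolding D_representation_iff
  proof (intro conjI exI[of _ "{0}"] zero_unitary_rep)
    show "\<forall>\<xi>\<in>{0 :: 'h}. \<forall>\<eta>\<in>{0}. matrix_coeff G (\<lambda>_ x. x) \<xi> \<eta> \<in> D"
      using ideal_linfD(2)[OF D] by (simp add: matrix_coeff_def cinner.zero_left cong: if_cong)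
  qed (simp_all add: csubspace_def)
  then show "{(H, \<pi>). D_representation G D (H :: 'h set) \<pi>} \<noteq> {}" by blast
qed (auto simp: D_norm_def D_representation_def)

lemma full_norm_dominated:
  assumes G: "group G"
  shows "star_monoid.dominated_norm G (m_inv G)
    {(H, \<pi>). unitary_rep G (H :: 'h::complex_hilbert set) \<pi>} (full_norm TYPE('h) G)"
  by (rule unitary_family_dominated[OF G]) (use zero_unitary_rep in \<open>auto simp: full_norm_def\<close>)

lemma pre_cstar_group_algebra:
  "group G \<Longrightarrow> star_monoid.dominated_norm G (m_inv G) R N \<Longrightarrow> pre_cstar (group_algebra G N)"
  unfolding group_algebra_def by (rule star_monoid.pre_cstar_dominated_norm[OF star_monoid_group])

lemma star_iso_sym:
  assumes A: "star_algebra A" and f: "star_iso A B f"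
  shows "star_iso B A (inv_into (carrier A) f)"
proof -
  interpret star_algebra A by fact
  have h: "star_hom A B f" and b: "bij_betw f (carrier A) (carrier B)" using f by (auto simp: star_iso_def)
  let ?g = "inv_into (carrier A) f"
  have g: "?g y \<in> carrier A" "f (?g y) = y" if "y \<in> carrier B" for y
    using that bij_betw_imp_surj_on[OF b] by (auto simp: inv_into_into f_inv_into_f)
  have gf: "?g (f x) = x" if "x \<in> carrier A" for x by (rule bij_betw_inv_into_left[OF b that])
  note hD = star_homD[OF h]
  have "star_hom B A ?g"
  proof (rule star_homI)
    show "?g \<one>\<^bsub>B\<^esub> = \<one>\<^bsub>A\<^esub>" using gf[OF one_closed] star_hom_one[OF h] by simp
    show "?g (x \<oplus>\<^bsub>B\<^esub> y) = ?g x \<oplus>\<^bsub>A\<^esub> ?g y" if "x \<in> carrier B" "y \<in> carrier B" for x y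
      using gf[OF a_closed[OF g(1)[OF that(1)] g(1)[OF that(2)]]] hD(2)[OF g(1)[OF that(1)] g(1)[OF that(2)]] g(2) that by simp
    show "?g (x \<otimes>\<^bsub>B\<^esub> y) = ?g x \<otimes>\<^bsub>A\<^esub> ?g y" if "x \<in> carrier B" "y \<in> carrier B" for x y
      using gf[OF m_closed[OF g(1)[OF that(1)] g(1)[OF that(2)]]] hD(3)[OF g(1)[OF that(1)] g(1)[OF that(2)]] g(2) that by simp
    show "?g (c \<odot>\<^bsub>B\<^esub> x) = c \<odot>\<^bsub>A\<^esub> ?g x" if "x \<in> carrier B" for c x
      using gf[OF smult_closed[OF g(1)[OF that]]] hD(5)[OF g(1)[OF that]] g(2)[OF that] by metis
    show "?g (star B x) = star A (?g x)" if "x \<in> carrier B" for x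
      using gf[OF star_closed[OF g(1)[OF that]]] hD(6)[OF g(1)[OF that]] g(2)[OF that] by metis
  qed (rule g)
  then show ?thesis using bij_betw_inv_into[OF b] by (simp add: star_iso_def)
qed

text \<open>An isomorphism and its inverse are both contractive, hence isometric. Two completions
  are therefore told apart by a single \<open>x\<close> with different norms.\<close>

lemma group_completions_equal_norms:
  assumes 1: "pre_cstar (group_algebra G N1)" and 2: "pre_cstar (group_algebra G N2)"
    and eq: "group_completions_equal G N1 N2" and x: "x \<in> fin_supp_on (carrier G)"
  shows "N1 x = N2 x"
proof -
  let ?A = "completion (group_algebra G N1)" and ?B = "completion (group_algebra G N2)"
  let ?a = "completion_emb (group_algebra G N1) x" and ?b = "completion_emb (group_algebra G N2) x"
  have cx: "x \<in> carrier (group_algebra G N)" and nx: "nrm (group_algebra G N) x = N x" for N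
    using x by (simp_all add: group_algebra_def monoid_star_algebra_sel)
  obtain \<Phi> where \<Phi>: "star_iso ?A ?B \<Phi>" "\<Phi> ?a = ?b"
    using eq x unfolding group_completions_equal_def by blast
  note A = pre_cstar.completion_op_cstar[OF 1] and B = pre_cstar.completion_op_cstar[OF 2]
  interpret A: op_cstar ?A by (rule A)
  interpret B: op_cstar ?B by (rule B)
  have a: "?a \<in> carrier ?A" by (rule star_homD(1)[OF pre_cstar.completion_emb_star_hom[OF 1] cx])
  have b: "?b \<in> carrier ?B" by (rule star_homD(1)[OF pre_cstar.completion_emb_star_hom[OF 2] cx])
  have na: "nrm ?A ?a = N1 x" using pre_cstar.completion_nrm_const[OF 1 cx] by (simp add: nx)
  have nb: "nrm ?B ?b = N2 x" using pre_cstar.completion_nrm_const[OF 2 cx] by (simp add: nx)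
  have h: "star_hom ?A ?B \<Phi>" "star_hom ?B ?A (inv_into (carrier ?A) \<Phi>)"
    using \<Phi>(1) star_iso_sym[OF A.star_algebra_axioms \<Phi>(1)] by (simp_all add: star_iso_def)
  have i: "inv_into (carrier ?A) \<Phi> ?b = ?a"
    unfolding \<Phi>(2)[symmetric] by (rule bij_betw_inv_into_left[of \<Phi> "carrier ?A" "carrier ?B", OF _ a]) (use \<Phi>(1) in \<open>simp add: star_iso_def\<close>)
  show ?thesis
    using star_hom_contractive[OF A B.pre_cstar_axioms h(1) a] star_hom_contractive[OF B A.pre_cstar_axioms h(2) b]
    unfolding \<Phi>(2) i na nb by simp
qed


section \<open>Property (T)\<close>

lift_definition ell2_basis :: "'i \<Rightarrow> 'i ell2" is delta
  by (rule summable_on_finite[THEN summable_on_cong_neutral[THEN iffD1, rotated -1], of "{_}"]) (auto simp: delta_def)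

lemma ell2_basis_nonzero: "ell2_basis i \<noteq> 0"
proof
  assume "ell2_basis i = 0"
  then have "Rep_ell2 (ell2_basis i) i = Rep_ell2 0 i" by simp
  then show False by (simp add: ell2_basis.rep_eq zero_ell2.rep_eq delta_def)
qed

text \<open>Parallelogram law: if the sum is nearly as long as possible, the difference is short.
  The condition on \<open>d\<close> comes from
  \<open>4 - (2 - d)\<^sup>2 = 4 * d - d\<^sup>2\<close>.\<close>

lemma norm_diff_less_if_norm_add:
  fixes u v :: "'h::real_inner"
  assumes "norm u = norm v" "(2 - d) * norm v < norm (u + v)" "0 < d" "d \<le> 1" "4 * d \<le> e\<^sup>2" "0 < e"
  shows "norm (u - v) < e * norm v"
proof -
  have p: "(norm (u - v))\<^sup>2 + (norm (u + v))\<^sup>2 = 4 * (norm v)\<^sup>2"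
    using assms(1) by (simp add: norm_eq_sqrt_inner) (simp add: power2_norm_eq_inner inner_add inner_diff inner_commute algebra_simps flip: norm_eq_sqrt_inner)
  have "(2 - d)\<^sup>2 * (norm v)\<^sup>2 < (norm (u + v))\<^sup>2"
    unfolding power_mult_distrib[symmetric] using assms(2-4) by (intro power_strict_mono) auto
  then have "(norm (u - v))\<^sup>2 < (4 - (2 - d)\<^sup>2) * (norm v)\<^sup>2" using p unfolding left_diff_distrib by linarith
  also have "\<dots> \<le> e\<^sup>2 * (norm v)\<^sup>2"
  proof (rule mult_right_mono)
    have "4 - (2 - d)\<^sup>2 = 4 * d - d * d" by (simp add: power2_eq_square algebra_simps)
    then show "4 - (2 - d)\<^sup>2 \<le> e\<^sup>2" using assms(5) zero_le_square[of d] by linarith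
  qed simp
  finally have "(norm (u - v))\<^sup>2 < (e * norm v)\<^sup>2" by (simp add: power_mult_distrib)
  then show ?thesis by (rule power2_less_imp_less) (use assms(6) in simp)
qed

text \<open>On a vector fixed by \<open>F\<close>, the sum of the group elements in \<open>F\<close>
  acts as the scalar \<open>card F\<close>.\<close>

lemma card_le_dominated_norm:
  assumes G: "group G" and N: "star_monoid.dominated_norm G (m_inv G) R N" and F: "finite F" "F \<subseteq> carrier G"
    and \<pi>: "(H, \<pi>) \<in> R" "e \<in> H" "e \<noteq> 0" "\<And>s. s \<in> F \<Longrightarrow> \<pi> s e = e"
  shows "real (card F) \<le> N (\<lambda>s. if s \<in> F then 1 else 0)" (is "_ \<le> N ?x")
proof -
  have x: "?x \<in> fin_supp_on (carrier G)" using F by (auto simp: fin_supp_on_def)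
  have "norm (group_algebra_op \<pi> ?x e) \<le> N ?x * norm e"
    by (rule star_monoid.dominated_normD(3)[OF star_monoid_group[OF G] N x \<pi>(1,2)])
  also have "group_algebra_op \<pi> ?x e = (\<Sum>s\<in>F. scaleC 1 e)"
    unfolding group_algebra_op_def by (rule sum.cong) (use \<pi>(4) in auto)
  also have "\<dots> = scaleC (of_nat (card F)) e" by (simp only: scaleC.sum_left[symmetric]) simp
  finally show ?thesis using \<pi>(3) by (simp add: norm_scaleC)
qed

text \<open>Since \<open>\<Sum>\<^sub>s \<pi>\<^sub>s v\<close> almost has the maximal possible norm, all the vectors \<open>\<pi>\<^sub>s v\<close> are almost equal.\<close>

lemma almost_invariant_vector:
  assumes G: "group G" and N: "star_monoid.dominated_norm G (m_inv G) R N"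
    and R: "\<And>H \<pi>. (H, \<pi>) \<in> R \<Longrightarrow> unitary_rep G H \<pi>"
    and Q: "finite Q" "Q \<subseteq> carrier G" "0 < \<epsilon>"
    and card: "real (card (insert \<one>\<^bsub>G\<^esub> Q)) \<le> N (\<lambda>s. if s \<in> insert \<one>\<^bsub>G\<^esub> Q then 1 else 0)"
  shows "\<exists>H \<pi> v. (H, \<pi>) \<in> R \<and> v \<in> H \<and> v \<noteq> 0 \<and> (\<forall>s\<in>Q. norm (\<pi> s v - v) < \<epsilon> * norm v)"
proof -
  interpret group G by fact
  define F where "F = insert \<one>\<^bsub>G\<^esub> Q"
  \<comment> \<open>The deficit for which \<open>norm_diff_less_if_norm_add\<close> yields the
    constant \<open>\<epsilon>\<close>.\<close>
  define d where "d = min 1 (\<epsilon>\<^sup>2 / 4)"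
  have F: "finite F" "F \<subseteq> carrier G" "\<one>\<^bsub>G\<^esub> \<in> F" "Q \<subseteq> F" using Q by (auto simp: F_def)
  have d: "0 < d" "d \<le> 1" "4 * d \<le> \<epsilon>\<^sup>2" using Q(3) by (auto simp: d_def)
  have card1: "1 \<le> real (card F)" using F(1,3) by (simp add: Suc_le_eq card_gt_0_iff) blast
  let ?x = "\<lambda>s. if s \<in> F then 1 else (0 :: complex)"
  have x: "?x \<in> fin_supp_on (carrier G)" using F by (auto simp: fin_supp_on_def)
  have "\<not> N ?x \<le> real (card F) - d" using card d(1) unfolding F_def by simp
  moreover have "N ?x \<le> real (card F) - d"
    if small: "\<forall>H \<pi>. (H, \<pi>) \<in> R \<longrightarrow> (\<forall>v\<in>H. norm (group_algebra_op \<pi> ?x v) \<le> (real (card F) - d) * norm v)"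
  proof (rule star_monoid.dominated_normD(4)[OF star_monoid_group[OF G] N x])
    show "norm (group_algebra_op W ?x v) \<le> (real (card F) - d) * norm v" if "(V, W) \<in> R" "v \<in> V" for V W v
      using small that by blast
  qed (use card1 d in simp)
  ultimately have "\<exists>H \<pi>. (H, \<pi>) \<in> R \<and> (\<exists>v\<in>H. (real (card F) - d) * norm v < norm (group_algebra_op \<pi> ?x v))"
    unfolding not_le[symmetric] by blast
  then obtain H \<pi> v where H: "(H, \<pi>) \<in> R" and v: "v \<in> H"
    and big: "(real (card F) - d) * norm v < norm (group_algebra_op \<pi> ?x v)" by (elim exE conjE bexE)
  have u: "unitary_rep G H \<pi>" by (rule R[OF H])
  note nrm = unitary_rep_norm[OF u _ v]
  have op: "group_algebra_op \<pi> ?x v = (\<Sum>s\<in>F. \<pi> s v)" by (simp add: group_algebra_op_def scaleC_one)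
  have v0: "v \<noteq> 0"
  proof
    assume "v = 0"
    then have "norm (\<Sum>s\<in>F. \<pi> s v) \<le> (\<Sum>s\<in>F. 0)" using nrm F(2) by (intro sum_norm_le) auto
    then show False using big[unfolded op] \<open>v = 0\<close> by simp
  qed
  have \<pi>1: "\<pi> \<one>\<^bsub>G\<^esub> v = v"
    using star_actD(5)[of G "m_inv G" H \<pi> v] u v unfolding unitary_rep_iff_star_act[OF G] by blast
  have "norm (\<pi> s v - v) < \<epsilon> * norm v" if s: "s \<in> Q" for s
  proof (cases "s = \<one>\<^bsub>G\<^esub>")
    case True then show ?thesis using \<pi>1 Q(3) v0 by simp
  next
    case False
    have s': "s \<in> F" "s \<in> carrier G" using s F by auto
    \<comment> \<open>The terms for \<open>s\<close> and for the identity are kept apart and the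
      others are estimated by \<open>norm v\<close> each, so the whole deficit \<open>d\<close> is
      charged to this one pair.\<close>
    have split: "(\<Sum>t\<in>F. \<pi> t v) = (\<pi> s v + v) + (\<Sum>t\<in>F - {s, \<one>\<^bsub>G\<^esub>}. \<pi> t v)"
      using sum.subset_diff[of "{s, \<one>\<^bsub>G\<^esub>}" F "\<lambda>t. \<pi> t v"] F(1,3) s' False \<pi>1 by (simp add: add.commute)
    have "norm (\<Sum>t\<in>F - {s, \<one>\<^bsub>G\<^esub>}. \<pi> t v) \<le> (\<Sum>t\<in>F - {s, \<one>\<^bsub>G\<^esub>}. norm v)"
      using nrm F(2) by (intro sum_norm_le) auto
    also have "\<dots> = (real (card F) - 2) * norm v"
    proof -
      have "card {s, \<one>\<^bsub>G\<^esub>} \<le> card F" by (rule card_mono) (use F s' in auto)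
      then show ?thesis using F(1,3) s' False by (simp add: card_Diff_subset of_nat_diff)
    qed
    finally have "(2 - d) * norm v < norm (\<pi> s v + v)"
      using big norm_triangle_ineq[of "\<pi> s v + v" "\<Sum>t\<in>F - {s, \<one>\<^bsub>G\<^esub>}. \<pi> t v"]
      unfolding op split by (simp add: algebra_simps)
    then show ?thesis by (rule norm_diff_less_if_norm_add[OF nrm[OF s'(2)] _ d Q(3)])
  qed
  then show ?thesis using H v v0 by blast
qed

lemma invariant_vector_imp_ideal_not_proper:
  assumes D: "ideal D (linf G)" and \<pi>: "D_representation G D H \<pi>"
    and \<eta>: "\<eta> \<in> H" "\<eta> \<noteq> 0" "\<And>s. s \<in> carrier G \<Longrightarrow> \<pi> s \<eta> = \<eta>"
  shows "D = carrier (linf G)"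
proof -
  obtain H0 where u: "unitary_rep G H \<pi>" and H0: "H0 \<subseteq> H" "H \<subseteq> closure H0"
    and c: "\<And>\<xi> \<eta>. \<xi> \<in> H0 \<Longrightarrow> \<eta> \<in> H0 \<Longrightarrow> matrix_coeff G \<pi> \<xi> \<eta> \<in> D"
    using \<pi> unfolding D_representation_iff by blast
  \<comment> \<open>For \<open>\<xi>\<close> within a quarter of \<open>norm \<eta>\<close>, the two
    error terms are at most \<open>5 / 16\<close> and \<open>4 / 16\<close> of the square of
    \<open>norm \<eta>\<close>, so the coefficient stays above a quarter of that square.\<close>
  have "\<eta> \<in> closure H0" "0 < norm \<eta> / 4" using H0(2) \<eta> by auto
  then obtain \<xi> where \<xi>: "\<xi> \<in> H0" "dist \<xi> \<eta> < norm \<eta> / 4" unfolding closure_approachable by blast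
  have \<xi>H: "\<xi> \<in> H" using \<xi>(1) H0(1) by blast
  define r where "r = norm \<eta>"
  have r: "0 < r" "norm (\<xi> - \<eta>) \<le> r / 4" using \<eta>(2) \<xi>(2) by (simp_all add: r_def dist_norm)
  have n\<xi>: "norm \<xi> \<le> r + r / 4" using norm_triangle_ineq[of \<eta> "\<xi> - \<eta>"] r(2) by (simp add: r_def)
  show ?thesis
  proof (rule ideal_linf_eq_carrier[OF D c[OF \<xi>(1) \<xi>(1)]])
    show "0 < r\<^sup>2 / 4" using r(1) by simp
    fix s assume s: "s \<in> carrier G"
    have "\<pi> s (\<xi> - \<eta>) = \<pi> s \<xi> - \<eta>"
      using linear_op_on_diff[OF unitary_rep_linear_op[OF u s] unitary_rep_csubspace[OF u] \<xi>H \<eta>(1)] \<eta>(3)[OF s] by simp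
    then have "cinner (\<pi> s \<xi>) \<xi> = cinner (\<pi> s (\<xi> - \<eta>)) \<xi> + cinner \<eta> (\<xi> - \<eta>) + of_real (r\<^sup>2)"
      by (simp add: cinner.diff_left cinner.diff_right cinner_self r_def)
    moreover have "cmod (cinner (\<pi> s (\<xi> - \<eta>)) \<xi>) \<le> r / 4 * (r + r / 4)"
      by (rule order_trans[OF cmod_cinner_le mult_mono])
        (use r n\<xi> unitary_rep_norm[OF u s csubspace_diff[OF unitary_rep_csubspace[OF u] \<xi>H \<eta>(1)]] in auto)
    moreover have "cmod (cinner \<eta> (\<xi> - \<eta>)) \<le> r * (r / 4)"
      by (rule order_trans[OF cmod_cinner_le mult_mono]) (use r in \<open>auto simp: r_def\<close>)
    moreover have "cmod (complex_of_real (r\<^sup>2)) = r\<^sup>2" by (simp only: norm_of_real) simp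
    moreover have "r / 4 * (r + r / 4) + r * (r / 4) \<le> r\<^sup>2 - r\<^sup>2 / 4" by (simp add: power2_eq_square field_simps)
    ultimately show "r\<^sup>2 / 4 \<le> cmod (matrix_coeff G \<pi> \<xi> \<xi> s)"
      using norm_triangle_ineq[of "cinner (\<pi> s (\<xi> - \<eta>)) \<xi>" "cinner \<eta> (\<xi> - \<eta>)"]
        norm_diff_ineq[of "complex_of_real (r\<^sup>2)" "cinner (\<pi> s (\<xi> - \<eta>)) \<xi> + cinner \<eta> (\<xi> - \<eta>)"]
      by (simp add: matrix_coeff_def s add.commute)
  qed
qed

theorem property_T_full_norm_neq_D_norm:
  assumes G: "group G" and T: "property_T TYPE('i ell2) G"
    and D: "ideal D (linf G)" "D \<noteq> carrier (linf G)"
  shows "\<exists>x\<in>fin_supp_on (carrier G). full_norm TYPE('i ell2) G x \<noteq> D_norm TYPE('i ell2) G D x"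
proof (rule ccontr)
  assume "\<not> ?thesis"
  then have eq: "full_norm TYPE('i ell2) G x = D_norm TYPE('i ell2) G D x" if "x \<in> fin_supp_on (carrier G)" for x
    using that by blast
  interpret group G by fact
  obtain Q \<epsilon> where Q: "finite Q" "Q \<subseteq> carrier G" "0 < \<epsilon>"
    and kazhdan: "\<forall>(H :: 'i ell2 set) \<pi>. unitary_rep G H \<pi>
      \<and> (\<exists>\<xi>\<in>H. \<xi> \<noteq> 0 \<and> (\<forall>s\<in>Q. norm (\<pi> s \<xi> - \<xi>) < \<epsilon> * norm \<xi>))
      \<longrightarrow> (\<exists>\<eta>\<in>H. \<eta> \<noteq> 0 \<and> (\<forall>s\<in>carrier G. \<pi> s \<eta> = \<eta>))"
    using T unfolding property_T_def by (elim exE conjE)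
  let ?e = "ell2_basis undefined :: 'i ell2"
  \<comment> \<open>The trivial representation has invariant vectors, so the full norm of the sum
    over the test set is at least its cardinality; equality of the norms would pass this on to the
    \<open>D\<close>-representations.\<close>
  have triv: "unitary_rep G (UNIV :: 'i ell2 set) (\<lambda>_ x. x)"
    by (simp add: unitary_rep_def closed_csubspace_def csubspace_def unitary_op_on_def linear_op_on_def)
  have F: "finite (insert \<one>\<^bsub>G\<^esub> Q)" "insert \<one>\<^bsub>G\<^esub> Q \<subseteq> carrier G" using Q by auto
  then have x: "(\<lambda>s. if s \<in> insert \<one>\<^bsub>G\<^esub> Q then 1 else 0) \<in> fin_supp_on (carrier G)" by (auto simp: fin_supp_on_def)
  have card: "real (card (insert \<one>\<^bsub>G\<^esub> Q)) \<le> D_norm TYPE('i ell2) G D (\<lambda>s. if s \<in> insert \<one>\<^bsub>G\<^esub> Q then 1 else 0)"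
    unfolding eq[OF x, symmetric]
    by (rule card_le_dominated_norm[OF G full_norm_dominated[OF G] F, of UNIV "\<lambda>_ x. x" ?e]) (simp_all add: triv ell2_basis_nonzero)
  have "\<exists>(H :: 'i ell2 set) \<pi> v. (H, \<pi>) \<in> {(H, \<pi>). D_representation G D H \<pi>}
      \<and> v \<in> H \<and> v \<noteq> 0 \<and> (\<forall>s\<in>Q. norm (\<pi> s v - v) < \<epsilon> * norm v)"
    by (rule almost_invariant_vector[OF G D_norm_dominated[OF G D(1)] _ Q card]) (simp add: D_representation_def)
  then obtain H :: "'i ell2 set" and \<pi> v where H: "D_representation G D H \<pi>"
    and v: "v \<in> H" "v \<noteq> 0" "\<forall>s\<in>Q. norm (\<pi> s v - v) < \<epsilon> * norm v" by blast
  then have "unitary_rep G H \<pi> \<and> (\<exists>\<xi>\<in>H. \<xi> \<noteq> 0 \<and> (\<forall>s\<in>Q. norm (\<pi> s \<xi> - \<xi>) < \<epsilon> * norm \<xi>))"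
    by (intro conjI bexI[of _ v]) (simp_all add: D_representation_def)
  then have "\<exists>\<eta>\<in>H. \<eta> \<noteq> 0 \<and> (\<forall>s\<in>carrier G. \<pi> s \<eta> = \<eta>)" by (rule mp[OF spec[OF spec[OF kazhdan]]])
  then obtain \<eta> where \<eta>: "\<eta> \<in> H" "\<eta> \<noteq> 0" "\<forall>s\<in>carrier G. \<pi> s \<eta> = \<eta>" by (elim bexE conjE)
  have "D = carrier (linf G)"
    by (rule invariant_vector_imp_ideal_not_proper[OF D(1) H \<eta>(1,2)]) (rule bspec[OF \<eta>(3)])
  then show False using D(2) by simp
qed


section \<open>Permutation representations\<close>

lemma Rep_ell2_le_norm: "cmod (Rep_ell2 f i) \<le> norm f"
  by (rule power2_le_imp_le) (use ell2_finite_sum_le[of "{i}" f] in simp_all)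

lemma cinner_ell2_eq: "cinner f g = (\<Sum>\<^sub>\<infinity>i. Rep_ell2 f i * cnj (Rep_ell2 g i))"
  by (simp add: cinner_ell2_def ell2_cinner.rep_eq)

lemma ell2_eqI: "(\<And>i. Rep_ell2 f i = Rep_ell2 g i) \<Longrightarrow> f = g"
  by (simp add: Rep_ell2_inject[symmetric] fun_eq_iff)

definition ell2_supp :: "'i set \<Rightarrow> 'i ell2 set" where
  "ell2_supp S = {f. \<forall>i. i \<notin> S \<longrightarrow> Rep_ell2 f i = 0}"

lemma closed_csubspace_ell2_supp: "closed_csubspace (ell2_supp S)"
  unfolding closed_csubspace_def
proof
  show "csubspace (ell2_supp S)"
    by (simp add: csubspace_def ell2_supp_def zero_ell2.rep_eq plus_ell2.rep_eq Rep_ell2_scaleC)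
  show "closed (ell2_supp S)"
    unfolding closed_sequential_limits
  proof (intro allI impI, elim conjE)
    fix g f assume g: "\<forall>n. g n \<in> ell2_supp S" and lim: "g \<longlonglongrightarrow> f"
    have "Rep_ell2 f i = 0" if i: "i \<notin> S" for i
    proof -
      have le: "cmod (Rep_ell2 f i) \<le> norm (f - g n)" for n
        using Rep_ell2_le_norm[of "f - g n" i] g i by (simp add: minus_ell2.rep_eq ell2_supp_def)
      have "(\<lambda>n. norm (f - g n)) \<longlonglongrightarrow> 0"
        using tendsto_norm[OF tendsto_diff[OF tendsto_const lim], of f] by simp
      then have "cmod (Rep_ell2 f i) \<le> 0" by (rule LIMSEQ_le_const) (simp add: le)
      then show ?thesis by simp
    qed
    then show "f \<in> ell2_supp S" by (simp add: ell2_supp_def)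
  qed
qed

lemma cinner_ell2_basis: "cinner (ell2_basis i) (ell2_basis j) = (if i = j then 1 else 0)"
proof -
  have "cinner (ell2_basis i) (ell2_basis j) = (\<Sum>\<^sub>\<infinity>k\<in>{i}. delta i k * cnj (delta j k))"
    unfolding cinner_ell2_eq ell2_basis.rep_eq by (rule infsum_cong_neutral) (auto simp: delta_def)
  then show ?thesis by (simp add: delta_def)
qed

lemma ell2_supp_basis_dense: "ell2_supp S \<subseteq> closure (cspan (ell2_basis ` S))"
proof
  fix f assume f: "f \<in> ell2_supp S"
  show "f \<in> closure (cspan (ell2_basis ` S))"
    unfolding closure_approachable
  proof (intro allI impI)
    fix e :: real assume e: "0 < e"
    let ?q = "\<lambda>i. (cmod (Rep_ell2 f i))\<^sup>2"
    have e2: "0 < (e / 2)\<^sup>2" using e by simp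
    obtain F where F: "finite F" "dist (sum ?q F) (infsum ?q UNIV) \<le> (e / 2)\<^sup>2"
      using infsum_finite_approximation[OF ell2_summable[of f] e2] by blast
    define u where "u = (\<lambda>i. if i \<in> F then Rep_ell2 f i else 0)"
    have u: "u \<in> fin_supp_on S" using F(1) f unfolding fin_supp_on_def u_def ell2_supp_def by auto
    have "Rep_ell2 (lincomb ell2_basis u) i = u i" for i
    proof -
      have "Rep_ell2 (lincomb ell2_basis u) i = (\<Sum>s | u s \<noteq> 0. u s * delta s i)"
        unfolding lincomb_def by (simp add: Rep_ell2_sum Rep_ell2_scaleC ell2_basis.rep_eq)
      also have "\<dots> = (\<Sum>s | u s \<noteq> 0. if s = i then u i else 0)" by (rule sum.cong) (auto simp: delta_def)
      finally show ?thesis using u by (simp add: fin_supp_on_def)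
    qed
    then have R: "Rep_ell2 (lincomb ell2_basis u - f) i = (if i \<in> F then 0 else - Rep_ell2 f i)" for i
      by (simp add: minus_ell2.rep_eq u_def)
    have "norm (lincomb ell2_basis u - f) \<le> e / 2"
    proof (rule ell2_norm_le)
      fix F' :: "'a set" assume F': "finite F'"
      have "(\<Sum>i\<in>F'. (cmod (Rep_ell2 (lincomb ell2_basis u - f) i))\<^sup>2) = sum ?q (F' - F)"
        unfolding R by (rule sum.mono_neutral_cong_right) (use F' in auto)
      also have "\<dots> + sum ?q F = sum ?q (F' \<union> F)"
        using sum.union_disjoint[of "F' - F" F ?q] F' F(1) by (simp add: Int_commute Diff_disjoint)
      then have "sum ?q (F' - F) = sum ?q (F' \<union> F) - sum ?q F" by simp
      also have "sum ?q (F' \<union> F) \<le> infsum ?q UNIV"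
        by (rule finite_sum_le_infsum[OF ell2_summable]) (use F' F(1) in auto)
      finally show "(\<Sum>i\<in>F'. (cmod (Rep_ell2 (lincomb ell2_basis u - f) i))\<^sup>2) \<le> (e / 2)\<^sup>2"
        using F(2) by (simp add: dist_real_def abs_le_iff)
    qed (use e in simp)
    then have "dist (lincomb ell2_basis u) f < e" using e by (simp add: dist_norm)
    then show "\<exists>y\<in>cspan (ell2_basis ` S). dist y f < e" unfolding cspan_eq_lincomb using u by blast
  qed
qed

text \<open>Composition with \<open>p\<close> reverses products, which is why group elements act
  through their inverses in \<open>permutation_rep\<close>. If \<open>p\<close> is a bijection of
  \<open>S\<close>, the function is square summable and \<open>Abs_ell2\<close> is applied inside
  its domain.\<close>

definition perm_op :: "'i set \<Rightarrow> ('i \<Rightarrow> 'i) \<Rightarrow> 'i ell2 \<Rightarrow> 'i ell2" where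
  "perm_op S p f = Abs_ell2 (\<lambda>i. if i \<in> S then Rep_ell2 f (p i) else 0)"

lemma Rep_perm_op:
  assumes "bij_betw p S S" shows "Rep_ell2 (perm_op S p f) = (\<lambda>i. if i \<in> S then Rep_ell2 f (p i) else 0)"
proof -
  have "(\<lambda>i. (cmod (Rep_ell2 f (p i)))\<^sup>2) summable_on S"
    using summable_on_reindex_bij_betw[OF assms, of "\<lambda>i. (cmod (Rep_ell2 f i))\<^sup>2"]
      summable_on_subset_banach[OF ell2_summable, of S f] by simp
  also have "?this \<longleftrightarrow> (\<lambda>i. (cmod (if i \<in> S then Rep_ell2 f (p i) else 0))\<^sup>2) summable_on UNIV"
    by (rule summable_on_cong_neutral) auto
  finally show ?thesis unfolding perm_op_def by (intro Abs_ell2_inverse) simp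
qed

lemma permutation_rep:
  assumes G: "group G" and cl: "\<And>s i. s \<in> carrier G \<Longrightarrow> i \<in> S \<Longrightarrow> act s i \<in> S"
    and one: "\<And>i. i \<in> S \<Longrightarrow> act \<one>\<^bsub>G\<^esub> i = i"
    and mul: "\<And>s t i. s \<in> carrier G \<Longrightarrow> t \<in> carrier G \<Longrightarrow> i \<in> S \<Longrightarrow> act (s \<otimes>\<^bsub>G\<^esub> t) i = act s (act t i)"
  shows "unitary_rep G (ell2_supp S) (\<lambda>s. perm_op S (act (inv\<^bsub>G\<^esub> s)))" (is "unitary_rep G ?V ?U")
proof -
  interpret group G by fact
  have inv: "act (inv\<^bsub>G\<^esub> s) (act s i) = i" "act s (act (inv\<^bsub>G\<^esub> s) i) = i" if "s \<in> carrier G" "i \<in> S" for s i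
    using that by (simp_all add: mul[symmetric] one)
  have bij: "bij_betw (act s) S S" if "s \<in> carrier G" for s
    by (rule bij_betwI[of _ _ _ "act (inv\<^bsub>G\<^esub> s)"]) (use that cl inv in auto)
  have R: "Rep_ell2 (perm_op S (act s) f) i = (if i \<in> S then Rep_ell2 f (act s i) else 0)" if "s \<in> carrier G" for s f i
    using Rep_perm_op[OF bij[OF that]] by simp
  have adj: "cinner (?U s f) g = cinner f (?U (inv\<^bsub>G\<^esub> s) g)" if s: "s \<in> carrier G" for s f g
  proof -
    have "cinner (?U s f) g = (\<Sum>\<^sub>\<infinity>i\<in>S. Rep_ell2 f (act (inv\<^bsub>G\<^esub> s) i) * cnj (Rep_ell2 g (act s (act (inv\<^bsub>G\<^esub> s) i))))"
      unfolding cinner_ell2_eq by (rule infsum_cong_neutral) (auto simp: R inv s)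
    also have "\<dots> = (\<Sum>\<^sub>\<infinity>i\<in>S. Rep_ell2 f i * cnj (Rep_ell2 g (act s i)))"
      by (rule infsum_reindex_bij_betw[OF bij]) (use s in simp)
    also have "\<dots> = cinner f (?U (inv\<^bsub>G\<^esub> s) g)"
      unfolding cinner_ell2_eq by (rule infsum_cong_neutral) (auto simp: R s)
    finally show ?thesis .
  qed
  have U1: "?U \<one>\<^bsub>G\<^esub> f = f" if "f \<in> ?V" for f
    using that by (intro ell2_eqI) (auto simp: R one ell2_supp_def)
  have Um: "?U (s \<otimes>\<^bsub>G\<^esub> t) f = ?U s (?U t f)" if "s \<in> carrier G" "t \<in> carrier G" for s t f
    using that by (intro ell2_eqI) (auto simp: R inv_mult_group mul cl)
  have nrm: "norm (?U s f) = norm f" if "s \<in> carrier G" "f \<in> ?V" for s f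
    by (rule norm_eq_cinnerI)
      (simp only: adj[OF that(1)] Um[OF inv_closed[OF that(1)] that(1), symmetric] l_inv[OF that(1)] U1[OF that(2)])
  have "bounded_op_on ?V (?U s)" if s: "s \<in> carrier G" for s
    unfolding bounded_op_on_def linear_op_on_def
  proof (intro conjI ballI allI exI[of _ 1])
    show "?U s f \<in> ?V" for f by (simp add: ell2_supp_def R s)
    show "?U s (f + g) = ?U s f + ?U s g" for f g by (rule ell2_eqI) (simp add: R s plus_ell2.rep_eq)
    show "?U s (scaleC a f) = scaleC a (?U s f)" for a f by (rule ell2_eqI) (simp add: R s Rep_ell2_scaleC)
    show "norm (?U s f) \<le> 1 * norm f" if "f \<in> ?V" for f using nrm[OF s that] by simp
  qed
  then show ?thesis
    unfolding unitary_rep_iff_star_act[OF G] star_act_def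
    using closed_csubspace_ell2_supp[of S] U1 Um adj by (simp add: closed_csubspace_def)
qed

lemma left_regular_eq: "left_regular G s = perm_op (carrier G) (\<lambda>t. inv\<^bsub>G\<^esub> s \<otimes>\<^bsub>G\<^esub> t)"
  by (simp add: fun_eq_iff left_regular_def left_translate_def perm_op_def)

lemma left_regular_unitary_rep: "group G \<Longrightarrow> unitary_rep G (ell2_supp (carrier G)) (left_regular G)"
proof -
  assume G: "group G"
  then interpret group G .
  have "unitary_rep G (ell2_supp (carrier G)) (\<lambda>s. perm_op (carrier G) (\<lambda>t. inv\<^bsub>G\<^esub> s \<otimes>\<^bsub>G\<^esub> t))"
    by (rule permutation_rep[OF G, of "carrier G" "\<lambda>s t. s \<otimes>\<^bsub>G\<^esub> t"]) (simp_all add: m_assoc)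
  then show ?thesis by (simp add: left_regular_eq[abs_def])
qed

lemma reduced_norm_dominated:
  assumes G: "group G"
  shows "star_monoid.dominated_norm G (m_inv G) {(ell2_supp (carrier G), left_regular G)} (reduced_norm G)"
  by (rule unitary_family_dominated[OF G]) (simp_all add: left_regular_unitary_rep[OF G] reduced_norm_def, simp add: ell2_supp_def)

lemma left_regular_eval:
  assumes G: "group G" and s: "s \<in> carrier G" and i: "i \<in> carrier G"
  shows "Rep_ell2 (left_regular G s f) i = Rep_ell2 f (inv\<^bsub>G\<^esub> s \<otimes>\<^bsub>G\<^esub> i)"
proof -
  interpret group G by fact
  have "bij_betw (\<lambda>t. inv\<^bsub>G\<^esub> s \<otimes>\<^bsub>G\<^esub> t) (carrier G) (carrier G)"
    by (rule bij_betwI[of _ _ _ "\<lambda>t. s \<otimes>\<^bsub>G\<^esub> t"]) (use s in \<open>auto simp: m_assoc[symmetric]\<close>)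
  from Rep_perm_op[OF this] show ?thesis using i by (simp add: left_regular_eq)
qed

text \<open>The quasi-regular representation on square summable functions on \<open>Q\<close>, moved
  into the universe along the injection \<open>j\<close>. Its coefficients at basis vectors are
  indicator functions of fibres of \<open>q\<close>, and the basis vector at the identity is fixed
  by the kernel.\<close>

lemma quotient_D_representation:
  fixes j :: "'q \<Rightarrow> 'i"
  assumes G: "group G" and Q: "group Q" and q: "q \<in> hom G Q" and j: "inj_on j (carrier Q)"
    and D: "ideal D (linf G)" "\<And>c. c \<in> carrier Q \<Longrightarrow> (\<lambda>s. if s \<in> carrier G \<and> q s = c then 1 else 0) \<in> D"
  shows "\<exists>(H :: 'i ell2 set) \<pi> e. D_representation G D H \<pi> \<and> e \<in> H \<and> e \<noteq> 0
    \<and> (\<forall>s\<in>carrier G. q s = \<one>\<^bsub>Q\<^esub> \<longrightarrow> \<pi> s e = e)"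
proof -
  interpret G: group G by fact
  interpret Q: group Q by fact
  interpret q: group_hom G Q q by unfold_locales (rule q)
  let ?S = "j ` carrier Q" and ?act = "\<lambda>s i. j (q s \<otimes>\<^bsub>Q\<^esub> inv_into (carrier Q) j i)"
  let ?\<pi> = "\<lambda>s. perm_op ?S (?act (inv\<^bsub>G\<^esub> s))"
  have k: "inv_into (carrier Q) j (j a) = a" if "a \<in> carrier Q" for a by (rule inv_into_f_f[OF j that])
  have rep: "unitary_rep G (ell2_supp ?S) ?\<pi>"
    by (rule permutation_rep[OF G]) (auto simp: k q.hom_closed Q.m_assoc q.hom_one q.hom_mult)
  have act_bij: "bij_betw (?act s) ?S ?S" if s: "s \<in> carrier G" for s
    by (rule bij_betwI[of _ _ _ "?act (inv\<^bsub>G\<^esub> s)"]) (use s in \<open>auto simp: k q.hom_closed Q.m_assoc[symmetric]\<close>)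
  have basis: "?\<pi> s (ell2_basis (j a)) = ell2_basis (j (q s \<otimes>\<^bsub>Q\<^esub> a))" if s: "s \<in> carrier G" and a: "a \<in> carrier Q" for s a
  proof (rule ell2_eqI)
    fix i
    have R: "Rep_ell2 (?\<pi> s (ell2_basis (j a))) i = (if i \<in> ?S then delta (j a) (?act (inv\<^bsub>G\<^esub> s) i) else 0)"
      using Rep_perm_op[OF act_bij[of "inv\<^bsub>G\<^esub> s"]] s by (simp add: ell2_basis.rep_eq)
    show "Rep_ell2 (?\<pi> s (ell2_basis (j a))) i = Rep_ell2 (ell2_basis (j (q s \<otimes>\<^bsub>Q\<^esub> a))) i"
    proof (cases "i \<in> ?S")
      case True
      then obtain b where b: "b \<in> carrier Q" "i = j b" by blast
      have qs: "q s \<in> carrier Q" using s by simp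
      have "j (inv\<^bsub>Q\<^esub> q s \<otimes>\<^bsub>Q\<^esub> b) = j a \<longleftrightarrow> inv\<^bsub>Q\<^esub> q s \<otimes>\<^bsub>Q\<^esub> b = a"
        by (rule inj_on_eq_iff[OF j]) (use qs a b(1) in auto)
      also have "\<dots> \<longleftrightarrow> b = q s \<otimes>\<^bsub>Q\<^esub> a" using Q.inv_solve_left'[of a "q s" b] qs a b(1) by blast
      also have "\<dots> \<longleftrightarrow> j b = j (q s \<otimes>\<^bsub>Q\<^esub> a)"
        by (rule inj_on_eq_iff[OF j, symmetric]) (use qs a b(1) in auto)
      finally show ?thesis unfolding R ell2_basis.rep_eq using True s by (simp add: b(2) k[OF b(1)] delta_def)
    next
      case False
      have "j (q s \<otimes>\<^bsub>Q\<^esub> a) \<in> ?S" using s a by (intro imageI) simp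
      then show ?thesis unfolding R ell2_basis.rep_eq using False by (auto simp: delta_def)
    qed
  qed
  have "D_representation G D (ell2_supp ?S) ?\<pi>"
  proof (rule D_representation_cspan[OF rep D(1) _ ell2_supp_basis_dense])
    show "ell2_basis ` ?S \<subseteq> ell2_supp ?S" by (auto simp: ell2_supp_def ell2_basis.rep_eq delta_def)
    fix \<xi> \<eta> assume "\<xi> \<in> ell2_basis ` ?S" "\<eta> \<in> ell2_basis ` ?S"
    then obtain a b where a: "\<xi> = ell2_basis (j a)" "a \<in> carrier Q" and b: "\<eta> = ell2_basis (j b)" "b \<in> carrier Q" by blast
    have "matrix_coeff G ?\<pi> \<xi> \<eta> = (\<lambda>s. if s \<in> carrier G \<and> q s = b \<otimes>\<^bsub>Q\<^esub> inv\<^bsub>Q\<^esub> a then 1 else 0)"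
    proof
      fix s
      show "matrix_coeff G ?\<pi> \<xi> \<eta> s = (if s \<in> carrier G \<and> q s = b \<otimes>\<^bsub>Q\<^esub> inv\<^bsub>Q\<^esub> a then 1 else 0)"
      proof (cases "s \<in> carrier G")
        case True
        have qs: "q s \<in> carrier Q" using True by simp
        have "matrix_coeff G ?\<pi> \<xi> \<eta> s = cinner (ell2_basis (j (q s \<otimes>\<^bsub>Q\<^esub> a))) (ell2_basis (j b))"
          by (simp only: matrix_coeff_def a(1) b(1) True basis[OF True a(2)] if_True)
        also have "\<dots> = (if j (q s \<otimes>\<^bsub>Q\<^esub> a) = j b then 1 else 0)" by (rule cinner_ell2_basis)
        also have "j (q s \<otimes>\<^bsub>Q\<^esub> a) = j b \<longleftrightarrow> q s \<otimes>\<^bsub>Q\<^esub> a = b" by (rule inj_on_eq_iff[OF j]) (use qs a b in auto)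
        also have "\<dots> \<longleftrightarrow> q s = b \<otimes>\<^bsub>Q\<^esub> inv\<^bsub>Q\<^esub> a"
          using Q.inv_solve_right[of "q s" b a] qs a b by auto
        finally show ?thesis using True by (simp only: simp_thms)
      qed (simp add: matrix_coeff_def)
    qed
    then show "matrix_coeff G ?\<pi> \<xi> \<eta> \<in> D" using D(2)[of "b \<otimes>\<^bsub>Q\<^esub> inv\<^bsub>Q\<^esub> a"] a b by simp
  qed
  moreover have "ell2_basis (j \<one>\<^bsub>Q\<^esub>) \<in> ell2_supp ?S" by (auto simp: ell2_supp_def ell2_basis.rep_eq delta_def)
  moreover have "?\<pi> s (ell2_basis (j \<one>\<^bsub>Q\<^esub>)) = ell2_basis (j \<one>\<^bsub>Q\<^esub>)" if "s \<in> carrier G" "q s = \<one>\<^bsub>Q\<^esub>" for s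
    using basis[OF that(1) Q.one_closed] that(2) by simp
  ultimately show ?thesis
    by (intro exI[of _ "ell2_supp ?S"] exI[of _ ?\<pi>] exI[of _ "ell2_basis (j \<one>\<^bsub>Q\<^esub>)"] conjI ballI impI ell2_basis_nonzero)
qed

text \<open>Multiplying a nonzero member by a suitable multiple of a point mass gives a point mass
  in the ideal, and left translation moves it to \<open>c\<close>.\<close>

lemma delta_in_translation_invariant_ideal:
  assumes Q: "group Q" and D: "ideal D (linf Q)" "D \<noteq> {\<zero>\<^bsub>linf Q\<^esub>}" "translation_invariant Q D" and c: "c \<in> carrier Q"
  shows "delta c \<in> D"
proof -
  interpret group Q by fact
  have "(\<lambda>_. 0) \<in> D" by (rule ideal_linfD(2)[OF D(1)])
  then obtain f where f: "f \<in> D" "f \<noteq> (\<lambda>_. 0)" using D(2) by (auto simp: linf_def)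
  then obtain a where a: "f a \<noteq> 0" by auto
  have aQ: "a \<in> carrier Q" using ideal_linfD(1)[OF D(1) f(1)] a by (auto simp: linf_def)
  have "bounded ((\<lambda>s. if s = a then 1 / f a else 0) ` carrier Q)"
    by (rule bounded_subset[of "{1 / f a, 0}"]) auto
  from ideal_linfD(4)[OF D(1) f(1) this]
  have "(\<lambda>s. if s \<in> carrier Q then (if s = a then 1 / f a else 0) * f s else 0) \<in> D" .
  also have "(\<lambda>s. if s \<in> carrier Q then (if s = a then 1 / f a else 0) * f s else 0) = delta a"
    using a aQ by (auto simp: delta_def fun_eq_iff)
  finally have "left_translate Q (c \<otimes>\<^bsub>Q\<^esub> inv\<^bsub>Q\<^esub> a) (delta a) \<in> D"
    using D(3) c aQ by (simp add: translation_invariant_def)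
  also have "left_translate Q (c \<otimes>\<^bsub>Q\<^esub> inv\<^bsub>Q\<^esub> a) (delta a) = delta c"
  proof
    fix t
    have "inv\<^bsub>Q\<^esub> (c \<otimes>\<^bsub>Q\<^esub> inv\<^bsub>Q\<^esub> a) \<otimes>\<^bsub>Q\<^esub> t = a \<longleftrightarrow> t = c" if t: "t \<in> carrier Q"
    proof -
      have "inv\<^bsub>Q\<^esub> (c \<otimes>\<^bsub>Q\<^esub> inv\<^bsub>Q\<^esub> a) \<otimes>\<^bsub>Q\<^esub> t = a \<longleftrightarrow> t = c \<otimes>\<^bsub>Q\<^esub> inv\<^bsub>Q\<^esub> a \<otimes>\<^bsub>Q\<^esub> a"
        using inv_solve_left'[of a "c \<otimes>\<^bsub>Q\<^esub> inv\<^bsub>Q\<^esub> a" t] t c aQ by blast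
      then show ?thesis using c aQ by (simp add: m_assoc)
    qed
    then show "left_translate Q (c \<otimes>\<^bsub>Q\<^esub> inv\<^bsub>Q\<^esub> a) (delta a) t = delta c t"
      using c by (auto simp: left_translate_def delta_def)
  qed
  finally show ?thesis .
qed


section \<open>Almost invariant vectors and amenability\<close>

text \<open>Tychonoff for the product of the discs of radius \<open>C f\<close>. As the index type
  is arbitrary, a convergent subsequence need not exist, so convergence is along a filter finer than
  \<open>sequentially\<close>.\<close>

lemma bounded_sequence_cluster:
  fixes \<phi> :: "nat \<Rightarrow> 'a \<Rightarrow> complex"
  assumes "\<And>n f. cmod (\<phi> n f) \<le> C f"
  shows "\<exists>F \<mu>. F \<noteq> bot \<and> F \<le> sequentially \<and> (\<forall>f. ((\<lambda>n. \<phi> n f) \<longlongrightarrow> \<mu> f) F)"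
proof -
  let ?K = "PiE UNIV (\<lambda>f. cball (0 :: complex) (C f))"
  have "compactin (product_topology (\<lambda>_. euclidean) UNIV) ?K" by (subst compactin_PiE) auto
  then have K: "compact ?K" by (simp add: euclidean_product_topology)
  have "eventually (\<lambda>x. x \<in> ?K) (filtermap \<phi> sequentially)" 
    unfolding eventually_filtermap by (intro always_eventually allI PiE_I) (use assms in auto)
  moreover have "filtermap \<phi> sequentially \<noteq> bot" by (simp add: filtermap_bot_iff)
  ultimately obtain \<mu> where \<mu>: "inf (nhds \<mu>) (filtermap \<phi> sequentially) \<noteq> bot"
    using K unfolding compact_filter by blast
  \<comment> \<open>The neighbourhoods of the cluster point, pulled back along \<open>\<phi>\<close>
    and restricted to large indices.\<close>
  define F where "F = inf sequentially (filtercomap \<phi> (nhds \<mu>))"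
  have "F \<noteq> bot"
  proof
    assume "F = bot"
    then have "eventually (\<lambda>_. False) F" by simp
    then obtain P Q where P: "eventually P sequentially" and Q: "eventually Q (filtercomap \<phi> (nhds \<mu>))"
      and PQ: "\<And>n. P n \<Longrightarrow> Q n \<Longrightarrow> False" unfolding F_def eventually_inf by blast
    obtain Q' where Q': "eventually Q' (nhds \<mu>)" "\<And>n. Q' (\<phi> n) \<Longrightarrow> Q n" using Q unfolding eventually_filtercomap by blast
    have "eventually (\<lambda>y. \<not> Q' y) (filtermap \<phi> sequentially)"
      unfolding eventually_filtermap by (rule eventually_mono[OF P]) (use PQ Q'(2) in blast)
    then have "eventually (\<lambda>_. False) (inf (nhds \<mu>) (filtermap \<phi> sequentially))"
      unfolding eventually_inf using Q'(1) by blast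
    then show False using \<mu> by (simp add: trivial_limit_def)
  qed
  moreover have "F \<le> sequentially" by (simp add: F_def)
  moreover have "((\<lambda>n. \<phi> n f) \<longlongrightarrow> \<mu> f) F" for f
  proof -
    have "(\<phi> \<longlongrightarrow> \<mu>) F" unfolding filterlim_iff_le_filtercomap F_def by simp
    then show ?thesis
      by (rule continuous_on_tendsto_compose[OF continuous_on_product_coordinates]) simp_all
  qed
  ultimately show ?thesis by (intro exI[of _ F] exI[of _ \<mu>] conjI allI)
qed

text \<open>The vector states of these multiplication operators are the approximations to the
  invariant mean.\<close>

definition mult_op :: "('i \<Rightarrow> complex) \<Rightarrow> 'i ell2 \<Rightarrow> 'i ell2" where
  "mult_op h x = Abs_ell2 (\<lambda>i. h i * Rep_ell2 x i)"

lemma Rep_mult_op: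
  assumes "\<And>i. cmod (h i) \<le> C" shows "Rep_ell2 (mult_op h x) i = h i * Rep_ell2 x i"
proof -
  have "(\<lambda>i. (cmod (h i * Rep_ell2 x i))\<^sup>2) summable_on UNIV"
  proof (rule summable_on_comparison_test)
    show "(\<lambda>i. C\<^sup>2 * (cmod (Rep_ell2 x i))\<^sup>2) summable_on UNIV" by (intro summable_on_cmult_right ell2_summable)
    show "(cmod (h i * Rep_ell2 x i))\<^sup>2 \<le> C\<^sup>2 * (cmod (Rep_ell2 x i))\<^sup>2" for i
      unfolding norm_mult power_mult_distrib using assms by (intro mult_right_mono power_mono) auto
  qed simp
  then show ?thesis unfolding mult_op_def by (subst Abs_ell2_inverse) simp_all
qed

lemma norm_mult_op_le:
  assumes C: "\<And>i. cmod (h i) \<le> C" shows "norm (mult_op h x) \<le> C * norm x"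
proof (rule ell2_norm_le)
  have C0: "0 \<le> C" using order_trans[OF norm_ge_zero C] .
  then show "0 \<le> C * norm x" by simp
  fix F :: "'a set" assume F: "finite F"
  have "(\<Sum>i\<in>F. (cmod (Rep_ell2 (mult_op h x) i))\<^sup>2) \<le> (\<Sum>i\<in>F. C\<^sup>2 * (cmod (Rep_ell2 x i))\<^sup>2)"
    unfolding Rep_mult_op[OF C] norm_mult power_mult_distrib
    using C by (intro sum_mono mult_right_mono power_mono) auto
  also have "\<dots> \<le> C\<^sup>2 * (norm x)\<^sup>2"
    unfolding sum_distrib_left[symmetric] by (intro mult_left_mono ell2_finite_sum_le F) simp
  finally show "(\<Sum>i\<in>F. (cmod (Rep_ell2 (mult_op h x) i))\<^sup>2) \<le> (C * norm x)\<^sup>2" by (simp add: power_mult_distrib)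
qed

text \<open>Both arguments of the quadratic form are moved from \<open>v\<close> to \<open>w\<close>
  one after the other. The estimate converts almost invariance of unit vectors into almost
  invariance of their vector states.\<close>

lemma mult_op_quadratic_diff:
  assumes C: "\<And>i. cmod (h i) \<le> C" and n: "norm v = 1" "norm w = 1"
  shows "cmod (cinner (mult_op h w) w - cinner (mult_op h v) v) \<le> 2 * C * norm (w - v)"
proof -
  have "mult_op h (w - v) = mult_op h w - mult_op h v"
    by (rule ell2_eqI) (simp add: Rep_mult_op[OF C] minus_ell2.rep_eq algebra_simps)
  then have "cinner (mult_op h w) w - cinner (mult_op h v) v = cinner (mult_op h (w - v)) w + cinner (mult_op h v) (w - v)"
    by (simp add: cinner.diff_left cinner.diff_right)
  also have "cmod \<dots> \<le> norm (mult_op h (w - v)) * norm w + norm (mult_op h v) * norm (w - v)"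
    by (intro order_trans[OF norm_triangle_ineq] add_mono cmod_cinner_le)
  also have "\<dots> \<le> C * norm (w - v) * 1 + C * 1 * norm (w - v)"
    using norm_mult_op_le[OF C, where x = "w - v"] norm_mult_op_le[OF C, where x = v] n
    by (intro add_mono mult_right_mono) simp_all
  finally show ?thesis by (simp add: algebra_simps)
qed

text \<open>The pointwise square root of \<open>h\<close> writes the value as a squared
  norm.\<close>

lemma mult_op_nonneg:
  assumes C: "\<And>i. cmod (h i) \<le> C" and h: "\<And>i. h i \<in> \<real>\<^sub>\<ge>\<^sub>0" shows "cinner (mult_op h v) v \<in> \<real>\<^sub>\<ge>\<^sub>0"
proof -
  define r where "r = (\<lambda>i. complex_of_real (sqrt (cmod (h i))))"
  have r: "cmod (r i) \<le> sqrt C" for i using C[of i] by (simp add: r_def)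
  have hr: "h i = r i * cnj (r i)" for i
  proof -
    have "h i = of_real (cmod (h i))" using h[of i] by (auto elim!: nonneg_Reals_cases)
    then show ?thesis by (simp add: r_def flip: of_real_mult)
  qed
  have "cinner (mult_op h v) v = cinner (mult_op r v) (mult_op r v)"
    unfolding cinner_ell2_eq Rep_mult_op[OF C] Rep_mult_op[OF r] by (rule infsum_cong) (simp add: hr mult_ac)
  then show ?thesis by (simp add: cinner_self)
qed

text \<open>
  The function \<open>\<sigma>\<close> identifies \<open>G\<close> with the product of \<open>L\<close> and the set of right cosets, compatibly with left
  translation by \<open>L\<close>.  It turns the almost invariant vector states on \<open>linf G\<close> into almost invariant means on \<open>linf L\<close>.
\<close>

lemma amenable_if_almost_invariant:
  assumes G: "group G" and L: "subgroup L G" "countable L"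
    and ai: "\<And>F \<epsilon>. finite F \<Longrightarrow> F \<subseteq> L \<Longrightarrow> 0 < \<epsilon> \<Longrightarrow>
      \<exists>v\<in>ell2_supp (carrier G). v \<noteq> 0 \<and> (\<forall>s\<in>F. norm (left_regular G s v - v) < \<epsilon> * norm v)"
  shows "amenable (G\<lparr>carrier := L\<rparr>)"
proof -
  interpret group G by fact
  let ?H = "G\<lparr>carrier := L\<rparr>" and ?V = "ell2_supp (carrier G)" and ?reg = "left_regular G"
  note sub = subgroup.subset[OF L(1)]
  have LG: "s \<in> L \<Longrightarrow> s \<in> carrier G" for s using sub by blast
  have u: "unitary_rep G ?V ?reg" by (rule left_regular_unitary_rep[OF G])
  have invL: "inv\<^bsub>?H\<^esub> s = inv\<^bsub>G\<^esub> s" "inv\<^bsub>G\<^esub> s \<in> L" if "s \<in> L" for s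
    using m_inv_consistent[OF L(1) that] subgroup.m_inv_closed[OF L(1) that] by auto
  define \<sigma> where "\<sigma> g = g \<otimes>\<^bsub>G\<^esub> inv\<^bsub>G\<^esub> (SOME r. r \<in> L #>\<^bsub>G\<^esub> g)" for g
  have \<sigma>: "\<sigma> g \<in> L" "\<And>s. s \<in> L \<Longrightarrow> \<sigma> (s \<otimes>\<^bsub>G\<^esub> g) = s \<otimes>\<^bsub>G\<^esub> \<sigma> g" if g: "g \<in> carrier G" for g
  proof -
    let ?r = "SOME r. r \<in> L #>\<^bsub>G\<^esub> g"
    have "g \<in> L #>\<^bsub>G\<^esub> g" by (rule rcos_self[OF g L(1)])
    then have "?r \<in> L #>\<^bsub>G\<^esub> g" by (rule someI[of "\<lambda>r. r \<in> L #>\<^bsub>G\<^esub> g"])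
    then obtain k where k: "k \<in> L" "?r = k \<otimes>\<^bsub>G\<^esub> g" unfolding r_coset_def by blast
    have "\<sigma> g = inv\<^bsub>G\<^esub> k"
      unfolding \<sigma>_def k(2) using g LG[OF k(1)] by (simp add: inv_mult_group m_assoc[symmetric])
    then show "\<sigma> g \<in> L" using invL(2)[OF k(1)] by simp
    show "\<sigma> (s \<otimes>\<^bsub>G\<^esub> g) = s \<otimes>\<^bsub>G\<^esub> \<sigma> g" if s: "s \<in> L" for s
    proof -
      have "L #>\<^bsub>G\<^esub> (s \<otimes>\<^bsub>G\<^esub> g) = L #>\<^bsub>G\<^esub> g"
        using coset_mult_assoc[OF sub LG[OF s] g] coset_join2[OF LG[OF s] L(1) s] by simp
      then show ?thesis unfolding \<sigma>_def using g LG[OF s] k LG[OF k(1)] by (simp add: m_assoc)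
    qed
  qed
  have "\<exists>v\<in>?V. norm v = 1 \<and> (\<forall>s\<in>F. norm (?reg s v - v) < \<epsilon>)" if F: "finite F" "F \<subseteq> L" "0 < \<epsilon>" for F \<epsilon>
  proof -
    obtain v where v: "v \<in> ?V" "v \<noteq> 0" "\<forall>s\<in>F. norm (?reg s v - v) < \<epsilon> * norm v" using ai[OF F] by blast
    let ?c = "complex_of_real (1 / norm v)"
    show ?thesis
    proof (intro bexI[of _ "scaleC ?c v"] conjI ballI)
      show "scaleC ?c v \<in> ?V" by (rule csubspace_scaleC[OF unitary_rep_csubspace[OF u] v(1)])
      show "norm (scaleC ?c v) = 1" using v(2) by (simp add: norm_scaleC norm_divide)
      fix s assume s: "s \<in> F"
      then have eq: "?reg s (scaleC ?c v) - scaleC ?c v = scaleC ?c (?reg s v - v)"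
        using linear_op_onD(3)[OF unitary_rep_linear_op[OF u] v(1)] F(2) LG by (auto simp: scaleC.diff_right)
      then show "norm (?reg s (scaleC ?c v) - scaleC ?c v) < \<epsilon>"
        unfolding eq norm_scaleC using bspec[OF v(3) s] v(2) by (simp add: norm_divide divide_less_eq)
    qed
  qed
  note unit = this
  have L0: "L \<noteq> {}" using subgroup.one_closed[OF L(1)] by blast
  \<comment> \<open>Increasing finite sets exhausting \<open>L\<close>; the enumeration may repeat
    elements, so finite \<open>L\<close> is covered as well.\<close>
  let ?F = "\<lambda>n. from_nat_into L ` {..n}"
  have "\<forall>n. \<exists>v. v \<in> ?V \<and> norm v = 1 \<and> (\<forall>s\<in>?F n. norm (?reg s v - v) < 1 / real (Suc n))"
  proof
    fix n
    have "?F n \<subseteq> L" using from_nat_into[OF L0] by blast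
    then show "\<exists>v. v \<in> ?V \<and> norm v = 1 \<and> (\<forall>s\<in>?F n. norm (?reg s v - v) < 1 / real (Suc n))"
      using unit[of "?F n" "1 / real (Suc n)"] by auto
  qed
  then obtain v where v: "\<And>n. v n \<in> ?V" "\<And>n. norm (v n) = 1"
    "\<And>n. \<forall>s\<in>?F n. norm (?reg s (v n) - v n) < 1 / real (Suc n)" by metis
  have lim0: "(\<lambda>n. norm (?reg s (v n) - v n)) \<longlonglongrightarrow> 0" if s: "s \<in> L" for s
  proof -
    obtain k where k: "from_nat_into L k = s" using from_nat_into_surj[OF L(2) s] by blast
    have "norm (?reg s (v n) - v n) \<le> 1 / real (Suc n)" if "k \<le> n" for n
      using v(3)[of n] k that by (intro less_imp_le) blast
    then have "eventually (\<lambda>n. norm (norm (?reg s (v n) - v n)) \<le> 1 / real (Suc n)) sequentially"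
      unfolding eventually_sequentially by auto
    then show ?thesis by (rule Lim_null_comparison) (rule LIMSEQ_Suc[OF lim_1_over_n])
  qed
  let ?M = "\<lambda>f n. cinner (mult_op (\<lambda>g. f (\<sigma> g)) (v n)) (v n)"
  have bdd: "\<exists>C. \<forall>t. cmod (f t) \<le> C" if "f \<in> carrier (linf ?H)" for f
    using that by (auto simp: linf_def bounded_iff)
  \<comment> \<open>The value 0 outside \<open>linf\<close> makes the family bounded in
    \<open>n\<close> for every function of the type, as \<open>bounded_sequence_cluster\<close>
    requires.\<close>
  define \<phi> where "\<phi> n f = (if f \<in> carrier (linf ?H) then ?M f n else 0)" for n f
  have "\<forall>f. \<exists>C. \<forall>n. cmod (\<phi> n f) \<le> C"
  proof
    fix f
    show "\<exists>C. \<forall>n. cmod (\<phi> n f) \<le> C"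
    proof (cases "f \<in> carrier (linf ?H)")
      case True
      then obtain C where C: "\<And>t. cmod (f t) \<le> C" using bdd by blast
      have "cmod (\<phi> n f) \<le> C" for n
        using order_trans[OF cmod_cinner_le mult_right_mono[OF norm_mult_op_le[of "\<lambda>g. f (\<sigma> g)" C "v n"], of "norm (v n)"]] True C
        by (simp add: \<phi>_def v(2))
      then show ?thesis by blast
    qed (auto simp: \<phi>_def)
  qed
  then obtain C where C: "\<And>n f. cmod (\<phi> n f) \<le> C f" by metis
  from bounded_sequence_cluster[of \<phi> C, OF C] obtain F \<mu> where F: "F \<noteq> bot" "F \<le> sequentially"
    and \<mu>: "\<And>f. ((\<lambda>n. \<phi> n f) \<longlongrightarrow> \<mu> f) F" by blast
  have lin: "(\<lambda>s. f s + g s) \<in> carrier (linf ?H)" "(\<lambda>s. c * f s) \<in> carrier (linf ?H)"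
    if fg: "f \<in> carrier (linf ?H)" "g \<in> carrier (linf ?H)" for f g c
  proof -
    obtain A B where AB: "\<And>t. cmod (f t) \<le> A" "\<And>t. cmod (g t) \<le> B" using bdd[OF fg(1)] bdd[OF fg(2)] by blast
    have "cmod (f t + g t) \<le> A + B" for t using norm_triangle_ineq[of "f t" "g t"] AB[of t] by linarith
    then show "(\<lambda>s. f s + g s) \<in> carrier (linf ?H)" using fg unfolding linf_def by (auto simp: bounded_iff)
    have "cmod (c * f t) \<le> cmod c * A" for t unfolding norm_mult by (intro mult_left_mono AB) simp
    then show "(\<lambda>s. c * f s) \<in> carrier (linf ?H)" using fg unfolding linf_def by (auto simp: bounded_iff)
  qed
  show ?thesis
    unfolding amenable_def
  proof (intro exI[of _ \<mu>] conjI ballI allI impI)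
    fix f g assume fg: "f \<in> carrier (linf ?H)" "g \<in> carrier (linf ?H)"
    obtain A B where AB: "\<And>t. cmod (f t) \<le> A" "\<And>t. cmod (g t) \<le> B" using bdd[OF fg(1)] bdd[OF fg(2)] by blast
    have S: "cmod (f t + g t) \<le> A + B" for t using norm_triangle_ineq[of "f t" "g t"] AB[of t] by linarith
    have "\<phi> n (\<lambda>s. f s + g s) = \<phi> n f + \<phi> n g" for n
    proof -
      have "mult_op (\<lambda>i. f (\<sigma> i) + g (\<sigma> i)) (v n) = mult_op (\<lambda>i. f (\<sigma> i)) (v n) + mult_op (\<lambda>i. g (\<sigma> i)) (v n)"
        by (rule ell2_eqI) (simp add: Rep_mult_op[OF S] Rep_mult_op[OF AB(1)] Rep_mult_op[OF AB(2)] plus_ell2.rep_eq algebra_simps)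
      then show ?thesis using fg lin(1)[OF fg] by (simp add: \<phi>_def cinner_add_left)
    qed
    then show "\<mu> (\<lambda>s. f s + g s) = \<mu> f + \<mu> g"
      using tendsto_unique[OF F(1) \<mu>[of "\<lambda>s. f s + g s"] ] tendsto_add[OF \<mu>[of f] \<mu>[of g]] by simp
  next
    fix c f assume f: "f \<in> carrier (linf ?H)"
    obtain A where A: "\<And>t. cmod (f t) \<le> A" using bdd[OF f] by blast
    have S: "cmod (c * f t) \<le> cmod c * A" for t unfolding norm_mult by (intro mult_left_mono A) simp
    have "\<phi> n (\<lambda>s. c * f s) = c * \<phi> n f" for n
    proof -
      have "mult_op (\<lambda>i. c * f (\<sigma> i)) (v n) = scaleC c (mult_op (\<lambda>i. f (\<sigma> i)) (v n))"
        by (rule ell2_eqI) (simp add: Rep_mult_op[OF S] Rep_mult_op[OF A] Rep_ell2_scaleC)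
      then show ?thesis using f lin(2)[OF f f] by (simp add: \<phi>_def cinner_scaleC_left)
    qed
    then show "\<mu> (\<lambda>s. c * f s) = c * \<mu> f"
      using tendsto_unique[OF F(1) \<mu>[of "\<lambda>s. c * f s"]] tendsto_mult_left[OF \<mu>[of f], of c] by simp
  next
    fix f assume f: "f \<in> carrier (linf ?H)" and pos: "range f \<subseteq> \<real>\<^sub>\<ge>\<^sub>0"
    obtain A where A: "\<And>t. cmod (f t) \<le> A" using bdd[OF f] by blast
    have "\<phi> n f \<in> \<real>\<^sub>\<ge>\<^sub>0" for n
      using mult_op_nonneg[of "\<lambda>g. f (\<sigma> g)" A "v n"] A pos f by (auto simp: \<phi>_def image_subset_iff)
    then show "\<mu> f \<in> \<real>\<^sub>\<ge>\<^sub>0"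
      by (intro Lim_in_closed_set[OF closed_nonneg_Reals_complex _ F(1) \<mu>[of f]]) simp
  next
    have 1: "\<one>\<^bsub>linf ?H\<^esub> = (\<lambda>s. if s \<in> L then 1 else 0)" by (simp add: linf_def)
    have b: "cmod (\<one>\<^bsub>linf ?H\<^esub> t) \<le> 1" for t by (simp add: 1)
    have c1: "\<one>\<^bsub>linf ?H\<^esub> \<in> carrier (linf ?H)" using b unfolding linf_def by (auto simp: bounded_iff)
    have "\<phi> n \<one>\<^bsub>linf ?H\<^esub> = 1" for n
    proof -
      have "mult_op (\<lambda>g. \<one>\<^bsub>linf ?H\<^esub> (\<sigma> g)) (v n) = v n"
      proof (rule ell2_eqI)
        fix i
        have "Rep_ell2 (mult_op (\<lambda>g. \<one>\<^bsub>linf ?H\<^esub> (\<sigma> g)) (v n)) i = \<one>\<^bsub>linf ?H\<^esub> (\<sigma> i) * Rep_ell2 (v n) i"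
          by (rule Rep_mult_op) (rule b)
        also have "\<dots> = Rep_ell2 (v n) i"
          using v(1)[of n] \<sigma>(1)[of i] by (cases "i \<in> carrier G") (simp_all add: 1 ell2_supp_def)
        finally show "Rep_ell2 (mult_op (\<lambda>g. \<one>\<^bsub>linf ?H\<^esub> (\<sigma> g)) (v n)) i = Rep_ell2 (v n) i" .
      qed
      then show ?thesis using c1 by (simp add: \<phi>_def cinner_self v(2))
    qed
    then show "\<mu> \<one>\<^bsub>linf ?H\<^esub> = 1" using tendsto_unique[OF F(1) \<mu>[of "\<one>\<^bsub>linf ?H\<^esub>"]] by simp
  next
    fix s f assume "s \<in> carrier ?H" and f: "f \<in> carrier (linf ?H)"
    then have s: "s \<in> L" by simp
    note s' = invL[OF s] and sG = LG[OF s]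
    let ?f = "left_translate ?H s f" and ?s = "inv\<^bsub>G\<^esub> s"
    obtain A where A: "\<And>t. cmod (f t) \<le> A" using bdd[OF f] by blast
    have A0: "0 \<le> A" using order_trans[OF norm_ge_zero A] .
    have fA: "cmod (?f t) \<le> A" for t using A A0 by (simp add: left_translate_def)
    have "bounded (range ?f)" using fA unfolding bounded_iff by blast
    then have fc: "?f \<in> carrier (linf ?H)" by (simp add: linf_def left_translate_def)
    \<comment> \<open>Translating \<open>f\<close> amounts to conjugating its multiplication
      operator by the regular representation, because \<open>\<sigma>\<close> is equivariant under
      left multiplication by \<open>L\<close>. The conjugation is then moved to the vectors.\<close>
    have tr: "\<phi> n ?f = cinner (mult_op (\<lambda>g. f (\<sigma> g)) (?reg ?s (v n))) (?reg ?s (v n))" for n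
    proof -
      have "mult_op (\<lambda>g. ?f (\<sigma> g)) (v n) = ?reg s (mult_op (\<lambda>g. f (\<sigma> g)) (?reg ?s (v n)))" (is "?l = ?r")
      proof (rule ell2_eqI)
        fix i
        have r: "?r \<in> ?V"
        proof -
          have "?reg ?s (v n) \<in> ?V" using linear_op_onD(1)[OF unitary_rep_linear_op[OF u inv_closed[OF sG]] v(1)] .
          then have "mult_op (\<lambda>g. f (\<sigma> g)) (?reg ?s (v n)) \<in> ?V" by (simp add: ell2_supp_def Rep_mult_op[OF A])
          then show ?thesis using linear_op_onD(1)[OF unitary_rep_linear_op[OF u sG]] by blast
        qed
        show "Rep_ell2 ?l i = Rep_ell2 ?r i"
        proof (cases "i \<in> carrier G")
          case True
          have si: "?s \<otimes>\<^bsub>G\<^esub> i \<in> carrier G" using sG True by simp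
          have "s \<otimes>\<^bsub>G\<^esub> (?s \<otimes>\<^bsub>G\<^esub> i) = i" using sG True by (simp add: m_assoc[symmetric])
          then have "Rep_ell2 ?r i = f (\<sigma> (?s \<otimes>\<^bsub>G\<^esub> i)) * Rep_ell2 (v n) i"
            using left_regular_eval[OF G sG True] left_regular_eval[OF G inv_closed[OF sG] si] sG
            by (simp add: Rep_mult_op[OF A])
          moreover have "Rep_ell2 ?l i = ?f (\<sigma> i) * Rep_ell2 (v n) i" by (rule Rep_mult_op) (rule fA)
          moreover have "?f (\<sigma> i) = f (?s \<otimes>\<^bsub>G\<^esub> \<sigma> i)"
            using \<sigma>(1)[OF True] s'(1) by (simp add: left_translate_def)
          ultimately show ?thesis using \<sigma>(2)[OF True s'(2)] by simp
        next
          case False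
          then show ?thesis using v(1)[of n] r by (simp add: ell2_supp_def Rep_mult_op[OF fA])
        qed
      qed
      moreover have "cinner (?reg s x) y = cinner x (?reg ?s y)" if "x \<in> ?V" "y \<in> ?V" for x y
        using u star_actD(7)[of G "m_inv G" ?V ?reg] that sG unfolding unitary_rep_iff_star_act[OF G] by blast
      moreover have "mult_op (\<lambda>g. f (\<sigma> g)) (?reg ?s (v n)) \<in> ?V"
        using linear_op_onD(1)[OF unitary_rep_linear_op[OF u inv_closed[OF sG]] v(1)[of n]]
        by (simp add: ell2_supp_def Rep_mult_op[OF A])
      ultimately show ?thesis using fc v(1) by (simp add: \<phi>_def)
    qed
    have "cmod (\<phi> n ?f - \<phi> n f) \<le> 2 * A * norm (?reg ?s (v n) - v n)" for n
      unfolding tr using mult_op_quadratic_diff[of "\<lambda>g. f (\<sigma> g)" A "v n" "?reg ?s (v n)"] A f v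
        unitary_rep_norm[OF u inv_closed[OF sG] v(1)] by (simp add: \<phi>_def)
    then have "(\<lambda>n. \<phi> n ?f - \<phi> n f) \<longlonglongrightarrow> 0"
      by (intro Lim_null_comparison[OF _ tendsto_mult_right_zero[OF lim0[OF s'(2)], of "2 * A"]]) simp
    then have "((\<lambda>n. \<phi> n ?f - \<phi> n f) \<longlongrightarrow> 0) F" by (rule tendsto_mono[OF F(2)])
    then have "\<mu> ?f - \<mu> f = 0" using tendsto_unique[OF F(1) tendsto_diff[OF \<mu>[of ?f] \<mu>[of f]]] by blast
    then show "\<mu> ?f = \<mu> f" by simp
  qed
qed

theorem D_norm_neq_reduced_norm:
  fixes G :: "('g, 'm) monoid_scheme"
  assumes G: "group G" "countable (carrier G)" and L: "L \<lhd> G" "\<not> amenable (G\<lparr>carrier := L\<rparr>)"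
    and D1: "ideal D1 (linf G)"
    and D2: "ideal D2 (linf (G Mod L))" "D2 \<noteq> {\<zero>\<^bsub>linf (G Mod L)\<^esub>}" "translation_invariant (G Mod L) D2"
    and D12: "quotient_pullback G L ` D2 \<subseteq> D1"
  shows "\<exists>x\<in>fin_supp_on (carrier G). D_norm TYPE('i::infinite ell2) G D1 x \<noteq> reduced_norm G x"
proof (rule ccontr)
  assume "\<not> ?thesis"
  then have eq: "D_norm TYPE('i ell2) G D1 x = reduced_norm G x" if "x \<in> fin_supp_on (carrier G)" for x
    using that by blast
  interpret L: normal L G by (rule L(1))
  let ?Q = "G Mod L" and ?q = "\<lambda>s. L #>\<^bsub>G\<^esub> s"
  have Q: "group ?Q" by (rule L.factorgroup_is_group)
  have cQ: "carrier ?Q = rcosets\<^bsub>G\<^esub> L" and oQ: "\<one>\<^bsub>?Q\<^esub> = L" by (simp_all add: FactGroup_def)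
  have "carrier ?Q = ?q ` carrier G" unfolding cQ RCOSETS_def by auto
  then have "countable (carrier ?Q)" using G(2) by simp
  then have i: "inj_on (to_nat_on (carrier ?Q)) (carrier ?Q)" by (rule inj_on_to_nat_on)
  \<comment> \<open>There are only countably many cosets, so they can be indexed inside the infinite
    type \<open>'i\<close>.\<close>
  obtain k :: "nat \<Rightarrow> 'i" where k: "inj k" using infinite_countable_subset[OF infinite_UNIV] by blast
  have j: "inj_on (k \<circ> to_nat_on (carrier ?Q)) (carrier ?Q)"
    by (rule comp_inj_on[OF i]) (rule inj_on_subset[OF k subset_UNIV])
  have del: "(\<lambda>s. if s \<in> carrier G \<and> ?q s = c then 1 else 0) \<in> D1" if "c \<in> carrier ?Q" for c
  proof -
    have "quotient_pullback G L (delta c) \<in> D1"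
      using D12 delta_in_translation_invariant_ideal[OF Q D2 that] by blast
    also have "quotient_pullback G L (delta c) = (\<lambda>s. if s \<in> carrier G \<and> ?q s = c then 1 else 0)"
      by (auto simp: quotient_pullback_def delta_def fun_eq_iff)
    finally show ?thesis .
  qed
  have "\<exists>(H :: 'i ell2 set) \<pi> e. D_representation G D1 H \<pi> \<and> e \<in> H \<and> e \<noteq> 0
      \<and> (\<forall>s\<in>carrier G. ?q s = \<one>\<^bsub>?Q\<^esub> \<longrightarrow> \<pi> s e = e)"
    by (rule quotient_D_representation[OF G(1) Q L.r_coset_hom_Mod j D1]) (rule del)
  then obtain H :: "'i ell2 set" and \<pi> e where H: "D_representation G D1 H \<pi>" "e \<in> H" "e \<noteq> 0"
    and efix: "\<forall>s\<in>carrier G. ?q s = \<one>\<^bsub>?Q\<^esub> \<longrightarrow> \<pi> s e = e"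
    by (elim exE conjE)
  have Lfix: "\<pi> s e = e" if "s \<in> L" for s
    using efix that L.subset L.rcos_const[OF L.is_group that] by (auto simp: oQ)
  have "amenable (G\<lparr>carrier := L\<rparr>)"
  proof (rule amenable_if_almost_invariant[OF G(1) L.subgroup_axioms])
    show "countable L" by (rule countable_subset[OF L.subset G(2)])
    fix F and \<epsilon> :: real assume F: "finite F" "F \<subseteq> L" "0 < \<epsilon>"
    \<comment> \<open>The identity is adjoined because \<open>almost_invariant_vector\<close>
      compares \<open>\<pi> s v\<close> with the summand \<open>v\<close>.\<close>
    let ?F = "insert \<one>\<^bsub>G\<^esub> F"
    have F': "finite ?F" "?F \<subseteq> L" "?F \<subseteq> carrier G" "F \<subseteq> carrier G" using F L.subset by auto
    have x: "(\<lambda>s. if s \<in> ?F then 1 else 0) \<in> fin_supp_on (carrier G)" using F'(1,3) by (auto simp: fin_supp_on_def)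
    have card: "real (card ?F) \<le> reduced_norm G (\<lambda>s. if s \<in> ?F then 1 else 0)"
      unfolding eq[OF x, symmetric]
      by (rule card_le_dominated_norm[OF G(1) D_norm_dominated[OF G(1) D1] F'(1,3), of H \<pi> e])
        (use H Lfix F'(2) in auto)
    have "\<exists>H \<pi> v. (H, \<pi>) \<in> {(ell2_supp (carrier G), left_regular G)} \<and> v \<in> H \<and> v \<noteq> 0
        \<and> (\<forall>s\<in>F. norm (\<pi> s v - v) < \<epsilon> * norm v)"
      by (rule almost_invariant_vector[OF G(1) reduced_norm_dominated[OF G(1)] _ F(1) F'(4) F(3) card])
        (use left_regular_unitary_rep[OF G(1)] in simp)
    then show "\<exists>v\<in>ell2_supp (carrier G). v \<noteq> 0 \<and> (\<forall>s\<in>F. norm (left_regular G s v - v) < \<epsilon> * norm v)" by auto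
  qed
  then show False using L(2) by simp
qed

theorem proposition4p2:
  fixes \<Gamma> :: "('g, 'm) monoid_scheme"
    and \<Lambda> :: "'g set"
    and D1 :: "('g \<Rightarrow> complex) set"
    and D2 :: "('g set \<Rightarrow> complex) set"
  assumes "group \<Gamma>"
    and "countable (carrier \<Gamma>)"
    and "property_T TYPE('i::infinite ell2) \<Gamma>"
    and "\<Lambda> \<lhd> \<Gamma>"
    and "\<not> amenable (\<Gamma>\<lparr>carrier := \<Lambda>\<rparr>)"
    and "infinite (rcosets\<^bsub>\<Gamma>\<^esub> \<Lambda>)"
    and "ideal D1 (linf \<Gamma>)"
    and "ideal D2 (linf (\<Gamma> Mod \<Lambda>))"
    and "D2 \<noteq> {\<zero>\<^bsub>linf (\<Gamma> Mod \<Lambda>)\<^esub>}"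
    and "D1 \<noteq> carrier (linf \<Gamma>)"
    and "translation_invariant \<Gamma> D1"
    and "translation_invariant (\<Gamma> Mod \<Lambda>) D2"
    and "quotient_pullback \<Gamma> \<Lambda> ` D2 \<subseteq> D1"
  shows "(let h = TYPE('i ell2); A = cstar_D h \<Gamma> D1; \<iota> = cstar_D_emb h \<Gamma> D1
          in \<exists>!\<Delta>. \<Delta> \<in> extensional (carrier A) \<and> compact_quantum_group h A \<Delta>
               \<and> (\<forall>s\<in>carrier \<Gamma>. \<Delta> (\<iota> s) = elem_tensor h A A (\<iota> s) (\<iota> s)))
    \<and> \<not> group_completions_equal \<Gamma> (full_norm TYPE('i ell2) \<Gamma>) (D_norm TYPE('i ell2) \<Gamma> D1)
    \<and> \<not> group_completions_equal \<Gamma> (D_norm TYPE('i ell2) \<Gamma> D1) (reduced_norm \<Gamma>)"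
proof (intro conjI notI)
  note G = assms(1) and D1 = assms(7)
  let ?R = "{(H, \<pi>). D_representation \<Gamma> D1 (H :: 'i ell2 set) \<pi>}"
  note pc = pre_cstar_group_algebra[OF G]
  \<comment> \<open>The ideal property enters here: it makes the \<open>D1\<close>-representations
    absorb unitary representations.\<close>
  have "tensor_absorbing \<Gamma> ?R (D_norm TYPE('i ell2) \<Gamma> D1)"
    by (intro tensor_absorbing.intro[OF G] tensor_absorbing_axioms.intro D_norm_dominated[OF G D1])
      (simp add: D_representation_tensor[OF G D1])
  from tensor_absorbing.compact_quantum_group[OF this]
  show "let h = TYPE('i ell2); A = cstar_D h \<Gamma> D1; \<iota> = cstar_D_emb h \<Gamma> D1
      in \<exists>!\<Delta>. \<Delta> \<in> extensional (carrier A) \<and> compact_quantum_group h A \<Delta>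
           \<and> (\<forall>s\<in>carrier \<Gamma>. \<Delta> (\<iota> s) = elem_tensor h A A (\<iota> s) (\<iota> s))"
    unfolding Let_def cstar_D_def cstar_D_emb_def .
  show False if eq: "group_completions_equal \<Gamma> (full_norm TYPE('i ell2) \<Gamma>) (D_norm TYPE('i ell2) \<Gamma> D1)"
  proof -
    obtain x where x: "x \<in> fin_supp_on (carrier \<Gamma>)" "full_norm TYPE('i ell2) \<Gamma> x \<noteq> D_norm TYPE('i ell2) \<Gamma> D1 x"
      using property_T_full_norm_neq_D_norm[OF G assms(3) D1 assms(10)] by (elim bexE)
    show False
      using group_completions_equal_norms[OF pc[OF full_norm_dominated[OF G]] pc[OF D_norm_dominated[OF G D1]] eq x(1)] x(2)
      by simp
  qed
  show False if eq: "group_completions_equal \<Gamma> (D_norm TYPE('i ell2) \<Gamma> D1) (reduced_norm \<Gamma>)"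
  proof -
    obtain x where x: "x \<in> fin_supp_on (carrier \<Gamma>)" "D_norm TYPE('i ell2) \<Gamma> D1 x \<noteq> reduced_norm \<Gamma> x"
      using D_norm_neq_reduced_norm[OF G assms(2,4,5) D1 assms(8,9,12,13), where 'i = 'i] by (elim bexE)
    show False
      using group_completions_equal_norms[OF pc[OF D_norm_dominated[OF G D1]] pc[OF reduced_norm_dominated[OF G]] eq x(1)] x(2)
      by simp
  qed
qed

end
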